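(* Let $f\colon M^n\to\mathbb{R}^{n+p}$, $n\ge 4$, be an $(n-2)$-umbilical isometric immersion of an Einstein manifold of Ricci curvature $\rho$ which does not have constant sectional curvature on any (nonempty) open subset. Then $p\ge 2$ and each point of an open dense subset of $M^n$ has an open neighborhood $V\subset M^n$ where, up to a rigid motion of $\mathbb{R}^{n+p}$, one of the following holds: (i) $\rho>0$, $V=U\times W$ is an open part of the Clifford torus $\mathbb{S}^2(1/\sqrt{\rho})\times\mathbb{S}^{n-2}(\sqrt{(n-3)/\rho})$, and $f|_V=g\times i$ is the product of an isometric immersion $g\colon U\to\mathbb{R}^{p+1}$ of an open subset $U\subset\mathbb{S}^2(1/\sqrt{\rho})$ and the inclusion $i\colon W\to\mathbb{R}^{n-1}$ of an open subset $W\subset\mathbb{S}^{n-2}(\sqrt{(n-3)/\rho})$. (ii) $f|_V$ is an $(n-2)$-rotational submanifold of the following form: there are a constant $c\in\mathbb{R}$, open intervals $I,I_0\subset\mathbb{R}$, a positive function $\varphi\in C^\infty(I)$ with $$\varphi'^2=1-\frac{\rho}{n-1}\varphi^2+\frac{c}{\varphi^{n-3}},\qquad 0<\varphi'^2<1,$$ and an isometric immersion $h\colon U\to\mathbb{R}^{p+1}$ of an open subset $U$ of $I\times I_0$ endowed with the metric $(1-\varphi'^2(t))\,dt^2+\varphi'^2(t)\,du^2$, such that $V$ is isometric to an open subset of the warped product $L^2\times_\varphi\mathbb{S}^{n-2}(1)$, where $L^2=U$ is endowed with the metric $dt^2+\varphi'^2(t)\,du^2$, and under this identification $$f(t,u,y)=(h(t,u),\varphi(t)\,\phi(y))\in\mathbb{R}^{p+1}\oplus\mathbb{R}^{n-1},$$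 where $\phi\colon\mathbb{S}^{n-2}(1)\to\mathbb{R}^{n-1}$ is the inclusion.
   Context: A Riemannian manifold $M^n$ is Einstein with Ricci curvature $\rho$ if $\mathrm{Ric}_M(X,Y)=\rho\langle X,Y\rangle$ for all vector fields $X,Y$ and a constant $\rho\in\mathbb{R}$ ($\rho$ is not normalized). A submanifold (isometric immersion) $f\colon M^n\to\mathbb{R}^{n+p}$, $n\ge 4$, with second fundamental form $\alpha\colon TM\times TM\to N_fM$ is called $(n-2)$-umbilical if its tangent bundle carries a maximal $(n-2)$-dimensional umbilical distribution $\mathcal{U}$, i.e. there is a smooth nowhere vanishing normal vector field $\eta$ such that $$\mathcal{U}=\{X\in TM:\alpha(X,Y)=\langle X,Y\rangle\eta\ \text{ for all } Y\in TM\}$$ is a distribution of rank $n-2$. $\mathbb{S}^m(r)$ is the round $m$-sphere of radius $r$. $L\times_\varphi F$ is the warped product with metric $g_L+\varphi^2 g_F$. An $(n-2)$-rotational submanifold with axis $\mathbb{R}^{p+1}$ over a surface $g\colon L^2\to\mathbb{R}^{p+2}$ is the submanifold of $\mathbb{R}^{n+p}$ generated by the orbits of the points of $g(L)$ (disjoint from $\mathbb{R}^{p+1}$) under the subgroup $SO(n-1)$ of $SO(n+p)$ fixing $\mathbb{R}^{p+1}$ pointwise; in (ii) the surface is $g=(h,\varphi)$. *)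

theory Defs
  imports "HOL-Analysis.Analysis"
begin

section \<open>Calculus on open subsets of Euclidean spaces\<close>

abbreviation dd :: "('a::real_normed_vector \<Rightarrow> 'b::real_normed_vector) \<Rightarrow> 'a \<Rightarrow> 'a \<Rightarrow> 'b" where
  "dd f x v \<equiv> frechet_derivative f (at x) v"

text \<open>Meant for open sets of finite-dimensional spaces, where it is the usual notion of class
  \<open>C\<^sup>k\<close>: iterated directional derivatives exist and are continuous.\<close>

primrec Ck_on :: "nat \<Rightarrow> 'a::real_normed_vector set \<Rightarrow> ('a \<Rightarrow> 'b::real_normed_vector) \<Rightarrow> bool" where
  "Ck_on 0 S f \<longleftrightarrow> continuous_on S f"
| "Ck_on (Suc k) S f \<longleftrightarrow>
     (\<forall>x\<in>S. f differentiable (at x)) \<and> (\<forall>v. Ck_on k S (\<lambda>x. dd f x v))"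

definition smooth_on :: "'a::real_normed_vector set \<Rightarrow> ('a \<Rightarrow> 'b::real_normed_vector) \<Rightarrow> bool" where
  "smooth_on S f \<longleftrightarrow> (\<forall>k. Ck_on k S f)"


section \<open>Riemannian metrics on open subsets of Euclidean spaces\<close>

text \<open>A metric is a field of bilinear forms: \<open>G x v w\<close> is the product at \<open>x\<close> of \<open>v\<close> and \<open>w\<close>.\<close>

type_synonym 'a metric_field = "'a \<Rightarrow> 'a \<Rightarrow> 'a \<Rightarrow> real"

definition euclidean_metric :: "'a::real_inner metric_field" where
  "euclidean_metric x v w = v \<bullet> w"

definition metric_on :: "'a::euclidean_space set \<Rightarrow> 'a metric_field \<Rightarrow> bool" where
  "metric_on S G \<longleftrightarrow>
     (\<forall>v w. smooth_on S (\<lambda>x. G x v w)) \<and>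
     (\<forall>x\<in>S. bilinear (G x) \<and> (\<forall>v w. G x v w = G x w v) \<and> (\<forall>v. v \<noteq> 0 \<longrightarrow> G x v v > 0))"

text \<open>\<open>F\<close> is smooth on \<open>S\<close> and \<open>G\<close> is the pullback of \<open>H\<close> under \<open>F\<close>. When \<open>G\<close> is a metric,
  \<open>F\<close> is then automatically an immersion.\<close>

definition isometric_on ::
  "'a::real_normed_vector set \<Rightarrow> 'a metric_field \<Rightarrow> ('a \<Rightarrow> 'b::real_normed_vector) \<Rightarrow> 'b metric_field \<Rightarrow> bool" where
  "isometric_on S G F H \<longleftrightarrow>
     smooth_on S F \<and> (\<forall>x\<in>S. \<forall>v w. H (F x) (dd F x v) (dd F x w) = G x v w)"

text \<open>Levi-Civita connection \<open>\<nabla>\<^sub>v w\<close> of the constant fields \<open>v\<close> and \<open>w\<close>, by the Koszul formula.\<close>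

definition christoffel :: "'a::real_normed_vector metric_field \<Rightarrow> 'a \<Rightarrow> 'a \<Rightarrow> 'a \<Rightarrow> 'a" where
  "christoffel G x v w = (THE z. \<forall>y. 2 * G x z y =
     dd (\<lambda>x. G x w y) x v + dd (\<lambda>x. G x v y) x w - dd (\<lambda>x. G x v w) x y)"

text \<open>\<open>R(u,v)w = \<nabla>\<^sub>u \<nabla>\<^sub>v w - \<nabla>\<^sub>v \<nabla>\<^sub>u w\<close> for constant fields, whose brackets vanish.\<close>

definition curvature :: "'a::real_normed_vector metric_field \<Rightarrow> 'a \<Rightarrow> 'a \<Rightarrow> 'a \<Rightarrow> 'a \<Rightarrow> 'a" where
  "curvature G x u v w =
     dd (\<lambda>x. christoffel G x v w) x u + christoffel G x u (christoffel G x v w) -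
     (dd (\<lambda>x. christoffel G x u w) x v + christoffel G x v (christoffel G x u w))"

definition ricci :: "(real^'n) metric_field \<Rightarrow> real^'n \<Rightarrow> real^'n \<Rightarrow> real^'n \<Rightarrow> real" where
  "ricci G x v w = trace (matrix (\<lambda>u. curvature G x u v w))"

definition sectional_curvature ::
  "'a::real_normed_vector metric_field \<Rightarrow> 'a \<Rightarrow> 'a \<Rightarrow> 'a \<Rightarrow> real" where
  "sectional_curvature G x v w =
     G x (curvature G x v w w) v / (G x v v * G x w w - (G x v w)\<^sup>2)"

text \<open>Second fundamental form of an isometric immersion \<open>F\<close> into a Euclidean space, through the
  Gauss formula: the ambient derivative minus the image of the Levi-Civita connection. It takes
  values in the normal spaces.\<close>

definition second_fundamental_form ::
  "'a::real_normed_vector metric_field \<Rightarrow> ('a \<Rightarrow> 'b::real_normed_vector) \<Rightarrow> 'a \<Rightarrow> 'a \<Rightarrow> 'a \<Rightarrow> 'b" where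
  "second_fundamental_form G F x v w =
     dd (\<lambda>y. dd F y w) x v - dd F x (christoffel G x v w)"

definition umbilical_space ::
  "'a::real_normed_vector metric_field \<Rightarrow> ('a \<Rightarrow> 'b::real_normed_vector) \<Rightarrow> 'b \<Rightarrow> 'a \<Rightarrow> 'a set" where
  "umbilical_space G F \<eta> x =
     {v. \<forall>w. second_fundamental_form G F x v w = G x v w *\<^sub>R \<eta>}"

definition smooth_distribution_on ::
  "'a::euclidean_space set \<Rightarrow> nat \<Rightarrow> ('a \<Rightarrow> 'a set) \<Rightarrow> bool" where
  "smooth_distribution_on S k \<Delta> \<longleftrightarrow>
     (\<forall>x\<in>S. subspace (\<Delta> x) \<and> dim (\<Delta> x) = k) \<and>
     (\<forall>x\<in>S. \<exists>N X. open N \<and> x \<in> N \<and> N \<subseteq> S \<and> (\<forall>i<k. smooth_on N (X i)) \<and>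
        (\<forall>y\<in>N. span ((\<lambda>i::nat. X i y) ` {..<k}) = \<Delta> y))"


section \<open>Riemannian manifolds and their immersions into Euclidean spaces\<close>

text \<open>The manifold is the whole type \<open>'m\<close>. A chart is a pair of an open domain and a coordinate
  map (whose values outside the domain are irrelevant).\<close>

type_synonym ('m, 'a) chart = "'m set \<times> ('m \<Rightarrow> 'a)"

definition coords :: "('m, 'a) chart \<Rightarrow> 'm set \<Rightarrow> 'a set" where
  "coords c V = snd c ` (fst c \<inter> V)"

definition param :: "('m, 'a) chart \<Rightarrow> 'a \<Rightarrow> 'm" where
  "param c = inv_into (fst c) (snd c)"

definition smooth_atlas ::
  "('m::topological_space, 'a::euclidean_space) chart set \<Rightarrow> bool" where
  "smooth_atlas A \<longleftrightarrow>
     (\<forall>c\<in>A. open (fst c) \<and> open (coords c UNIV) \<and>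
        homeomorphism (fst c) (coords c UNIV) (snd c) (param c)) \<and>
     (\<Union>c\<in>A. fst c) = UNIV \<and>
     (\<forall>c\<in>A. \<forall>d\<in>A. smooth_on (coords c (fst d)) (snd d \<circ> param c))"

definition smooth_map_on ::
  "('m, 'a::real_normed_vector) chart set \<Rightarrow> 'm set \<Rightarrow> ('m \<Rightarrow> 'b::real_normed_vector) \<Rightarrow> bool" where
  "smooth_map_on A V F \<longleftrightarrow> (\<forall>c\<in>A. smooth_on (coords c V) (F \<circ> param c))"

text \<open>A metric on the manifold is given by its coordinate expressions \<open>g c\<close> in all charts \<open>c\<close> of
  the atlas; the changes of coordinates carry them into each other.\<close>

definition riemannian_metric ::
  "('m, 'a::euclidean_space) chart set \<Rightarrow> (('m, 'a) chart \<Rightarrow> 'a metric_field) \<Rightarrow> bool" where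
  "riemannian_metric A g \<longleftrightarrow>
     (\<forall>c\<in>A. metric_on (coords c UNIV) (g c)) \<and>
     (\<forall>c\<in>A. \<forall>d\<in>A. isometric_on (coords c (fst d)) (g c) (snd d \<circ> param c) (g d))"

definition isometric_map_on ::
  "('m, 'a::euclidean_space) chart set \<Rightarrow> (('m, 'a) chart \<Rightarrow> 'a metric_field) \<Rightarrow> 'm set \<Rightarrow>
   ('m \<Rightarrow> 'b::real_normed_vector) \<Rightarrow> 'b metric_field \<Rightarrow> bool" where
  "isometric_map_on A g V F H \<longleftrightarrow> (\<forall>c\<in>A. isometric_on (coords c V) (g c) (F \<circ> param c) H)"

definition isometric_immersion ::
  "('m, 'a::euclidean_space) chart set \<Rightarrow> (('m, 'a) chart \<Rightarrow> 'a metric_field) \<Rightarrow>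
   ('m \<Rightarrow> 'b::real_inner) \<Rightarrow> bool" where
  "isometric_immersion A g f \<longleftrightarrow> isometric_map_on A g UNIV f euclidean_metric"

text \<open>\<open>\<Theta>\<close> is a Riemannian isometry of the open set \<open>V\<close> onto a submanifold \<open>P\<close> of a Euclidean space,
  whose metric is the restriction of \<open>H\<close> to its tangent spaces. It is applied when \<open>P\<close> has the
  dimension of the manifold; the homeomorphism \<open>\<Theta>\<close>, being an immersion, is then a diffeomorphism
  onto \<open>P\<close>.\<close>

definition isometry_onto ::
  "('m::topological_space, 'a::euclidean_space) chart set \<Rightarrow> (('m, 'a) chart \<Rightarrow> 'a metric_field) \<Rightarrow>
   'm set \<Rightarrow> ('m \<Rightarrow> 'b::euclidean_space) \<Rightarrow> 'b set \<Rightarrow> 'b metric_field \<Rightarrow> bool" where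
  "isometry_onto A g V \<Theta> P H \<longleftrightarrow>
     (\<exists>\<Psi>. homeomorphism V P \<Theta> \<Psi>) \<and> isometric_map_on A g V \<Theta> H"

definition einstein ::
  "('m, real^'n) chart set \<Rightarrow> (('m, real^'n) chart \<Rightarrow> (real^'n) metric_field) \<Rightarrow> real \<Rightarrow> bool" where
  "einstein A g \<rho> \<longleftrightarrow>
     (\<forall>c\<in>A. \<forall>x\<in>coords c UNIV. \<forall>v w. ricci (g c) x v w = \<rho> * g c x v w)"

definition constant_sectional_curvature_on ::
  "('m, 'a::euclidean_space) chart set \<Rightarrow> (('m, 'a) chart \<Rightarrow> 'a metric_field) \<Rightarrow> 'm set \<Rightarrow> bool" where
  "constant_sectional_curvature_on A g V \<longleftrightarrow>
     (\<exists>\<kappa>. \<forall>c\<in>A. \<forall>x\<in>coords c V. \<forall>v w. v \<noteq> w \<and> independent {v, w} \<longrightarrow>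
        sectional_curvature (g c) x v w = \<kappa>)"

definition umbilical_immersion ::
  "nat \<Rightarrow> ('m, 'a::euclidean_space) chart set \<Rightarrow> (('m, 'a) chart \<Rightarrow> 'a metric_field) \<Rightarrow>
   ('m \<Rightarrow> 'b::real_inner) \<Rightarrow> bool" where
  "umbilical_immersion k A g f \<longleftrightarrow>
     isometric_immersion A g f \<and>
     (\<exists>\<eta>. smooth_map_on A UNIV \<eta> \<and> (\<forall>x. \<eta> x \<noteq> 0) \<and>
        (\<forall>c\<in>A. \<forall>x\<in>coords c UNIV. \<forall>v. \<eta> (param c x) \<bullet> dd (f \<circ> param c) x v = 0) \<and>
        (\<forall>c\<in>A. smooth_distribution_on (coords c UNIV) k
           (\<lambda>x. umbilical_space (g c) (f \<circ> param c) (\<eta> (param c x)) x)))"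

definition rigid_motion :: "('a::real_inner \<Rightarrow> 'a) \<Rightarrow> bool" where
  "rigid_motion T \<longleftrightarrow> (\<exists>a L. orthogonal_transformation L \<and> T = (\<lambda>x. a + L x))"


section \<open>The two local models\<close>

text \<open>An isometric immersion of an open subset of a round sphere: smoothness on a subset of the
  sphere means smoothness of an extension to a neighbourhood, and the tangent space of the sphere
  at \<open>x\<close> is the orthogonal complement of \<open>x\<close>.\<close>

definition sphere_isometric_immersion ::
  "real \<Rightarrow> 'a::euclidean_space set \<Rightarrow> ('a \<Rightarrow> 'b::real_inner) \<Rightarrow> bool" where
  "sphere_isometric_immersion r U G \<longleftrightarrow>
     openin (top_of_set (sphere 0 r)) U \<and>
     (\<exists>N. open N \<and> U \<subseteq> N \<and> smooth_on N G) \<and>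
     (\<forall>x\<in>U. \<forall>v w. v \<bullet> x = 0 \<and> w \<bullet> x = 0 \<longrightarrow> dd G x v \<bullet> dd G x w = v \<bullet> w)"

text \<open>Throughout, \<open>CARD('n) = n\<close>, \<open>CARD('q) = p + 1\<close> and \<open>CARD('r) = n - 1\<close>, so that
  \<open>(real^'q) \<times> (real^'r)\<close> is the ambient space of dimension \<open>n + p\<close>.
  The metric of the Clifford torus is induced from its Euclidean ambient space.\<close>

definition clifford_product ::
  "('m::topological_space, real^'n) chart set \<Rightarrow> (('m, real^'n) chart \<Rightarrow> (real^'n) metric_field) \<Rightarrow>
   real \<Rightarrow> 'm set \<Rightarrow> ('m \<Rightarrow> (real^'q) \<times> (real^'r)) \<Rightarrow> bool" where
  "clifford_product A g \<rho> V F \<longleftrightarrow>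
     \<rho> > 0 \<and>
     (\<exists>(U :: (real^3) set) (W :: (real^'r) set) \<Theta> (G :: real^3 \<Rightarrow> real^'q).
        openin (top_of_set (sphere 0 (1 / sqrt \<rho>))) U \<and>
        openin (top_of_set (sphere 0 (sqrt ((real CARD('n) - 3) / \<rho>)))) W \<and>
        isometry_onto A g V \<Theta> (U \<times> W) euclidean_metric \<and>
        sphere_isometric_immersion (1 / sqrt \<rho>) U G \<and>
        (\<forall>x\<in>V. F x = (G (fst (\<Theta> x)), snd (\<Theta> x))))"

text \<open>The metric \<open>a(t) dt\<^sup>2 + b(t) du\<^sup>2\<close> on the \<open>(t,u)\<close>-plane.\<close>

definition diagonal_metric :: "(real \<Rightarrow> real) \<Rightarrow> (real \<Rightarrow> real) \<Rightarrow> (real \<times> real) metric_field" where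
  "diagonal_metric a b x v w = a (fst x) * (fst v * fst w) + b (fst x) * (snd v * snd w)"

text \<open>The warped product metric, the fibre being a submanifold of a Euclidean space.\<close>

definition warped_metric ::
  "'l metric_field \<Rightarrow> ('l \<Rightarrow> real) \<Rightarrow> ('l \<times> 'k::real_inner) metric_field" where
  "warped_metric G \<phi> x v w = G (fst x) (fst v) (fst w) + (\<phi> (fst x))\<^sup>2 * (snd v \<bullet> snd w)"

text \<open>\<open>F\<close> maps \<open>V\<close> into the submanifold generated by the orbits of the points of the surface
  \<open>S\<close> under the rotations fixing the axis \<open>(real^'q) \<times> {0}\<close> pointwise. The surface, disjoint from
  the axis, lies in \<open>(real^'q) \<times> span {e}\<close>, which is identified with \<open>(real^'q) \<times> real\<close>.\<close>

definition rotational_over ::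
  "'m set \<Rightarrow> ('m \<Rightarrow> (real^'q) \<times> (real^'r)) \<Rightarrow> ((real^'q) \<times> real) set \<Rightarrow> bool" where
  "rotational_over V F S \<longleftrightarrow>
     (\<forall>(a, b)\<in>S. b \<noteq> 0) \<and>
     (\<exists>e. norm e = 1 \<and>
        F ` V \<subseteq> {(a, R *v (b *\<^sub>R e)) | a b R. (a, b) \<in> S \<and> rotation_matrix R})"

definition einstein_rotational ::
  "('m::topological_space, real^'n) chart set \<Rightarrow> (('m, real^'n) chart \<Rightarrow> (real^'n) metric_field) \<Rightarrow>
   real \<Rightarrow> 'm set \<Rightarrow> ('m \<Rightarrow> (real^'q) \<times> (real^'r)) \<Rightarrow> bool" where
  "einstein_rotational A g \<rho> V F \<longleftrightarrow>
     (\<exists>(c::real) (I::real set) (I0::real set) (\<phi>::real \<Rightarrow> real) (U::(real \<times> real) set)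
        (h::real \<times> real \<Rightarrow> real^'q) (P::((real \<times> real) \<times> (real^'r)) set) \<Theta>.
        open I \<and> is_interval I \<and> open I0 \<and> is_interval I0 \<and>
        smooth_on I \<phi> \<and>
        (\<forall>t\<in>I. \<phi> t > 0 \<and>
           (deriv \<phi> t)\<^sup>2 = 1 - \<rho> / (real CARD('n) - 1) * (\<phi> t)\<^sup>2 + c / \<phi> t ^ (CARD('n) - 3) \<and>
           0 < (deriv \<phi> t)\<^sup>2 \<and> (deriv \<phi> t)\<^sup>2 < 1) \<and>
        open U \<and> U \<subseteq> I \<times> I0 \<and>
        isometric_on U (diagonal_metric (\<lambda>t. 1 - (deriv \<phi> t)\<^sup>2) (\<lambda>t. (deriv \<phi> t)\<^sup>2)) h
          euclidean_metric \<and>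
        openin (top_of_set (U \<times> sphere 0 1)) P \<and>
        isometry_onto A g V \<Theta> P
          (warped_metric (diagonal_metric (\<lambda>t. 1) (\<lambda>t. (deriv \<phi> t)\<^sup>2)) (\<lambda>(t, u). \<phi> t)) \<and>
        rotational_over V F ((\<lambda>(t, u). (h (t, u), \<phi> t)) ` U) \<and>
        (\<forall>x\<in>V. \<forall>t u y. \<Theta> x = ((t, u), y) \<longrightarrow> F x = (h (t, u), \<phi> t *\<^sub>R y)))"

end

theory Submission
  imports Defs
begin

text \<open>Let \<open>P\<close> be the complement of the umbilical distribution \<open>U\<close>. The Gauss equation turns the
  Einstein condition into two facts: the shape operator of \<open>\<eta>\<close> is \<open>\<mu>\<close> times the identity on \<open>P\<close>, with
  \<open>2\<mu> = \<rho> - (n - 3) \<bar>\<eta>\<bar>\<^sup>2\<close>, and the extrinsic curvature of \<open>P\<close> is \<open>\<rho> - (n - 2) \<mu>\<close>. Where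
  \<open>\<mu> = \<bar>\<eta>\<bar>\<^sup>2\<close> the curvature is constant, so \<open>\<mu> \<noteq> \<bar>\<eta>\<bar>\<^sup>2\<close> on a dense open set. There the
  Codazzi equation shows that \<open>P\<close> is totally geodesic and that the leaves of \<open>U\<close> are open parts of
  round spheres of some radius \<open>\<phi>\<close>, lying in parallel affine subspaces. The first case is \<open>\<phi>\<close>
  constant: then \<open>\<mu> = 0\<close>, the submanifold is a product, and the surface factor has constant curvature
  \<open>\<rho>\<close>. Otherwise the centres of the spheres lie in a subspace orthogonal to the leaves, so the
  submanifold is rotational; the Hessian of \<open>\<phi>\<close> on the profile surface is \<open>- \<mu> \<phi>\<close> times its metric.
  Hence \<open>\<bar>grad \<phi>\<bar>\<^sup>2\<close> is a function of \<open>\<phi>\<close>, the surface is locally a warped product of an interval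
  with warping function \<open>\<phi>'\<close>, and the equation for \<open>\<phi>\<close> says that
  \<open>(\<bar>\<eta>\<bar>\<^sup>2 - \<mu>) \<phi> ^ (n - 1)\<close> is constant.\<close>

section \<open>Smooth functions\<close>

text \<open>Tangent fields are replaced by their images \<open>E i\<close> in the ambient space, and
  each structural equation is read off from the symmetry of a second derivative of a vector valued
  function. The Codazzi equation has force because n - 2 \<ge> 2: a leaf direction can be compared
  with a second one orthogonal to it, which makes \<eta>, and then the mean curvature vector of the
  leaves, parallel along them. In every nonempty open set one good point is enough, so the work
  takes place on a ball, and the case is decided by whether \<eta> has constant length there; if so,
  the Hessian equation reads \<mu> \<phi> = 0. Coordinates for the models come from flat linear
  systems: the potential u of the form dual to the gradient of \<phi>, and the developing map of a
  surface of constant curvature. Maps into spheres are thickened by radial variables, so that the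
  inverse function theorem applies between open sets of equal dimension. In codimension one, (n - 3)
  times the square of \<eta> would be - \<rho>, hence constant, while constancy requires the value
  \<rho>; this is the source of p \<ge> 2.\<close>

lemma dd_eq: "(f has_derivative f') (at x) \<Longrightarrow> dd f x v = f' v"
  by (metis frechet_derivative_at)

lemma has_derivative_dd: "f differentiable (at x) \<Longrightarrow> (f has_derivative dd f x) (at x)"
  using frechet_derivative_works by blast

lemma linear_dd: "f differentiable (at x) \<Longrightarrow> linear (dd f x)"
  using has_derivative_dd has_derivative_linear by blast

lemma has_derivative_cong_open:
  assumes "open S" "x \<in> S" "\<And>y. y \<in> S \<Longrightarrow> f y = g y"
  shows "(f has_derivative f') (at x) \<longleftrightarrow> (g has_derivative f') (at x)"
  using assms by (metis has_derivative_transform_within_open)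

lemma dd_cong_open:
  assumes "open S" "x \<in> S" "\<And>y. y \<in> S \<Longrightarrow> f y = g y"
  shows "dd f x = dd g x"
  unfolding frechet_derivative_def using has_derivative_cong_open[OF assms] by simp

lemma differentiable_cong_open:
  assumes "open S" "x \<in> S" "\<And>y. y \<in> S \<Longrightarrow> f y = g y"
  shows "f differentiable (at x) \<longleftrightarrow> g differentiable (at x)"
  unfolding differentiable_def using has_derivative_cong_open[OF assms] by simp

lemma Ck_on_cong:
  assumes "open S" "\<And>y. y \<in> S \<Longrightarrow> f y = g y"
  shows "Ck_on k S f \<longleftrightarrow> Ck_on k S g"
  using assms(2)
proof (induction k arbitrary: f g)
  case 0
  then show ?case by (simp cong: continuous_on_cong)
next
  case (Suc k)
  have "Ck_on k S (\<lambda>x. dd f x v) = Ck_on k S (\<lambda>x. dd g x v)" for v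
    by (rule Suc.IH) (simp add: dd_cong_open[OF assms(1) _ Suc.prems])
  moreover have "f differentiable (at x) \<longleftrightarrow> g differentiable (at x)" if "x \<in> S" for x
    by (rule differentiable_cong_open[OF assms(1) that Suc.prems])
  ultimately show ?case by simp
qed

lemma smooth_on_cong:
  assumes "open S" "\<And>y. y \<in> S \<Longrightarrow> f y = g y"
  shows "smooth_on S f \<longleftrightarrow> smooth_on S g"
  unfolding smooth_on_def using Ck_on_cong[OF assms] by simp

lemma Ck_on_dd_eqI:
  assumes "open S" "\<And>x. x \<in> S \<Longrightarrow> (f has_derivative f' x) (at x)" "Ck_on k S (\<lambda>x. f' x v)"
  shows "Ck_on k S (\<lambda>x. dd f x v)"
proof -
  have "dd f x v = f' x v" if "x \<in> S" for x using dd_eq[OF assms(2)[OF that]] .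
  then show ?thesis using Ck_on_cong[OF assms(1), of "\<lambda>x. dd f x v" "\<lambda>x. f' x v" k] assms(3) by simp
qed

lemma Ck_on_subset: "Ck_on k S f \<Longrightarrow> T \<subseteq> S \<Longrightarrow> Ck_on k T f"
  by (induction k arbitrary: f) (auto intro: continuous_on_subset)

lemma smooth_on_subset: "smooth_on S f \<Longrightarrow> T \<subseteq> S \<Longrightarrow> smooth_on T f"
  unfolding smooth_on_def using Ck_on_subset by blast

lemma Ck_on_SucD: "Ck_on (Suc k) S f \<Longrightarrow> Ck_on k S f"
proof (induction k arbitrary: f)
  case 0
  then show ?case
    by (auto intro!: continuous_at_imp_continuous_on differentiable_imp_continuous_within)
qed auto

text \<open>Quantifying over all orders absorbs the shift by one in \<open>Ck_on\<close>, so
  smoothness passes to directional derivatives without loss; the converse recovers order k from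
  order k + 1.\<close>

lemma smooth_on_rec:
  "smooth_on S f \<longleftrightarrow> (\<forall>x\<in>S. f differentiable (at x)) \<and> (\<forall>v. smooth_on S (\<lambda>x. dd f x v))"
proof
  assume "smooth_on S f"
  then have "Ck_on (Suc k) S f" for k unfolding smooth_on_def by blast
  then show "(\<forall>x\<in>S. f differentiable (at x)) \<and> (\<forall>v. smooth_on S (\<lambda>x. dd f x v))"
    unfolding smooth_on_def by auto
next
  assume "(\<forall>x\<in>S. f differentiable (at x)) \<and> (\<forall>v. smooth_on S (\<lambda>x. dd f x v))"
  then have "Ck_on (Suc k) S f" for k unfolding smooth_on_def by auto
  then show "smooth_on S f" unfolding smooth_on_def using Ck_on_SucD by blast
qed

lemma smooth_on_differentiable: "smooth_on S f \<Longrightarrow> x \<in> S \<Longrightarrow> f differentiable (at x)"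
  using smooth_on_rec by blast

lemma smooth_on_has_derivative: "smooth_on S f \<Longrightarrow> x \<in> S \<Longrightarrow> (f has_derivative dd f x) (at x)"
  using smooth_on_differentiable has_derivative_dd by blast

lemma smooth_on_dd: "smooth_on S f \<Longrightarrow> smooth_on S (\<lambda>x. dd f x v)"
  using smooth_on_rec by blast

lemma smooth_on_continuous_on: "smooth_on S f \<Longrightarrow> continuous_on S f"
  by (meson Ck_on.simps(1) smooth_on_def)

lemma smooth_onI_deriv:
  assumes "open S" "\<And>x. x \<in> S \<Longrightarrow> (f has_derivative f' x) (at x)"
    "\<And>v. smooth_on S (\<lambda>x. f' x v)"
  shows "smooth_on S f"
proof -
  have "smooth_on S (\<lambda>x. dd f x v)" for v
    using assms(3)[of v] smooth_on_cong[OF assms(1)] dd_eq[OF assms(2)] by (metis (no_types, lifting))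
  then show ?thesis
    using smooth_on_rec assms(2) differentiable_def by blast
qed

lemma Ck_on_const: "Ck_on k S (\<lambda>x. c)"
  by (induction k arbitrary: c) (auto simp: continuous_on_const)

lemma smooth_on_const [simp]: "smooth_on S (\<lambda>x. c)"
  unfolding smooth_on_def using Ck_on_const by blast

lemma dd_bounded_linear: "bounded_linear L \<Longrightarrow> dd L x v = L v"
  by (rule dd_eq) (rule bounded_linear_imp_has_derivative)

lemma smooth_on_bounded_linear:
  assumes "bounded_linear L" shows "smooth_on S L"
proof -
  have "smooth_on S (\<lambda>x. dd L x v)" for v
    by (simp add: dd_bounded_linear[OF assms])
  then show ?thesis
    using smooth_on_rec assms bounded_linear_imp_differentiable by blast
qed

lemma Ck_on_add:
  assumes "open S"
  shows "Ck_on k S f \<Longrightarrow> Ck_on k S g \<Longrightarrow> Ck_on k S (\<lambda>x. f x + g x)"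
proof (induction k arbitrary: f g)
  case 0 then show ?case by (simp add: continuous_on_add)
next
  case (Suc k)
  have "Ck_on k S (\<lambda>x. dd (\<lambda>x. f x + g x) x v)" for v
  proof -
    have "dd (\<lambda>x. f x + g x) x v = dd f x v + dd g x v" if "x \<in> S" for x
      using Suc.prems that
      by (intro dd_eq has_derivative_add has_derivative_dd) auto
    moreover have "Ck_on k S (\<lambda>x. dd f x v + dd g x v)"
      by (rule Suc.IH) (use Suc.prems in auto)
    ultimately show ?thesis using Ck_on_cong[OF assms] by (metis (no_types, lifting))
  qed
  then show ?case using Suc.prems by auto
qed

lemma Ck_on_bilinear:
  assumes "open S" and b: "bounded_bilinear b"
  shows "Ck_on k S f \<Longrightarrow> Ck_on k S g \<Longrightarrow> Ck_on k S (\<lambda>x. b (f x) (g x))"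
proof (induction k arbitrary: f g)
  case 0 then show ?case by (simp add: bounded_bilinear.continuous_on[OF b])
next
  case (Suc k)
  have "Ck_on k S (\<lambda>x. dd (\<lambda>x. b (f x) (g x)) x v)" for v
  proof -
    have "dd (\<lambda>x. b (f x) (g x)) x v = b (f x) (dd g x v) + b (dd f x v) (g x)" if "x \<in> S" for x
      using Suc.prems that
      by (intro dd_eq bounded_bilinear.FDERIV[OF b] has_derivative_dd) auto
    moreover have "Ck_on k S (\<lambda>x. b (f x) (dd g x v) + b (dd f x v) (g x))"
      by (intro Ck_on_add[OF assms(1)] Suc.IH) (use Suc.prems Ck_on_SucD in auto)
    ultimately show ?thesis using Ck_on_cong[OF assms(1)] by (metis (no_types, lifting))
  qed
  moreover have "(\<lambda>x. b (f x) (g x)) differentiable (at x)" if "x \<in> S" for x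
    using Suc.prems that bounded_bilinear.FDERIV[OF b] unfolding differentiable_def Ck_on.simps by blast
  ultimately show ?case by auto
qed

lemma smooth_on_add:
  "open S \<Longrightarrow> smooth_on S f \<Longrightarrow> smooth_on S g \<Longrightarrow> smooth_on S (\<lambda>x. f x + g x)"
  unfolding smooth_on_def using Ck_on_add by blast

lemma smooth_on_bilinear:
  "open S \<Longrightarrow> bounded_bilinear b \<Longrightarrow> smooth_on S f \<Longrightarrow> smooth_on S g \<Longrightarrow> smooth_on S (\<lambda>x. b (f x) (g x))"
  unfolding smooth_on_def using Ck_on_bilinear by blast

lemmas smooth_on_scaleR = smooth_on_bilinear[OF _ bounded_bilinear_scaleR]
lemmas smooth_on_inner = smooth_on_bilinear[OF _ bounded_bilinear_inner]
lemmas smooth_on_mult = smooth_on_bilinear[OF _ bounded_bilinear_mult]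

lemma smooth_on_sum:
  assumes "open S" "\<And>i. i \<in> I \<Longrightarrow> smooth_on S (f i)"
  shows "smooth_on S (\<lambda>x. \<Sum>i\<in>I. f i x)"
  using assms(2)
  by (induction I rule: infinite_finite_induct) (auto intro: smooth_on_add[OF assms(1)])

lemma Ck_on_sum:
  assumes "open S" "\<And>i. i \<in> I \<Longrightarrow> Ck_on k S (f i)"
  shows "Ck_on k S (\<lambda>x. \<Sum>i\<in>I. f i x)"
  using assms(2)
  by (induction I rule: infinite_finite_induct) (auto intro: Ck_on_add[OF assms(1)] Ck_on_const)

lemma dd_sum_Basis:
  fixes f :: "'a::euclidean_space \<Rightarrow> 'b::real_normed_vector"
  assumes "f differentiable (at x)"
  shows "dd f x v = (\<Sum>b\<in>Basis. (v \<bullet> b) *\<^sub>R dd f x b)"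
proof -
  have "dd f x v = dd f x (\<Sum>b\<in>Basis. (v \<bullet> b) *\<^sub>R b)" by (simp add: euclidean_representation)
  then show ?thesis
    by (simp add: linear_sum[OF linear_dd[OF assms]] linear_scale[OF linear_dd[OF assms]])
qed

text \<open>The chain rule differentiates g in the moving direction \<open>dd f x v\<close>.
  Expanding that direction in the basis leaves derivatives of g in fixed directions, to which the
  induction hypothesis applies.\<close>

lemma Ck_on_compose:
  fixes f :: "'a::real_normed_vector \<Rightarrow> 'b::euclidean_space"
  assumes "open S" "open T" "f ` S \<subseteq> T"
  shows "Ck_on k T g \<Longrightarrow> Ck_on k S f \<Longrightarrow> Ck_on k S (\<lambda>x. g (f x))"
proof (induction k arbitrary: g)
  case 0 then show ?case using assms(3)
    by (auto intro: continuous_on_compose2)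
next
  case (Suc k)
  have D: "((\<lambda>x. g (f x)) has_derivative (\<lambda>v. dd g (f x) (dd f x v))) (at x)" if "x \<in> S" for x
    using Suc.prems that assms(3)
    by (intro has_derivative_compose[of f "dd f x" x UNIV g "dd g (f x)"] has_derivative_dd) auto
  have "Ck_on k S (\<lambda>x. dd (\<lambda>x. g (f x)) x v)" for v
  proof -
    have "dd (\<lambda>x. g (f x)) x v = (\<Sum>b\<in>Basis. (dd f x v \<bullet> b) *\<^sub>R dd g (f x) b)" if "x \<in> S" for x
      using Suc.prems that assms(3) dd_eq[OF D[OF that], of v] dd_sum_Basis[of g "f x"] by auto
    moreover have "Ck_on k S (\<lambda>x. \<Sum>b\<in>Basis. (dd f x v \<bullet> b) *\<^sub>R dd g (f x) b)"
      by (intro Ck_on_sum[OF assms(1)] Ck_on_bilinear[OF assms(1) bounded_bilinear_scaleR]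
          Ck_on_bilinear[OF assms(1) bounded_bilinear_inner] Suc.IH Ck_on_const)
        (use Suc.prems Ck_on_SucD in auto)
    ultimately show ?thesis using Ck_on_cong[OF assms(1)] by (metis (no_types, lifting))
  qed
  moreover have "(\<lambda>x. g (f x)) differentiable (at x)" if "x \<in> S" for x
    using D[OF that] unfolding differentiable_def by blast
  ultimately show ?case by auto
qed

lemma smooth_on_compose:
  fixes f :: "'a::real_normed_vector \<Rightarrow> 'b::euclidean_space"
  shows "open S \<Longrightarrow> open T \<Longrightarrow> f ` S \<subseteq> T \<Longrightarrow> smooth_on T g \<Longrightarrow> smooth_on S f \<Longrightarrow> smooth_on S (\<lambda>x. g (f x))"
  unfolding smooth_on_def using Ck_on_compose by blast

lemma smooth_on_linear_compose:
  fixes f :: "'a::real_normed_vector \<Rightarrow> 'b::euclidean_space"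
  shows "open S \<Longrightarrow> bounded_linear L \<Longrightarrow> smooth_on S f \<Longrightarrow> smooth_on S (\<lambda>x. L (f x))"
  using smooth_on_compose[of S UNIV f L] smooth_on_bounded_linear[of L UNIV] by simp

lemma smooth_on_minus:
  assumes "open S" "smooth_on S f" shows "smooth_on S (\<lambda>x. - f x)"
  using smooth_on_scaleR[OF assms(1) smooth_on_const[of S "-1"] assms(2)] by simp

lemma smooth_on_diff:
  "open S \<Longrightarrow> smooth_on S f \<Longrightarrow> smooth_on S g \<Longrightarrow> smooth_on S (\<lambda>x. f x - g x)"
  using smooth_on_add[of S f "\<lambda>x. - g x"] smooth_on_minus[of S g] by simp

lemma smooth_on_power:
  fixes f :: "'a::real_normed_vector \<Rightarrow> real"
  assumes "open S" "smooth_on S f" shows "smooth_on S (\<lambda>x. f x ^ n)"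
  by (induction n) (auto intro: smooth_on_mult[OF assms(1)] assms)

lemma smooth_on_Pair:
  assumes "open S" "smooth_on S f" "smooth_on S g"
  shows "smooth_on S (\<lambda>x. (f x, g x))"
proof -
  have P: "Ck_on k S f \<Longrightarrow> Ck_on k S g \<Longrightarrow> Ck_on k S (\<lambda>x. (f x, g x))" for k
  proof (induction k arbitrary: f g)
    case 0 then show ?case by (auto intro: continuous_on_Pair)
  next
    case (Suc k)
    have D: "((\<lambda>x. (f x, g x)) has_derivative (\<lambda>v. (dd f x v, dd g x v))) (at x)" if "x \<in> S" for x
      using Suc.prems that by (intro has_derivative_Pair has_derivative_dd) auto
    have "Ck_on k S (\<lambda>x. dd (\<lambda>x. (f x, g x)) x v)" for v
    proof -
      have "Ck_on k S (\<lambda>x. (dd f x v, dd g x v))" using Suc by auto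
      moreover have "dd (\<lambda>x. (f x, g x)) x v = (dd f x v, dd g x v)" if "x \<in> S" for x
        using dd_eq[OF D[OF that]] .
      ultimately show ?thesis using Ck_on_cong[OF assms(1)] by (metis (no_types, lifting))
    qed
    moreover have "(\<lambda>x. (f x, g x)) differentiable (at x)" if "x \<in> S" for x
      using D[OF that] unfolding differentiable_def by blast
    ultimately show ?case by auto
  qed
  then show ?thesis using assms unfolding smooth_on_def by blast
qed

lemma smooth_on_dd_field:
  fixes f :: "'a::euclidean_space \<Rightarrow> 'b::euclidean_space"
  assumes "open S" "smooth_on S f" "smooth_on S X"
  shows "smooth_on S (\<lambda>x. dd f x (X x))"
proof -
  have "smooth_on S (\<lambda>x. \<Sum>b\<in>Basis. (X x \<bullet> b) *\<^sub>R dd f x b)"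
    using assms by (intro smooth_on_sum smooth_on_scaleR smooth_on_inner smooth_on_dd) auto
  moreover have "dd f x (X x) = (\<Sum>b\<in>Basis. (X x \<bullet> b) *\<^sub>R dd f x b)" if "x \<in> S" for x
    by (rule dd_sum_Basis) (rule smooth_on_differentiable[OF assms(2) that])
  ultimately show ?thesis using smooth_on_cong[OF assms(1)] by (metis (no_types, lifting))
qed

lemma smooth_on_inverse_real: "smooth_on {x::real. x \<noteq> 0} inverse"
proof -
  have o: "open {x::real. x \<noteq> 0}" by (simp add: open_Collect_neq)
  \<comment> \<open>Written as a product of \<open>inverse\<close> with itself, so that the
    induction hypothesis yields the regularity of the derivative.\<close>
  have D: "(inverse has_derivative (\<lambda>v. (- 1 * v) * (inverse x * inverse x))) (at x)" if "x \<noteq> 0" for x :: real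
    using that by (auto intro!: derivative_eq_intros)
  have "Ck_on k {x::real. x \<noteq> 0} inverse" for k
  proof (induction k)
    case 0 then show ?case by (auto intro: continuous_intros)
  next
    case (Suc k)
    have "Ck_on k {x. x \<noteq> 0} (\<lambda>x::real. dd inverse x v)" for v :: real
    proof -
      have "Ck_on k {x. x \<noteq> 0} (\<lambda>x::real. (- 1 * v) * (inverse x * inverse x))"
        by (intro Ck_on_bilinear[OF o bounded_bilinear_mult] Ck_on_const Suc)
      moreover have "dd inverse x v = (- 1 * v) * (inverse x * inverse x)" if "x \<in> {x. x \<noteq> 0}" for x :: real
        using dd_eq[OF D] that by blast
      ultimately show ?thesis using Ck_on_cong[OF o] by (metis (no_types, lifting))
    qed
    then show ?case using D unfolding differentiable_def by auto
  qed
  then show ?thesis unfolding smooth_on_def by blast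
qed

lemma smooth_on_inverse:
  fixes f :: "'a::real_normed_vector \<Rightarrow> real"
  assumes "open S" "smooth_on S f" "\<And>x. x \<in> S \<Longrightarrow> f x \<noteq> 0"
  shows "smooth_on S (\<lambda>x. inverse (f x))"
  by (rule smooth_on_compose[OF assms(1) _ _ smooth_on_inverse_real assms(2)])
    (use assms in \<open>auto simp: open_Collect_neq\<close>)

lemma smooth_on_divide:
  fixes f :: "'a::real_normed_vector \<Rightarrow> real"
  assumes "open S" "smooth_on S f" "smooth_on S g" "\<And>x. x \<in> S \<Longrightarrow> g x \<noteq> 0"
  shows "smooth_on S (\<lambda>x. f x / g x)"
  unfolding divide_inverse using assms by (intro smooth_on_mult smooth_on_inverse) auto

text \<open>A function whose derivative is an expression in the function itself gains one order at a
  time. Square roots, inverse maps and solutions of linear systems are all of this kind.\<close>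

lemma smooth_on_bootstrap:
  assumes "open S" "\<And>x. x \<in> S \<Longrightarrow> (f has_derivative f' x) (at x)"
    "\<And>k v. Ck_on k S f \<Longrightarrow> Ck_on k S (\<lambda>x. f' x v)"
  shows "smooth_on S f"
proof -
  have "Ck_on k S f" for k
  proof (induction k)
    case 0 show ?case
      using assms(2) by (auto intro!: continuous_at_imp_continuous_on dest: has_derivative_continuous)
  next
    case (Suc k)
    have "Ck_on k S (\<lambda>x. dd f x v)" for v
      by (rule Ck_on_dd_eqI[OF assms(1,2) assms(3)[OF Suc]])
    moreover have "f differentiable (at x)" if "x \<in> S" for x
      using assms(2)[OF that] unfolding differentiable_def by blast
    ultimately show ?case by simp
  qed
  then show ?thesis unfolding smooth_on_def by blast
qed

lemma smooth_on_sqrt_real: "smooth_on {x::real. x > 0} sqrt"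
proof (rule smooth_on_bootstrap)
  show o: "open {x::real. x > 0}" by (simp add: open_Collect_less)
  show "(sqrt has_derivative (\<lambda>v. v * (1/2) * inverse (sqrt x))) (at x)" if "x \<in> {x. x > 0}" for x :: real
    using that by (auto intro!: derivative_eq_intros simp: field_simps)
  show "Ck_on k {x. x > 0} (\<lambda>x. v * (1/2) * inverse (sqrt x))" if "Ck_on k {x::real. x > 0} sqrt" for k and v :: real
  proof (intro Ck_on_bilinear[OF o bounded_bilinear_mult] Ck_on_const)
    show "Ck_on k {x. x > 0} (\<lambda>x. inverse (sqrt x))"
      by (rule Ck_on_compose[OF o _ _ _ that, of "{x. x \<noteq> 0}"])
        (use smooth_on_inverse_real in \<open>auto simp: open_Collect_neq smooth_on_def\<close>)
  qed
qed

lemma smooth_on_sqrt: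
  fixes f :: "'a::real_normed_vector \<Rightarrow> real"
  assumes "open S" "smooth_on S f" "\<And>x. x \<in> S \<Longrightarrow> f x > 0"
  shows "smooth_on S (\<lambda>x. sqrt (f x))"
  by (rule smooth_on_compose[OF assms(1) _ _ smooth_on_sqrt_real assms(2)])
    (use assms in \<open>auto simp: open_Collect_less\<close>)

lemma has_derivative_inner_dd:
  assumes "X differentiable (at x)" "Y differentiable (at x)"
  shows "((\<lambda>z. X z \<bullet> Y z) has_derivative (\<lambda>v. X x \<bullet> dd Y x v + dd X x v \<bullet> Y x)) (at x)"
  by (intro has_derivative_inner has_derivative_dd assms)

lemma dd_inner:
  assumes "X differentiable (at x)" "Y differentiable (at x)"
  shows "dd (\<lambda>z. X z \<bullet> Y z) x v = X x \<bullet> dd Y x v + dd X x v \<bullet> Y x"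
  using dd_eq[OF has_derivative_inner_dd[OF assms]] .

section \<open>Symmetry of second derivatives\<close>

lemma second_difference_mvt:
  fixes f :: "'a::real_normed_vector \<Rightarrow> real"
  assumes C: "Ck_on 2 S f" and s: "s > 0"
    and sub: "\<And>a b. 0 \<le> a \<Longrightarrow> a \<le> s \<Longrightarrow> 0 \<le> b \<Longrightarrow> b \<le> s \<Longrightarrow> x + a *\<^sub>R v + b *\<^sub>R w \<in> S"
  shows "\<exists>a b. 0 \<le> a \<and> a \<le> s \<and> 0 \<le> b \<and> b \<le> s \<and>
    f (x + s *\<^sub>R v + s *\<^sub>R w) - f (x + s *\<^sub>R v) - f (x + s *\<^sub>R w) + f x
      = s * s * dd (\<lambda>y. dd f y v) (x + a *\<^sub>R v + b *\<^sub>R w) w"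
proof -
  have df: "f differentiable (at y)" "(\<lambda>y. dd f y v) differentiable (at y)" if "y \<in> S" for y
    using C that by (auto simp: numeral_2_eq_2)
  \<comment> \<open>The mean value theorem is applied twice: to the increment in direction w as a
    function of the step in direction v, and then to the resulting first derivative along w.\<close>
  define h where "h a = f (x + a *\<^sub>R v + s *\<^sub>R w) - f (x + a *\<^sub>R v)" for a
  have Dh: "(h has_real_derivative dd f (x + a *\<^sub>R v + s *\<^sub>R w) v - dd f (x + a *\<^sub>R v) v) (at a)"
    if "0 \<le> a" "a \<le> s" for a
  proof -
    have 1: "x + a *\<^sub>R v + s *\<^sub>R w \<in> S" "x + a *\<^sub>R v \<in> S" using sub[of a s] sub[of a 0] that s by auto
    have "((\<lambda>a. f (x + a *\<^sub>R v + s *\<^sub>R w)) has_derivative (\<lambda>d. dd f (x + a *\<^sub>R v + s *\<^sub>R w) (d *\<^sub>R v))) (at a)"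
      by (rule has_derivative_compose[of "\<lambda>a. x + a *\<^sub>R v + s *\<^sub>R w" "\<lambda>d. d *\<^sub>R v" a UNIV f, OF _ has_derivative_dd[OF df(1)[OF 1(1)]]])
        (auto intro!: derivative_eq_intros)
    moreover have "((\<lambda>a. f (x + a *\<^sub>R v)) has_derivative (\<lambda>d. dd f (x + a *\<^sub>R v) (d *\<^sub>R v))) (at a)"
      by (rule has_derivative_compose[of "\<lambda>a. x + a *\<^sub>R v" "\<lambda>d. d *\<^sub>R v" a UNIV f, OF _ has_derivative_dd[OF df(1)[OF 1(2)]]])
        (auto intro!: derivative_eq_intros)
    ultimately have "(h has_derivative (\<lambda>d. dd f (x + a *\<^sub>R v + s *\<^sub>R w) (d *\<^sub>R v) - dd f (x + a *\<^sub>R v) (d *\<^sub>R v))) (at a)"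
      unfolding h_def by (rule has_derivative_diff)
    moreover have "(\<lambda>d. dd f (x + a *\<^sub>R v + s *\<^sub>R w) (d *\<^sub>R v) - dd f (x + a *\<^sub>R v) (d *\<^sub>R v))
        = (*) (dd f (x + a *\<^sub>R v + s *\<^sub>R w) v - dd f (x + a *\<^sub>R v) v)"
      using 1 by (auto simp: linear_scale[OF linear_dd[OF df(1)]] fun_eq_iff algebra_simps)
    ultimately show ?thesis
      unfolding has_field_derivative_def by simp
  qed
  obtain a where a: "0 < a" "a < s" "h s - h 0 = s * (dd f (x + a *\<^sub>R v + s *\<^sub>R w) v - dd f (x + a *\<^sub>R v) v)"
    using MVT2[of 0 s h, OF s Dh] by auto
  define k where "k b = dd f (x + a *\<^sub>R v + b *\<^sub>R w) v" for b
  have Dk: "(k has_real_derivative dd (\<lambda>y. dd f y v) (x + a *\<^sub>R v + b *\<^sub>R w) w) (at b)"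
    if "0 \<le> b" "b \<le> s" for b
  proof -
    have 1: "x + a *\<^sub>R v + b *\<^sub>R w \<in> S" using sub[of a b] that a by auto
    have "(k has_derivative (\<lambda>d. dd (\<lambda>y. dd f y v) (x + a *\<^sub>R v + b *\<^sub>R w) (d *\<^sub>R w))) (at b)"
      unfolding k_def
      by (rule has_derivative_compose[of "\<lambda>b. x + a *\<^sub>R v + b *\<^sub>R w" "\<lambda>d. d *\<^sub>R w" b UNIV "\<lambda>y. dd f y v", OF _ has_derivative_dd[OF df(2)[OF 1]]])
        (auto intro!: derivative_eq_intros)
    then show ?thesis
      unfolding has_field_derivative_def
      by (simp add: linear_scale[OF linear_dd[OF df(2)]] 1 mult_commute_abs)
  qed
  obtain b where b: "0 < b" "b < s" "k s - k 0 = s * dd (\<lambda>y. dd f y v) (x + a *\<^sub>R v + b *\<^sub>R w) w"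
    using MVT2[of 0 s k, OF s Dk] by auto
  show ?thesis
    by (rule exI[of _ a], rule exI[of _ b])
      (use a b in \<open>auto simp: h_def k_def\<close>)
qed

lemma second_difference_tendsto:
  fixes f :: "'a::real_normed_vector \<Rightarrow> real"
  assumes C: "Ck_on 2 S f" and S: "open S" "x \<in> S"
  shows "((\<lambda>s. (f (x + s *\<^sub>R v + s *\<^sub>R w) - f (x + s *\<^sub>R v) - f (x + s *\<^sub>R w) + f x) / (s * s))
      \<longlongrightarrow> dd (\<lambda>y. dd f y v) x w) (at_right 0)"
proof (rule tendstoI)
  fix e :: real assume e: "e > 0"
  have "continuous_on S (\<lambda>y. dd (\<lambda>y. dd f y v) y w)" using C by (auto simp: numeral_2_eq_2)
  then have "isCont (\<lambda>y. dd (\<lambda>y. dd f y v) y w) x"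
    using S continuous_on_eq_continuous_at by blast
  then obtain d1 where d1: "d1 > 0" "\<And>y. dist y x < d1 \<Longrightarrow> dist (dd (\<lambda>y. dd f y v) y w) (dd (\<lambda>y. dd f y v) x w) < e"
    using e unfolding continuous_at_eps_delta by blast
  obtain d2 where d2: "d2 > 0" "ball x d2 \<subseteq> S" using S openE by blast
  define d where "d = min d1 d2 / (norm v + norm w + 1)"
  have pos: "norm v + norm w + 1 > 0" by (simp add: add_nonneg_pos)
  have d: "d > 0" unfolding d_def using d1 d2 pos by simp
  have near: "dist (x + a *\<^sub>R v + b *\<^sub>R w) x < min d1 d2"
    if "0 \<le> a" "a \<le> s" "0 \<le> b" "b \<le> s" "0 < s" "s < d" for a b s
  proof -
    have "norm (a *\<^sub>R v + b *\<^sub>R w) \<le> s * norm v + s * norm w"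
      using that norm_triangle_le[of "a *\<^sub>R v" "b *\<^sub>R w"]
      by (smt (verit) mult_right_mono norm_ge_zero norm_scaleR)
    also have "\<dots> < s * (norm v + norm w + 1)" using that by (simp add: algebra_simps)
    also have "\<dots> < d * (norm v + norm w + 1)" using that pos by simp
    also have "\<dots> = min d1 d2" unfolding d_def using pos by simp
    finally show ?thesis by (simp add: dist_norm algebra_simps)
  qed
  show "\<forall>\<^sub>F s in at_right 0. dist ((f (x + s *\<^sub>R v + s *\<^sub>R w) - f (x + s *\<^sub>R v) - f (x + s *\<^sub>R w) + f x) / (s * s))
      (dd (\<lambda>y. dd f y v) x w) < e"
    unfolding eventually_at_right_field
  proof (intro exI[of _ d] conjI d allI impI)
    fix s :: real assume s: "0 < s" "s < d"
    obtain a b where ab: "0 \<le> a" "a \<le> s" "0 \<le> b" "b \<le> s"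
      "f (x + s *\<^sub>R v + s *\<^sub>R w) - f (x + s *\<^sub>R v) - f (x + s *\<^sub>R w) + f x
        = s * s * dd (\<lambda>y. dd f y v) (x + a *\<^sub>R v + b *\<^sub>R w) w"
      using second_difference_mvt[OF C s(1), of x v w] near[OF _ _ _ _ s] d2(2)
      by (force simp: dist_commute)
    then show "dist ((f (x + s *\<^sub>R v + s *\<^sub>R w) - f (x + s *\<^sub>R v) - f (x + s *\<^sub>R w) + f x) / (s * s))
      (dd (\<lambda>y. dd f y v) x w) < e"
      using d1(2)[of "x + a *\<^sub>R v + b *\<^sub>R w"] near[OF ab(1-4) s] s by simp
  qed
qed

text \<open>The second difference is symmetric in v and w, so its limit equals both mixed
  derivatives. Components along basis vectors are taken because the mean value theorem is about real
  values.\<close>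

lemma dd_dd_commute:
  fixes f :: "'a::real_normed_vector \<Rightarrow> 'b::euclidean_space"
  assumes f: "smooth_on S f" and S: "open S" "x \<in> S"
  shows "dd (\<lambda>y. dd f y v) x w = dd (\<lambda>y. dd f y w) x v"
proof (rule euclidean_eqI)
  fix b :: 'b assume "b \<in> Basis"
  have sm: "smooth_on S (\<lambda>y. f y \<bullet> b)" by (intro smooth_on_inner S f smooth_on_const)
  then have C: "Ck_on 2 S (\<lambda>y. f y \<bullet> b)" unfolding smooth_on_def by blast
  have 1: "dd (\<lambda>y. f y \<bullet> b) y v = dd f y v \<bullet> b" if "y \<in> S" for y v
    using smooth_on_has_derivative[OF f that]
    by (intro dd_eq has_derivative_inner_left)
  have 2: "dd (\<lambda>y. dd (\<lambda>y. f y \<bullet> b) y v) x w = dd (\<lambda>y. dd f y v) x w \<bullet> b" for v w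
  proof -
    have "dd (\<lambda>y. dd (\<lambda>y. f y \<bullet> b) y v) x = dd (\<lambda>y. dd f y v \<bullet> b) x"
      by (rule dd_cong_open[OF S]) (simp add: 1)
    moreover have "dd (\<lambda>y. dd f y v \<bullet> b) x w = dd (\<lambda>y. dd f y v) x w \<bullet> b"
      using smooth_on_has_derivative[OF smooth_on_dd[OF f] S(2)]
      by (intro dd_eq has_derivative_inner_left)
    ultimately show ?thesis by simp
  qed
  have "((\<lambda>s. (f (x + s *\<^sub>R v + s *\<^sub>R w) \<bullet> b - f (x + s *\<^sub>R v) \<bullet> b - f (x + s *\<^sub>R w) \<bullet> b + f x \<bullet> b) / (s * s))
      \<longlongrightarrow> dd (\<lambda>y. dd (\<lambda>y. f y \<bullet> b) y w) x v) (at_right 0)"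
    using second_difference_tendsto[OF C S, of w v]
    by (simp add: algebra_simps)
  then have "dd (\<lambda>y. dd (\<lambda>y. f y \<bullet> b) y v) x w = dd (\<lambda>y. dd (\<lambda>y. f y \<bullet> b) y w) x v"
    using second_difference_tendsto[OF C S, of v w] tendsto_unique[OF trivial_limit_at_right_real] by blast
  then show "dd (\<lambda>y. dd f y v) x w \<bullet> b = dd (\<lambda>y. dd f y w) x v \<bullet> b"
    using 2 by simp
qed

section \<open>Flat linear systems\<close>

lemma Ck_on_1:
  "Ck_on 1 S f \<longleftrightarrow> (\<forall>x\<in>S. f differentiable (at x)) \<and> (\<forall>v. continuous_on S (\<lambda>x. dd f x v))"
  by simp

lemma scaleR_in_ball0: "x \<in> ball 0 r \<Longrightarrow> t \<in> {0..1} \<Longrightarrow> t *\<^sub>R x \<in> ball (0::'a::real_normed_vector) r"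
proof -
  assume "x \<in> ball 0 r" "t \<in> {0..1}"
  then have "norm (t *\<^sub>R x) \<le> 1 * norm x" unfolding norm_scaleR by (intro mult_right_mono) auto
  then show ?thesis using \<open>x \<in> ball 0 r\<close> by simp
qed

lemma continuous_on_ray:
  fixes c :: "'a::euclidean_space \<Rightarrow> 'b::real_normed_vector"
  assumes "continuous_on (ball 0 r) c"
  shows "continuous_on (ball 0 r \<times> {0..1}) (\<lambda>(x, t). c (t *\<^sub>R x))"
  unfolding split_beta
proof (rule continuous_on_compose2[OF assms])
  show "(\<lambda>p. snd p *\<^sub>R fst p) ` (ball 0 r \<times> {0..1}) \<subseteq> ball (0::'a) r"
    using scaleR_in_ball0 by fastforce
qed (intro continuous_intros)

lemma continuous_on_ray1:
  fixes c :: "'a::euclidean_space \<Rightarrow> 'b::real_normed_vector"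
  assumes "continuous_on (ball 0 r) c" "x \<in> ball 0 r"
  shows "continuous_on {0..1} (\<lambda>t. c (t *\<^sub>R x))"
proof (rule continuous_on_compose2[OF assms(1)])
  show "(\<lambda>t. t *\<^sub>R x) ` {0..1} \<subseteq> ball 0 r"
    using scaleR_in_ball0[OF assms(2)] by blast
qed (intro continuous_intros)

text \<open>Differentiation under the integral sign; the factor t is the inner derivative of the
  dilation by t.\<close>

lemma ray_integral_has_derivative:
  fixes a :: "'a::euclidean_space \<Rightarrow> 'b::euclidean_space"
  assumes a: "Ck_on 1 (ball 0 r) a" and x0: "x0 \<in> ball 0 r"
  shows "((\<lambda>x. integral {0..1} (\<lambda>t. a (t *\<^sub>R x))) has_derivative
      (\<lambda>v. integral {0..1} (\<lambda>t. t *\<^sub>R dd a (t *\<^sub>R x0) v))) (at x0)"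
proof -
  \<comment> \<open>\<open>leibniz_rule\<close> takes the derivative as a bounded linear function.
    \<open>Blinfun\<close> has the intended value for x in the ball and t in the unit interval,
    which is what \<open>bl\<close> and \<open>fxa\<close> record.\<close>
  define fx where "fx x t = Blinfun (\<lambda>v. t *\<^sub>R dd a (t *\<^sub>R x) v)" for x t
  have da: "a differentiable (at z)" if "z \<in> ball 0 r" for z using a that by (simp add: Ck_on_1)
  have bl: "bounded_linear (\<lambda>v. t *\<^sub>R dd a (t *\<^sub>R x) v)" if "x \<in> ball 0 r" "t \<in> {0..1}" for x t
    using has_derivative_bounded_linear[OF has_derivative_dd[OF da[OF scaleR_in_ball0[OF that]]]]
    by (intro bounded_linear_const_scaleR)
  have fxa: "blinfun_apply (fx x t) v = t *\<^sub>R dd a (t *\<^sub>R x) v" if "x \<in> ball 0 r" "t \<in> {0..1}" for x t v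
    unfolding fx_def by (simp add: bounded_linear_Blinfun_apply[OF bl[OF that]])
  have fxd: "((\<lambda>x. a (t *\<^sub>R x)) has_derivative blinfun_apply (fx x t)) (at x within ball 0 r)"
    if "x \<in> ball 0 r" "t \<in> cbox 0 1" for x t
  proof -
    have t: "t \<in> {0..1}" using that by simp
    have "((\<lambda>x. a (t *\<^sub>R x)) has_derivative (\<lambda>v. dd a (t *\<^sub>R x) (t *\<^sub>R v))) (at x within ball 0 r)"
      by (rule has_derivative_compose[of "\<lambda>x. t *\<^sub>R x" "\<lambda>v. t *\<^sub>R v" x "ball 0 r" a, OF _ has_derivative_dd[OF da[OF scaleR_in_ball0[OF that(1) t]]]])
        (auto intro!: derivative_eq_intros)
    moreover have "(\<lambda>v. dd a (t *\<^sub>R x) (t *\<^sub>R v)) = blinfun_apply (fx x t)"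
      using fxa[OF that(1) t] linear_scale[OF linear_dd[OF da[OF scaleR_in_ball0[OF that(1) t]]]] by (auto simp: fun_eq_iff)
    ultimately show ?thesis by simp
  qed
  have ca: "continuous_on (ball 0 r) a"
    using Ck_on_SucD[of 0 "ball 0 r" a] a by simp
  have int1: "(\<lambda>t. a (t *\<^sub>R x)) integrable_on cbox 0 (1::real)" if "x \<in> ball 0 r" for x
    using continuous_on_ray1[OF ca that] by (intro integrable_continuous) simp
  have cfx: "continuous_on (ball 0 r \<times> cbox 0 1) (\<lambda>(x, t). fx x t)"
    unfolding split_beta
  proof (rule continuous_on_blinfun_componentwise)
    fix v :: 'a
    have "continuous_on (ball 0 r \<times> {0..1}) (\<lambda>p. snd p *\<^sub>R (case p of (x, t) \<Rightarrow> dd a (t *\<^sub>R x) v))"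
      using a by (intro continuous_intros continuous_on_ray) (simp add: Ck_on_1)
    moreover have "snd p *\<^sub>R (case p of (x, t) \<Rightarrow> dd a (t *\<^sub>R x) v) = blinfun_apply (fx (fst p) (snd p)) v"
      if "p \<in> ball 0 r \<times> {0..1}" for p
      using fxa[of "fst p" "snd p" v] that by (simp add: split_beta mem_Times_iff)
    ultimately show "continuous_on (ball 0 r \<times> cbox 0 1) (\<lambda>p. blinfun_apply (fx (fst p) (snd p)) v)"
      using continuous_on_cong[of "ball 0 r \<times> {0..1}" "ball 0 r \<times> {0..1}"
          "\<lambda>p. snd p *\<^sub>R (case p of (x, t) \<Rightarrow> dd a (t *\<^sub>R x) v)" "\<lambda>p. blinfun_apply (fx (fst p) (snd p)) v"]
      by simp
  qed
  have D: "((\<lambda>x. integral (cbox 0 1) (\<lambda>t. a (t *\<^sub>R x))) has_derivative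
      blinfun_apply (integral (cbox 0 1) (fx x0))) (at x0 within ball 0 r)"
    by (rule leibniz_rule[OF fxd int1 cfx x0 convex_ball])
  have "continuous_on (cbox 0 1) (\<lambda>t. (x0, t))"
    by (intro continuous_intros)
  moreover have "(\<lambda>t. (x0, t)) ` cbox 0 1 \<subseteq> ball 0 r \<times> cbox 0 1" using x0 by auto
  ultimately have "continuous_on (cbox 0 1) (\<lambda>t. case (x0, t) of (x, t) \<Rightarrow> fx x t)"
    using continuous_on_compose2[OF cfx, of "cbox 0 1" "\<lambda>t. (x0, t)"] by blast
  then have "continuous_on (cbox 0 1) (fx x0)" by simp
  then have ifx: "fx x0 integrable_on cbox 0 1" by (rule integrable_continuous)
  have "blinfun_apply (integral (cbox 0 1) (fx x0)) v = integral {0..1} (\<lambda>t. t *\<^sub>R dd a (t *\<^sub>R x0) v)" for v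
  proof -
    have "blinfun_apply (integral (cbox 0 1) (fx x0)) v = integral (cbox 0 1) (\<lambda>t. blinfun_apply (fx x0 t) v)"
      using integral_linear[OF ifx blinfun.bounded_linear_left[of v]] by (simp add: o_def)
    also have "\<dots> = integral {0..1} (\<lambda>t. t *\<^sub>R dd a (t *\<^sub>R x0) v)"
      unfolding box_real by (intro Henstock_Kurzweil_Integration.integral_cong fxa[OF x0])
    finally show ?thesis .
  qed
  then have "blinfun_apply (integral (cbox 0 1) (fx x0)) = (\<lambda>v. integral {0..1} (\<lambda>t. t *\<^sub>R dd a (t *\<^sub>R x0) v))" by blast
  then show ?thesis using D x0 by (simp add: at_within_open[OF x0])
qed

text \<open>The homotopy operator of the Poincare lemma, on one-forms.\<close>

definition ray_integral :: "('a::euclidean_space \<Rightarrow> 'a \<Rightarrow> 'b::euclidean_space) \<Rightarrow> 'a \<Rightarrow> 'b" where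
  "ray_integral \<alpha> x = integral {0..1} (\<lambda>t. \<alpha> (t *\<^sub>R x) x)"

text \<open>The regularity is that of the Picard iterates below, which are followed together with
  their first derivatives.\<close>

locale one_form =
  fixes \<alpha> :: "'a::euclidean_space \<Rightarrow> 'a \<Rightarrow> 'b::euclidean_space" and r :: real
  assumes C1: "Ck_on 1 (ball 0 r) (\<lambda>z. \<alpha> z v)"
    and lin: "z \<in> ball 0 r \<Longrightarrow> linear (\<alpha> z)"
begin

text \<open>The exterior derivative of \<alpha>, evaluated on constant fields.\<close>

definition ext :: "'a \<Rightarrow> 'a \<Rightarrow> 'a \<Rightarrow> 'b" where
  "ext z v w = dd (\<lambda>z. \<alpha> z w) z v - dd (\<lambda>z. \<alpha> z v) z w"

lemma diff: "z \<in> ball 0 r \<Longrightarrow> (\<lambda>z. \<alpha> z v) differentiable (at z)"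
  using C1 by (simp add: Ck_on_1)

lemma cont: "continuous_on (ball 0 r) (\<lambda>z. \<alpha> z v)"
  using Ck_on_SucD[of 0 "ball 0 r" "\<lambda>z. \<alpha> z v"] C1[of v] by simp

lemma cont_dd: "continuous_on (ball 0 r) (\<lambda>z. dd (\<lambda>z. \<alpha> z v) z w)"
  using C1 by (simp add: Ck_on_1)

lemma expand: "z \<in> ball 0 r \<Longrightarrow> \<alpha> z v = (\<Sum>b\<in>Basis. (v \<bullet> b) *\<^sub>R \<alpha> z b)"
proof -
  assume z: "z \<in> ball 0 r"
  have "\<alpha> z v = \<alpha> z (\<Sum>b\<in>Basis. (v \<bullet> b) *\<^sub>R b)" by (simp add: euclidean_representation)
  then show ?thesis by (simp add: linear_sum[OF lin[OF z]] linear_scale[OF lin[OF z]])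
qed

lemma expand_dd: 
  assumes z: "z \<in> ball 0 r"
  shows "dd (\<lambda>z. \<alpha> z v) z w = (\<Sum>b\<in>Basis. (v \<bullet> b) *\<^sub>R dd (\<lambda>z. \<alpha> z b) z w)"
proof -
  have "dd (\<lambda>z. \<alpha> z v) z = dd (\<lambda>z. \<Sum>b\<in>Basis. (v \<bullet> b) *\<^sub>R \<alpha> z b) z"
    by (rule dd_cong_open[OF open_ball z]) (rule expand)
  moreover have "dd (\<lambda>z. \<Sum>b\<in>Basis. (v \<bullet> b) *\<^sub>R \<alpha> z b) z w = (\<Sum>b\<in>Basis. (v \<bullet> b) *\<^sub>R dd (\<lambda>z. \<alpha> z b) z w)"
    by (rule dd_eq) (intro has_derivative_sum has_derivative_scaleR_right has_derivative_dd diff z)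
  ultimately show ?thesis by simp
qed

lemma ray_cont: "x \<in> ball 0 r \<Longrightarrow> continuous_on {0..1} (\<lambda>t. \<alpha> (t *\<^sub>R x) v)"
  by (rule continuous_on_ray1[OF cont])

lemma ray_cont_dd: "x \<in> ball 0 r \<Longrightarrow> continuous_on {0..1} (\<lambda>t. dd (\<lambda>z. \<alpha> z v) (t *\<^sub>R x) w)"
  by (rule continuous_on_ray1[OF cont_dd])

lemma ray_cont_ext:
  "x \<in> ball 0 r \<Longrightarrow> continuous_on {0..1} (\<lambda>t. t *\<^sub>R ext (t *\<^sub>R x) v w)"
  unfolding ext_def by (intro continuous_on_scaleR continuous_on_diff continuous_on_id ray_cont_dd)

lemma ray_integral_sum:
  assumes "x \<in> ball 0 r"
  shows "ray_integral \<alpha> x = (\<Sum>b\<in>Basis. (x \<bullet> b) *\<^sub>R integral {0..1} (\<lambda>t. \<alpha> (t *\<^sub>R x) b))"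
proof -
  have "ray_integral \<alpha> x = integral {0..1} (\<lambda>t. \<Sum>b\<in>Basis. (x \<bullet> b) *\<^sub>R \<alpha> (t *\<^sub>R x) b)"
    unfolding ray_integral_def using expand[OF scaleR_in_ball0[OF assms]]
    by (intro Henstock_Kurzweil_Integration.integral_cong) blast
  also have "\<dots> = (\<Sum>b\<in>Basis. integral {0..1} (\<lambda>t. (x \<bullet> b) *\<^sub>R \<alpha> (t *\<^sub>R x) b))"
    using ray_cont[OF assms]
    by (intro integral_sum integrable_continuous_interval continuous_intros) auto
  finally show ?thesis by simp
qed

text \<open>The point x occurs twice in the integrand. Expanding the second occurrence in the basis
  takes it out of the integral, so that the product rule and
  \<open>ray_integral_has_derivative\<close> treat one occurrence each.\<close>

lemma has_derivative_ray_integral: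
  assumes x: "x \<in> ball 0 r"
  shows "(ray_integral \<alpha> has_derivative
    (\<lambda>v. integral {0..1} (\<lambda>t. \<alpha> (t *\<^sub>R x) v + t *\<^sub>R dd (\<lambda>z. \<alpha> z x) (t *\<^sub>R x) v))) (at x)"
proof -
  have "((\<lambda>x. \<Sum>b\<in>Basis. (x \<bullet> b) *\<^sub>R integral {0..1} (\<lambda>t. \<alpha> (t *\<^sub>R x) b)) has_derivative
    (\<lambda>v. \<Sum>b\<in>Basis. (x \<bullet> b) *\<^sub>R integral {0..1} (\<lambda>t. t *\<^sub>R dd (\<lambda>z. \<alpha> z b) (t *\<^sub>R x) v) + (v \<bullet> b) *\<^sub>R integral {0..1} (\<lambda>t. \<alpha> (t *\<^sub>R x) b))) (at x)"
    by (intro has_derivative_sum has_derivative_scaleR has_derivative_inner_left has_derivative_ident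
        ray_integral_has_derivative[OF C1 x])
  moreover have "(\<Sum>b\<in>Basis. (x \<bullet> b) *\<^sub>R integral {0..1} (\<lambda>t. t *\<^sub>R dd (\<lambda>z. \<alpha> z b) (t *\<^sub>R x) v) + (v \<bullet> b) *\<^sub>R integral {0..1} (\<lambda>t. \<alpha> (t *\<^sub>R x) b))
     = integral {0..1} (\<lambda>t. \<alpha> (t *\<^sub>R x) v + t *\<^sub>R dd (\<lambda>z. \<alpha> z x) (t *\<^sub>R x) v)" for v
  proof -
    have "integral {0..1} (\<lambda>t. \<alpha> (t *\<^sub>R x) v + t *\<^sub>R dd (\<lambda>z. \<alpha> z x) (t *\<^sub>R x) v)
      = integral {0..1} (\<lambda>t. \<Sum>b\<in>Basis. (x \<bullet> b) *\<^sub>R (t *\<^sub>R dd (\<lambda>z. \<alpha> z b) (t *\<^sub>R x) v) + (v \<bullet> b) *\<^sub>R \<alpha> (t *\<^sub>R x) b)"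
    proof (rule Henstock_Kurzweil_Integration.integral_cong)
      fix t :: real assume "t \<in> {0..1}"
      then have "t *\<^sub>R x \<in> ball 0 r" using x scaleR_in_ball0 by blast
      from expand[OF this, of v] expand_dd[OF this, of x v]
      show "\<alpha> (t *\<^sub>R x) v + t *\<^sub>R dd (\<lambda>z. \<alpha> z x) (t *\<^sub>R x) v
        = (\<Sum>b\<in>Basis. (x \<bullet> b) *\<^sub>R (t *\<^sub>R dd (\<lambda>z. \<alpha> z b) (t *\<^sub>R x) v) + (v \<bullet> b) *\<^sub>R \<alpha> (t *\<^sub>R x) b)"
        by (simp add: sum.distrib scaleR_sum_right mult.commute)
    qed
    also have "\<dots> = (\<Sum>b\<in>Basis. integral {0..1} (\<lambda>t. (x \<bullet> b) *\<^sub>R (t *\<^sub>R dd (\<lambda>z. \<alpha> z b) (t *\<^sub>R x) v) + (v \<bullet> b) *\<^sub>R \<alpha> (t *\<^sub>R x) b))"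
      using ray_cont[OF x] ray_cont_dd[OF x]
      by (intro integral_sum integrable_continuous_interval continuous_intros) auto
    also have "\<dots> = (\<Sum>b\<in>Basis. integral {0..1} (\<lambda>t. (x \<bullet> b) *\<^sub>R (t *\<^sub>R dd (\<lambda>z. \<alpha> z b) (t *\<^sub>R x) v)) + integral {0..1} (\<lambda>t. (v \<bullet> b) *\<^sub>R \<alpha> (t *\<^sub>R x) b))"
      using ray_cont[OF x] ray_cont_dd[OF x]
      by (intro sum.cong refl Henstock_Kurzweil_Integration.integral_add integrable_continuous_interval continuous_intros) auto
    finally show ?thesis by (simp only: Henstock_Kurzweil_Integration.integral_cmul)
  qed
  ultimately have "((\<lambda>x. \<Sum>b\<in>Basis. (x \<bullet> b) *\<^sub>R integral {0..1} (\<lambda>t. \<alpha> (t *\<^sub>R x) b)) has_derivative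
    (\<lambda>v. integral {0..1} (\<lambda>t. \<alpha> (t *\<^sub>R x) v + t *\<^sub>R dd (\<lambda>z. \<alpha> z x) (t *\<^sub>R x) v))) (at x)"
    by simp
  then show ?thesis
    using has_derivative_cong_open[OF open_ball x, of "ray_integral \<alpha>", OF ray_integral_sum] by blast
qed

text \<open>Fundamental theorem of calculus for
  \<open>t *\<^sub>R \<alpha> (t *\<^sub>R x) v\<close> on the unit interval.\<close>

lemma ray_integral_ftc:
  assumes x: "x \<in> ball 0 r"
  shows "integral {0..1} (\<lambda>t. \<alpha> (t *\<^sub>R x) v + t *\<^sub>R dd (\<lambda>z. \<alpha> z v) (t *\<^sub>R x) x) = \<alpha> x v"
proof -
  have D: "((\<lambda>t. t *\<^sub>R \<alpha> (t *\<^sub>R x) v) has_vector_derivative \<alpha> (t *\<^sub>R x) v + t *\<^sub>R dd (\<lambda>z. \<alpha> z v) (t *\<^sub>R x) x) (at t within {0..1})"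
    if t: "t \<in> {0..1}" for t
  proof -
    note tx = scaleR_in_ball0[OF x t]
    have "((\<lambda>t. \<alpha> (t *\<^sub>R x) v) has_derivative (\<lambda>d. dd (\<lambda>z. \<alpha> z v) (t *\<^sub>R x) (d *\<^sub>R x))) (at t within {0..1})"
      by (rule has_derivative_compose[of "\<lambda>t. t *\<^sub>R x" "\<lambda>d. d *\<^sub>R x" t "{0..1}" "\<lambda>z. \<alpha> z v", OF _ has_derivative_dd[OF diff[OF tx]]])
        (auto intro!: derivative_eq_intros)
    then have "((\<lambda>t. \<alpha> (t *\<^sub>R x) v) has_vector_derivative dd (\<lambda>z. \<alpha> z v) (t *\<^sub>R x) x) (at t within {0..1})"
      unfolding has_vector_derivative_def by (simp add: linear_scale[OF linear_dd[OF diff[OF tx]]])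
    from has_vector_derivative_scaleR[OF DERIV_ident this]
    show ?thesis by (simp add: add.commute)
  qed
  have "((\<lambda>t. \<alpha> (t *\<^sub>R x) v + t *\<^sub>R dd (\<lambda>z. \<alpha> z v) (t *\<^sub>R x) x) has_integral (1 *\<^sub>R \<alpha> (1 *\<^sub>R x) v - 0 *\<^sub>R \<alpha> (0 *\<^sub>R x) v)) {0..1}"
    by (rule fundamental_theorem_of_calculus) (use D in auto)
  then show ?thesis by (simp add: integral_unique)
qed

text \<open>Subtracting \<open>ray_integral_ftc\<close> from
  \<open>has_derivative_ray_integral\<close> cancels the terms without derivatives and leaves the
  exterior derivative along the ray: the ray integral is a primitive of \<alpha> up to the failure
  of closedness.\<close>

lemma ray_integral_homotopy:
  assumes x: "x \<in> ball 0 r"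
  shows "dd (ray_integral \<alpha>) x v - \<alpha> x v = integral {0..1} (\<lambda>t. t *\<^sub>R ext (t *\<^sub>R x) v x)"
proof -
  have "dd (ray_integral \<alpha>) x v - \<alpha> x v =
    integral {0..1} (\<lambda>t. \<alpha> (t *\<^sub>R x) v + t *\<^sub>R dd (\<lambda>z. \<alpha> z x) (t *\<^sub>R x) v) -
    integral {0..1} (\<lambda>t. \<alpha> (t *\<^sub>R x) v + t *\<^sub>R dd (\<lambda>z. \<alpha> z v) (t *\<^sub>R x) x)"
    using dd_eq[OF has_derivative_ray_integral[OF x]] ray_integral_ftc[OF x] by simp
  also have "\<dots> = integral {0..1} (\<lambda>t. (\<alpha> (t *\<^sub>R x) v + t *\<^sub>R dd (\<lambda>z. \<alpha> z x) (t *\<^sub>R x) v) -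
     (\<alpha> (t *\<^sub>R x) v + t *\<^sub>R dd (\<lambda>z. \<alpha> z v) (t *\<^sub>R x) x))"
    using ray_cont[OF x] ray_cont_dd[OF x]
    by (intro Henstock_Kurzweil_Integration.integral_diff[symmetric] integrable_continuous_interval continuous_intros)
  also have "\<dots> = integral {0..1} (\<lambda>t. t *\<^sub>R ext (t *\<^sub>R x) v x)"
    by (simp add: ext_def scaleR_diff_right)
  finally show ?thesis .
qed

lemma Ck_ray_integral: "Ck_on 1 (ball 0 r) (ray_integral \<alpha>)"
proof -
  have "continuous_on (ball 0 r) (\<lambda>x. dd (ray_integral \<alpha>) x v)" for v
  proof -
    have "continuous_on (ball 0 r \<times> {0..1}) (\<lambda>p. (case p of (x, t) \<Rightarrow> \<alpha> (t *\<^sub>R x) v) +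
      (\<Sum>b\<in>Basis. (fst p \<bullet> b) *\<^sub>R snd p *\<^sub>R (case p of (x, t) \<Rightarrow> dd (\<lambda>z. \<alpha> z b) (t *\<^sub>R x) v)))"
      by (intro continuous_intros continuous_on_ray cont cont_dd)
    moreover have "(case p of (x, t) \<Rightarrow> \<alpha> (t *\<^sub>R x) v) +
      (\<Sum>b\<in>Basis. (fst p \<bullet> b) *\<^sub>R snd p *\<^sub>R (case p of (x, t) \<Rightarrow> dd (\<lambda>z. \<alpha> z b) (t *\<^sub>R x) v))
      = (\<lambda>(x, t). \<alpha> (t *\<^sub>R x) v + t *\<^sub>R dd (\<lambda>z. \<alpha> z x) (t *\<^sub>R x) v) p" if "p \<in> ball 0 r \<times> {0..1}" for p
    proof -
      have "snd p *\<^sub>R fst p \<in> ball 0 r" using that scaleR_in_ball0 by (metis mem_Times_iff)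
      from expand_dd[OF this, of "fst p" v] show ?thesis
        by (simp add: split_beta scaleR_sum_right mult.commute)
    qed
    ultimately have "continuous_on (ball 0 r \<times> {0..1}) (\<lambda>(x, t). \<alpha> (t *\<^sub>R x) v + t *\<^sub>R dd (\<lambda>z. \<alpha> z x) (t *\<^sub>R x) v)"
      by (simp cong: continuous_on_cong)
    then have "continuous_on (ball 0 r) (\<lambda>x. integral (cbox 0 1) (\<lambda>t. \<alpha> (t *\<^sub>R x) v + t *\<^sub>R dd (\<lambda>z. \<alpha> z x) (t *\<^sub>R x) v))"
      by (intro integral_continuous_on_param) simp
    then show ?thesis
      by (subst continuous_on_cong[OF refl dd_eq[OF has_derivative_ray_integral]]) auto
  qed
  then show ?thesis unfolding Ck_on_1
    using has_derivative_ray_integral unfolding differentiable_def by blast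
qed

end

text \<open>Picard iteration for \<open>dP = \<Omega>P\<close>. The homotopy formula shows that the defect
  \<open>dP\<^sub>k - \<Omega>P\<^sub>k\<close> satisfies a contractive recursion when \<open>\<Omega>\<close> is flat, so that the derivatives
  converge together with the iterates.\<close>

locale flat_system =
  fixes \<Omega> :: "'a::euclidean_space \<Rightarrow> 'a \<Rightarrow> 'b::euclidean_space \<Rightarrow> 'b"
    and r M :: real and y0 :: 'b
  assumes r: "r > 0"
    and smooth: "smooth_on (ball 0 r) (\<lambda>x. \<Omega> x v y)"
    and lin1: "x \<in> ball 0 r \<Longrightarrow> linear (\<lambda>v. \<Omega> x v y)"
    and lin2: "x \<in> ball 0 r \<Longrightarrow> linear (\<Omega> x v)"
    and bound: "x \<in> ball 0 r \<Longrightarrow> norm (\<Omega> x v y) \<le> M * norm v * norm y"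
    and M: "M \<ge> 0" "M * r \<le> 1/4"
    and flat: "x \<in> ball 0 r \<Longrightarrow>
      dd (\<lambda>x. \<Omega> x w y) x v + \<Omega> x w (\<Omega> x v y) = dd (\<lambda>x. \<Omega> x v y) x w + \<Omega> x v (\<Omega> x w y)"
begin

primrec P :: "nat \<Rightarrow> 'a \<Rightarrow> 'b" where
  "P 0 = (\<lambda>x. y0)"
| "P (Suc k) = (\<lambda>x. y0 + ray_integral (\<lambda>x v. \<Omega> x v (P k x)) x)"

lemma expand2: "x \<in> ball 0 r \<Longrightarrow> \<Omega> x v y = (\<Sum>b\<in>Basis. (y \<bullet> b) *\<^sub>R \<Omega> x v b)"
proof -
  assume z: "x \<in> ball 0 r"
  have "\<Omega> x v y = \<Omega> x v (\<Sum>b\<in>Basis. (y \<bullet> b) *\<^sub>R b)" by (simp add: euclidean_representation)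
  then show ?thesis by (simp add: linear_sum[OF lin2[OF z]] linear_scale[OF lin2[OF z]])
qed

lemma Ck_apply: "Ck_on k (ball 0 r) Q \<Longrightarrow> Ck_on k (ball 0 r) (\<lambda>x. \<Omega> x v (Q x))"
proof -
  assume Q: "Ck_on k (ball 0 r) Q"
  have "Ck_on k (ball 0 r) (\<lambda>x. \<Sum>b\<in>Basis. (Q x \<bullet> b) *\<^sub>R \<Omega> x v b)"
    by (intro Ck_on_sum Ck_on_bilinear[OF _ bounded_bilinear_scaleR] Ck_on_bilinear[OF _ bounded_bilinear_inner] Ck_on_const Q open_ball)
      (use smooth smooth_on_def in blast)
  then show ?thesis
    using Ck_on_cong[OF open_ball, of 0 r "\<lambda>x. \<Omega> x v (Q x)" "\<lambda>x. \<Sum>b\<in>Basis. (Q x \<bullet> b) *\<^sub>R \<Omega> x v b" k]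
      expand2 by blast
qed

lemma dd_apply:
  assumes x: "x \<in> ball 0 r" and Q: "Q differentiable (at x)"
  shows "dd (\<lambda>x. \<Omega> x w (Q x)) x v = dd (\<lambda>z. \<Omega> z w (Q x)) x v + \<Omega> x w (dd Q x v)"
proof -
  have D: "(\<lambda>x. \<Omega> x w b) differentiable (at x)" for b
    using smooth_on_differentiable[OF smooth x] .
  have "dd (\<lambda>x. \<Omega> x w (Q x)) x = dd (\<lambda>x. \<Sum>b\<in>Basis. (Q x \<bullet> b) *\<^sub>R \<Omega> x w b) x"
    by (rule dd_cong_open[OF open_ball x]) (rule expand2)
  moreover have "dd (\<lambda>x. \<Sum>b\<in>Basis. (Q x \<bullet> b) *\<^sub>R \<Omega> x w b) x v =
      (\<Sum>b\<in>Basis. (Q x \<bullet> b) *\<^sub>R dd (\<lambda>x. \<Omega> x w b) x v + (dd Q x v \<bullet> b) *\<^sub>R \<Omega> x w b)"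
    by (rule dd_eq) (intro has_derivative_sum has_derivative_scaleR has_derivative_inner_left has_derivative_dd Q D)
  moreover have "dd (\<lambda>z. \<Omega> z w (Q x)) x = dd (\<lambda>z. \<Sum>b\<in>Basis. (Q x \<bullet> b) *\<^sub>R \<Omega> z w b) x"
    by (rule dd_cong_open[OF open_ball x]) (rule expand2)
  moreover have "dd (\<lambda>z. \<Sum>b\<in>Basis. (Q x \<bullet> b) *\<^sub>R \<Omega> z w b) x v = (\<Sum>b\<in>Basis. (Q x \<bullet> b) *\<^sub>R dd (\<lambda>x. \<Omega> x w b) x v)"
    by (rule dd_eq) (intro has_derivative_sum has_derivative_scaleR_right has_derivative_dd D)
  ultimately show ?thesis
    using expand2[OF x, of w "dd Q x v"] by (simp add: sum.distrib)
qed

lemma C1_one_form: "Ck_on 1 (ball 0 r) Q \<Longrightarrow> one_form (\<lambda>x v. \<Omega> x v (Q x)) r"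
  by (rule one_form.intro) (intro Ck_apply, assumption, intro lin1)

lemma C1_P: "Ck_on 1 (ball 0 r) (P k)"
proof (induction k)
  case 0 then show ?case using Ck_on_const by simp
next
  case (Suc k)
  interpret one_form "\<lambda>x v. \<Omega> x v (P k x)" r by (rule C1_one_form[OF Suc])
  show ?case unfolding P.simps by (intro Ck_on_add open_ball Ck_on_const Ck_ray_integral)
qed

lemma diff_P: "x \<in> ball 0 r \<Longrightarrow> P k differentiable (at x)"
  using C1_P[of k] by (simp add: Ck_on_1)

definition defect :: "nat \<Rightarrow> 'a \<Rightarrow> 'a \<Rightarrow> 'b" where
  "defect k x v = dd (P k) x v - \<Omega> x v (P k x)"

text \<open>The product rule produces derivatives of \<Omega> and terms in which \<Omega> is applied
  to the derivative of \<open>P k\<close>. Once that derivative is written as \<Omega> applied to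
  \<open>P k\<close> plus the defect, \<open>flat\<close> cancels everything that does not contain
  the defect.\<close>

lemma ext_P:
  assumes x: "x \<in> ball 0 r"
  shows "one_form.ext (\<lambda>x v. \<Omega> x v (P k x)) x v w = \<Omega> x w (defect k x v) - \<Omega> x v (defect k x w)"
proof -
  interpret one_form "\<lambda>x v. \<Omega> x v (P k x)" r by (rule C1_one_form[OF C1_P])
  show ?thesis
    using flat[OF x, of w "P k x" v]
    by (simp add: ext_def defect_def dd_apply[OF x diff_P[OF x]] linear_diff[OF lin2[OF x]] algebra_simps)
qed

lemma norm_ray_integral_le:
  fixes f :: "real \<Rightarrow> 'b"
  assumes "continuous_on {0..1} f" "\<And>t. t \<in> {0..1} \<Longrightarrow> norm (f t) \<le> B"
  shows "norm (integral {0..1} f) \<le> B"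
  using integral_bound[of 0 1 f B] assms by simp

text \<open>A ray inside the ball is shorter than r, so each iteration contributes a factor M * r
  \<le> 1/4.\<close>

lemma step_bound:
  assumes x: "x \<in> ball 0 r"
  shows "norm (P (Suc k) x - P k x) \<le> norm y0 * (1/4) ^ k"
  using x
proof (induction k arbitrary: x)
  case 0
  interpret one_form "\<lambda>x v. \<Omega> x v (P 0 x)" r by (rule C1_one_form[OF C1_P])
  have "norm (\<Omega> (t *\<^sub>R x) x (P 0 (t *\<^sub>R x))) \<le> norm y0" if "t \<in> {0..1}" for t
  proof -
    have "norm (\<Omega> (t *\<^sub>R x) x y0) \<le> M * norm x * norm y0"
      by (rule bound[OF scaleR_in_ball0[OF 0 that]])
    also have "\<dots> \<le> M * r * norm y0"
      using 0 M by (intro mult_right_mono mult_left_mono) auto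
    also have "\<dots> \<le> 1 * norm y0" using M by (intro mult_right_mono) auto
    finally show ?thesis by simp
  qed
  from norm_ray_integral_le[OF ray_cont[OF 0] this] show ?case by (simp add: ray_integral_def)
next
  case (Suc k)
  interpret A: one_form "\<lambda>x v. \<Omega> x v (P k x)" r by (rule C1_one_form[OF C1_P])
  interpret B: one_form "\<lambda>x v. \<Omega> x v (P (Suc k) x)" r by (rule C1_one_form[OF C1_P])
  have "P (Suc (Suc k)) x - P (Suc k) x = integral {0..1} (\<lambda>t. \<Omega> (t *\<^sub>R x) x (P (Suc k) (t *\<^sub>R x)))
     - integral {0..1} (\<lambda>t. \<Omega> (t *\<^sub>R x) x (P k (t *\<^sub>R x)))"
    by (simp add: ray_integral_def)
  also have "\<dots> = integral {0..1} (\<lambda>t. \<Omega> (t *\<^sub>R x) x (P (Suc k) (t *\<^sub>R x)) - \<Omega> (t *\<^sub>R x) x (P k (t *\<^sub>R x)))"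
    by (intro Henstock_Kurzweil_Integration.integral_diff[symmetric] integrable_continuous_interval
        A.ray_cont[OF Suc.prems] B.ray_cont[OF Suc.prems])
  also have "norm \<dots> \<le> norm y0 * (1/4) ^ Suc k"
  proof (rule norm_ray_integral_le)
    show "continuous_on {0..1} (\<lambda>t. \<Omega> (t *\<^sub>R x) x (P (Suc k) (t *\<^sub>R x)) - \<Omega> (t *\<^sub>R x) x (P k (t *\<^sub>R x)))"
      by (intro continuous_on_diff A.ray_cont[OF Suc.prems] B.ray_cont[OF Suc.prems])
    fix t :: real assume t: "t \<in> {0..1}"
    note tx = scaleR_in_ball0[OF Suc.prems t]
    have "norm (\<Omega> (t *\<^sub>R x) x (P (Suc k) (t *\<^sub>R x) - P k (t *\<^sub>R x)))
       \<le> M * norm x * norm (P (Suc k) (t *\<^sub>R x) - P k (t *\<^sub>R x))" by (rule bound[OF tx])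
    also have "\<dots> \<le> M * r * (norm y0 * (1/4) ^ k)"
      using Suc.prems M r by (intro mult_mono mult_left_mono Suc.IH[OF tx]) auto
    also have "\<dots> \<le> 1/4 * (norm y0 * (1/4) ^ k)" using M by (intro mult_right_mono) auto
    finally show "norm (\<Omega> (t *\<^sub>R x) x (P (Suc k) (t *\<^sub>R x)) - \<Omega> (t *\<^sub>R x) x (P k (t *\<^sub>R x))) \<le> norm y0 * (1/4) ^ Suc k"
      by (simp add: linear_diff[OF lin2[OF tx]])
  qed
  finally show ?case .
qed

lemma norm_apply_le:
  assumes x: "x \<in> ball 0 r" and y: "norm y \<le> C * norm w"
  shows "norm (\<Omega> x v y) \<le> M * C * norm v * norm w"
proof -
  have "norm (\<Omega> x v y) \<le> M * norm v * norm y" by (rule bound[OF x])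
  also have "\<dots> \<le> M * norm v * (C * norm w)" using M by (intro mult_left_mono y) auto
  finally show ?thesis by (simp add: mult_ac)
qed

text \<open>By the homotopy formula the old defect enters with the factor 2 * M * r \<le> 1/2. The
  last change of the iterate adds at most M * norm y0 * (1/4)^k, which is within a quarter of the
  k-th bound; this is the reason for the constant 4. The two shares together make 3/4.\<close>

lemma defect_bound:
  assumes x: "x \<in> ball 0 r"
  shows "norm (defect k x v) \<le> 4 * M * norm y0 * (3/4) ^ k * norm v"
  using x
proof (induction k arbitrary: x v)
  case 0
  have "defect 0 x v = - \<Omega> x v y0" by (simp add: defect_def)
  moreover have "norm (\<Omega> x v y0) \<le> M * norm v * norm y0" by (rule bound[OF 0])
  moreover have "0 \<le> M * norm v * norm y0" using M by simp
  ultimately have "norm (defect 0 x v) \<le> 4 * (M * norm v * norm y0)" by (simp only: norm_minus_cancel)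
  then show ?case by (simp add: mult_ac)
next
  case (Suc k)
  define C where "C = 4 * M * norm y0 * (3/4) ^ k"
  have C: "C \<ge> 0" unfolding C_def using M by simp
  interpret one_form "\<lambda>x v. \<Omega> x v (P k x)" r by (rule C1_one_form[OF C1_P])
  have cont_ext: "continuous_on {0..1} (\<lambda>t. t *\<^sub>R ext (t *\<^sub>R x) v x)"
    by (rule ray_cont_ext[OF Suc.prems])
  have "ray_integral (\<lambda>x v. \<Omega> x v (P k x)) differentiable (at x)"
    using Ck_ray_integral Suc.prems by (simp add: Ck_on_1)
  then have ddP: "dd (P (Suc k)) x v = dd (ray_integral (\<lambda>x v. \<Omega> x v (P k x))) x v"
    by (intro dd_eq) (auto intro!: derivative_eq_intros has_derivative_dd)
  have "defect (Suc k) x v = (dd (ray_integral (\<lambda>x v. \<Omega> x v (P k x))) x v - \<Omega> x v (P k x)) - \<Omega> x v (P (Suc k) x - P k x)"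
    unfolding defect_def ddP by (simp add: linear_diff[OF lin2[OF Suc.prems]])
  also have "\<dots> = integral {0..1} (\<lambda>t. t *\<^sub>R ext (t *\<^sub>R x) v x) - \<Omega> x v (P (Suc k) x - P k x)"
    by (simp add: ray_integral_homotopy[OF Suc.prems])
  finally have "norm (defect (Suc k) x v)
      \<le> norm (integral {0..1} (\<lambda>t. t *\<^sub>R ext (t *\<^sub>R x) v x)) + norm (\<Omega> x v (P (Suc k) x - P k x))"
    by (simp only: norm_triangle_ineq4)
  also have "\<dots> \<le> C / 2 * norm v + C / 4 * norm v"
  proof (rule add_mono)
    have ext_bound: "norm (t *\<^sub>R ext (t *\<^sub>R x) v x) \<le> C / 2 * norm v" if t: "t \<in> {0..1}" for t :: real
    proof -
      note tx = scaleR_in_ball0[OF Suc.prems t]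
      have D: "norm (defect k (t *\<^sub>R x) u) \<le> C * norm u" for u
        unfolding C_def by (rule Suc.IH[OF tx])
      have *: "norm (\<Omega> (t *\<^sub>R x) u (defect k (t *\<^sub>R x) u')) \<le> M * C * norm u * norm u'" for u u'
        by (rule norm_apply_le[OF tx D])
      have "norm (t *\<^sub>R ext (t *\<^sub>R x) v x) \<le> 1 * norm (ext (t *\<^sub>R x) v x)"
        unfolding norm_scaleR using t by (intro mult_right_mono) auto
      also have "\<dots> \<le> M * C * norm x * norm v + M * C * norm v * norm x"
        unfolding ext_P[OF tx] using norm_triangle_ineq4 *[of x v] *[of v x] by (smt (verit))
      also have "\<dots> = 2 * (M * norm x) * (C * norm v)" by (simp add: algebra_simps)
      also have "\<dots> \<le> 2 * (M * r) * (C * norm v)"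
        using Suc.prems M C by (intro mult_right_mono mult_left_mono) auto
      also have "\<dots> \<le> 2 * (1/4) * (C * norm v)"
        using M C by (intro mult_right_mono mult_left_mono) auto
      finally show ?thesis by simp
    qed
    show "norm (integral {0..1} (\<lambda>t. t *\<^sub>R ext (t *\<^sub>R x) v x)) \<le> C / 2 * norm v"
      by (rule norm_ray_integral_le[OF cont_ext ext_bound])
    have "norm (\<Omega> x v (P (Suc k) x - P k x)) \<le> M * norm v * norm (P (Suc k) x - P k x)"
      by (rule bound[OF Suc.prems])
    also have "\<dots> \<le> M * norm v * (norm y0 * (1/4) ^ k)"
      using M by (intro mult_left_mono step_bound[OF Suc.prems]) auto
    also have "\<dots> \<le> M * norm v * (norm y0 * (3/4) ^ k)"
      using M by (intro mult_left_mono power_mono) auto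
    finally show "norm (\<Omega> x v (P (Suc k) x - P k x)) \<le> C / 4 * norm v"
      unfolding C_def by (simp add: mult_ac)
  qed
  finally show ?case unfolding C_def by (simp add: algebra_simps)
qed

lemma solution_exists:
  "\<exists>Y. Y 0 = y0 \<and> (\<forall>x\<in>ball 0 r. (Y has_derivative (\<lambda>v. \<Omega> x v (Y x))) (at x))"
proof -
  \<comment> \<open>The limit of the iterates, written as a telescoping series in order to get
    uniform convergence from the geometric bound \<open>step_bound\<close>.\<close>
  define Y where "Y x = y0 + suminf (\<lambda>k. P (Suc k) x - P k x)" for x
  have "uniform_limit (ball 0 r) (\<lambda>n x. \<Sum>k<n. P (Suc k) x - P k x) (\<lambda>x. suminf (\<lambda>k. P (Suc k) x - P k x)) sequentially"
  proof (rule Weierstrass_m_test)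
    show "\<And>n x. x \<in> ball 0 r \<Longrightarrow> norm (P (Suc n) x - P n x) \<le> norm y0 * (1/4) ^ n" by (rule step_bound)
    show "summable (\<lambda>n. norm y0 * (1/4::real) ^ n)" by (intro summable_mult summable_geometric) simp
  qed
  then have "uniform_limit (ball 0 r) (\<lambda>n x. y0 + (\<Sum>k<n. P (Suc k) x - P k x)) Y sequentially"
    unfolding Y_def by (intro uniform_limit_add uniform_limit_const)
  moreover have "(\<Sum>k<n. P (Suc k) x - P k x) = P n x - y0" for n x
    using sum_lessThan_telescope[of "\<lambda>k. P k x" n] by simp
  ultimately have U: "uniform_limit (ball 0 r) P Y sequentially" by (simp add: fun_eq_iff[symmetric])
  \<comment> \<open>The derivatives converge uniformly because their distance from \<Omega> applied
    to Y is the defect plus \<Omega> applied to P - Y, and both tend to zero.\<close>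
  have "\<exists>g. \<forall>x\<in>ball 0 r. (\<lambda>n. P n x) \<longlonglongrightarrow> g x \<and> (g has_derivative (\<lambda>v. \<Omega> x v (Y x))) (at x within ball 0 r)"
  proof (rule has_derivative_sequence[where f' = "\<lambda>n x. dd (P n) x"])
    show "(P n has_derivative dd (P n) x) (at x within ball 0 r)" if "x \<in> ball 0 r" for n x
      using has_derivative_dd[OF diff_P[OF that]] has_derivative_at_withinI by blast
    show "\<forall>\<^sub>F n in sequentially. \<forall>x\<in>ball 0 r. \<forall>h. norm (dd (P n) x h - \<Omega> x h (Y x)) \<le> e * norm h"
      if e: "e > 0" for e
    proof -
      \<comment> \<open>The shift to M + 1 keeps the quotient meaningful when M = 0.\<close>
      have 1: "\<forall>\<^sub>F n in sequentially. \<forall>x\<in>ball 0 r. dist (P n x) (Y x) < e / (2 * (M + 1))"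
        using U e M unfolding uniform_limit_iff by simp
      have "(\<lambda>n. 4 * M * norm y0 * (3/4) ^ n) \<longlonglongrightarrow> 4 * M * norm y0 * 0"
        by (intro tendsto_mult_left LIMSEQ_power_zero) simp
      then have 2: "\<forall>\<^sub>F n in sequentially. 4 * M * norm y0 * (3/4) ^ n < e / 2"
        by (rule order_tendstoD(2)) (use e in simp)
      show ?thesis using 1 2
      proof eventually_elim
        case (elim n)
        show ?case
        proof (intro ballI allI)
          fix x h :: 'a assume x: "x \<in> ball 0 r"
          have "dd (P n) x h - \<Omega> x h (Y x) = defect n x h + \<Omega> x h (P n x - Y x)"
            by (simp add: defect_def linear_diff[OF lin2[OF x]])
          then have "norm (dd (P n) x h - \<Omega> x h (Y x)) \<le> norm (defect n x h) + norm (\<Omega> x h (P n x - Y x))"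
            using norm_triangle_ineq by metis
          also have "\<dots> \<le> e / 2 * norm h + e / 2 * norm h"
          proof (rule add_mono)
            show "norm (defect n x h) \<le> e / 2 * norm h"
              using defect_bound[OF x, of n h] elim(2) mult_right_mono[of "4 * M * norm y0 * (3/4) ^ n" "e/2" "norm h"]
              by simp
            have "norm (\<Omega> x h (P n x - Y x)) \<le> M * norm h * norm (P n x - Y x)" by (rule bound[OF x])
            also have "\<dots> \<le> (M + 1) * norm h * (e / (2 * (M + 1)))"
              using elim(1) x M by (intro mult_mono) (auto simp: dist_norm less_imp_le)
            also have "\<dots> = e / 2 * norm h" using M by (simp add: field_simps)
            finally show "norm (\<Omega> x h (P n x - Y x)) \<le> e / 2 * norm h" .
          qed
          finally show "norm (dd (P n) x h - \<Omega> x h (Y x)) \<le> e * norm h" by (simp add: algebra_simps)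
        qed
      qed
    qed
    show "(0::'a) \<in> ball 0 r" using r by simp
    show "(\<lambda>n. P n 0) \<longlonglongrightarrow> Y 0"
      using tendsto_uniform_limitI[OF U, of 0] r by simp
  qed (rule convex_ball)
  then obtain g where g: "\<And>x. x \<in> ball 0 r \<Longrightarrow> (\<lambda>n. P n x) \<longlonglongrightarrow> g x"
    "\<And>x. x \<in> ball 0 r \<Longrightarrow> (g has_derivative (\<lambda>v. \<Omega> x v (Y x))) (at x within ball 0 r)" by blast
  have gY: "g x = Y x" if "x \<in> ball 0 r" for x
    using LIMSEQ_unique[OF g(1)[OF that] tendsto_uniform_limitI[OF U that]] .
  have 0: "0 \<in> ball (0::'a) r" using r by simp
  \<comment> \<open>At the origin the ray has length zero, so every iterate has the prescribed value
    there.\<close>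
  have "P n 0 = y0" for n
    by (cases n) (auto simp: ray_integral_def linear_0[OF lin1[OF 0]])
  then have "(\<lambda>n. y0) \<longlonglongrightarrow> g 0" using g(1)[OF 0] by simp
  then have "g 0 = y0" by (simp add: LIMSEQ_const_iff)
  moreover have "(g has_derivative (\<lambda>v. \<Omega> x v (g x))) (at x)" if "x \<in> ball 0 r" for x
    using g(2)[OF that] gY[OF that] that by (simp add: at_within_open[OF that])
  ultimately show ?thesis by blast
qed

end

lemma bilinear_uniform_bound:
  fixes \<Omega> :: "'a::euclidean_space \<Rightarrow> 'a \<Rightarrow> 'b::euclidean_space \<Rightarrow> 'b"
  assumes "compact K" "\<And>v y. continuous_on K (\<lambda>x. \<Omega> x v y)"
    and "\<And>x y. x \<in> K \<Longrightarrow> linear (\<lambda>v. \<Omega> x v y)" "\<And>x v. x \<in> K \<Longrightarrow> linear (\<Omega> x v)"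
  obtains M where "M \<ge> 0" "\<And>x v y. x \<in> K \<Longrightarrow> norm (\<Omega> x v y) \<le> M * norm v * norm y"
proof -
  have "\<exists>B. \<forall>x\<in>K. norm (\<Omega> x v y) \<le> B" for v y
    using compact_imp_bounded[OF compact_continuous_image[OF assms(2)[of v y] assms(1)]]
    unfolding bounded_iff by auto
  then have "\<exists>B. \<forall>v y. \<forall>x\<in>K. norm (\<Omega> x v y) \<le> B v y" by (intro choice allI)
  then obtain B where B: "\<And>v y x. x \<in> K \<Longrightarrow> norm (\<Omega> x v y) \<le> B v y" by blast
  define M where "M = (\<Sum>v\<in>Basis. \<Sum>y\<in>Basis. \<bar>B v y\<bar>)"
  have "norm (\<Omega> x v y) \<le> M * norm v * norm y" if x: "x \<in> K" for x v y
  proof -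
    have "\<Omega> x v y = \<Omega> x (\<Sum>b\<in>Basis. (v \<bullet> b) *\<^sub>R b) (\<Sum>c\<in>Basis. (y \<bullet> c) *\<^sub>R c)"
      by (simp add: euclidean_representation)
    also have "\<dots> = (\<Sum>b\<in>Basis. \<Sum>c\<in>Basis. ((v \<bullet> b) * (y \<bullet> c)) *\<^sub>R \<Omega> x b c)"
      by (simp add: linear_sum[OF assms(3)[OF x]] linear_scale[OF assms(3)[OF x]]
          linear_sum[OF assms(4)[OF x]] linear_scale[OF assms(4)[OF x]] scaleR_sum_right)
        (subst sum.swap, simp add: mult.commute)
    finally have "norm (\<Omega> x v y) \<le> (\<Sum>b\<in>Basis. \<Sum>c\<in>Basis. norm (((v \<bullet> b) * (y \<bullet> c)) *\<^sub>R \<Omega> x b c))"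
      by (simp only:) (intro order_trans[OF norm_sum] sum_mono norm_sum)
    also have "\<dots> \<le> (\<Sum>b\<in>(Basis::'a set). \<Sum>c\<in>(Basis::'b set). (norm v * norm y) * \<bar>B b c\<bar>)"
    proof (intro sum_mono)
      fix b :: 'a and c :: 'b assume "b \<in> Basis" "c \<in> Basis"
      then have "\<bar>v \<bullet> b\<bar> * \<bar>y \<bullet> c\<bar> \<le> norm v * norm y"
        by (intro mult_mono Basis_le_norm) auto
      then show "norm (((v \<bullet> b) * (y \<bullet> c)) *\<^sub>R \<Omega> x b c) \<le> (norm v * norm y) * \<bar>B b c\<bar>"
        using B[OF x, of b c] by (auto simp: abs_mult intro!: mult_mono)
    qed
    also have "\<dots> = M * norm v * norm y"
      by (simp add: M_def sum_distrib_left[symmetric] mult_ac)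
    finally show ?thesis .
  qed
  moreover have "M \<ge> 0" unfolding M_def by (intro sum_nonneg) simp
  ultimately show ?thesis using that by blast
qed

text \<open>\<open>flat\<close> says that the connection d - \<Omega> has no curvature, which is the
  symmetry of the second derivative of a solution. A translation of x0 to the origin and a radius
  small against the bound of \<Omega> reduce the claim to \<open>flat_system\<close>.\<close>

theorem flat_linear_system:
  fixes \<Omega> :: "'a::euclidean_space \<Rightarrow> 'a \<Rightarrow> 'b::euclidean_space \<Rightarrow> 'b"
  assumes S: "open S" "x0 \<in> S"
    and smooth: "\<And>v y. smooth_on S (\<lambda>x. \<Omega> x v y)"
    and lin1: "\<And>x y. x \<in> S \<Longrightarrow> linear (\<lambda>v. \<Omega> x v y)"
    and lin2: "\<And>x v. x \<in> S \<Longrightarrow> linear (\<Omega> x v)"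
    and flat: "\<And>x v w y. x \<in> S \<Longrightarrow>
      dd (\<lambda>x. \<Omega> x w y) x v + \<Omega> x w (\<Omega> x v y) = dd (\<lambda>x. \<Omega> x v y) x w + \<Omega> x v (\<Omega> x w y)"
  obtains r Y where "r > 0" "ball x0 r \<subseteq> S" "Y x0 = y0" "smooth_on (ball x0 r) Y"
    "\<And>x. x \<in> ball x0 r \<Longrightarrow> (Y has_derivative (\<lambda>v. \<Omega> x v (Y x))) (at x)"
proof -
  obtain R where R: "R > 0" "cball x0 R \<subseteq> S" using S open_contains_cball by blast
  have "continuous_on (cball x0 R) (\<lambda>x. \<Omega> x v y)" for v y
    using smooth_on_continuous_on[OF smooth] R(2) continuous_on_subset by blast
  then obtain M where M: "M \<ge> 0" "\<And>x v y. x \<in> cball x0 R \<Longrightarrow> norm (\<Omega> x v y) \<le> M * norm v * norm y"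
    using bilinear_uniform_bound[of "cball x0 R" \<Omega>] lin1 lin2 R(2) by (metis compact_cball subsetD)
  \<comment> \<open>The second entry gives M * r \<le> 1/4, with M + 1 again covering M = 0.\<close>
  define r where "r = min R (1 / (4 * (M + 1)))"
  have r: "r > 0" "r \<le> R" using R M by (auto simp: r_def)
  have "M * r \<le> M * (1 / (4 * (M + 1)))" using M(1) by (intro mult_left_mono) (auto simp: r_def)
  also have "\<dots> \<le> 1/4" using M(1) by (simp add: field_simps)
  finally have Mr: "M * r \<le> 1/4" .
  define O' where "O' x = \<Omega> (x0 + x)" for x
  have inS: "x0 + x \<in> S" "x0 + x \<in> cball x0 R" if "x \<in> ball 0 r" for x
    using that R(2) r(2) by (auto simp: dist_norm)
  have shift: "dd (\<lambda>x. \<Omega> (x0 + x) v y) x w = dd (\<lambda>x. \<Omega> x v y) (x0 + x) w" if "x \<in> ball 0 r" for v y x w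
  proof -
    have "((\<lambda>x. \<Omega> (x0 + x) v y) has_derivative (\<lambda>w. dd (\<lambda>x. \<Omega> x v y) (x0 + x) w)) (at x)"
      by (rule has_derivative_compose[of "\<lambda>x. x0 + x" "\<lambda>w. w" x UNIV "\<lambda>x. \<Omega> x v y",
            OF _ smooth_on_has_derivative[OF smooth inS(1)[OF that]]])
        (auto intro!: derivative_eq_intros)
    then show ?thesis by (rule dd_eq)
  qed
  interpret F: flat_system O' r M y0
  proof (rule flat_system.intro)
    show "smooth_on (ball 0 r) (\<lambda>x. O' x v y)" for v y
      unfolding O'_def
    proof (rule smooth_on_compose[OF open_ball S(1) _ smooth])
      show "(\<lambda>x. x0 + x) ` ball 0 r \<subseteq> S" using inS(1) by blast
      show "smooth_on (ball 0 r) (\<lambda>x. x0 + x)"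
        by (rule smooth_on_add[OF open_ball smooth_on_const smooth_on_bounded_linear[OF bounded_linear_ident]])
    qed
    show "dd (\<lambda>x. O' x w y) x v + O' x w (O' x v y) = dd (\<lambda>x. O' x v y) x w + O' x v (O' x w y)"
      if "x \<in> ball 0 r" for x w y v
      unfolding O'_def shift[OF that] by (rule flat[OF inS(1)[OF that]])
    show "linear (\<lambda>v. O' x v y)" "linear (O' x v)" "norm (O' x v y) \<le> M * norm v * norm y"
      if "x \<in> ball 0 r" for x v y
      unfolding O'_def by (fact lin1[OF inS(1)[OF that]], fact lin2[OF inS(1)[OF that]], fact M(2)[OF inS(2)[OF that]])
    show "r > 0" by (fact r(1))
    show "M \<ge> 0" by (fact M(1))
    show "M * r \<le> 1/4" by (fact Mr)
  qed
  obtain Z where Z0: "Z 0 = y0 \<and> (\<forall>x\<in>ball 0 r. (Z has_derivative (\<lambda>v. O' x v (Z x))) (at x))"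
    using F.solution_exists by (rule exE)
  note Z = conjunct1[OF Z0] bspec[OF conjunct2[OF Z0]]
  define Y where "Y x = Z (x - x0)" for x
  have D: "(Y has_derivative (\<lambda>v. \<Omega> x v (Y x))) (at x)" if "x \<in> ball x0 r" for x
  proof -
    have "x - x0 \<in> ball 0 r" using that by (simp add: dist_norm norm_minus_commute)
    note Zx = Z(2)[OF this]
    have "((\<lambda>x. Z (x - x0)) has_derivative (\<lambda>v. O' (x - x0) v (Z (x - x0)))) (at x)"
      by (rule has_derivative_compose[of "\<lambda>x. x - x0" "\<lambda>w. w" x UNIV Z, OF _ Zx])
        (auto intro!: derivative_eq_intros)
    then have "(Y has_derivative (\<lambda>v. O' (x - x0) v (Y x))) (at x)" unfolding Y_def .
    then show ?thesis by (simp add: O'_def)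
  qed
  have "ball x0 r \<subseteq> cball x0 R" using r(2) by (meson ball_subset_cball subset_ball order_trans)
  then have sub: "ball x0 r \<subseteq> S" using R(2) by (rule order_trans)
  have sm: "smooth_on (ball x0 r) Y"
  proof (rule smooth_on_bootstrap[OF open_ball D])
    fix k v assume Y: "Ck_on k (ball x0 r) Y"
    have "Ck_on k (ball x0 r) (\<lambda>x. \<Omega> x v b)" for b
      using smooth_on_subset[OF smooth sub] unfolding smooth_on_def by simp
    then have "Ck_on k (ball x0 r) (\<lambda>x. \<Sum>b\<in>Basis. (Y x \<bullet> b) *\<^sub>R \<Omega> x v b)"
      by (intro Ck_on_sum Ck_on_bilinear[OF _ bounded_bilinear_scaleR] Ck_on_bilinear[OF _ bounded_bilinear_inner] Ck_on_const Y open_ball)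
    moreover have "\<Omega> x v (Y x) = (\<Sum>b\<in>Basis. (Y x \<bullet> b) *\<^sub>R \<Omega> x v b)" if "x \<in> ball x0 r" for x
    proof -
      note xS = subsetD[OF sub that]
      have "\<Omega> x v (Y x) = \<Omega> x v (\<Sum>b\<in>Basis. (Y x \<bullet> b) *\<^sub>R b)" by (simp add: euclidean_representation)
      then show ?thesis
        by (simp only: linear_sum[OF lin2[OF xS]] linear_scale[OF lin2[OF xS]])
    qed
    ultimately show "Ck_on k (ball x0 r) (\<lambda>x. \<Omega> x v (Y x))"
      using Ck_on_cong[OF open_ball, of x0 r "\<lambda>x. \<Omega> x v (Y x)" "\<lambda>x. \<Sum>b\<in>Basis. (Y x \<bullet> b) *\<^sub>R \<Omega> x v b" k]
      by simp
  qed
  have "Y x0 = y0" using Z(1) by (simp add: Y_def)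
  then show ?thesis by (rule that[OF r(1) sub _ sm D])
qed

section \<open>Umbilical distributions of Einstein submanifolds\<close>

lemma dd_dd_field:
  fixes f :: "'a::euclidean_space \<Rightarrow> 'b::euclidean_space"
  assumes S: "open S" "x \<in> S" and f: "smooth_on S f" and X: "smooth_on S X"
  shows "dd (\<lambda>z. dd f z (X z)) x v = dd (\<lambda>z. dd f z (X x)) x v + dd f x (dd X x v)"
proof -
  note df = smooth_on_differentiable[OF f]
  have 1: "dd f z u = (\<Sum>b\<in>Basis. (u \<bullet> b) *\<^sub>R dd f z b)" if "z \<in> S" for z u
    by (rule dd_sum_Basis[OF df[OF that]])
  have "dd (\<lambda>z. dd f z (X z)) x = dd (\<lambda>z. \<Sum>b\<in>Basis. (X z \<bullet> b) *\<^sub>R dd f z b) x"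
    by (rule dd_cong_open[OF S]) (rule 1)
  moreover have "dd (\<lambda>z. \<Sum>b\<in>Basis. (X z \<bullet> b) *\<^sub>R dd f z b) x v =
      (\<Sum>b\<in>Basis. (X x \<bullet> b) *\<^sub>R dd (\<lambda>z. dd f z b) x v + (dd X x v \<bullet> b) *\<^sub>R dd f x b)"
    by (rule dd_eq) (intro has_derivative_sum has_derivative_scaleR has_derivative_inner_left
        smooth_on_has_derivative[OF X S(2)] smooth_on_has_derivative[OF smooth_on_dd[OF f] S(2)])
  moreover have "dd (\<lambda>z. dd f z (X x)) x = dd (\<lambda>z. \<Sum>b\<in>Basis. (X x \<bullet> b) *\<^sub>R dd f z b) x"
    by (rule dd_cong_open[OF S]) (rule 1)
  moreover have "dd (\<lambda>z. \<Sum>b\<in>Basis. (X x \<bullet> b) *\<^sub>R dd f z b) x v =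
      (\<Sum>b\<in>Basis. (X x \<bullet> b) *\<^sub>R dd (\<lambda>z. dd f z b) x v)"
    by (rule dd_eq) (intro has_derivative_sum has_derivative_scaleR_right
        smooth_on_has_derivative[OF smooth_on_dd[OF f] S(2)])
  ultimately show ?thesis using 1[OF S(2), of "dd X x v"] by (simp add: sum.distrib)
qed

text \<open>The Codazzi equation: symmetry of the second
  derivative of \<open>Y\<close>, tested against a vector \<open>y\<close> that annihilates the \<open>E\<^sub>i\<close> at the point.\<close>

lemma codazzi_symmetry:
  fixes F :: "'a::euclidean_space \<Rightarrow> 'b::euclidean_space"
  assumes S: "open S" "x \<in> S"
    and F: "smooth_on S F" and Y: "smooth_on S Y" and N: "smooth_on S N"
    and E: "\<And>i. i \<in> I \<Longrightarrow> smooth_on S (E i)"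
    and str: "\<And>z w. z \<in> S \<Longrightarrow>
      dd Y z w = (\<Sum>i\<in>I. (dd Y z w \<bullet> E i z) *\<^sub>R E i z) + (Y z \<bullet> dd F z w) *\<^sub>R N z"
    and y: "\<And>i. i \<in> I \<Longrightarrow> E i x \<bullet> y = 0"
  defines "Q \<equiv> \<lambda>v w. (\<Sum>i\<in>I. (dd Y x w \<bullet> E i x) * (dd (E i) x v \<bullet> y - (E i x \<bullet> dd F x v) * (N x \<bullet> y)))
      + (Y x \<bullet> dd F x w) * (dd N x v \<bullet> y - (N x \<bullet> dd F x v) * (N x \<bullet> y))"
  shows "Q v w = Q w v"
proof -
  note DY = smooth_on_has_derivative[OF smooth_on_dd[OF Y] S(2)]
  note DF = smooth_on_has_derivative[OF smooth_on_dd[OF F] S(2)]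
  \<comment> \<open>\<open>str\<close> is paired with y and differentiated in direction v. The
    unknown derivatives of the coefficients along \<open>E i\<close> disappear because
    \<open>E i x\<close> is orthogonal to y.\<close>
  have main: "dd (\<lambda>z. dd Y z w) x v \<bullet> y - (Y x \<bullet> dd (\<lambda>z. dd F z w) x v) * (N x \<bullet> y)
     = (\<Sum>i\<in>I. (dd Y x w \<bullet> E i x) * (dd (E i) x v \<bullet> y)) + (Y x \<bullet> dd F x w) * (dd N x v \<bullet> y)
       + (dd Y x v \<bullet> dd F x w) * (N x \<bullet> y)" for v w
  proof -
    have "dd (\<lambda>z. dd Y z w \<bullet> y) x = dd (\<lambda>z. (\<Sum>i\<in>I. (dd Y z w \<bullet> E i z) * (E i z \<bullet> y)) + (Y z \<bullet> dd F z w) * (N z \<bullet> y)) x"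
    proof (rule dd_cong_open[OF S])
      fix z assume "z \<in> S"
      show "dd Y z w \<bullet> y = (\<Sum>i\<in>I. (dd Y z w \<bullet> E i z) * (E i z \<bullet> y)) + (Y z \<bullet> dd F z w) * (N z \<bullet> y)"
        by (subst str[OF \<open>z \<in> S\<close>, of w]) (simp add: inner_add_left inner_sum_left)
    qed
    moreover have "dd (\<lambda>z. dd Y z w \<bullet> y) x v = dd (\<lambda>z. dd Y z w) x v \<bullet> y"
      by (rule dd_eq) (intro has_derivative_inner_left DY)
    moreover have "dd (\<lambda>z. (\<Sum>i\<in>I. (dd Y z w \<bullet> E i z) * (E i z \<bullet> y)) + (Y z \<bullet> dd F z w) * (N z \<bullet> y)) x v
      = (\<Sum>i\<in>I. (dd Y x w \<bullet> E i x) * (dd (E i) x v \<bullet> y) + (dd Y x w \<bullet> dd (E i) x v + dd (\<lambda>z. dd Y z w) x v \<bullet> E i x) * (E i x \<bullet> y))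
       + ((Y x \<bullet> dd F x w) * (dd N x v \<bullet> y) + (Y x \<bullet> dd (\<lambda>z. dd F z w) x v + dd Y x v \<bullet> dd F x w) * (N x \<bullet> y))"
      by (rule dd_eq) (intro has_derivative_add has_derivative_sum has_derivative_mult has_derivative_inner_left has_derivative_inner
          DY DF smooth_on_has_derivative[OF E S(2)] smooth_on_has_derivative[OF N S(2)] smooth_on_has_derivative[OF Y S(2)])
    moreover have "(\<Sum>i\<in>I. (dd Y x w \<bullet> E i x) * (dd (E i) x v \<bullet> y) + (dd Y x w \<bullet> dd (E i) x v + dd (\<lambda>z. dd Y z w) x v \<bullet> E i x) * (E i x \<bullet> y))
      = (\<Sum>i\<in>I. (dd Y x w \<bullet> E i x) * (dd (E i) x v \<bullet> y))"
      by (intro sum.cong refl) (simp add: y)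
    ultimately show ?thesis by (simp add: algebra_simps)
  qed
  \<comment> \<open>Substituting \<open>str\<close> for the first derivative of Y turns the mixed
    term into the corrections by N that appear in \<open>Q\<close>.\<close>
  have inn: "dd Y x v \<bullet> dd F x w = (\<Sum>i\<in>I. (dd Y x v \<bullet> E i x) * (E i x \<bullet> dd F x w)) + (Y x \<bullet> dd F x v) * (N x \<bullet> dd F x w)" for v w
    by (subst str[OF S(2), of v]) (simp add: inner_add_left inner_sum_left)
  have "dd (\<lambda>z. dd Y z w) x v = dd (\<lambda>z. dd Y z v) x w" "dd (\<lambda>z. dd F z w) x v = dd (\<lambda>z. dd F z v) x w"
    by (rule dd_dd_commute[OF Y S], rule dd_dd_commute[OF F S])
  with main[of w v] main[of v w]
  have "(\<Sum>i\<in>I. (dd Y x w \<bullet> E i x) * (dd (E i) x v \<bullet> y)) + (Y x \<bullet> dd F x w) * (dd N x v \<bullet> y)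
       + (dd Y x v \<bullet> dd F x w) * (N x \<bullet> y) = (\<Sum>i\<in>I. (dd Y x v \<bullet> E i x) * (dd (E i) x w \<bullet> y)) + (Y x \<bullet> dd F x v) * (dd N x w \<bullet> y)
       + (dd Y x w \<bullet> dd F x v) * (N x \<bullet> y)" by simp
  moreover have "Q v w = (\<Sum>i\<in>I. (dd Y x w \<bullet> E i x) * (dd (E i) x v \<bullet> y)) + (Y x \<bullet> dd F x w) * (dd N x v \<bullet> y)
      - (dd Y x w \<bullet> dd F x v) * (N x \<bullet> y)" for v w
    unfolding Q_def inn[of w v]
    by (simp add: sum_subtractf right_diff_distrib sum_distrib_right distrib_right mult.assoc)
  ultimately show ?thesis by simp
qed

text \<open>The residual is orthogonal to all \<open>e i\<close> and therefore itself an admissible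
  test vector; testing with it shows that its square vanishes.\<close>

lemma orthonormal_residual_zero:
  fixes u :: "'b::euclidean_space"
  assumes "finite I" "\<And>i j. i \<in> I \<Longrightarrow> j \<in> I \<Longrightarrow> e i \<bullet> e j = (if i = j then 1 else 0)"
    and "\<And>y. (\<And>i. i \<in> I \<Longrightarrow> e i \<bullet> y = 0) \<Longrightarrow> u \<bullet> y = N \<bullet> y"
    and "\<And>i. i \<in> I \<Longrightarrow> e i \<bullet> N = 0"
  shows "u = (\<Sum>i\<in>I. (u \<bullet> e i) *\<^sub>R e i) + N"
proof -
  define y where "y = u - (\<Sum>i\<in>I. (u \<bullet> e i) *\<^sub>R e i) - N"
  have s: "e j \<bullet> (\<Sum>i\<in>I. (u \<bullet> e i) *\<^sub>R e i) = u \<bullet> e j" if "j \<in> I" for j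
  proof -
    have "e j \<bullet> (\<Sum>i\<in>I. (u \<bullet> e i) *\<^sub>R e i) = (\<Sum>i\<in>I. if i = j then u \<bullet> e i else 0)"
      unfolding inner_sum_right using assms(2)[OF that] by (intro sum.cong refl) auto
    then show ?thesis using assms(1) that by (simp add: sum.delta)
  qed
  have y0: "e i \<bullet> y = 0" if "i \<in> I" for i
    using s[OF that] assms(4)[OF that] by (simp add: y_def inner_diff_right inner_commute)
  then have "(\<Sum>i\<in>I. (u \<bullet> e i) *\<^sub>R e i) \<bullet> y = 0" by (simp add: inner_sum_left)
  moreover have "u \<bullet> y = N \<bullet> y" using assms(3) y0 by blast
  ultimately have "y \<bullet> y = 0" by (subst (1) y_def) (simp add: inner_diff_left)
  then have "y = 0" by simp
  then show ?thesis unfolding y_def by (simp add: algebra_simps)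
qed

lemma sum_lessThan_add_2: "(\<Sum>k<(m::nat)+2. f k) = (\<Sum>k<m. f k) + (f m + f (m+1) :: 'c::comm_monoid_add)"
  by (simp add: numeral_2_eq_2 add.assoc)

text \<open>The first \<open>m\<close> fields of the frame span the umbilical distribution. In the notation of the
  paper \<open>m = n - 2\<close>; \<open>\<mu>\<close> is the eigenvalue of the shape operator of \<open>\<eta>\<close> on the orthogonal
  complement of the distribution.\<close>

locale umbilic_patch =
  fixes S :: "'a::euclidean_space set" and F :: "'a \<Rightarrow> 'b::euclidean_space"
    and \<xi> :: "nat \<Rightarrow> 'a \<Rightarrow> 'a" and E :: "nat \<Rightarrow> 'a \<Rightarrow> 'b" and \<eta> :: "'a \<Rightarrow> 'b" and m :: nat and \<rho> :: real
  assumes S: "open S" and F: "smooth_on S F"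
    and \<xi>: "i < m + 2 \<Longrightarrow> smooth_on S (\<xi> i)" and E: "i < m + 2 \<Longrightarrow> smooth_on S (E i)"
    and \<eta>: "smooth_on S \<eta>" and m: "m \<ge> 2"
    and E_eq: "x \<in> S \<Longrightarrow> i < m + 2 \<Longrightarrow> dd F x (\<xi> i x) = E i x"
    and orth: "x \<in> S \<Longrightarrow> i < m + 2 \<Longrightarrow> j < m + 2 \<Longrightarrow> E i x \<bullet> E j x = (if i = j then 1 else 0)"
    and frame: "x \<in> S \<Longrightarrow> v = (\<Sum>i<m+2. (E i x \<bullet> dd F x v) *\<^sub>R \<xi> i x)"
    and \<eta>_normal: "x \<in> S \<Longrightarrow> \<eta> x \<bullet> dd F x v = 0" and \<eta>_nz: "x \<in> S \<Longrightarrow> \<eta> x \<noteq> 0"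
    and umbilic: "x \<in> S \<Longrightarrow> i < m \<Longrightarrow> (\<And>k. k < m + 2 \<Longrightarrow> E k x \<bullet> y = 0) \<Longrightarrow>
      dd (E i) x v \<bullet> y = (E i x \<bullet> dd F x v) * (\<eta> x \<bullet> y)"
    and einstein: "x \<in> S \<Longrightarrow> a \<in> {m, m + 1} \<Longrightarrow>
      dd (E a) x v \<bullet> \<eta> x = ((\<rho> - (real m - 1) * (\<eta> x \<bullet> \<eta> x)) / 2) * (E a x \<bullet> dd F x v)"
    and nonconst: "x \<in> S \<Longrightarrow> (real m + 1) * (\<eta> x \<bullet> \<eta> x) \<noteq> \<rho>"
begin

abbreviation \<epsilon> :: "nat \<Rightarrow> 'a \<Rightarrow> 'a \<Rightarrow> real" where "\<epsilon> i x v \<equiv> E i x \<bullet> dd F x v"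

definition lam :: "'a \<Rightarrow> real" where "lam x = \<eta> x \<bullet> \<eta> x"
definition \<mu> :: "'a \<Rightarrow> real" where "\<mu> x = (\<rho> - (real m - 1) * lam x) / 2"
text \<open>Equal to ((m + 1) * lam - \<rho>) / 2, so \<open>nonconst\<close> states that it has no
  zero. The identities behind \<open>dT_T_e\<close> and \<open>de_e_T\<close> are solved by dividing
  by it.\<close>

definition \<theta> :: "'a \<Rightarrow> real" where "\<theta> x = lam x - \<mu> x"

lemma \<theta>_nz: "x \<in> S \<Longrightarrow> \<theta> x \<noteq> 0"
  using nonconst[of x] by (auto simp: \<theta>_def \<mu>_def lam_def field_simps)

lemma einstein_\<mu>: "x \<in> S \<Longrightarrow> a \<in> {m, m + 1} \<Longrightarrow> dd (E a) x v \<bullet> \<eta> x = \<mu> x * \<epsilon> a x v"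
  using einstein unfolding \<mu>_def lam_def by blast

lemma smooth_lam: "smooth_on S lam"
  unfolding lam_def by (intro smooth_on_inner S \<eta>)

lemma smooth_\<mu>: "smooth_on S \<mu>"
proof -
  have "smooth_on S (\<lambda>x. (\<rho> - (real m - 1) * lam x) * (1/2))"
    by (intro smooth_on_mult smooth_on_diff smooth_on_const S smooth_lam)
  then show ?thesis unfolding \<mu>_def by simp
qed

lemma smooth_\<theta>: "smooth_on S \<theta>"
  unfolding \<theta>_def by (intro smooth_on_diff S smooth_lam smooth_\<mu>)

lemma \<eta>_E: "x \<in> S \<Longrightarrow> i < m + 2 \<Longrightarrow> \<eta> x \<bullet> E i x = 0"
  using \<eta>_normal E_eq by metis

lemma diff_E: "x \<in> S \<Longrightarrow> i < m + 2 \<Longrightarrow> E i differentiable (at x)"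
  using smooth_on_differentiable[OF E] .

lemma diff_\<eta>: "x \<in> S \<Longrightarrow> \<eta> differentiable (at x)"
  using smooth_on_differentiable[OF \<eta>] .

lemma \<epsilon>_\<xi>: "x \<in> S \<Longrightarrow> i < m + 2 \<Longrightarrow> j < m + 2 \<Longrightarrow> \<epsilon> i x (\<xi> j x) = (if i = j then 1 else 0)"
  by (simp add: E_eq orth)

lemma linear_dF: "x \<in> S \<Longrightarrow> linear (dd F x)"
  using linear_dd smooth_on_differentiable[OF F] by blast

lemma linear_ext:
  assumes "x \<in> S" "linear L" "\<And>i. i < m + 2 \<Longrightarrow> L (\<xi> i x) = 0"
  shows "L v = 0"
proof -
  have "L v = L (\<Sum>i<m+2. (E i x \<bullet> dd F x v) *\<^sub>R \<xi> i x)" using frame[OF assms(1), of v] by simp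
  also have "\<dots> = (\<Sum>i<m+2. (E i x \<bullet> dd F x v) *\<^sub>R L (\<xi> i x))"
    by (simp only: linear_sum[OF assms(2)] linear_scale[OF assms(2)])
  finally show ?thesis using assms(3) by simp
qed

lemma dF_expand: "x \<in> S \<Longrightarrow> dd F x v = (\<Sum>i<m+2. \<epsilon> i x v *\<^sub>R E i x)"
proof -
  assume x: "x \<in> S"
  have "dd F x v = dd F x (\<Sum>i<m+2. (E i x \<bullet> dd F x v) *\<^sub>R \<xi> i x)" using frame[OF x, of v] by simp
  also have "\<dots> = (\<Sum>i<m+2. (E i x \<bullet> dd F x v) *\<^sub>R dd F x (\<xi> i x))"
    by (simp only: linear_sum[OF linear_dF[OF x]] linear_scale[OF linear_dF[OF x]])
  finally show ?thesis using E_eq[OF x] by simp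
qed

text \<open>As \<open>E i\<close> is dF applied to \<open>\<xi> i\<close>, its derivative is a
  Hessian of F plus a tangent vector coming from the derivative of \<open>\<xi> i\<close>; y sees
  only the Hessian, which is symmetric.\<close>

lemma sff_symmetric:
  assumes x: "x \<in> S" "i < m + 2" "j < m + 2" and y: "\<And>v. y \<bullet> dd F x v = 0"
  shows "dd (E i) x (\<xi> j x) \<bullet> y = dd (E j) x (\<xi> i x) \<bullet> y"
proof -
  have 1: "dd (E i) x (\<xi> j x) \<bullet> y = dd (\<lambda>z. dd F z (\<xi> i x)) x (\<xi> j x) \<bullet> y" if "i < m + 2" for i j
  proof -
    have "dd (E i) x = dd (\<lambda>z. dd F z (\<xi> i z)) x"
      by (rule dd_cong_open[OF S x(1)]) (use E_eq that in metis)
    then show ?thesis using dd_dd_field[OF S x(1) F \<xi>[OF that], of "\<xi> j x"] y[of "dd (\<xi> i) x (\<xi> j x)"]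
      by (simp add: inner_add_left inner_add_right inner_commute)
  qed
  show ?thesis unfolding 1[OF x(2)] 1[OF x(3)] using dd_dd_commute[OF F S x(1)] by simp
qed

lemma normal_iff:
  assumes x: "x \<in> S" and y: "\<And>k. k < m + 2 \<Longrightarrow> E k x \<bullet> y = 0"
  shows "y \<bullet> dd F x v = 0"
proof -
  have "y \<bullet> dd F x v = y \<bullet> (\<Sum>i<m+2. \<epsilon> i x v *\<^sub>R E i x)" by (rule arg_cong[OF dF_expand[OF x]])
  also have "\<dots> = 0" unfolding inner_sum_right
    by (intro sum.neutral ballI) (simp add: y inner_commute[of y])
  finally show ?thesis .
qed

lemma inner_const_deriv:
  assumes x: "x \<in> S" and X: "X differentiable (at x)" and Y: "Y differentiable (at x)"
    and c: "\<And>z. z \<in> S \<Longrightarrow> X z \<bullet> Y z = c"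
  shows "dd X x v \<bullet> Y x = - (X x \<bullet> dd Y x v)"
proof -
  have "dd (\<lambda>z. X z \<bullet> Y z) x = dd (\<lambda>z. c) x" by (rule dd_cong_open[OF S x c])
  then have "X x \<bullet> dd Y x v + dd X x v \<bullet> Y x = dd (\<lambda>z. c) x v" using dd_inner[OF X Y, of v] by metis
  then show ?thesis by (simp add: frechet_derivative_const)
qed

lemma dE_skew: "x \<in> S \<Longrightarrow> i < m + 2 \<Longrightarrow> j < m + 2 \<Longrightarrow> dd (E i) x v \<bullet> E j x = - (E i x \<bullet> dd (E j) x v)"
  by (rule inner_const_deriv[OF _ diff_E diff_E]) (use orth in auto)

lemma d\<eta>_E: "x \<in> S \<Longrightarrow> i < m + 2 \<Longrightarrow> dd \<eta> x v \<bullet> E i x = - (\<eta> x \<bullet> dd (E i) x v)"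
  by (rule inner_const_deriv[OF _ diff_\<eta> diff_E]) (use \<eta>_E in auto)

lemma d\<eta>_T: "x \<in> S \<Longrightarrow> i < m \<Longrightarrow> dd \<eta> x v \<bullet> E i x = - lam x * \<epsilon> i x v"
  using d\<eta>_E[of x i v] umbilic[of x i "\<eta> x" v] \<eta>_E[of x] by (simp add: lam_def inner_commute)

lemma d\<eta>_e: "x \<in> S \<Longrightarrow> a \<in> {m, m + 1} \<Longrightarrow> dd \<eta> x v \<bullet> E a x = - \<mu> x * \<epsilon> a x v"
  using d\<eta>_E[of x a v] einstein_\<mu>[of x a v] by (auto simp: inner_commute)

lemma dlam: "x \<in> S \<Longrightarrow> dd lam x v = 2 * (dd \<eta> x v \<bullet> \<eta> x)"
  unfolding lam_def using dd_inner[OF diff_\<eta> diff_\<eta>, of x v] by (simp add: inner_commute)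

lemma dT_expand:
  assumes x: "x \<in> S" and i: "i < m"
  shows "dd (E i) x v = (\<Sum>k<m+2. (dd (E i) x v \<bullet> E k x) *\<^sub>R E k x) + \<epsilon> i x v *\<^sub>R \<eta> x"
proof (rule orthonormal_residual_zero)
  show "dd (E i) x v \<bullet> y = (\<epsilon> i x v *\<^sub>R \<eta> x) \<bullet> y" if "\<And>k. k \<in> {..<m+2} \<Longrightarrow> E k x \<bullet> y = 0" for y
    using umbilic[OF x i, of y v] that by auto
qed (use orth[OF x] \<eta>_E[OF x] in \<open>auto simp: inner_commute\<close>)

text \<open>Symmetry trades the derivative of \<open>E a\<close> for that of the umbilical field
  \<open>E j\<close> in the direction \<open>\<xi> a\<close>, and this has no normal part because
  \<open>\<xi> a\<close> is orthogonal to \<open>\<xi> j\<close>.\<close>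

lemma de_T_normal:
  assumes x: "x \<in> S" and a: "a \<in> {m, m + 1}" and j: "j < m" and y: "\<And>k. k < m + 2 \<Longrightarrow> E k x \<bullet> y = 0"
  shows "dd (E a) x (\<xi> j x) \<bullet> y = 0"
proof -
  have "dd (E a) x (\<xi> j x) \<bullet> y = dd (E j) x (\<xi> a x) \<bullet> y"
    by (rule sff_symmetric[OF x]) (use a j normal_iff[OF x y] in auto)
  also have "\<dots> = \<epsilon> j x (\<xi> a x) * (\<eta> x \<bullet> y)" by (rule umbilic[OF x j y])
  also have "\<epsilon> j x (\<xi> a x) = 0" using \<epsilon>_\<xi>[OF x, of j a] a j by auto
  finally show ?thesis by simp
qed

text \<open>The Codazzi equation for Y = \<open>E i\<close> and N = \<eta>. The umbilical indices
  drop out of the sum since their normal part is exactly \<open>\<epsilon> k\<close> times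
  \<eta>.\<close>

lemma codazzi_T:
  assumes x: "x \<in> S" and i: "i < m" and y: "\<And>k. k < m + 2 \<Longrightarrow> E k x \<bullet> y = 0"
  defines "Q \<equiv> \<lambda>v w. (\<Sum>a\<in>{m, m+1}. (dd (E i) x w \<bullet> E a x) * (dd (E a) x v \<bullet> y - \<epsilon> a x v * (\<eta> x \<bullet> y)))
    + \<epsilon> i x w * (dd \<eta> x v \<bullet> y)"
  shows "Q v w = Q w v"
proof -
  have Q: "Q v w = (\<Sum>k\<in>{..<m+2}. (dd (E i) x w \<bullet> E k x) * (dd (E k) x v \<bullet> y - (E k x \<bullet> dd F x v) * (\<eta> x \<bullet> y)))
      + (E i x \<bullet> dd F x w) * (dd \<eta> x v \<bullet> y - (\<eta> x \<bullet> dd F x v) * (\<eta> x \<bullet> y))" for v w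
  proof -
    have "{..<m+2} = {..<m} \<union> {m, m+1}" by auto
    then have "(\<Sum>k\<in>{..<m+2}. (dd (E i) x w \<bullet> E k x) * (dd (E k) x v \<bullet> y - (E k x \<bullet> dd F x v) * (\<eta> x \<bullet> y)))
      = (\<Sum>k\<in>{..<m}. (dd (E i) x w \<bullet> E k x) * (dd (E k) x v \<bullet> y - (E k x \<bullet> dd F x v) * (\<eta> x \<bullet> y)))
      + (\<Sum>k\<in>{m,m+1}. (dd (E i) x w \<bullet> E k x) * (dd (E k) x v \<bullet> y - (E k x \<bullet> dd F x v) * (\<eta> x \<bullet> y)))"
      by (simp only:) (intro sum.union_disjoint, auto)
    moreover have "(\<Sum>k\<in>{..<m}. (dd (E i) x w \<bullet> E k x) * (dd (E k) x v \<bullet> y - (E k x \<bullet> dd F x v) * (\<eta> x \<bullet> y))) = 0"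
      by (intro sum.neutral ballI) (use umbilic[OF x _ y] in auto)
    ultimately show ?thesis unfolding Q_def by (simp add: \<eta>_normal[OF x])
  qed
  have "dd (E i) z w = (\<Sum>k<m+2. (dd (E i) z w \<bullet> E k z) *\<^sub>R E k z) + (E i z \<bullet> dd F z w) *\<^sub>R \<eta> z"
    if "z \<in> S" for z w by (rule dT_expand[OF that i])
  then show ?thesis unfolding Q
    by (intro codazzi_symmetry[OF S x F E \<eta>]) (use i E y in auto)
qed

text \<open>Here m \<ge> 2 is used: with i \<noteq> j the Codazzi equation on \<open>\<xi> i\<close>
  and \<open>\<xi> j\<close> loses its sums over the complement by \<open>de_T_normal\<close> and
  one of its two remaining terms by orthogonality, leaving the normal derivative of \<eta> along
  \<open>\<xi> j\<close>.\<close>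

lemma \<eta>_parallel:
  assumes x: "x \<in> S" and j: "j < m" and y: "\<And>k. k < m + 2 \<Longrightarrow> E k x \<bullet> y = 0"
  shows "dd \<eta> x (\<xi> j x) \<bullet> y = 0"
proof -
  obtain i where i: "i < m" "i \<noteq> j" using m by (metis One_nat_def Suc_1 less_le_trans lessI zero_less_Suc zero_neq_one)
  have z: "dd (E a) x (\<xi> k x) \<bullet> y - \<epsilon> a x (\<xi> k x) * (\<eta> x \<bullet> y) = 0" if "a \<in> {m, m+1}" "k < m" for a k
    using de_T_normal[OF x that y] \<epsilon>_\<xi>[OF x, of a k] that by auto
  have "(\<Sum>a\<in>{m, m+1}. (dd (E i) x w \<bullet> E a x) * (dd (E a) x (\<xi> k x) \<bullet> y - \<epsilon> a x (\<xi> k x) * (\<eta> x \<bullet> y))) = 0"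
    if "k < m" for k w
    by (intro sum.neutral ballI) (use z that in auto)
  with codazzi_T[OF x i(1) y, of "\<xi> i x" "\<xi> j x"] i j
  show ?thesis using \<epsilon>_\<xi>[OF x, of i i] \<epsilon>_\<xi>[OF x, of i j] by auto
qed

lemma d\<eta>_\<xi>:
  assumes x: "x \<in> S" and j: "j < m"
  shows "dd \<eta> x (\<xi> j x) = - lam x *\<^sub>R E j x"
proof -
  have "dd \<eta> x (\<xi> j x) = (\<Sum>k<m+2. (dd \<eta> x (\<xi> j x) \<bullet> E k x) *\<^sub>R E k x) + 0"
    by (rule orthonormal_residual_zero) (use orth[OF x] \<eta>_parallel[OF x j] in auto)
  also have "\<dots> = (\<Sum>k<m+2. if k = j then - lam x *\<^sub>R E k x else 0)"
  proof -
    have "dd \<eta> x (\<xi> j x) \<bullet> E k x = (if k = j then - lam x else 0)" if "k < m + 2" for k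
    proof (cases "k < m")
      case True then show ?thesis using d\<eta>_T[OF x True, of "\<xi> j x"] \<epsilon>_\<xi>[OF x, of k j] j by auto
    next
      case False
      then have "k \<in> {m, m+1}" using that by auto
      from d\<eta>_e[OF x this, of "\<xi> j x"] show ?thesis using \<epsilon>_\<xi>[OF x, of k j] j False that by auto
    qed
    then show ?thesis unfolding add_0_right by (intro sum.cong refl) auto
  qed
  also have "\<dots> = - lam x *\<^sub>R E j x" using j by (simp add: sum.delta)
  finally show ?thesis .
qed

lemma dlam_\<xi>: "x \<in> S \<Longrightarrow> j < m \<Longrightarrow> dd lam x (\<xi> j x) = 0"
  using dlam[of x "\<xi> j x"] d\<eta>_\<xi>[of x j] \<eta>_E[of x j] by (simp add: inner_commute)

text \<open>The Codazzi equation on \<open>\<xi> a\<close> and \<open>\<xi> j\<close>, tested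
  against \<eta> itself: the Einstein condition turns the sum into - \<theta> times the wanted
  component, and the other term is half the derivative of \<open>lam\<close>.\<close>

lemma dT_T_e:
  assumes x: "x \<in> S" and i: "i < m" and j: "j < m" and a: "a \<in> {m, m + 1}"
  shows "dd (E i) x (\<xi> j x) \<bullet> E a x = (if i = j then dd lam x (\<xi> a x) / (2 * \<theta> x) else 0)"
proof -
  have b: "dd (E c) x v \<bullet> \<eta> x - \<epsilon> c x v * (\<eta> x \<bullet> \<eta> x) = - \<theta> x * \<epsilon> c x v" if "c \<in> {m, m+1}" for c v
    using einstein_\<mu>[OF x that, of v] by (simp add: \<theta>_def lam_def algebra_simps)
  have Q: "(\<Sum>c\<in>{m, m+1}. (dd (E i) x w \<bullet> E c x) * (dd (E c) x v \<bullet> \<eta> x - \<epsilon> c x v * (\<eta> x \<bullet> \<eta> x)))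
     = - \<theta> x * (\<Sum>c\<in>{m, m+1}. (dd (E i) x w \<bullet> E c x) * \<epsilon> c x v)" for v w
    unfolding sum_distrib_left by (intro sum.cong refl) (simp only: b, simp)
  have 1: "(\<Sum>c\<in>{m, m+1}. (dd (E i) x (\<xi> j x) \<bullet> E c x) * \<epsilon> c x (\<xi> a x)) = dd (E i) x (\<xi> j x) \<bullet> E a x"
    using a \<epsilon>_\<xi>[OF x] by auto
  have 2: "(\<Sum>c\<in>{m, m+1}. (dd (E i) x (\<xi> a x) \<bullet> E c x) * \<epsilon> c x (\<xi> j x)) = 0"
    using j \<epsilon>_\<xi>[OF x] by auto
  have 3: "\<epsilon> i x (\<xi> a x) = 0" "\<epsilon> i x (\<xi> j x) = (if i = j then 1 else 0)"
    using a i j \<epsilon>_\<xi>[OF x, of i] by auto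
  have "- \<theta> x * (dd (E i) x (\<xi> j x) \<bullet> E a x) + (if i = j then 1 else 0) * (dd \<eta> x (\<xi> a x) \<bullet> \<eta> x) = 0"
    using codazzi_T[OF x i, of "\<eta> x" "\<xi> a x" "\<xi> j x"] \<eta>_E[OF x] unfolding Q 1 2 3 by (simp add: inner_commute)
  then show ?thesis using \<theta>_nz[OF x] dlam[OF x, of "\<xi> a x"] by (auto simp: field_simps split: if_splits)
qed

text \<open>Symmetry of the second derivative of \<open>\<eta>\<close> shows that the complementary distribution is
  totally geodesic.\<close>

lemma de_e_T:
  assumes x: "x \<in> S" and j: "j < m" and b: "b \<in> {m, m + 1}" and c: "c \<in> {m, m + 1}"
  shows "dd (E b) x (\<xi> c x) \<bullet> E j x = 0"
proof -
  have bm: "b < m + 2" and cm: "c < m + 2" using b c by auto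
  \<comment> \<open>The identity \<open>d\<eta>_e\<close> is differentiated along v. Comparing the
    two orders of \<open>\<xi> c\<close> and \<open>\<xi> j\<close> later cancels the Hessians of
    \<eta> and F, and the factor lam - \<mu> remains.\<close>
  have main: "dd \<eta> x w \<bullet> dd (E b) x v + dd (\<lambda>z. dd \<eta> z w) x v \<bullet> E b x
    = - (\<mu> x * (E b x \<bullet> dd (\<lambda>z. dd F z w) x v + dd (E b) x v \<bullet> dd F x w) + dd \<mu> x v * \<epsilon> b x w)" for v w
  proof -
    have "dd (\<lambda>z. dd \<eta> z w \<bullet> E b z) x = dd (\<lambda>z. - (\<mu> z * (E b z \<bullet> dd F z w))) x"
      by (rule dd_cong_open[OF S x]) (use d\<eta>_e[OF _ b] in simp)
    moreover have "dd (\<lambda>z. dd \<eta> z w \<bullet> E b z) x v = dd \<eta> x w \<bullet> dd (E b) x v + dd (\<lambda>z. dd \<eta> z w) x v \<bullet> E b x"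
      by (rule dd_inner[OF smooth_on_differentiable[OF smooth_on_dd[OF \<eta>] x] diff_E[OF x bm]])
    moreover have "dd (\<lambda>z. - (\<mu> z * (E b z \<bullet> dd F z w))) x v
       = - (\<mu> x * (E b x \<bullet> dd (\<lambda>z. dd F z w) x v + dd (E b) x v \<bullet> dd F x w) + dd \<mu> x v * \<epsilon> b x w)"
      by (rule dd_eq) (intro has_derivative_minus has_derivative_mult has_derivative_inner
          smooth_on_has_derivative[OF smooth_\<mu> x] smooth_on_has_derivative[OF E[OF bm] x] smooth_on_has_derivative[OF smooth_on_dd[OF F] x])
    ultimately show ?thesis by metis
  qed
  have d\<mu>: "dd \<mu> x (\<xi> j x) = 0"
  proof -
    have "(\<mu> has_derivative (\<lambda>v. - ((real m - 1) * dd lam x v / 2))) (at x)"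
      unfolding \<mu>_def using smooth_on_has_derivative[OF smooth_lam x]
      by (auto intro!: derivative_eq_intros)
    then show ?thesis using dd_eq[of \<mu> _ x] dlam_\<xi>[OF x j] by fastforce
  qed
  have comm: "dd (\<lambda>z. dd \<eta> z (\<xi> c x)) x (\<xi> j x) = dd (\<lambda>z. dd \<eta> z (\<xi> j x)) x (\<xi> c x)"
      "dd (\<lambda>z. dd F z (\<xi> c x)) x (\<xi> j x) = dd (\<lambda>z. dd F z (\<xi> j x)) x (\<xi> c x)"
    by (rule dd_dd_commute[OF \<eta> S x], rule dd_dd_commute[OF F S x])
  have e: "\<epsilon> b x (\<xi> j x) = 0" using \<epsilon>_\<xi>[OF x bm, of j] b j by auto
  \<comment> \<open>Along \<open>\<xi> j\<close> the derivative of \<open>E b\<close> is tangent,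
    and the tangent part of the derivative of \<eta> along \<open>\<xi> c\<close> is - \<mu> times
    \<open>E c\<close>.\<close>
  have t: "dd \<eta> x (\<xi> c x) \<bullet> dd (E b) x (\<xi> j x) = - \<mu> x * (dd (E b) x (\<xi> j x) \<bullet> E c x)"
  proof -
    have "dd (E b) x (\<xi> j x) = (\<Sum>k<m+2. (dd (E b) x (\<xi> j x) \<bullet> E k x) *\<^sub>R E k x) + 0"
      by (rule orthonormal_residual_zero) (use orth[OF x] de_T_normal[OF x b j] in auto)
    then have "dd \<eta> x (\<xi> c x) \<bullet> dd (E b) x (\<xi> j x) = (\<Sum>k<m+2. (dd (E b) x (\<xi> j x) \<bullet> E k x) * (dd \<eta> x (\<xi> c x) \<bullet> E k x))"
      by (metis (no_types, lifting) add.right_neutral inner_scaleR_right inner_sum_right sum.cong)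
    also have "\<dots> = (\<Sum>k<m+2. if k = c then - \<mu> x * (dd (E b) x (\<xi> j x) \<bullet> E c x) else 0)"
    proof (intro sum.cong refl)
      fix k assume k: "k \<in> {..<m+2}"
      show "(dd (E b) x (\<xi> j x) \<bullet> E k x) * (dd \<eta> x (\<xi> c x) \<bullet> E k x) = (if k = c then - \<mu> x * (dd (E b) x (\<xi> j x) \<bullet> E c x) else 0)"
      proof (cases "k < m")
        case True then show ?thesis using d\<eta>_T[OF x True, of "\<xi> c x"] \<epsilon>_\<xi>[OF x, of k c] c cm k by auto
      next
        case False
        then have "k \<in> {m, m+1}" using k by auto
        from d\<eta>_e[OF x this, of "\<xi> c x"] show ?thesis using \<epsilon>_\<xi>[OF x, of k c] cm k by auto
      qed
    qed
    also have "\<dots> = - \<mu> x * (dd (E b) x (\<xi> j x) \<bullet> E c x)" using cm by (simp add: sum.delta)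
    finally show ?thesis .
  qed
  have Fc: "dd F x (\<xi> c x) = E c x" "dd F x (\<xi> j x) = E j x" using E_eq[OF x] cm j by auto
  have "\<theta> x * (dd (E b) x (\<xi> c x) \<bullet> E j x) = 0"
    using main[of "\<xi> c x" "\<xi> j x"] main[of "\<xi> j x" "\<xi> c x"] d\<eta>_\<xi>[OF x j] d\<mu> t comm e Fc
    by (auto simp add: \<theta>_def inner_commute algebra_simps)
  then show ?thesis using \<theta>_nz[OF x] by simp
qed

text \<open>The component along \<open>E a\<close> of the mean curvature vector of the leaves, as
  found in \<open>dT_T_e\<close>.\<close>

definition Z :: "nat \<Rightarrow> 'a \<Rightarrow> real" where "Z a x = dd lam x (\<xi> a x) / (2 * \<theta> x)"

lemma smooth_Z: "a < m + 2 \<Longrightarrow> smooth_on S (Z a)"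
  unfolding Z_def
  by (intro smooth_on_divide S smooth_on_dd_field smooth_lam \<xi> smooth_on_mult smooth_on_const smooth_\<theta>) (use \<theta>_nz in auto)

text \<open>Leaf directions are \<open>dT_T_e\<close>; complementary directions give zero because
  the complement is totally geodesic, by \<open>de_e_T\<close> and skew symmetry. Geometrically, the
  leaves are umbilical in the manifold.\<close>

lemma dT_e:
  assumes x: "x \<in> S" and i: "i < m" and a: "a \<in> {m, m + 1}"
  shows "dd (E i) x v \<bullet> E a x = \<epsilon> i x v * Z a x"
proof -
  have am: "a < m + 2" "i < m + 2" using a i by auto
  have "linear (\<lambda>v. dd (E i) x v \<bullet> E a x - \<epsilon> i x v * Z a x)"
    using linear_dd[OF diff_E[OF x am(2)]] linear_dF[OF x]
    by (intro linearI) (simp_all add: linear_add linear_scale inner_add_left inner_add_right algebra_simps)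
  moreover have "dd (E i) x (\<xi> k x) \<bullet> E a x - \<epsilon> i x (\<xi> k x) * Z a x = 0" if k: "k < m + 2" for k
  proof (cases "k < m")
    case True
    then show ?thesis using dT_T_e[OF x i True a] \<epsilon>_\<xi>[OF x am(2) k] by (simp add: Z_def)
  next
    case False
    then have "k \<in> {m, m+1}" using k by auto
    then show ?thesis using de_e_T[OF x i a, of k] dE_skew[OF x am(2,1), of "\<xi> k x"] \<epsilon>_\<xi>[OF x am(2) k] i
      by (auto simp: inner_commute)
  qed
  ultimately have "dd (E i) x v \<bullet> E a x - \<epsilon> i x v * Z a x = 0" by (rule linear_ext[OF x])
  then show ?thesis by simp
qed

text \<open>The mean curvature vector of the leaves in the ambient space; \<open>dT_H\<close> shows
  that they are umbilical there.\<close>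

definition H :: "'a \<Rightarrow> 'b" where "H x = Z m x *\<^sub>R E m x + Z (m+1) x *\<^sub>R E (m+1) x + \<eta> x"

lemma smooth_H: "smooth_on S H"
  unfolding H_def by (intro smooth_on_add smooth_on_scaleR S smooth_Z E \<eta>) auto

lemma H_T: "x \<in> S \<Longrightarrow> i < m \<Longrightarrow> H x \<bullet> E i x = 0"
  using \<eta>_E[of x i] orth[of x m i] orth[of x "m+1" i] by (simp add: H_def inner_add_left)

lemma H_e: "x \<in> S \<Longrightarrow> a \<in> {m, m + 1} \<Longrightarrow> H x \<bullet> E a x = Z a x"
  using \<eta>_E[of x a] orth[of x m a] orth[of x "m+1" a] by (auto simp: H_def inner_add_left)

lemma H_H: "x \<in> S \<Longrightarrow> H x \<bullet> H x = lam x + (Z m x)\<^sup>2 + (Z (m+1) x)\<^sup>2"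
  using H_e[of x m] H_e[of x "m+1"] \<eta>_E[of x m] \<eta>_E[of x "m+1"] orth[of x m m] orth[of x m "m+1"] orth[of x "m+1" "m+1"]
  by (subst (2) H_def) (simp add: inner_add_right power2_eq_square H_def inner_add_left lam_def inner_commute)

lemma H_H_pos: "x \<in> S \<Longrightarrow> H x \<bullet> H x > 0"
  using H_H[of x] \<eta>_nz[of x] by (simp add: lam_def add_pos_nonneg)

lemma dT_H:
  assumes x: "x \<in> S" and i: "i < m"
  shows "dd (E i) x v = (\<Sum>k<m. (dd (E i) x v \<bullet> E k x) *\<^sub>R E k x) + \<epsilon> i x v *\<^sub>R H x"
  using dT_expand[OF x i, of v] dT_e[OF x i, of m v] dT_e[OF x i, of "m+1" v]
  unfolding sum_lessThan_add_2 by (simp add: H_def algebra_simps)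

text \<open>The components along \<open>E j\<close> come from H being orthogonal to the leaves. For
  the others the Codazzi argument is repeated with H in the role of \<eta>: as \<open>dT_H\<close>
  involves only leaf fields and H, a test vector has to be orthogonal to the leaf alone, and a leaf
  index i different from k isolates the derivative along \<open>\<xi> k\<close>.\<close>

lemma dH:
  assumes x: "x \<in> S"
  shows "dd H x v = (H x \<bullet> dd F x v) *\<^sub>R H x - (H x \<bullet> H x) *\<^sub>R (\<Sum>j<m. \<epsilon> j x v *\<^sub>R E j x)"
proof -
  have diffH: "H differentiable (at x)" using smooth_on_differentiable[OF smooth_H x] .
  have T: "dd H x v \<bullet> E j x = - (H x \<bullet> H x) * \<epsilon> j x v" if j: "j < m" for j v
  proof -
    have "dd H x v \<bullet> E j x = - (H x \<bullet> dd (E j) x v)"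
      by (rule inner_const_deriv[OF x diffH diff_E[OF x]]) (use H_T j in auto)
    also have "H x \<bullet> dd (E j) x v = \<epsilon> j x v * (H x \<bullet> H x)"
      by (subst dT_H[OF x j]) (simp add: inner_add_right inner_sum_right H_T[OF x])
    finally show ?thesis by simp
  qed
  have N: "dd H x v \<bullet> y = (H x \<bullet> dd F x v) * (H x \<bullet> y)" if y: "\<And>j. j < m \<Longrightarrow> E j x \<bullet> y = 0" for y v
  proof -
    have sym: "\<epsilon> i x w * (dd H x v \<bullet> y - (H x \<bullet> dd F x v) * (H x \<bullet> y)) = \<epsilon> i x v * (dd H x w \<bullet> y - (H x \<bullet> dd F x w) * (H x \<bullet> y))"
      if i: "i < m" for i v w
    proof -
      have *: "dd (E i) z w = (\<Sum>k\<in>{..<m}. (dd (E i) z w \<bullet> E k z) *\<^sub>R E k z) + (E i z \<bullet> dd F z w) *\<^sub>R H z"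
        if "z \<in> S" for z w by (rule dT_H[OF that i])
      have b: "(\<Sum>k\<in>{..<m}. (dd (E i) x w \<bullet> E k x) * (dd (E k) x v \<bullet> y - (E k x \<bullet> dd F x v) * (H x \<bullet> y))) = 0" for v w
      proof (intro sum.neutral ballI)
        fix k assume k: "k \<in> {..<m}"
        have "dd (E k) x v \<bullet> y = \<epsilon> k x v * (H x \<bullet> y)"
          using k by (subst dT_H[OF x]) (auto simp: inner_add_left inner_sum_left y)
        then show "(dd (E i) x w \<bullet> E k x) * (dd (E k) x v \<bullet> y - (E k x \<bullet> dd F x v) * (H x \<bullet> y)) = 0" by simp
      qed
      have i2: "i < m + 2" using i by simp
      have "(\<Sum>k\<in>{..<m}. (dd (E i) x w \<bullet> E k x) * (dd (E k) x v \<bullet> y - (E k x \<bullet> dd F x v) * (H x \<bullet> y)))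
          + (E i x \<bullet> dd F x w) * (dd H x v \<bullet> y - (H x \<bullet> dd F x v) * (H x \<bullet> y))
        = (\<Sum>k\<in>{..<m}. (dd (E i) x v \<bullet> E k x) * (dd (E k) x w \<bullet> y - (E k x \<bullet> dd F x w) * (H x \<bullet> y)))
          + (E i x \<bullet> dd F x v) * (dd H x w \<bullet> y - (H x \<bullet> dd F x w) * (H x \<bullet> y))"
        by (rule codazzi_symmetry[OF S x F E[OF i2] smooth_H _ *]) (use E y in auto)
      then show ?thesis unfolding b by simp
    qed
    have lin: "linear (\<lambda>v. dd H x v \<bullet> y - (H x \<bullet> dd F x v) * (H x \<bullet> y))"
      using linear_dd[OF diffH] linear_dF[OF x]
      by (intro linearI) (simp_all add: linear_add linear_scale inner_add_left inner_add_right algebra_simps)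
    have "dd H x (\<xi> k x) \<bullet> y - (H x \<bullet> dd F x (\<xi> k x)) * (H x \<bullet> y) = 0" if k: "k < m + 2" for k
    proof -
      obtain i where i: "i < m" "i \<noteq> k"
        using m by (metis One_nat_def Suc_1 less_le_trans lessI zero_less_Suc zero_neq_one)
      have i2: "i < m + 2" using i by simp
      show ?thesis using sym[OF i(1), of "\<xi> i x" "\<xi> k x"] \<epsilon>_\<xi>[OF x i2 i2] \<epsilon>_\<xi>[OF x i2 k] i by simp
    qed
    from linear_ext[OF x lin this, of v] show ?thesis by simp
  qed
  have "dd H x v = (\<Sum>i\<in>{..<m}. (dd H x v \<bullet> E i x) *\<^sub>R E i x) + (H x \<bullet> dd F x v) *\<^sub>R H x"
    by (rule orthonormal_residual_zero) (use orth[OF x] N H_T[OF x] in \<open>auto simp: inner_commute\<close>)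
  also have "(\<Sum>i\<in>{..<m}. (dd H x v \<bullet> E i x) *\<^sub>R E i x) = - ((H x \<bullet> H x) *\<^sub>R (\<Sum>j<m. \<epsilon> j x v *\<^sub>R E j x))"
    unfolding scaleR_sum_right sum_negf[symmetric] by (intro sum.cong refl) (simp add: T)
  finally show ?thesis by simp
qed

end

context umbilic_patch begin

text \<open>The leaves of the umbilical distribution are open parts of round spheres of radius \<open>\<phi>\<close>,
  with outward unit normal \<open>\<psi>\<close> in the affine subspaces they span.\<close>

definition \<phi> :: "'a \<Rightarrow> real" where "\<phi> x = inverse (sqrt (H x \<bullet> H x))"
definition \<psi> :: "'a \<Rightarrow> 'b" where "\<psi> x = - (\<phi> x *\<^sub>R H x)"
text \<open>The derivative of \<phi> along \<open>\<xi> a\<close>, by \<open>d\<phi>_\<psi>\<close>.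
  Written through \<psi>, it can be differentiated again with the known derivatives of \<psi> and
  \<open>E a\<close>.\<close>

definition D\<phi> :: "nat \<Rightarrow> 'a \<Rightarrow> real" where "D\<phi> a x = \<psi> x \<bullet> E a x"
text \<open>The connection form of the complementary planes.\<close>

definition \<omega> :: "'a \<Rightarrow> 'a \<Rightarrow> real" where "\<omega> x v = dd (E m) x v \<bullet> E (m + 1) x"
text \<open>The centre of the sphere that contains the leaf through x.\<close>

definition h :: "'a \<Rightarrow> 'b" where "h x = F x - \<phi> x *\<^sub>R \<psi> x"

lemma \<phi>_pos: "x \<in> S \<Longrightarrow> \<phi> x > 0"
  using H_H_pos[of x] by (simp add: \<phi>_def)

lemma \<phi>_H: "x \<in> S \<Longrightarrow> (\<phi> x)\<^sup>2 * (H x \<bullet> H x) = 1"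
  using H_H_pos[of x] by (simp add: \<phi>_def power_inverse)

lemma smooth_\<phi>: "smooth_on S \<phi>"
  unfolding \<phi>_def
  by (intro smooth_on_inverse smooth_on_sqrt smooth_on_inner S smooth_H) (use H_H_pos in force)+

lemma smooth_\<psi>: "smooth_on S \<psi>"
  unfolding \<psi>_def by (intro smooth_on_minus smooth_on_scaleR S smooth_\<phi> smooth_H)

lemma smooth_D\<phi>: "a < m + 2 \<Longrightarrow> smooth_on S (D\<phi> a)"
  unfolding D\<phi>_def by (intro smooth_on_inner S smooth_\<psi> E)

lemma smooth_h: "smooth_on S h"
  unfolding h_def by (intro smooth_on_diff smooth_on_scaleR S smooth_\<phi> smooth_\<psi> F)

lemma diff_\<phi>: "x \<in> S \<Longrightarrow> \<phi> differentiable (at x)"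
  using smooth_on_differentiable[OF smooth_\<phi>] .

lemma diff_\<psi>: "x \<in> S \<Longrightarrow> \<psi> differentiable (at x)"
  using smooth_on_differentiable[OF smooth_\<psi>] .

lemma diff_H: "x \<in> S \<Longrightarrow> H differentiable (at x)"
  using smooth_on_differentiable[OF smooth_H] .

lemma H_dH: "x \<in> S \<Longrightarrow> H x \<bullet> dd H x v = (H x \<bullet> dd F x v) * (H x \<bullet> H x)"
  using H_T[of x] by (simp add: dH inner_diff_right inner_sum_right)

lemma \<psi>_\<psi>: "x \<in> S \<Longrightarrow> \<psi> x \<bullet> \<psi> x = 1"
  using \<phi>_H[of x] by (simp add: \<psi>_def power2_eq_square)

lemma \<psi>_T: "x \<in> S \<Longrightarrow> j < m \<Longrightarrow> \<psi> x \<bullet> E j x = 0"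
  using H_T[of x j] by (simp add: \<psi>_def)

lemma d\<phi>_H:
  assumes x: "x \<in> S" shows "dd \<phi> x v = - \<phi> x * (H x \<bullet> dd F x v)"
proof -
  have "dd (\<lambda>z. (\<phi> z * \<phi> z) * (H z \<bullet> H z)) x = dd (\<lambda>z. 1) x"
    by (rule dd_cong_open[OF S x]) (use \<phi>_H in \<open>simp add: power2_eq_square\<close>)
  moreover have "dd (\<lambda>z. (\<phi> z * \<phi> z) * (H z \<bullet> H z)) x v =
     (\<phi> x * \<phi> x) * (H x \<bullet> dd H x v + dd H x v \<bullet> H x) + (\<phi> x * dd \<phi> x v + dd \<phi> x v * \<phi> x) * (H x \<bullet> H x)"
    by (rule dd_eq) (intro has_derivative_mult has_derivative_inner has_derivative_dd diff_\<phi> diff_H x)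
  moreover have "dd (\<lambda>z. 1::real) x v = 0" by (simp add: frechet_derivative_const)
  ultimately have "2 * (\<phi> x * (H x \<bullet> H x)) * (dd \<phi> x v + \<phi> x * (H x \<bullet> dd F x v)) = 0"
    using H_dH[OF x, of v] by (simp add: inner_commute algebra_simps)
  moreover have "2 * (\<phi> x * (H x \<bullet> H x)) \<noteq> 0" using \<phi>_pos[OF x] H_H_pos[OF x] by simp
  ultimately have "dd \<phi> x v + \<phi> x * (H x \<bullet> dd F x v) = 0" by (simp only: mult_eq_0_iff) simp
  then show ?thesis by simp
qed

lemma d\<phi>_\<psi>: "x \<in> S \<Longrightarrow> dd \<phi> x v = \<psi> x \<bullet> dd F x v"
  by (simp add: d\<phi>_H \<psi>_def)

lemma d\<phi>:
  assumes x: "x \<in> S" shows "dd \<phi> x v = D\<phi> m x * \<epsilon> m x v + D\<phi> (m + 1) x * \<epsilon> (m + 1) x v"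
proof -
  have "\<psi> x \<bullet> dd F x v = \<psi> x \<bullet> (\<Sum>i<m+2. \<epsilon> i x v *\<^sub>R E i x)" by (rule arg_cong[OF dF_expand[OF x]])
  then show ?thesis unfolding d\<phi>_\<psi>[OF x] sum_lessThan_add_2
    by (simp add: inner_add_right inner_sum_right \<psi>_T[OF x] D\<phi>_def mult.commute)
qed

text \<open>The multiple of H in \<open>dH\<close> cancels against the derivative of \<phi>, so
  \<psi> varies along the leaf only, like the normal of a sphere of radius \<phi>.\<close>

lemma d\<psi>:
  assumes x: "x \<in> S" shows "dd \<psi> x v = (1 / \<phi> x) *\<^sub>R (\<Sum>j<m. \<epsilon> j x v *\<^sub>R E j x)"
proof -
  have "dd \<psi> x v = - (\<phi> x *\<^sub>R dd H x v + dd \<phi> x v *\<^sub>R H x)"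
    unfolding \<psi>_def by (rule dd_eq) (intro has_derivative_minus has_derivative_scaleR has_derivative_dd diff_\<phi> diff_H x)
  also have "\<dots> = (\<phi> x * (H x \<bullet> H x)) *\<^sub>R (\<Sum>j<m. \<epsilon> j x v *\<^sub>R E j x)"
    by (simp add: dH[OF x] d\<phi>_H[OF x] scaleR_diff_right)
  also have "\<phi> x * (H x \<bullet> H x) = 1 / \<phi> x"
    using \<phi>_H[OF x] \<phi>_pos[OF x] by (simp add: field_simps power2_eq_square)
  finally show ?thesis .
qed

lemma dT_\<psi>:
  assumes x: "x \<in> S" and i: "i < m"
  shows "dd (E i) x v = (\<Sum>k<m. (dd (E i) x v \<bullet> E k x) *\<^sub>R E k x) - (\<epsilon> i x v / \<phi> x) *\<^sub>R \<psi> x"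
  using dT_H[OF x i, of v] \<phi>_pos[OF x] by (simp add: \<psi>_def)

lemma D\<phi>_Z: "x \<in> S \<Longrightarrow> a \<in> {m, m + 1} \<Longrightarrow> D\<phi> a x = - \<phi> x * Z a x"
  using H_e[of x a] by (simp add: D\<phi>_def \<psi>_def)

lemma e_de: "x \<in> S \<Longrightarrow> i < m + 2 \<Longrightarrow> E i x \<bullet> dd (E i) x v = 0"
  using dE_skew[of x i i v] by (simp add: inner_commute)

text \<open>The Hessian equation for \<phi> in the frame. The derivative of \<psi> is tangent to the
  leaf and drops out; in the derivative of \<open>E a\<close> the rotation of the frame gives
  \<omega>, and the component along \<eta> gives \<mu> by the Einstein condition.\<close>

lemma dD\<phi>:
  assumes x: "x \<in> S"
  shows "dd (D\<phi> m) x v = \<omega> x v * D\<phi> (m + 1) x - \<phi> x * \<mu> x * \<epsilon> m x v"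
    and "dd (D\<phi> (m + 1)) x v = - \<omega> x v * D\<phi> m x - \<phi> x * \<mu> x * \<epsilon> (m + 1) x v"
proof -
  have *: "dd (D\<phi> a) x v = \<psi> x \<bullet> dd (E a) x v" if "a \<in> {m, m + 1}" for a
  proof -
    have a: "a < m + 2" using that by auto
    have "dd \<psi> x v \<bullet> E a x = 0"
      unfolding d\<psi>[OF x] inner_scaleR_left inner_sum_left
      using that orth[OF x _ a] by (auto intro!: sum.neutral)
    then show ?thesis unfolding D\<phi>_def using dd_inner[OF diff_\<psi>[OF x] diff_E[OF x a], of v] by simp
  qed
  have **: "\<psi> x \<bullet> u = - \<phi> x * (Z m x * (E m x \<bullet> u) + Z (m + 1) x * (E (m + 1) x \<bullet> u) + \<eta> x \<bullet> u)" for u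
    by (simp add: \<psi>_def H_def inner_add_left)
  have sk: "E m x \<bullet> dd (E (m + 1)) x v = - \<omega> x v" "E (m + 1) x \<bullet> dd (E m) x v = \<omega> x v"
    using dE_skew[OF x, of m "m + 1" v] by (auto simp: \<omega>_def inner_commute)
  have n: "\<eta> x \<bullet> dd (E a) x v = \<mu> x * \<epsilon> a x v" if "a \<in> {m, m + 1}" for a
    using einstein_\<mu>[OF x that, of v] by (simp add: inner_commute)
  show "dd (D\<phi> m) x v = \<omega> x v * D\<phi> (m + 1) x - \<phi> x * \<mu> x * \<epsilon> m x v"
    using *[of m] **[of "dd (E m) x v"] sk n[of m] e_de[OF x, of m v] D\<phi>_Z[OF x, of "m + 1"] by (simp add: algebra_simps)
  show "dd (D\<phi> (m + 1)) x v = - \<omega> x v * D\<phi> m x - \<phi> x * \<mu> x * \<epsilon> (m + 1) x v"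
    using *[of "m + 1"] **[of "dd (E (m + 1)) x v"] sk n[of "m + 1"] e_de[OF x, of "m + 1" v] D\<phi>_Z[OF x, of m] by (simp add: algebra_simps)
qed

lemma smooth_\<epsilon>: "i < m + 2 \<Longrightarrow> smooth_on S (\<lambda>x. \<epsilon> i x v)"
  by (intro smooth_on_inner S E smooth_on_dd F)

text \<open>The first structure equations of the complementary coframe. The leaf contributions are
  \<open>Z a\<close> times a sum symmetric in v and w, so they vanish after
  antisymmetrization.\<close>

lemma d\<epsilon>:
  assumes x: "x \<in> S"
  shows "dd (\<lambda>z. \<epsilon> m z w) x v - dd (\<lambda>z. \<epsilon> m z v) x w = \<omega> x v * \<epsilon> (m + 1) x w - \<omega> x w * \<epsilon> (m + 1) x v"
    and "dd (\<lambda>z. \<epsilon> (m + 1) z w) x v - dd (\<lambda>z. \<epsilon> (m + 1) z v) x w = - (\<omega> x v * \<epsilon> m x w - \<omega> x w * \<epsilon> m x v)"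
proof -
  have 1: "dd (\<lambda>z. \<epsilon> a z w) x v = E a x \<bullet> dd (\<lambda>z. dd F z w) x v + dd (E a) x v \<bullet> dd F x w" if "a < m + 2" for a v w
    by (rule dd_inner[OF diff_E[OF x that] smooth_on_differentiable[OF smooth_on_dd[OF F] x]])
  have 2: "dd (\<lambda>z. dd F z w) x v = dd (\<lambda>z. dd F z v) x w" by (rule dd_dd_commute[OF F S x])
  have 3: "dd (E a) x v \<bullet> dd F x w = - Z a x * (\<Sum>k<m. \<epsilon> k x v * \<epsilon> k x w)
      + (dd (E a) x v \<bullet> E m x) * \<epsilon> m x w + (dd (E a) x v \<bullet> E (m + 1) x) * \<epsilon> (m + 1) x w"
    if a: "a \<in> {m, m + 1}" for a v w
  proof -
    have am: "a < m + 2" using a by auto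
    have "dd (E a) x v \<bullet> dd F x w = dd (E a) x v \<bullet> (\<Sum>k<m+2. \<epsilon> k x w *\<^sub>R E k x)" by (rule arg_cong[OF dF_expand[OF x]])
    also have "\<dots> = (\<Sum>k<m. \<epsilon> k x w * (dd (E a) x v \<bullet> E k x))
      + ((dd (E a) x v \<bullet> E m x) * \<epsilon> m x w + (dd (E a) x v \<bullet> E (m + 1) x) * \<epsilon> (m + 1) x w)"
      unfolding sum_lessThan_add_2 by (simp add: inner_add_right inner_sum_right mult.commute)
    also have "(\<Sum>k<m. \<epsilon> k x w * (dd (E a) x v \<bullet> E k x)) = - Z a x * (\<Sum>k<m. \<epsilon> k x v * \<epsilon> k x w)"
      unfolding sum_distrib_left
    proof (intro sum.cong refl)
      fix k assume k: "k \<in> {..<m}"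
      then have "dd (E a) x v \<bullet> E k x = - (\<epsilon> k x v * Z a x)"
        using dE_skew[OF x am, of k v] dT_e[OF x _ a, of k v] by (simp add: inner_commute)
      then show "\<epsilon> k x w * (dd (E a) x v \<bullet> E k x) = - Z a x * (\<epsilon> k x v * \<epsilon> k x w)" by simp
    qed
    finally show ?thesis by simp
  qed
  have 4: "(\<Sum>k<m. \<epsilon> k x v * \<epsilon> k x w) = (\<Sum>k<m. \<epsilon> k x w * \<epsilon> k x v)" by (simp add: mult.commute)
  have 5: "dd (E m) x u \<bullet> E m x = 0" "dd (E (m + 1)) x u \<bullet> E (m + 1) x = 0" "dd (E m) x u \<bullet> E (m + 1) x = \<omega> x u"
     "dd (E (m + 1)) x u \<bullet> E m x = - \<omega> x u" for u
    using dE_skew[OF x, of m "m + 1" u] e_de[OF x, of m u] e_de[OF x, of "m + 1" u] by (auto simp: \<omega>_def inner_commute)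
  have m2: "m < m + 2" "m + 1 < m + 2" by auto
  show "dd (\<lambda>z. \<epsilon> m z w) x v - dd (\<lambda>z. \<epsilon> m z v) x w = \<omega> x v * \<epsilon> (m + 1) x w - \<omega> x w * \<epsilon> (m + 1) x v"
    unfolding 1[OF m2(1)] 2 using 3[of m v w] 3[of m w v] 4 5 by simp
  show "dd (\<lambda>z. \<epsilon> (m + 1) z w) x v - dd (\<lambda>z. \<epsilon> (m + 1) z v) x w = - (\<omega> x v * \<epsilon> m x w - \<omega> x w * \<epsilon> m x v)"
    unfolding 1[OF m2(2)] 2 using 3[of "m + 1" v w] 3[of "m + 1" w v] 4 5 by simp
qed

lemma D\<phi>_norm: "x \<in> S \<Longrightarrow> (D\<phi> m x)\<^sup>2 + (D\<phi> (m + 1) x)\<^sup>2 = 1 - (\<phi> x)\<^sup>2 * lam x"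
  using \<phi>_H[of x] by (simp add: D\<phi>_Z H_H power_mult_distrib algebra_simps)

lemma lam_\<theta>: "lam x = (\<rho> + 2 * \<theta> x) / (real m + 1)"
  by (simp add: \<theta>_def \<mu>_def field_simps)

lemma lam_pos: "x \<in> S \<Longrightarrow> lam x > 0"
  using \<eta>_nz[of x] by (simp add: lam_def)

lemma dlam_Z:
  assumes x: "x \<in> S" shows "dd lam x v = 2 * \<theta> x * (H x \<bullet> dd F x v)"
proof -
  have dl: "lam differentiable (at x)" using smooth_on_differentiable[OF smooth_lam x] .
  have "linear (\<lambda>v. dd lam x v - 2 * \<theta> x * (H x \<bullet> dd F x v))"
    using linear_dd[OF dl] linear_dF[OF x]
    by (intro linearI) (simp_all add: linear_add linear_scale inner_add_right algebra_simps)
  moreover have "dd lam x (\<xi> k x) - 2 * \<theta> x * (H x \<bullet> dd F x (\<xi> k x)) = 0" if k: "k < m + 2" for k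
  proof (cases "k < m")
    case True then show ?thesis using dlam_\<xi>[OF x True] H_T[OF x True] E_eq[OF x k] by simp
  next
    case False
    then have "k \<in> {m, m+1}" using k by auto
    then show ?thesis using H_e[OF x, of k] E_eq[OF x k] \<theta>_nz[OF x] by (simp add: Z_def)
  qed
  ultimately have "dd lam x v - 2 * \<theta> x * (H x \<bullet> dd F x v) = 0" by (rule linear_ext[OF x])
  then show ?thesis by simp
qed

text \<open>Both factors have derivatives proportional to themselves and to the product of H with
  dF: \<theta> with the factor m + 1, since \<theta> is (m + 1) / 2 * lam up to a constant, and
  \<phi> with the factor -1.\<close>

lemma \<theta>_\<phi>_const:
  assumes x: "x \<in> S" shows "((\<lambda>z. \<theta> z * \<phi> z ^ (m + 1)) has_derivative (\<lambda>v. 0)) (at x)"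
proof -
  have d\<theta>: "(\<theta> has_derivative (\<lambda>v. (real m + 1) / 2 * dd lam x v)) (at x)"
    unfolding \<theta>_def \<mu>_def using smooth_on_has_derivative[OF smooth_lam x]
    by (auto intro!: derivative_eq_intros simp: field_simps)
  have "((\<lambda>z. \<theta> z * \<phi> z ^ (m + 1)) has_derivative
     (\<lambda>v. \<theta> x * (real (m + 1) * dd \<phi> x v * \<phi> x ^ (m + 1 - 1)) + ((real m + 1) / 2 * dd lam x v) * \<phi> x ^ (m + 1))) (at x)"
    by (intro has_derivative_mult has_derivative_power d\<theta> has_derivative_dd diff_\<phi> x)
  moreover have "\<theta> x * (real (m + 1) * dd \<phi> x v * \<phi> x ^ (m + 1 - 1)) + ((real m + 1) / 2 * dd lam x v) * \<phi> x ^ (m + 1) = 0" for v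
    by (simp add: d\<phi>_H[OF x] dlam_Z[OF x] algebra_simps)
  ultimately show ?thesis by simp
qed

text \<open>In \<open>D\<phi>_norm\<close> the value of \<open>lam\<close> is expressed by \<theta>,
  and \<theta> by the constant c0 = \<theta> * \<phi>^(m + 1). This gives c = - 2 * c0 / (m + 1) and
  the exponent (m + 1) - 2 = m - 1.\<close>

lemma D\<phi>_profile:
  assumes "convex S"
  obtains c where "\<And>x. x \<in> S \<Longrightarrow>
    (D\<phi> m x)\<^sup>2 + (D\<phi> (m + 1) x)\<^sup>2 = 1 - \<rho> / (real m + 1) * (\<phi> x)\<^sup>2 + c / \<phi> x ^ (m - 1)"
proof -
  have "\<exists>c. \<forall>x\<in>S. \<theta> x * \<phi> x ^ (m + 1) = c"
    by (rule has_derivative_zero_constant[OF assms]) (use \<theta>_\<phi>_const has_derivative_at_withinI in blast)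
  then obtain c0 where c0: "\<And>x. x \<in> S \<Longrightarrow> \<theta> x * \<phi> x ^ (m + 1) = c0" by blast
  show ?thesis
  proof (rule that)
    fix x assume x: "x \<in> S"
    have "\<phi> x ^ (m + 1) = \<phi> x ^ (m - 1) * (\<phi> x)\<^sup>2"
      using m by (simp flip: power_add)
    then have "(\<phi> x)\<^sup>2 * \<theta> x = c0 / \<phi> x ^ (m - 1)"
      using c0[OF x] \<phi>_pos[OF x] by (simp add: field_simps)
    moreover have "(\<phi> x)\<^sup>2 * lam x = \<rho> / (real m + 1) * (\<phi> x)\<^sup>2 + 2 / (real m + 1) * ((\<phi> x)\<^sup>2 * \<theta> x)"
      by (simp add: lam_\<theta> add_divide_distrib algebra_simps)
    ultimately show "(D\<phi> m x)\<^sup>2 + (D\<phi> (m + 1) x)\<^sup>2 = 1 - \<rho> / (real m + 1) * (\<phi> x)\<^sup>2 + (- (2 / (real m + 1) * c0)) / \<phi> x ^ (m - 1)"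
      using D\<phi>_norm[OF x] by simp
  qed
qed

text \<open>The orthogonal projection onto the span of \<open>\<psi>\<close> and the umbilical distribution is constant,
  because this orthonormal frame only rotates.\<close>

lemma leaf_projection_const:
  assumes "convex S" "x \<in> S" "x' \<in> S"
  shows "(\<Sum>j<m. (E j x \<bullet> a) * (E j x \<bullet> b)) + (\<psi> x \<bullet> a) * (\<psi> x \<bullet> b)
    = (\<Sum>j<m. (E j x' \<bullet> a) * (E j x' \<bullet> b)) + (\<psi> x' \<bullet> a) * (\<psi> x' \<bullet> b)"
proof -
  define q where "q x = (\<Sum>j<m. (E j x \<bullet> a) * (E j x \<bullet> b)) + (\<psi> x \<bullet> a) * (\<psi> x \<bullet> b)" for x
  have D: "(q has_derivative (\<lambda>v. 0)) (at x)" if x: "x \<in> S" for x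
  proof -
    have "(q has_derivative (\<lambda>v. (\<Sum>j<m. (E j x \<bullet> a) * (dd (E j) x v \<bullet> b) + (dd (E j) x v \<bullet> a) * (E j x \<bullet> b))
       + ((\<psi> x \<bullet> a) * (dd \<psi> x v \<bullet> b) + (dd \<psi> x v \<bullet> a) * (\<psi> x \<bullet> b)))) (at x)"
      unfolding q_def
      by (intro has_derivative_add has_derivative_sum has_derivative_mult has_derivative_inner_left has_derivative_dd diff_\<psi> diff_E x) auto
    moreover have "(\<Sum>j<m. (E j x \<bullet> a) * (dd (E j) x v \<bullet> b) + (dd (E j) x v \<bullet> a) * (E j x \<bullet> b))
       + ((\<psi> x \<bullet> a) * (dd \<psi> x v \<bullet> b) + (dd \<psi> x v \<bullet> a) * (\<psi> x \<bullet> b)) = 0" for v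
    proof -
      define w where "w j k = dd (E j) x v \<bullet> E k x" for j k
      have sk: "w j k = - w k j" if "j < m" "k < m" for j k
        using dE_skew[OF x, of j k v] that by (simp add: w_def inner_commute)
      have e: "dd (E j) x v \<bullet> b = (\<Sum>k<m. w j k * (E k x \<bullet> b)) - \<epsilon> j x v / \<phi> x * (\<psi> x \<bullet> b)" if "j < m" for j b
        by (subst dT_\<psi>[OF x that]) (simp add: inner_diff_left inner_sum_left w_def)
      have p: "dd \<psi> x v \<bullet> b = (\<Sum>j<m. \<epsilon> j x v / \<phi> x * (E j x \<bullet> b))" for b
        by (simp add: d\<psi>[OF x] inner_sum_left sum_distrib_left)
      \<comment> \<open>The rotation of the leaf frame within itself contributes nothing because its
        matrix w is skew; the remaining \<psi> parts are cancelled by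
        \<open>d\<psi>\<close>.\<close>
      have z: "(\<Sum>j<m. (E j x \<bullet> a) * (\<Sum>k<m. w j k * (E k x \<bullet> b))) + (\<Sum>j<m. (\<Sum>k<m. w j k * (E k x \<bullet> a)) * (E j x \<bullet> b)) = 0"
      proof -
        have "(\<Sum>j<m. (\<Sum>k<m. w j k * (E k x \<bullet> a)) * (E j x \<bullet> b)) = (\<Sum>k<m. \<Sum>j<m. w j k * (E k x \<bullet> a) * (E j x \<bullet> b))"
          unfolding sum_distrib_right by (rule sum.swap)
        also have "\<dots> = (\<Sum>k<m. \<Sum>j<m. - (E k x \<bullet> a) * (w k j * (E j x \<bullet> b)))"
        proof (intro sum.cong refl)
          fix k j assume "k \<in> {..<m}" "j \<in> {..<m}"
          then have "w j k = - w k j" by (intro sk) auto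
          then show "w j k * (E k x \<bullet> a) * (E j x \<bullet> b) = - (E k x \<bullet> a) * (w k j * (E j x \<bullet> b))"
            by (simp only:) simp
        qed
        finally show ?thesis by (simp add: sum_distrib_left sum_negf)
      qed
      have "(\<Sum>j<m. (E j x \<bullet> a) * (dd (E j) x v \<bullet> b) + (dd (E j) x v \<bullet> a) * (E j x \<bullet> b))
        = (\<Sum>j<m. ((E j x \<bullet> a) * (\<Sum>k<m. w j k * (E k x \<bullet> b)) + (\<Sum>k<m. w j k * (E k x \<bullet> a)) * (E j x \<bullet> b))
           - ((\<epsilon> j x v / \<phi> x * (E j x \<bullet> a)) * (\<psi> x \<bullet> b) + (\<epsilon> j x v / \<phi> x * (E j x \<bullet> b)) * (\<psi> x \<bullet> a)))"
        by (intro sum.cong refl) (simp add: e algebra_simps)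
      also have "\<dots> = - ((dd \<psi> x v \<bullet> a) * (\<psi> x \<bullet> b) + (dd \<psi> x v \<bullet> b) * (\<psi> x \<bullet> a))"
        unfolding sum_subtractf sum.distrib using z by (simp add: p sum_distrib_right)
      finally show ?thesis by simp
    qed
    ultimately show ?thesis by simp
  qed
  have "\<exists>c. \<forall>x\<in>S. q x = c"
    by (rule has_derivative_zero_constant[OF assms(1)]) (use D has_derivative_at_withinI in blast)
  then have "q x = q x'" using assms by metis
  then show ?thesis unfolding q_def .
qed

lemma diff_h: "x \<in> S \<Longrightarrow> h differentiable (at x)"
  using smooth_on_differentiable[OF smooth_h] .

lemma dh:
  assumes x: "x \<in> S"
  shows "dd h x v = \<epsilon> m x v *\<^sub>R E m x + \<epsilon> (m + 1) x v *\<^sub>R E (m + 1) x - dd \<phi> x v *\<^sub>R \<psi> x"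
proof -
  have "dd h x v = dd F x v - (\<phi> x *\<^sub>R dd \<psi> x v + dd \<phi> x v *\<^sub>R \<psi> x)"
    unfolding h_def by (rule dd_eq)
      (intro has_derivative_diff has_derivative_scaleR smooth_on_has_derivative[OF F x] has_derivative_dd diff_\<phi> diff_\<psi> x)
  also have "\<phi> x *\<^sub>R dd \<psi> x v = (\<Sum>j<m. \<epsilon> j x v *\<^sub>R E j x)" using d\<psi>[OF x] \<phi>_pos[OF x] by simp
  finally have 1: "dd h x v = (dd F x v - (\<Sum>j<m. \<epsilon> j x v *\<^sub>R E j x)) - dd \<phi> x v *\<^sub>R \<psi> x" by simp
  have "dd F x v - (\<Sum>j<m. \<epsilon> j x v *\<^sub>R E j x) = \<epsilon> m x v *\<^sub>R E m x + \<epsilon> (m + 1) x v *\<^sub>R E (m + 1) x"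
    unfolding diff_eq_eq by (subst add.commute) (rule dF_expand[OF x, of v, unfolded sum_lessThan_add_2])
  then show ?thesis unfolding 1 by (rule arg_cong)
qed

lemma dh_T: "x \<in> S \<Longrightarrow> j < m \<Longrightarrow> dd h x v \<bullet> E j x = 0"
  using orth[of x m j] orth[of x "m + 1" j] \<psi>_T[of x j] by (simp add: dh inner_diff_left inner_add_left)

lemma dh_\<psi>:
  assumes x: "x \<in> S" shows "dd h x v \<bullet> \<psi> x = 0"
proof -
  have "E a x \<bullet> \<psi> x = D\<phi> a x" for a by (simp add: D\<phi>_def inner_commute)
  then show ?thesis
    using \<psi>_\<psi>[OF x] by (simp add: dh[OF x] d\<phi>[OF x] inner_diff_left inner_add_left)
qed

text \<open>Since dh is orthogonal to \<psi>, the metric of the complement is reduced by the square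
  of d\<phi>; this is the origin of the coefficient 1 - \<phi>'^2 in the metric of the
  profile.\<close>

lemma dh_dh:
  assumes x: "x \<in> S"
  shows "dd h x v \<bullet> dd h x w = \<epsilon> m x v * \<epsilon> m x w + \<epsilon> (m + 1) x v * \<epsilon> (m + 1) x w - dd \<phi> x v * dd \<phi> x w"
proof -
  have "dd h x v \<bullet> dd h x w = dd h x v \<bullet> (\<epsilon> m x w *\<^sub>R E m x + \<epsilon> (m + 1) x w *\<^sub>R E (m + 1) x)"
    using dh_\<psi>[OF x, of v] by (subst (2) dh[OF x]) (simp add: inner_diff_right)
  also have "\<dots> = \<epsilon> m x v * \<epsilon> m x w + \<epsilon> (m + 1) x v * \<epsilon> (m + 1) x w - dd \<phi> x v * (D\<phi> m x * \<epsilon> m x w + D\<phi> (m + 1) x * \<epsilon> (m + 1) x w)"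
    using orth[OF x, of m m] orth[OF x, of m "m+1"] orth[OF x, of "m+1" m] orth[OF x, of "m+1" "m+1"]
    by (simp add: dh[OF x] inner_diff_left inner_add_left inner_add_right D\<phi>_def algebra_simps)
  finally show ?thesis by (simp add: d\<phi>[OF x])
qed

lemma dF_dF:
  assumes x: "x \<in> S" shows "dd F x v \<bullet> dd F x w = (\<Sum>j<m. \<epsilon> j x v * \<epsilon> j x w) + \<epsilon> m x v * \<epsilon> m x w + \<epsilon> (m + 1) x v * \<epsilon> (m + 1) x w"
proof -
  have "dd F x v \<bullet> dd F x w = (\<Sum>i<m+2. \<epsilon> i x v *\<^sub>R E i x) \<bullet> dd F x w"
    by (rule arg_cong[OF dF_expand[OF x], of "\<lambda>u. u \<bullet> dd F x w"])
  then show ?thesis unfolding sum_lessThan_add_2 by (simp add: inner_add_left inner_sum_left)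
qed

text \<open>If \<open>lam\<close> is constant, \<open>Z\<close> and hence the gradient of \<phi>
  vanish on all of S; the Hessian equation \<open>dD\<phi>\<close> then leaves \<phi> * \<mu> =
  0.\<close>

lemma lam_const_cases:
  assumes "\<And>x v. x \<in> S \<Longrightarrow> dd lam x v = 0" and x: "x \<in> S"
  shows "D\<phi> m x = 0" "D\<phi> (m + 1) x = 0" "\<mu> x = 0"
proof -
  have z: "D\<phi> a x = 0" if "a \<in> {m, m + 1}" "x \<in> S" for a x
    using assms(1)[OF that(2)] D\<phi>_Z[OF that(2,1)] by (simp add: Z_def)
  show "D\<phi> m x = 0" "D\<phi> (m + 1) x = 0" using z x by auto
  have "dd (D\<phi> m) x (\<xi> m x) = dd (\<lambda>x. 0) x (\<xi> m x)"
    using dd_cong_open[OF S x, of "D\<phi> m" "\<lambda>x. 0"] z by simp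
  then have "\<phi> x * \<mu> x = 0"
    using dD\<phi>(1)[OF x, of "\<xi> m x"] z x \<epsilon>_\<xi>[OF x, of m m] by (simp add: frechet_derivative_const)
  then show "\<mu> x = 0" using \<phi>_pos[OF x] by simp
qed

end

section \<open>Smooth inverses and local products\<close>

lemma linear_right_inverse_left:
  fixes f :: "'a::euclidean_space \<Rightarrow> 'b::euclidean_space"
  assumes f: "linear f" and g: "\<And>w. f (g w) = w" and dim: "DIM('a) = DIM('b)"
  shows "linear g" "\<And>v. g (f v) = v"
proof -
  have "surj f" using g by (metis surjI)
  then have inj: "inj f"
    using linear_surjective_imp_injective[OF f] dim by simp
  show "\<And>v. g (f v) = v" using g inj by (metis injD)
  show "linear g"
    by (rule linearI; rule injD[OF inj]) (simp_all add: g linear_add[OF f] linear_scale[OF f])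
qed

text \<open>The inverse L of the derivative is supplied as a smooth field. The derivative of the
  local inverse g is then L at the preimage, and smoothness follows by bootstrapping. Openness of
  the image is invariance of domain.\<close>

lemma smooth_local_inverse:
  fixes f :: "'a::euclidean_space \<Rightarrow> 'b::euclidean_space" and L :: "'a \<Rightarrow> 'b \<Rightarrow> 'a"
  assumes S: "open S" "x0 \<in> S" and f: "smooth_on S f"
    and L: "\<And>w. smooth_on S (\<lambda>x. L x w)" "\<And>x w. x \<in> S \<Longrightarrow> dd f x (L x w) = w"
    and dim: "DIM('a) = DIM('b)"
  obtains r g where "r > 0" "ball x0 r \<subseteq> S" "open (f ` ball x0 r)"
    "homeomorphism (ball x0 r) (f ` ball x0 r) f g" "smooth_on (f ` ball x0 r) g"
    "\<And>x. x \<in> ball x0 r \<Longrightarrow> (g has_derivative L x) (at (f x))"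
proof -
  have Df: "(f has_derivative dd f x) (at x)" if "x \<in> S" for x by (rule smooth_on_has_derivative[OF f that])
  have linf: "linear (dd f x)" if "x \<in> S" for x using Df[OF that] has_derivative_linear by blast
  have linL: "linear (L x)" and Ldf: "L x (dd f x v) = v" if "x \<in> S" for x v
    using linear_right_inverse_left[OF linf[OF that] L(2)[OF that] dim] by auto
  have on: "\<exists>d>0. \<forall>x. dist x0 x < d \<longrightarrow> onorm (\<lambda>v. dd f x v - dd f x0 v) < e" if e: "e > 0" for e
  proof -
    define q where "q x = (\<Sum>b\<in>Basis. norm (dd f x b - dd f x0 b))" for x
    have "continuous_on S q"
      unfolding q_def by (intro continuous_intros smooth_on_continuous_on[OF smooth_on_dd[OF f]])
    then have "isCont q x0" using S continuous_on_eq_continuous_at by blast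
    moreover have "q x0 = 0" by (simp add: q_def)
    ultimately obtain d where d: "d > 0" "\<And>x. dist x x0 < d \<Longrightarrow> \<bar>q x\<bar> < e"
      using e unfolding continuous_at_eps_delta by (auto simp: dist_real_def)
    obtain d' where d': "d' > 0" "ball x0 d' \<subseteq> S" using S openE by blast
    have "onorm (\<lambda>v. dd f x v - dd f x0 v) < e" if "dist x0 x < min d d'" for x
    proof -
      have x: "x \<in> S" using that d' by auto
      have "bounded_linear (\<lambda>v. dd f x v - dd f x0 v)"
        using Df[OF x] Df[OF S(2)] by (intro bounded_linear_sub has_derivative_bounded_linear)
      then have "onorm (\<lambda>v. dd f x v - dd f x0 v) \<le> q x" unfolding q_def by (rule onorm_componentwise)
      also have "q x < e" using d(2)[of x] that by (auto simp: dist_commute)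
      finally show ?thesis .
    qed
    then show ?thesis using d(1) d'(1) by (intro exI[of _ "min d d'"]) auto
  qed
  have "L x0 \<circ> dd f x0 = id" using Ldf[OF S(2)] by auto
  with linL[OF S(2)] obtain r where r: "r > 0" "ball x0 r \<subseteq> S" "inj_on f (ball x0 r)"
    using has_derivative_locally_injective[OF S(2) S(1) _ _ Df on, of "L x0"] linear_conv_bounded_linear by blast
  have cf: "continuous_on (ball x0 r) f"
    using continuous_on_subset[OF smooth_on_continuous_on[OF f] r(2)] .
  have op: "open (f ` ball x0 r)" by (rule invariance_of_domain_gen[OF open_ball cf r(3)]) (simp add: dim)
  obtain g where g: "homeomorphism (ball x0 r) (f ` ball x0 r) f g"
    using invariance_of_domain_homeomorphism[OF open_ball cf _ r(3)] dim by auto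
  have Dg: "(g has_derivative L x) (at (f x))" if x: "x \<in> ball x0 r" for x
  proof (rule has_derivative_inverse_basic_x[OF Df _ _ _ _ op])
    show "x \<in> S" using x r(2) by blast
    then show "bounded_linear (L x)" "L x \<circ> dd f x = id" using linL Ldf linear_conv_bounded_linear by auto
    show "continuous (at (f x)) g"
      using homeomorphism_cont2[OF g] op x continuous_on_eq_continuous_at by blast
    show "g (f x) = x" by (rule homeomorphism_apply1[OF g x])
    show "f x \<in> f ` ball x0 r" using x by blast
    show "\<And>y. y \<in> f ` ball x0 r \<Longrightarrow> f (g y) = y" using homeomorphism_apply2[OF g] .
  qed
  have "smooth_on (f ` ball x0 r) g"
  proof (rule smooth_on_bootstrap[OF op])
    fix y assume "y \<in> f ` ball x0 r"
    then show "(g has_derivative L (g y)) (at y)" using Dg homeomorphism_apply1[OF g] by auto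
  next
    fix k v assume "Ck_on k (f ` ball x0 r) g"
    moreover have "g ` (f ` ball x0 r) \<subseteq> S" using homeomorphism_image2[OF g] r(2) by simp
    moreover have "Ck_on k S (\<lambda>x. L x v)" using L(1)[of v] by (simp add: smooth_on_def)
    ultimately show "Ck_on k (f ` ball x0 r) (\<lambda>y. L (g y) v)"
      using Ck_on_compose[OF op S(1), of g k "\<lambda>x. L x v"] by simp
  qed
  then show ?thesis by (rule that[OF r(1,2) op g _ Dg])
qed

text \<open>L makes (A, B) a local coordinate system. The derivative of h vanishes along the B
  directions, so on a product of balls h depends on A alone.\<close>

lemma local_product:
  fixes A :: "'a::euclidean_space \<Rightarrow> 'p::euclidean_space" and B :: "'a \<Rightarrow> 'q::euclidean_space"
    and h :: "'a \<Rightarrow> 'd::euclidean_space" and L :: "'a \<Rightarrow> 'p \<times> 'q \<Rightarrow> 'a"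
  assumes S: "open S" "x0 \<in> S" and sm: "smooth_on S A" "smooth_on S B" "smooth_on S h"
    and L: "\<And>w. smooth_on S (\<lambda>x. L x w)" "\<And>x w. x \<in> S \<Longrightarrow> dd A x (L x w) = fst w"
      "\<And>x w. x \<in> S \<Longrightarrow> dd B x (L x w) = snd w"
    and h0: "\<And>x w. x \<in> S \<Longrightarrow> dd h x (L x (0, w)) = 0"
    and dim: "DIM('a) = DIM('p) + DIM('q)"
  obtains N r g h' where "open N" "x0 \<in> N" "N \<subseteq> S" "r > 0"
    "homeomorphism N (ball (A x0) r \<times> ball (B x0) r) (\<lambda>x. (A x, B x)) g"
    "smooth_on (ball (A x0) r) h'" "\<And>x. x \<in> N \<Longrightarrow> h x = h' (A x)"
    "\<And>x w. x \<in> N \<Longrightarrow> dd h' (A x) w = dd h x (L x (w, 0))"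
proof -
  define f where "f x = (A x, B x)" for x
  have f: "smooth_on S f" unfolding f_def by (intro smooth_on_Pair S sm)
  have LD: "dd f x (L x w) = w" if x: "x \<in> S" for x w
  proof -
    have "dd f x v = (dd A x v, dd B x v)" for v
      unfolding f_def by (rule dd_eq) (intro has_derivative_Pair smooth_on_has_derivative[OF sm(1) x] smooth_on_has_derivative[OF sm(2) x])
    then show ?thesis using L(2,3)[OF x] by simp
  qed
  have dim': "DIM('a) = DIM('p \<times> 'q)" using dim by simp
  obtain r0 g where g: "r0 > 0" "ball x0 r0 \<subseteq> S" "open (f ` ball x0 r0)"
    "homeomorphism (ball x0 r0) (f ` ball x0 r0) f g" "smooth_on (f ` ball x0 r0) g"
    "\<And>x. x \<in> ball x0 r0 \<Longrightarrow> (g has_derivative L x) (at (f x))"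
    by (rule smooth_local_inverse[where L = L, OF S f L(1) LD dim']) (assumption | rule that)+
  have "f x0 \<in> f ` ball x0 r0" using g(1) by simp
  with g(3) obtain U W where UW: "open U" "open W" "(A x0, B x0) \<in> U \<times> W" "U \<times> W \<subseteq> f ` ball x0 r0"
    unfolding f_def by (rule open_prod_elim) blast
  obtain r1 where r1: "r1 > 0" "ball (A x0) r1 \<subseteq> U" using UW openE by (metis mem_Sigma_iff)
  obtain r2 where r2: "r2 > 0" "ball (B x0) r2 \<subseteq> W" using UW openE by (metis mem_Sigma_iff)
  define r where "r = min r1 r2"
  define Q where "Q = ball (A x0) r \<times> ball (B x0) r"
  have rpos: "r > 0" using r1 r2 by (simp add: r_def)
  have "Q \<subseteq> U \<times> W" using r1(2) r2(2) by (auto simp: Q_def r_def)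
  then have Qsub: "Q \<subseteq> f ` ball x0 r0" using UW(4) by (rule order_trans)
  have oQ: "open Q" unfolding Q_def by (intro open_Times open_ball)
  define N where "N = ball x0 r0 \<inter> f -` Q"
  have cf: "continuous_on (ball x0 r0) f"
    using homeomorphism_cont1[OF g(4)] .
  have oN: "open N" unfolding N_def by (rule continuous_open_preimage[OF cf open_ball oQ])
  have x0N: "x0 \<in> N" using g(1) rpos by (simp add: N_def Q_def f_def)
  have NS: "N \<subseteq> S" using g(2) by (auto simp: N_def)
  have fN: "f ` N = Q" unfolding N_def using Qsub by auto
  have hom: "homeomorphism N Q f g"
    by (rule homeomorphism_of_subsets[OF g(4) _ Qsub fN]) (auto simp: N_def)
  \<comment> \<open>The second coordinate is frozen at its value in x0; by \<open>const\<close> the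
    choice does not matter.\<close>
  define h' where "h' a = h (g (a, B x0))" for a
  have gN: "g q \<in> N" "f (g q) = q" "g q \<in> S" if "q \<in> Q" for q
    using homeomorphism_image2[OF hom] homeomorphism_apply2[OF hom that] that NS by auto
  have Dhg: "((\<lambda>q. h (g q)) has_derivative (\<lambda>w. dd h (g q) (L (g q) w))) (at q)" if q: "q \<in> Q" for q
  proof -
    have "(g has_derivative L (g q)) (at q)"
      using g(6)[of "g q"] gN[OF q] by (simp add: N_def)
    then show ?thesis
      by (rule has_derivative_compose[of g "L (g q)" q UNIV h "dd h (g q)", OF _ smooth_on_has_derivative[OF sm(3) gN(3)[OF q]]])
  qed
  have const: "h (g (a, b)) = h (g (a, b'))" if a: "a \<in> ball (A x0) r" and b: "b \<in> ball (B x0) r" "b' \<in> ball (B x0) r" for a b b'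
  proof -
    have "((\<lambda>b. h (g (a, b))) has_derivative (\<lambda>w. 0)) (at b within ball (B x0) r)" if "b \<in> ball (B x0) r" for b
    proof -
      have q: "(a, b) \<in> Q" using a that by (simp add: Q_def)
      have "((\<lambda>b. h (g (a, b))) has_derivative (\<lambda>w. dd h (g (a, b)) (L (g (a, b)) (0, w)))) (at b within ball (B x0) r)"
        by (rule has_derivative_compose[of "\<lambda>b. (a, b)" "\<lambda>w. (0, w)" b "ball (B x0) r" "\<lambda>q. h (g q)", OF _ Dhg[OF q]])
          (auto intro!: derivative_eq_intros)
      then show ?thesis using h0[OF gN(3)[OF q]] by simp
    qed
    then have "\<exists>c. \<forall>b\<in>ball (B x0) r. h (g (a, b)) = c"
      by (intro has_derivative_zero_constant convex_ball)
    then show ?thesis using b by metis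
  qed
  have hh': "h x = h' (A x)" if x: "x \<in> N" for x
  proof -
    have q: "(A x, B x) \<in> Q" and gx: "g (A x, B x) = x"
      using x fN homeomorphism_apply1[OF hom x] by (auto simp: f_def)
    then show ?thesis using const[of "A x" "B x" "B x0"] rpos by (simp add: h'_def Q_def)
  qed
  have sm_h': "smooth_on (ball (A x0) r) h'"
  proof -
    have "smooth_on Q g" using smooth_on_subset[OF g(5) Qsub] .
    then have "smooth_on Q (\<lambda>q. h (g q))"
      using gN(3) by (intro smooth_on_compose[OF oQ S(1) _ sm(3)]) auto
    moreover have "smooth_on (ball (A x0) r) (\<lambda>a. (a, B x0))"
      by (intro smooth_on_Pair open_ball smooth_on_const smooth_on_bounded_linear bounded_linear_ident)
    moreover have "(\<lambda>a. (a, B x0)) ` ball (A x0) r \<subseteq> Q" using rpos by (auto simp: Q_def)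
    ultimately show ?thesis unfolding h'_def
      using smooth_on_compose[OF open_ball oQ, where f = "\<lambda>a. (a, B x0)" and g = "\<lambda>q. h (g q)"] by simp
  qed
  have dh': "dd h' (A x) w = dd h x (L x (w, 0))" if x: "x \<in> N" for x w
  proof -
    have q: "(A x, B x) \<in> Q" and gx: "g (A x, B x) = x"
      using x fN homeomorphism_apply1[OF hom x] by (auto simp: f_def)
    have "((\<lambda>a. h (g (a, B x))) has_derivative (\<lambda>w. dd h (g (A x, B x)) (L (g (A x, B x)) (w, 0)))) (at (A x))"
      by (rule has_derivative_compose[of "\<lambda>a. (a, B x)" "\<lambda>w. (w, 0)" "A x" UNIV "\<lambda>q. h (g q)", OF _ Dhg[OF q]])
        (auto intro!: derivative_eq_intros)
    moreover have "dd h' (A x) = dd (\<lambda>a. h (g (a, B x))) (A x)"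
      by (rule dd_cong_open[OF open_ball, of "A x" "A x0" r]) (use q rpos const in \<open>auto simp: h'_def Q_def\<close>)
    ultimately show ?thesis using dd_eq gx by metis
  qed
  show ?thesis
    using that[OF oN x0N NS rpos _ sm_h' hh' dh'] hom by (simp add: f_def[abs_def] Q_def)
qed

section \<open>The local models\<close>

definition orthonormal :: "nat \<Rightarrow> (nat \<Rightarrow> 'b::real_inner) \<Rightarrow> bool" where
  "orthonormal k w \<longleftrightarrow> (\<forall>i<k. \<forall>j<k. w i \<bullet> w j = (if i = j then 1 else 0))"

lemma projection_facts:
  fixes w :: "nat \<Rightarrow> 'b::euclidean_space"
  assumes orth: "orthonormal k w"
  defines "P \<equiv> \<lambda>v. \<Sum>i<k. (w i \<bullet> v) *\<^sub>R w i"
  shows "linear P" "\<And>i. i < k \<Longrightarrow> P (w i) = w i" "\<And>v i. i < k \<Longrightarrow> w i \<bullet> P v = w i \<bullet> v"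
    "\<And>v. P (P v) = P v" "\<And>u v. P u \<bullet> (v - P v) = 0"
proof -
  have w: "w i \<bullet> w j = (if i = j then 1 else 0)" if "i < k" "j < k" for i j
    using orth that by (simp add: orthonormal_def)
  show "linear P" unfolding P_def
    by (rule linearI) (simp_all add: inner_add_right scaleR_add_left sum.distrib scaleR_sum_right)
  show 1: "w i \<bullet> P v = w i \<bullet> v" if i: "i < k" for v i
  proof -
    have "w i \<bullet> P v = (\<Sum>j<k. if j = i then w j \<bullet> v else 0)"
      unfolding P_def inner_sum_right by (intro sum.cong refl) (use w i in auto)
    then show ?thesis using i by (simp add: sum.delta)
  qed
  show "P (w i) = w i" if i: "i < k" for i
  proof -
    have "P (w i) = (\<Sum>j<k. if j = i then w j else 0)"
      unfolding P_def by (intro sum.cong refl) (use w i in auto)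
    then show ?thesis using i by (simp add: sum.delta)
  qed
  show "P (P v) = P v" for v
    by (subst (1 3) P_def) (use 1 in simp)
  show "P u \<bullet> (v - P v) = 0" for u v
    by (subst (1) P_def) (simp add: inner_sum_left inner_diff_right 1)
qed

lemma dim_projection:
  fixes w :: "nat \<Rightarrow> 'b::euclidean_space"
  assumes orth: "orthonormal k w"
  shows "dim (range (\<lambda>v. \<Sum>i<k. (w i \<bullet> v) *\<^sub>R w i)) = k"
proof -
  have w: "w i \<bullet> w j = (if i = j then 1 else 0)" if "i < k" "j < k" for i j
    using orth that by (simp add: orthonormal_def)
  define P where "P v = (\<Sum>i<k. (w i \<bullet> v) *\<^sub>R w i)" for v
  note pf = projection_facts[OF orth, folded P_def]
  define W where "W = range P"
  have sW: "subspace W" unfolding W_def using linear_subspace_image[OF pf(1) subspace_UNIV] .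
  have inj: "inj_on w {..<k}"
  proof (rule inj_onI)
    fix i j assume "i \<in> {..<k}" "j \<in> {..<k}" "w i = w j"
    then show "i = j" using w[of i j] w[of i i] by (auto split: if_splits)
  qed
  have Wspan: "W = span (w ` {..<k})"
  proof
    have "P v \<in> span (w ` {..<k})" for v
      unfolding P_def by (intro span_sum span_scale span_base imageI)
    then show "W \<subseteq> span (w ` {..<k})" unfolding W_def by (rule image_subsetI)
    have "w ` {..<k} \<subseteq> W"
    proof (rule image_subsetI)
      fix i assume "i \<in> {..<k}"
      then have "w i = P (w i)" using pf(2) by simp
      then show "w i \<in> W" unfolding W_def by (rule range_eqI)
    qed
    then show "span (w ` {..<k}) \<subseteq> W" using sW by (rule span_minimal)
  qed
  have "pairwise orthogonal (w ` {..<k})"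
  proof (rule pairwiseI)
    fix u v assume "u \<in> w ` {..<k}" "v \<in> w ` {..<k}" "u \<noteq> v"
    then obtain i j where "i < k" "j < k" "u = w i" "v = w j" "i \<noteq> j" by auto
    then show "orthogonal u v" using w by (simp add: orthogonal_def)
  qed
  moreover have "0 \<notin> w ` {..<k}"
  proof
    assume "0 \<in> w ` {..<k}"
    then obtain i where "i < k" "w i = 0" by auto
    then show False using w[of i i] by simp
  qed
  ultimately have "independent (w ` {..<k})" by (rule pairwise_orthogonal_independent)
  then have "dim (w ` {..<k}) = card (w ` {..<k})" by (rule dim_eq_card_independent)
  then have dW: "dim W = k"
    unfolding Wspan dim_span card_image[OF inj] by simp
  then show ?thesis unfolding W_def P_def .
qed

lemma orthonormal_expansion:
  fixes w :: "nat \<Rightarrow> 'b::euclidean_space"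
  assumes orth: "orthonormal k w" and k: "k = DIM('b)"
  shows "v = (\<Sum>i<k. (w i \<bullet> v) *\<^sub>R w i)"
proof -
  define P where "P v = (\<Sum>i<k. (w i \<bullet> v) *\<^sub>R w i)" for v
  note pf = projection_facts[OF orth, folded P_def]
  have "subspace (range P)" using linear_subspace_image[OF pf(1) subspace_UNIV] .
  moreover have "dim (range P) = DIM('b)" using dim_projection[OF orth] k unfolding P_def by simp
  ultimately have "range P = UNIV" by (metis dim_eq_full span_eq_iff)
  then obtain u where "v = P u" by blast
  then show ?thesis using pf(4)[of u] unfolding P_def by simp
qed

text \<open>Used to bring the rotation axis into standard position. Two linear isometries, one
  between the k-dimensional spaces and one between their complements, are glued along the orthogonal
  decomposition given by P.\<close>

lemma orthonormal_split:
  fixes w :: "nat \<Rightarrow> (real^'q) \<times> (real^'r)"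
  assumes orth: "orthonormal k w" and k: "CARD('r) = k"
  shows "\<exists>L :: (real^'q) \<times> (real^'r) \<Rightarrow> (real^'q) \<times> (real^'r). orthogonal_transformation L \<and>
    (\<forall>v. fst (L (\<Sum>i<k. (w i \<bullet> v) *\<^sub>R w i)) = 0) \<and>
    (\<forall>v. snd (L (v - (\<Sum>i<k. (w i \<bullet> v) *\<^sub>R w i))) = 0)"
proof -
  define P where "P v = (\<Sum>i<k. (w i \<bullet> v) *\<^sub>R w i)" for v
  have w: "w i \<bullet> w j = (if i = j then 1 else 0)" if "i < k" "j < k" for i j
    using orth that by (simp add: orthonormal_def)
  note pf = projection_facts[OF orth, folded P_def]
  define W where "W = range P"
  define W' where "W' = {v. P v = 0}"
  define T :: "((real^'q) \<times> (real^'r)) set" where "T = {v. fst v = 0}"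
  define T' :: "((real^'q) \<times> (real^'r)) set" where "T' = {v. snd v = 0}"
  have sW: "subspace W" unfolding W_def using linear_subspace_image[OF pf(1) subspace_UNIV] .
  have sW': "subspace W'" unfolding W'_def by (rule linear_subspace_kernel[OF pf(1)])
  have sT: "subspace T" "subspace T'" unfolding T_def T'_def subspace_def by auto
  have dW: "dim W = k" unfolding W_def P_def by (rule dim_projection[OF orth])
  have W'_perp: "W' = {y. \<forall>x\<in>W. orthogonal x y}"
  proof
    show "W' \<subseteq> {y. \<forall>x\<in>W. orthogonal x y}"
    proof
      fix y assume "y \<in> W'"
      then have "P u \<bullet> y = 0" for u using pf(5)[of u y] by (simp add: W'_def)
      then show "y \<in> {y. \<forall>x\<in>W. orthogonal x y}" by (auto simp: W_def orthogonal_def)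
    qed
    show "{y. \<forall>x\<in>W. orthogonal x y} \<subseteq> W'"
    proof
      fix y assume "y \<in> {y. \<forall>x\<in>W. orthogonal x y}"
      then have "P u \<bullet> y = 0" for u unfolding W_def orthogonal_def by blast
      then have "w i \<bullet> y = 0" if "i < k" for i
        using pf(2)[OF that] by metis
      then show "y \<in> W'" unfolding W'_def P_def by simp
    qed
  qed
  have dW': "dim W' = DIM((real^'q) \<times> (real^'r)) - k"
  proof -
    have "dim {y \<in> UNIV. \<forall>x\<in>W. orthogonal x y} + dim W = dim (UNIV :: ((real^'q) \<times> (real^'r)) set)"
      by (rule dim_subspace_orthogonal_to_vectors[OF sW subspace_UNIV]) simp
    then show ?thesis using dW unfolding W'_perp by simp
  qed
  have dT: "dim T = CARD('r)"
  proof -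
    have "T = (\<lambda>v. (0, v)) ` UNIV" unfolding T_def by (auto simp: image_iff)
    moreover have "dim ((\<lambda>v::real^'r. (0::real^'q, v)) ` UNIV) = dim (UNIV :: (real^'r) set)"
      by (rule dim_image_eq) (auto intro!: linearI injI inj_onI)
    ultimately show ?thesis by simp
  qed
  have dT': "dim T' = CARD('q)"
  proof -
    have "T' = (\<lambda>v. (v, 0)) ` UNIV" unfolding T'_def by (auto simp: image_iff)
    moreover have "dim ((\<lambda>v::real^'q. (v, 0::real^'r)) ` UNIV) = dim (UNIV :: (real^'q) set)"
      by (rule dim_image_eq) (auto intro!: linearI injI inj_onI)
    ultimately show ?thesis by simp
  qed
  obtain f1 where f1: "linear f1" "f1 ` W = T" "\<And>x. x \<in> W \<Longrightarrow> norm (f1 x) = norm x"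
    using isometries_subspaces[OF sW sT(1)] dW dT k by metis
  have "dim W' = dim T'" using dW' dT' k by simp
  then obtain f2 where f2: "linear f2" "f2 ` W' = T'" "\<And>x. x \<in> W' \<Longrightarrow> norm (f2 x) = norm x"
    using isometries_subspaces[OF sW' sT(2)] by metis
  define L where "L v = f1 (P v) + f2 (v - P v)" for v
  have inW: "P v \<in> W" "v - P v \<in> W'" for v
    by (simp_all add: W_def W'_def linear_diff[OF pf(1)] pf(4))
  have L1: "fst (f1 (P v)) = 0" and L2: "snd (f2 (v - P v)) = 0" for v
  proof -
    have "f1 (P v) \<in> T" "f2 (v - P v) \<in> T'" using imageI[OF inW(1), of f1] imageI[OF inW(2), of f2] f1(2) f2(2) by simp_all
    then show "fst (f1 (P v)) = 0" "snd (f2 (v - P v)) = 0" by (simp_all add: T_def T'_def)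
  qed
  have "linear L"
    unfolding L_def using f1(1) f2(1) pf(1)
    by (intro linearI) (simp_all add: linear_add linear_scale linear_diff algebra_simps)
  moreover have "norm (L v) = norm v" for v
  proof -
    have "f1 (P v) \<bullet> f2 (v - P v) = 0"
      using L1[of v] L2[of v] by (simp add: inner_prod_def)
    then have "(norm (L v))\<^sup>2 = (norm (P v))\<^sup>2 + (norm (v - P v))\<^sup>2"
      unfolding L_def using norm_add_Pythagorean[of "f1 (P v)" "f2 (v - P v)"] f1(3)[OF inW(1)] f2(3)[OF inW(2)]
      by (simp add: orthogonal_def)
    also have "\<dots> = (norm v)\<^sup>2"
      using norm_add_Pythagorean[of "P v" "v - P v"] pf(5)[of v v] by (simp add: orthogonal_def)
    finally show ?thesis by simp
  qed
  ultimately have ot: "orthogonal_transformation L" by (simp add: orthogonal_transformation)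
  have fs: "fst (L (P v)) = 0" "snd (L (v - P v)) = 0" for v
    using L1 L2 linear_0[OF f1(1)] linear_0[OF f2(1)] by (simp_all add: L_def pf(4) linear_diff[OF pf(1)])
  show ?thesis using ot fs unfolding P_def by (intro exI[of _ L] conjI allI)
qed

section \<open>Separating the leaf spheres from the profile surface\<close>

context umbilic_patch begin

text \<open>With the index m standing for \<psi>, this is an orthonormal basis of the direction
  space of the affine subspace spanned by the leaf.\<close>

definition leaf :: "nat \<Rightarrow> 'a \<Rightarrow> 'b" where "leaf i x = (if i < m then E i x else \<psi> x)"

lemma leaf_orthonormal: "x \<in> S \<Longrightarrow> orthonormal (m + 1) (\<lambda>i. leaf i x)"
  using orth[of x] \<psi>_T[of x] \<psi>_\<psi>[of x]
  by (auto simp: orthonormal_def leaf_def inner_commute less_Suc_eq)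

lemma sum_leaf: "(\<Sum>i<m + 1. f (leaf i x)) = (\<Sum>i<m. f (E i x)) + (f (\<psi> x) :: 'c::comm_monoid_add)"
  by (simp add: leaf_def)

lemma leaf_projection_eq:
  assumes "convex S" "x \<in> S" "x' \<in> S"
  shows "(\<Sum>i<m + 1. (leaf i x \<bullet> v) *\<^sub>R leaf i x) = (\<Sum>i<m + 1. (leaf i x' \<bullet> v) *\<^sub>R leaf i x')" (is "?l = ?r")
proof (rule vector_eq_rdot[THEN iffD1], rule allI)
  fix a
  have "(\<Sum>i<m + 1. (leaf i z \<bullet> v) *\<^sub>R leaf i z) \<bullet> a = (\<Sum>j<m. (E j z \<bullet> v) * (E j z \<bullet> a)) + (\<psi> z \<bullet> v) * (\<psi> z \<bullet> a)" for z
    using sum_leaf[of "\<lambda>l. (l \<bullet> v) *\<^sub>R l" z] by (simp add: inner_add_left inner_sum_left)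
  then show "?l \<bullet> a = ?r \<bullet> a" using leaf_projection_const[OF assms, of v a] by simp
qed

lemma leaf_projection_dh: "x \<in> S \<Longrightarrow> (\<Sum>i<m + 1. (leaf i x \<bullet> dd h x v) *\<^sub>R leaf i x) = 0"
  using dh_T[of x _ v] dh_\<psi>[of x v] by (intro sum.neutral ballI) (auto simp: leaf_def inner_commute)

text \<open>The projection is the same at all points and annihilates dh everywhere, so the centres
  stay in one affine subspace orthogonal to the leaves.\<close>

lemma leaf_projection_h:
  assumes "convex S" "x0 \<in> S" "x \<in> S"
  shows "(\<Sum>i<m + 1. (leaf i x0 \<bullet> (h x - h x0)) *\<^sub>R leaf i x0) = 0"
proof -
  define P where "P v = (\<Sum>i<m + 1. (leaf i x0 \<bullet> v) *\<^sub>R leaf i x0)" for v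
  have lin: "linear P" unfolding P_def by (rule projection_facts[OF leaf_orthonormal[OF assms(2)]])
  have D: "((\<lambda>z. P (h z)) has_derivative (\<lambda>v. 0)) (at z within S)" if z: "z \<in> S" for z
  proof -
    have "bounded_linear P" using lin by (simp add: linear_conv_bounded_linear)
    from bounded_linear.has_derivative[OF this has_derivative_at_withinI[OF has_derivative_dd[OF diff_h[OF z]]]]
    have "((\<lambda>z. P (h z)) has_derivative (\<lambda>v. P (dd h z v))) (at z within S)" .
    moreover have "P (dd h z v) = 0" for v
      unfolding P_def leaf_projection_eq[OF assms(1,2) z] by (rule leaf_projection_dh[OF z])
    ultimately show ?thesis by simp
  qed
  have "\<exists>c. \<forall>z\<in>S. P (h z) = c" by (rule has_derivative_zero_constant[OF assms(1) D])
  then have "P (h x) = P (h x0)" using assms by metis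
  then have "P (h x - h x0) = 0" by (simp add: linear_diff[OF lin])
  then show ?thesis unfolding P_def .
qed

end

text \<open>T moves the centre \<open>h x0\<close> to the origin and the leaf space onto the second
  factor; k is the displaced centre, y the outward normal \<psi> and Y the leaf frame, all read in
  these coordinates. The lemma stands outside the locale because its ambient space is specialised to
  a product.\<close>

lemma leaf_split:
  fixes F :: "'a::euclidean_space \<Rightarrow> (real^'q) \<times> (real^'r)"
  assumes "umbilic_patch S F \<xi> E \<eta> m \<rho>" and cvx: "convex S" "x0 \<in> S" and r: "CARD('r) = m + 1"
  obtains T k y and Y :: "nat \<Rightarrow> 'a \<Rightarrow> real^'r" where "rigid_motion T" "smooth_on S k" "smooth_on S y"
    "\<And>j. j < m \<Longrightarrow> smooth_on S (Y j)"
    "\<And>x. x \<in> S \<Longrightarrow> T (F x) = (k x, umbilic_patch.\<phi> \<xi> E \<eta> m \<rho> x *\<^sub>R y x)"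
    "\<And>x. x \<in> S \<Longrightarrow> y x \<bullet> y x = 1"
    "\<And>x i j. x \<in> S \<Longrightarrow> i < m \<Longrightarrow> j < m \<Longrightarrow> Y i x \<bullet> Y j x = (if i = j then 1 else 0)"
    "\<And>x w. x \<in> S \<Longrightarrow> w = (\<Sum>j<m. (Y j x \<bullet> w) *\<^sub>R Y j x) + (y x \<bullet> w) *\<^sub>R y x"
    "\<And>x v. x \<in> S \<Longrightarrow> dd y x v = (1 / umbilic_patch.\<phi> \<xi> E \<eta> m \<rho> x) *\<^sub>R (\<Sum>j<m. (E j x \<bullet> dd F x v) *\<^sub>R Y j x)"
    "\<And>x v w. x \<in> S \<Longrightarrow> dd k x v \<bullet> dd k x w = dd (umbilic_patch.h F \<xi> E \<eta> m \<rho>) x v \<bullet> dd (umbilic_patch.h F \<xi> E \<eta> m \<rho>) x w"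
proof -
  interpret umbilic_patch S F \<xi> E \<eta> m \<rho> by fact
  note oS = umbilic_patch.S[OF assms(1)]
  define P where "P v = (\<Sum>i<m + 1. (leaf i x0 \<bullet> v) *\<^sub>R leaf i x0)" for v
  obtain L :: "(real^'q) \<times> (real^'r) \<Rightarrow> (real^'q) \<times> (real^'r)" where L0: "orthogonal_transformation L \<and> (\<forall>v. fst (L (P v)) = 0) \<and> (\<forall>v. snd (L (v - P v)) = 0)"
    using orthonormal_split[OF leaf_orthonormal[OF cvx(2)] r] unfolding P_def by (rule exE)
  then have L: "orthogonal_transformation L" "\<And>v. fst (L (P v)) = 0" "\<And>v. snd (L (v - P v)) = 0" by blast+
  have linL: "linear L" using L(1) by (rule orthogonal_transformation_linear)
  have blL: "bounded_linear L" using linL by (simp add: linear_conv_bounded_linear)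
  have LL: "L u \<bullet> L v = u \<bullet> v" for u v using L(1) unfolding orthogonal_transformation_def by blast
  have Pleaf: "P (leaf i x) = leaf i x" if x: "x \<in> S" and i: "i < m + 1" for i x
    using projection_facts(2)[OF leaf_orthonormal[OF x] i] leaf_projection_eq[OF cvx(1) x cvx(2), of "leaf i x"]
    unfolding P_def by simp
  have fleaf: "fst (L (leaf i x)) = 0" if "x \<in> S" "i < m + 1" for i x
    using L(2)[of "leaf i x"] Pleaf[OF that] by simp
  define T where "T v = - L (h x0) + L v" for v
  define k where "k x = fst (L (h x - h x0))" for x
  define y where "y x = snd (L (\<psi> x))" for x
  define Y where "Y j x = snd (L (E j x))" for j x
  have sndin: "snd (L u) \<bullet> snd (L v) = u \<bullet> v" if "fst (L u) = 0" for u v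
    using LL[of u v] that by (simp add: inner_prod_def)
  have f\<psi>: "fst (L (\<psi> x)) = 0" if "x \<in> S" for x using fleaf[OF that, of m] by (simp add: leaf_def)
  have fE: "fst (L (E j x)) = 0" if "x \<in> S" "j < m" for x j using fleaf[OF that(1), of j] that(2) by (simp add: leaf_def)
  have sh: "snd (L (h x - h x0)) = 0" if "x \<in> S" for x
    using L(3)[of "h x - h x0"] leaf_projection_h[OF cvx that] by (simp add: P_def)
  have D: "((\<lambda>x. L (h x - h x0)) has_derivative (\<lambda>v. L (dd h x v))) (at x)" if "x \<in> S" for x
    by (rule bounded_linear.has_derivative[OF blL]) (auto intro!: derivative_eq_intros has_derivative_dd diff_h that)
  have ddk: "dd k x v = fst (L (dd h x v))" if "x \<in> S" for x v
    unfolding k_def by (rule dd_eq) (rule has_derivative_fst[OF D[OF that]])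
  have ddy: "dd y x v = snd (L (dd \<psi> x v))" if "x \<in> S" for x v
    unfolding y_def by (rule dd_eq) (intro has_derivative_snd bounded_linear.has_derivative[OF blL] has_derivative_dd diff_\<psi> that)
  have sdh: "snd (L (dd h x v)) = 0" if x: "x \<in> S" for x v
    using L(3)[of "dd h x v"] leaf_projection_dh[OF x, of v] leaf_projection_eq[OF cvx(1) x cvx(2), of "dd h x v"] by (simp add: P_def)
  show ?thesis
  proof (rule that[of T k y Y])
    show "rigid_motion T" unfolding rigid_motion_def T_def using L(1) by blast
    show "smooth_on S k" unfolding k_def
      by (intro smooth_on_linear_compose[OF oS bounded_linear_fst] smooth_on_linear_compose[OF oS blL] smooth_on_diff oS smooth_h smooth_on_const)
    show "smooth_on S y" unfolding y_def
      by (intro smooth_on_linear_compose[OF oS bounded_linear_snd] smooth_on_linear_compose[OF oS blL] smooth_\<psi>)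
    show "smooth_on S (Y j)" if "j < m" for j unfolding Y_def
      by (intro smooth_on_linear_compose[OF oS bounded_linear_snd] smooth_on_linear_compose[OF oS blL] E) (use that in simp)
    show "T (F x) = (k x, \<phi> x *\<^sub>R y x)" if x: "x \<in> S" for x
    proof -
      have "T (F x) = L (h x - h x0) + \<phi> x *\<^sub>R L (\<psi> x)"
        by (simp add: T_def h_def linear_add[OF linL] linear_diff[OF linL] linear_scale[OF linL])
      then show ?thesis using sh[OF x] f\<psi>[OF x]
        by (simp add: prod_eq_iff k_def y_def)
    qed
    show "y x \<bullet> y x = 1" if "x \<in> S" for x
      unfolding y_def using sndin[OF f\<psi>[OF that]] \<psi>_\<psi>[OF that] by simp
    show "Y i x \<bullet> Y j x = (if i = j then 1 else 0)" if "x \<in> S" "i < m" "j < m" for x i j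
      unfolding Y_def using sndin[OF fE[OF that(1,2)]] orth[OF that(1), of i j] that by simp
    show "w = (\<Sum>j<m. (Y j x \<bullet> w) *\<^sub>R Y j x) + (y x \<bullet> w) *\<^sub>R y x" if x: "x \<in> S" for x w
    proof -
      define l where "l i = snd (L (leaf i x))" for i
      have "orthonormal (m + 1) l"
        using leaf_orthonormal[OF x] sndin[OF fleaf[OF x]] by (simp add: orthonormal_def l_def)
      then have "w = (\<Sum>i<m + 1. (l i \<bullet> w) *\<^sub>R l i)" by (rule orthonormal_expansion) (simp add: r)
      then show ?thesis by (simp add: l_def leaf_def Y_def y_def)
    qed
    show "dd y x v = (1 / \<phi> x) *\<^sub>R (\<Sum>j<m. (E j x \<bullet> dd F x v) *\<^sub>R Y j x)" if x: "x \<in> S" for x v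
      unfolding ddy[OF x] d\<psi>[OF x] Y_def
      by (simp add: linear_scale[OF linL] linear_sum[OF linL] snd_sum)
    show "dd k x v \<bullet> dd k x w = dd h x v \<bullet> dd h x w" if x: "x \<in> S" for x v w
      using LL[of "dd h x v" "dd h x w"] sdh[OF x] unfolding ddk[OF x] by (simp add: inner_prod_def)
  qed
qed

text \<open>The inhomogeneous equation du = \<alpha> becomes a homogeneous linear system by adding a
  second unknown with zero derivative and initial value 1. Closedness of \<alpha> is flatness of
  that system.\<close>

lemma closed_form_potential:
  fixes \<alpha> :: "'a::euclidean_space \<Rightarrow> 'a \<Rightarrow> real"
  assumes S: "open S" "x0 \<in> S" and sm: "\<And>v. smooth_on S (\<lambda>x. \<alpha> x v)"
    and lin: "\<And>x. x \<in> S \<Longrightarrow> linear (\<alpha> x)"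
    and closed: "\<And>x v w. x \<in> S \<Longrightarrow> dd (\<lambda>x. \<alpha> x w) x v = dd (\<lambda>x. \<alpha> x v) x w"
  obtains r u where "r > 0" "ball x0 r \<subseteq> S" "smooth_on (ball x0 r) u"
    "\<And>x. x \<in> ball x0 r \<Longrightarrow> (u has_derivative \<alpha> x) (at x)"
proof -
  define \<Omega> where "\<Omega> x v y = (snd y * \<alpha> x v, 0::real)" for x v and y :: "real \<times> real"
  have d\<Omega>: "dd (\<lambda>x. \<Omega> x w y) x v = (snd y * dd (\<lambda>x. \<alpha> x w) x v, 0)" if "x \<in> S" for x v w y
    unfolding \<Omega>_def
    by (rule dd_eq) (intro has_derivative_Pair has_derivative_mult_right has_derivative_const smooth_on_has_derivative[OF sm that])
  have 1: "smooth_on S (\<lambda>x. \<Omega> x v y)" for v y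
    unfolding \<Omega>_def by (intro smooth_on_Pair smooth_on_mult smooth_on_const S sm)
  have 2: "linear (\<lambda>v. \<Omega> x v y)" if "x \<in> S" for x y
    unfolding \<Omega>_def using lin[OF that] by (intro linearI) (simp_all add: linear_add linear_scale algebra_simps)
  have 3: "linear (\<Omega> x v)" if "x \<in> S" for x v
    unfolding \<Omega>_def by (intro linearI) (simp_all add: algebra_simps)
  have 4: "dd (\<lambda>x. \<Omega> x w y) x v + \<Omega> x w (\<Omega> x v y) = dd (\<lambda>x. \<Omega> x v y) x w + \<Omega> x v (\<Omega> x w y)" if "x \<in> S" for x v w y
    unfolding d\<Omega>[OF that] closed[OF that, of w v] by (simp add: \<Omega>_def)
  obtain r Y where r: "r > 0" "ball x0 r \<subseteq> S" "Y x0 = (0, 1)" "smooth_on (ball x0 r) Y"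
    "\<And>x. x \<in> ball x0 r \<Longrightarrow> (Y has_derivative (\<lambda>v. \<Omega> x v (Y x))) (at x)"
    by (rule flat_linear_system[OF S 1 2 3 4, where ?y0.0 = "(0, 1)"]) (assumption | rule that)+
  have "((\<lambda>x. snd (Y x)) has_derivative (\<lambda>v. 0)) (at x within ball x0 r)" if "x \<in> ball x0 r" for x
    using has_derivative_snd[OF r(5)[OF that]] by (simp add: \<Omega>_def has_derivative_at_withinI)
  then have "\<exists>c. \<forall>x\<in>ball x0 r. snd (Y x) = c" by (intro has_derivative_zero_constant convex_ball)
  then have s1: "snd (Y x) = 1" if "x \<in> ball x0 r" for x using r(1,3) that by (metis centre_in_ball snd_conv)
  have D: "((\<lambda>x. fst (Y x)) has_derivative \<alpha> x) (at x)" if "x \<in> ball x0 r" for x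
    using has_derivative_fst[OF r(5)[OF that]] s1[OF that] by (simp add: \<Omega>_def)
  have "smooth_on (ball x0 r) (\<lambda>x. fst (Y x))"
    by (rule smooth_on_linear_compose[OF open_ball bounded_linear_fst r(4)])
  then show ?thesis using that[OF r(1,2) _ D] by blast
qed

text \<open>The solution is the inverse of a primitive of \<open>1 / sqrt f\<close>.\<close>

lemma autonomous_solution:
  fixes f :: "real \<Rightarrow> real"
  assumes J: "open J" "s0 \<in> J" and f: "smooth_on J f" "\<And>s. s \<in> J \<Longrightarrow> f s > 0"
  obtains d \<tau> p where "d > 0" "ball s0 d \<subseteq> J" "smooth_on (ball s0 d) \<tau>"
    "\<And>s. s \<in> ball s0 d \<Longrightarrow> (\<tau> has_derivative (\<lambda>w. w / sqrt (f s))) (at s)"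
    "open (\<tau> ` ball s0 d)" "is_interval (\<tau> ` ball s0 d)" "smooth_on (\<tau> ` ball s0 d) p"
    "\<And>s. s \<in> ball s0 d \<Longrightarrow> p (\<tau> s) = s"
    "\<And>s. s \<in> ball s0 d \<Longrightarrow> deriv p (\<tau> s) = sqrt (f s)"
proof -
  obtain e where e: "e > 0" "cball s0 e \<subseteq> J" using J open_contains_cball by blast
  define q where "q s = inverse (sqrt (f s))" for s
  have q: "smooth_on J q"
    unfolding q_def using f J by (intro smooth_on_inverse smooth_on_sqrt) force+
  have "continuous_on {s0 - e..s0 + e} q"
    using continuous_on_subset[OF smooth_on_continuous_on[OF q] e(2)] by (simp add: cball_eq_atLeastAtMost)
  then obtain \<tau> where \<tau>: "\<And>x. x \<in> {s0 - e..s0 + e} \<Longrightarrow> (\<tau> has_vector_derivative q x) (at x within {s0 - e..s0 + e})"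
    using antiderivative_continuous[of "s0 - e" "s0 + e" q] by blast
  have D: "(\<tau> has_derivative (\<lambda>w. w * q s)) (at s)" if s: "s \<in> ball s0 e" for s
  proof -
    have i: "s \<in> interior {s0 - e..s0 + e}" using s by (simp add: ball_eq_greaterThanLessThan)
    have "(\<tau> has_vector_derivative q s) (at s)"
      using \<tau>[OF subsetD[OF interior_subset i]] unfolding at_within_interior[OF i] .
    then show ?thesis by (simp add: has_vector_derivative_def)
  qed
  have sub: "ball s0 e \<subseteq> J" using e(2) ball_subset_cball by blast
  have sm\<tau>: "smooth_on (ball s0 e) \<tau>"
    by (rule smooth_onI_deriv[OF open_ball D], assumption, intro smooth_on_mult open_ball smooth_on_const smooth_on_subset[OF q sub])
  have ddt: "dd \<tau> s w = w * q s" if "s \<in> ball s0 e" for s w by (rule dd_eq[OF D[OF that]])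
  have fq: "sqrt (f s) * q s = 1" if "s \<in> J" for s using f(2)[OF that] by (simp add: q_def)
  have L1: "smooth_on (ball s0 e) (\<lambda>s. w * sqrt (f s))" for w
    using f(2) sub by (intro smooth_on_mult open_ball smooth_on_const smooth_on_sqrt smooth_on_subset[OF f(1) sub]) auto
  have L2: "dd \<tau> s (w * sqrt (f s)) = w" if s: "s \<in> ball s0 e" for s w
    using ddt[OF s, of "w * sqrt (f s)"] fq[OF subsetD[OF sub s]] by (simp add: mult.assoc)
  obtain d p where d: "d > 0" "ball s0 d \<subseteq> ball s0 e" "open (\<tau> ` ball s0 d)"
    "homeomorphism (ball s0 d) (\<tau> ` ball s0 d) \<tau> p" "smooth_on (\<tau> ` ball s0 d) p"
    "\<And>s. s \<in> ball s0 d \<Longrightarrow> (p has_derivative (\<lambda>w. w * sqrt (f s))) (at (\<tau> s))"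
    by (rule smooth_local_inverse[where L = "\<lambda>s w. w * sqrt (f s)", OF open_ball _ sm\<tau> L1 L2 refl, of s0])
      (use e(1) in simp, assumption?, (assumption | rule that)+)
  have "connected (\<tau> ` ball s0 d)"
    using homeomorphism_cont1[OF d(4)] by (intro connected_continuous_image) auto
  then have int: "is_interval (\<tau> ` ball s0 d)" by (simp add: is_interval_connected_1)
  have dp: "deriv p (\<tau> s) = sqrt (f s)" if "s \<in> ball s0 d" for s
    using d(6)[OF that] by (intro DERIV_imp_deriv) (simp add: has_field_derivative_def mult_commute_abs)
  show ?thesis
  proof (rule that[OF d(1) _ _ _ d(3) int d(5) _ dp])
    show "ball s0 d \<subseteq> J" using d(2) sub by blast
    show "smooth_on (ball s0 d) \<tau>" by (rule smooth_on_subset[OF sm\<tau> d(2)])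
    show "(\<tau> has_derivative (\<lambda>w. w / sqrt (f s))) (at s)" if "s \<in> ball s0 d" for s
      using D[of s] d(2) that by (auto simp: q_def divide_inverse)
    show "p (\<tau> s) = s" if "s \<in> ball s0 d" for s by (rule homeomorphism_apply1[OF d(4) that])
  qed
qed

section \<open>From one chart to the manifold\<close>

lemma param_coords:
  assumes "smooth_atlas A" "c \<in> A"
  shows "x \<in> fst c \<Longrightarrow> param c (snd c x) = x" "x \<in> fst c \<Longrightarrow> snd c x \<in> coords c UNIV"
    "z \<in> coords c UNIV \<Longrightarrow> snd c (param c z) = z" "z \<in> coords c UNIV \<Longrightarrow> param c z \<in> fst c"
    "open (fst c)" "open (coords c UNIV)" "homeomorphism (fst c) (coords c UNIV) (snd c) (param c)"
proof -
  have h: "homeomorphism (fst c) (coords c UNIV) (snd c) (param c)" "open (fst c)" "open (coords c UNIV)"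
    using assms unfolding smooth_atlas_def by blast+
  then show "homeomorphism (fst c) (coords c UNIV) (snd c) (param c)" "open (fst c)" "open (coords c UNIV)" by blast+
  show "x \<in> fst c \<Longrightarrow> param c (snd c x) = x" "z \<in> coords c UNIV \<Longrightarrow> snd c (param c z) = z"
    using h(1) unfolding homeomorphism_def by blast+
  show "x \<in> fst c \<Longrightarrow> snd c x \<in> coords c UNIV" by (auto simp: coords_def)
  show "z \<in> coords c UNIV \<Longrightarrow> param c z \<in> fst c"
    using homeomorphism_image2[OF h(1)] by blast
qed

lemma open_coords:
  assumes "smooth_atlas A" "c \<in> A" "open V"
  shows "open (coords c V)"
proof -
  have "openin (top_of_set (fst c)) (fst c \<inter> V)" using assms(3) by (simp add: openin_open_Int)
  then have "openin (top_of_set (coords c UNIV)) (snd c ` (fst c \<inter> V))"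
    using homeomorphism_imp_open_map[OF param_coords(7)[OF assms(1,2)]] by blast
  then show ?thesis
    unfolding coords_def[of c V] using openin_open_trans param_coords(6)[OF assms(1,2)] by blast
qed

text \<open>\<open>isometric_map_on\<close> speaks of every chart. In another chart d the map is
  \<Theta> after a change of coordinates, which is an isometry by \<open>riemannian_metric\<close>,
  so the pullback is the metric of d.\<close>

lemma chart_isometry:
  fixes A :: "('m::topological_space, 'a::euclidean_space) chart set" and \<Theta> :: "'a \<Rightarrow> 'b::euclidean_space"
  assumes A: "smooth_atlas A" and g: "riemannian_metric A g" and c: "c \<in> A"
    and V: "open V" "V \<subseteq> coords c UNIV"
    and hom: "homeomorphism V P \<Theta> \<Psi>" and iso: "isometric_on V (g c) \<Theta> H"
  shows "open (param c ` V)" "isometry_onto A g (param c ` V) (\<Theta> \<circ> snd c) P H"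
proof -
  note pc = param_coords[OF A c]
  let ?V = "param c ` V"
  have "openin (top_of_set (coords c UNIV)) V" by (rule open_subset[OF V(2,1)])
  then have "openin (top_of_set (fst c)) ?V"
    using homeomorphism_imp_open_map[OF homeomorphism_symD[OF pc(7)]] by blast
  then show oV: "open ?V" using openin_open_trans pc(5) by blast
  have Vc: "?V \<subseteq> fst c" using pc(4) V(2) by blast
  have "homeomorphism ?V V (snd c) (param c)"
  proof (rule homeomorphism_of_subsets[OF pc(7) Vc V(2)])
    show "snd c ` ?V = V" using pc(3) V(2) by (force simp: image_iff)
  qed
  then have h: "homeomorphism ?V P (\<Theta> \<circ> snd c) (param c \<circ> \<Psi>)" by (rule homeomorphism_compose[OF _ hom])
  have "isometric_on (coords d ?V) (g d) (\<Theta> \<circ> snd c \<circ> param d) H" if d: "d \<in> A" for d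
  proof -
    note pd = param_coords[OF A d]
    have od: "open (coords d ?V)" by (rule open_coords[OF A d oV])
    have sub: "coords d ?V \<subseteq> coords d (fst c)" using Vc by (auto simp: coords_def)
    let ?k = "snd c \<circ> param d"
    have k: "isometric_on (coords d (fst c)) (g d) ?k (g c)"
      using g c d unfolding riemannian_metric_def by blast
    then have smk: "smooth_on (coords d ?V) ?k"
      unfolding isometric_on_def using smooth_on_subset sub by blast
    have kV: "?k z \<in> V" if "z \<in> coords d ?V" for z
    proof -
      obtain x where x: "x \<in> fst d" "x \<in> ?V" "z = snd d x" using \<open>z \<in> coords d ?V\<close> by (auto simp: coords_def)
      then show ?thesis using pd(1)[OF x(1)] pc(3) V(2) by auto
    qed
    have smT: "smooth_on V \<Theta>" using iso unfolding isometric_on_def by blast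
    have sm: "smooth_on (coords d ?V) (\<lambda>z. \<Theta> (?k z))"
      by (rule smooth_on_compose[OF od V(1) _ smT smk]) (use kV in blast)
    show ?thesis unfolding isometric_on_def
    proof (intro conjI ballI allI)
      show "smooth_on (coords d ?V) (\<Theta> \<circ> snd c \<circ> param d)" using sm by (simp add: o_def)
      fix z v w assume z: "z \<in> coords d ?V"
      have "((\<lambda>z. \<Theta> (?k z)) has_derivative (\<lambda>v. dd \<Theta> (?k z) (dd ?k z v))) (at z)"
        by (rule has_derivative_compose[of ?k "dd ?k z" z UNIV \<Theta> "dd \<Theta> (?k z)",
              OF smooth_on_has_derivative[OF smk z] smooth_on_has_derivative[OF smT kV[OF z]]])
      then have D: "dd (\<Theta> \<circ> snd c \<circ> param d) z v = dd \<Theta> (?k z) (dd ?k z v)" for v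
        using dd_eq[of "\<lambda>z. \<Theta> (?k z)"] by (simp add: o_def)
      have "H (\<Theta> (?k z)) (dd \<Theta> (?k z) (dd ?k z v)) (dd \<Theta> (?k z) (dd ?k z w)) = g c (?k z) (dd ?k z v) (dd ?k z w)"
        using iso kV[OF z] unfolding isometric_on_def by blast
      also have "\<dots> = g d z v w"
        using k z sub unfolding isometric_on_def by blast
      finally show "H ((\<Theta> \<circ> snd c \<circ> param d) z) (dd (\<Theta> \<circ> snd c \<circ> param d) z v) (dd (\<Theta> \<circ> snd c \<circ> param d) z w) = g d z v w"
        unfolding D by simp
    qed
  qed
  then show "isometry_onto A g ?V (\<Theta> \<circ> snd c) P H"
    unfolding isometry_onto_def isometric_map_on_def using h by blast
qed

lemma smooth_on_fst_compose:
  fixes q :: "'a::euclidean_space \<Rightarrow> 'b::euclidean_space"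
  assumes "open S" "open (T :: 'c::euclidean_space set)" "smooth_on S q"
  shows "smooth_on (S \<times> T) (\<lambda>z. q (fst z))"
  by (rule smooth_on_compose[OF open_Times[OF assms(1,2)] assms(1) _ assms(3) smooth_on_bounded_linear[OF bounded_linear_fst]]) auto

lemma dd_fst_compose:
  fixes q :: "'a::euclidean_space \<Rightarrow> 'b::euclidean_space" and z :: "'a \<times> 'c::euclidean_space"
  assumes "q differentiable (at (fst z))"
  shows "((\<lambda>z. q (fst z)) has_derivative (\<lambda>v. dd q (fst z) (fst v))) (at z)"
  by (rule has_derivative_compose[of fst fst z UNIV q, OF _ has_derivative_dd[OF assms]])
    (auto intro!: derivative_eq_intros)

section \<open>Polar coordinates on the profile surface and the rotational model\<close>

context umbilic_patch begin

definition grad\<phi>_sq :: "'a \<Rightarrow> real" where "grad\<phi>_sq x = (D\<phi> m x)\<^sup>2 + (D\<phi> (m + 1) x)\<^sup>2"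

text \<open>The form obtained from d\<phi> by a quarter turn, divided by the squared length of the
  gradient. Its potential is the coordinate u.\<close>

definition \<upsilon> :: "'a \<Rightarrow> 'a \<Rightarrow> real" where
  "\<upsilon> x v = (D\<phi> m x * \<epsilon> (m + 1) x v - D\<phi> (m + 1) x * \<epsilon> m x v) / grad\<phi>_sq x"

lemma smooth_grad\<phi>_sq: "smooth_on S grad\<phi>_sq"
  unfolding grad\<phi>_sq_def by (intro smooth_on_add smooth_on_power S smooth_D\<phi>) auto

lemma linear_\<epsilon>: "x \<in> S \<Longrightarrow> linear (\<epsilon> i x)"
  using linear_dF[of x] by (intro linearI) (simp_all add: linear_add linear_scale inner_add_right)

lemma linear_\<upsilon>: "x \<in> S \<Longrightarrow> linear (\<upsilon> x)"
  unfolding \<upsilon>_def using linear_dF[of x]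
  by (intro linearI) (simp_all add: linear_add linear_scale inner_add_right add_divide_distrib[symmetric] algebra_simps)

lemma smooth_\<upsilon>:
  assumes "open S'" "S' \<subseteq> S" "\<And>x. x \<in> S' \<Longrightarrow> grad\<phi>_sq x > 0"
  shows "smooth_on S' (\<lambda>x. \<upsilon> x v)"
  unfolding \<upsilon>_def
  by (intro smooth_on_divide smooth_on_diff smooth_on_mult assms(1) smooth_on_subset[OF smooth_D\<phi> assms(2)]
      smooth_on_subset[OF smooth_\<epsilon> assms(2)] smooth_on_subset[OF smooth_grad\<phi>_sq assms(2)]) (use assms(3) in fastforce)+

text \<open>By the Hessian equation the numerator n has exterior derivative - 2 * \<mu> * \<phi>
  times the area form, while the denominator has differential - 2 * \<mu> * \<phi> times d\<phi>.
  The wedge of d\<phi> with n is the denominator times the area form, so the two contributions to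
  the quotient rule cancel.\<close>

lemma \<upsilon>_closed:
  assumes x: "x \<in> S" and pos: "grad\<phi>_sq x > 0"
  shows "dd (\<lambda>x. \<upsilon> x w) x v = dd (\<lambda>x. \<upsilon> x v) x w"
proof -
  define a where "a = D\<phi> m x" define b where "b = D\<phi> (m + 1) x"
  define k where "k = \<phi> x * \<mu> x"
  define n where "n w z = D\<phi> m z * \<epsilon> (m + 1) z w - D\<phi> (m + 1) z * \<epsilon> m z w" for w z
  have m2: "m < m + 2" "m + 1 < m + 2" by auto
  note DD = smooth_on_has_derivative[OF smooth_D\<phi> x]
  note De = smooth_on_has_derivative[OF smooth_\<epsilon> x]
  have Dn: "(n w has_derivative (\<lambda>v. (D\<phi> m x * dd (\<lambda>z. \<epsilon> (m + 1) z w) x v + dd (D\<phi> m) x v * \<epsilon> (m + 1) x w)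
      - (D\<phi> (m + 1) x * dd (\<lambda>z. \<epsilon> m z w) x v + dd (D\<phi> (m + 1)) x v * \<epsilon> m x w))) (at x)" for w
    unfolding n_def by (intro has_derivative_diff has_derivative_mult DD De m2)
  have Dg: "(grad\<phi>_sq has_derivative (\<lambda>v. - 2 * k * (a * \<epsilon> m x v + b * \<epsilon> (m + 1) x v))) (at x)"
  proof -
    have "(grad\<phi>_sq has_derivative (\<lambda>v. real 2 * dd (D\<phi> m) x v * D\<phi> m x ^ (2 - 1) + real 2 * dd (D\<phi> (m + 1)) x v * D\<phi> (m + 1) x ^ (2 - 1))) (at x)"
      unfolding grad\<phi>_sq_def by (intro has_derivative_add has_derivative_power DD m2)
    moreover have "real 2 * dd (D\<phi> m) x v * D\<phi> m x ^ (2 - 1) + real 2 * dd (D\<phi> (m + 1)) x v * D\<phi> (m + 1) x ^ (2 - 1)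
       = - 2 * k * (a * \<epsilon> m x v + b * \<epsilon> (m + 1) x v)" for v
      unfolding dD\<phi>[OF x] a_def b_def k_def by (simp add: algebra_simps)
    ultimately show ?thesis by simp
  qed
  have nz: "grad\<phi>_sq x \<noteq> 0" using pos by simp
  have Q: "dd (\<lambda>x. \<upsilon> x w) x v = (dd (n w) x v * grad\<phi>_sq x - n w x * (- 2 * k * (a * \<epsilon> m x v + b * \<epsilon> (m + 1) x v))) / (grad\<phi>_sq x * grad\<phi>_sq x)" for v w
  proof -
    have "((\<lambda>x. n w x / grad\<phi>_sq x) has_derivative (\<lambda>v. (dd (n w) x v * grad\<phi>_sq x - n w x * (- 2 * k * (a * \<epsilon> m x v + b * \<epsilon> (m + 1) x v))) / (grad\<phi>_sq x * grad\<phi>_sq x))) (at x)"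
      by (rule has_derivative_divide'[OF has_derivative_dd[OF differentiableI[OF Dn]] Dg nz])
    then show ?thesis unfolding \<upsilon>_def n_def[symmetric] by (rule dd_eq)
  qed
  have dn: "dd (n w) x v - dd (n v) x w = - 2 * k * (\<epsilon> m x v * \<epsilon> (m + 1) x w - \<epsilon> m x w * \<epsilon> (m + 1) x v)" 
  proof -
    have e0: "dd (\<lambda>z. \<epsilon> m z w) x v = dd (\<lambda>z. \<epsilon> m z v) x w + (\<omega> x v * \<epsilon> (m + 1) x w - \<omega> x w * \<epsilon> (m + 1) x v)"
      using d\<epsilon>(1)[OF x, of w v] by linarith
    have e1: "dd (\<lambda>z. \<epsilon> (m + 1) z w) x v = dd (\<lambda>z. \<epsilon> (m + 1) z v) x w - (\<omega> x v * \<epsilon> m x w - \<omega> x w * \<epsilon> m x v)"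
      using d\<epsilon>(2)[OF x, of w v] by linarith
    show ?thesis unfolding dd_eq[OF Dn] dD\<phi>[OF x] e0 e1 k_def by (simp add: algebra_simps)
  qed
  have n': "n w x = a * \<epsilon> (m + 1) x w - b * \<epsilon> m x w" for w by (simp add: n_def a_def b_def)
  have g: "grad\<phi>_sq x = a\<^sup>2 + b\<^sup>2" by (simp add: grad\<phi>_sq_def a_def b_def)
  have dn': "dd (n w) x v = dd (n v) x w - 2 * k * (\<epsilon> m x v * \<epsilon> (m + 1) x w - \<epsilon> m x w * \<epsilon> (m + 1) x v)"
    using dn by simp
  show ?thesis unfolding Q dn' n' by (rule arg_cong[of _ _ "\<lambda>t. t / _"]) (simp add: g power2_eq_square algebra_simps)
qed

text \<open>d\<phi> divided by the length of the gradient, and \<upsilon> multiplied by it, form the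
  orthonormal coframe obtained by rotating \<open>\<epsilon> m\<close> and
  \<open>\<epsilon> (m + 1)\<close> towards the gradient.\<close>

lemma polar_metric:
  assumes x: "x \<in> S" and pos: "grad\<phi>_sq x > 0"
  shows "dd \<phi> x v * dd \<phi> x w / grad\<phi>_sq x + grad\<phi>_sq x * (\<upsilon> x v * \<upsilon> x w) = \<epsilon> m x v * \<epsilon> m x w + \<epsilon> (m + 1) x v * \<epsilon> (m + 1) x w"
proof -
  have "grad\<phi>_sq x * (\<upsilon> x v * \<upsilon> x w) = (D\<phi> m x * \<epsilon> (m + 1) x v - D\<phi> (m + 1) x * \<epsilon> m x v) * (D\<phi> m x * \<epsilon> (m + 1) x w - D\<phi> (m + 1) x * \<epsilon> m x w) / grad\<phi>_sq x"
    using pos by (simp add: \<upsilon>_def)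
  moreover have "dd \<phi> x v * dd \<phi> x w + (D\<phi> m x * \<epsilon> (m + 1) x v - D\<phi> (m + 1) x * \<epsilon> m x v) * (D\<phi> m x * \<epsilon> (m + 1) x w - D\<phi> (m + 1) x * \<epsilon> m x w)
     = (\<epsilon> m x v * \<epsilon> m x w + \<epsilon> (m + 1) x v * \<epsilon> (m + 1) x w) * grad\<phi>_sq x"
    by (simp add: d\<phi>[OF x] grad\<phi>_sq_def power2_eq_square algebra_simps)
  ultimately show ?thesis using pos by (simp add: add_divide_distrib[symmetric])
qed

lemma \<epsilon>_frame_sum:
  assumes x: "x \<in> S" and k: "k < m + 2"
  shows "\<epsilon> k x (\<Sum>i<m+2. b i *\<^sub>R \<xi> i x) = b k"
proof -
  have "\<epsilon> k x (\<Sum>i<m+2. b i *\<^sub>R \<xi> i x) = (\<Sum>i<m+2. b i * \<epsilon> k x (\<xi> i x))"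
    by (simp only: linear_sum[OF linear_\<epsilon>[OF x]] linear_scale[OF linear_\<epsilon>[OF x]] real_scaleR_def)
  also have "\<dots> = (\<Sum>i<m+2. if i = k then b i else 0)"
    by (intro sum.cong refl) (use \<epsilon>_\<xi>[OF x k] in auto)
  finally show ?thesis using k by (simp add: sum.delta)
qed

end

lemma rotation_to:
  fixes e y :: "real^'r"
  assumes "norm e = 1" "norm y = 1" "2 \<le> CARD('r)"
  obtains R where "rotation_matrix R" "R *v e = y"
proof -
  obtain f where f: "orthogonal_transformation f" "det (matrix f) = 1" "f e = y"
    using rotation_exists[of e y] assms by auto
  have "rotation_matrix (matrix f)"
    using f(1,2) orthogonal_transformation_matrix[of f] by (simp add: rotation_matrix_def)
  moreover have "matrix f *v e = y"
    using f(3) matrix_vector_mul(2)[OF orthogonal_transformation_linear[OF f(1)]] by simp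
  ultimately show ?thesis using that by blast
qed

text \<open>In dimension at least two a rotation takes the chosen unit vector e to any unit vector
  y, so a point of the given form lies on the orbit of a profile point.\<close>

lemma rotational_overI:
  fixes h :: "real \<times> real \<Rightarrow> real^'q" and F :: "'m \<Rightarrow> (real^'q) \<times> (real^'r)"
  assumes "2 \<le> CARD('r)" "\<And>a. a \<in> U \<Longrightarrow> p (fst a) > 0"
    and "\<And>x. x \<in> V \<Longrightarrow> \<exists>a\<in>U. \<exists>y. norm y = 1 \<and> F x = (h a, p (fst a) *\<^sub>R y)"
  shows "rotational_over V F ((\<lambda>(t, u). (h (t, u), p t)) ` U)"
  unfolding rotational_over_def
proof (intro conjI)
  show "\<forall>(a, b)\<in>(\<lambda>(t, u). (h (t, u), p t)) ` U. b \<noteq> 0" using assms(2) by force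
  obtain e :: "real^'r" where e: "norm e = 1" using vector_choose_size[of 1] by auto
  show "\<exists>e. norm e = 1 \<and> F ` V \<subseteq> {(a, R *v (b *\<^sub>R e)) |a b R. (a, b) \<in> (\<lambda>(t, u). (h (t, u), p t)) ` U \<and> rotation_matrix R}"
  proof (intro exI[of _ e] conjI e subsetI)
    fix q assume "q \<in> F ` V"
    then obtain x where x: "x \<in> V" "q = F x" by blast
    obtain a y where ay: "a \<in> U" "norm y = 1" "F x = (h a, p (fst a) *\<^sub>R y)" using assms(3)[OF x(1)] by blast
    obtain R where R: "rotation_matrix R" "R *v e = y" using rotation_to[OF e ay(2) assms(1)] by blast
    have "(h a, p (fst a)) \<in> (\<lambda>(t, u). (h (t, u), p t)) ` U" using ay(1) by (force simp: image_iff split_beta)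
    moreover have "q = (h a, R *v (p (fst a) *\<^sub>R e))"
      using x(2) ay(3) R(2) by (simp add: matrix_vector_mult_scaleR)
    ultimately show "q \<in> {(a, R *v (b *\<^sub>R e)) |a b R. (a, b) \<in> (\<lambda>(t, u). (h (t, u), p t)) ` U \<and> rotation_matrix R}"
      using R(1) by blast
  qed
qed

text \<open>The coordinate t is \<tau> applied to \<phi>, where the derivative of \<tau> is the
  reciprocal of the gradient length; the inverse p of \<tau> then has value \<phi> and derivative
  the gradient length. Together with the potential u of \<upsilon> and the unit vector y these are
  the coordinates of the warped product.\<close>

lemma rotational_patch:
  fixes A :: "('m::topological_space, real^'n) chart set" and f :: "'m \<Rightarrow> (real^'q) \<times> (real^'r)"
  assumes A: "smooth_atlas A" and g: "riemannian_metric A g" and c: "c \<in> A"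
    and n: "CARD('n) = m + 2" and rr: "CARD('r) = m + 1"
    and patch: "umbilic_patch S F \<xi> E \<eta> m \<rho>" and cvx: "convex S" "S \<subseteq> coords c UNIV" and x0: "x0 \<in> S"
    and Ff: "\<And>x. x \<in> S \<Longrightarrow> f (param c x) = F x"
    and met: "\<And>x v w. x \<in> S \<Longrightarrow> g c x v w = dd F x v \<bullet> dd F x w"
    and ne: "umbilic_patch.grad\<phi>_sq \<xi> E \<eta> m \<rho> x0 > 0"
  shows "\<exists>V T. open V \<and> param c x0 \<in> V \<and> rigid_motion T \<and> einstein_rotational A g \<rho> V (T \<circ> f)"
proof -
  interpret U: umbilic_patch S F \<xi> E \<eta> m \<rho> by fact
  note oS = U.S and m2 = U.m
  obtain c0 where c0: "\<And>x. x \<in> S \<Longrightarrow> U.grad\<phi>_sq x = 1 - \<rho> / (real m + 1) * (U.\<phi> x)\<^sup>2 + c0 / U.\<phi> x ^ (m - 1)"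
    unfolding U.grad\<phi>_sq_def by (rule U.D\<phi>_profile[OF cvx(1)]) blast
  define f1 where "f1 s = 1 - \<rho> / (real m + 1) * s\<^sup>2 + c0 / s ^ (m - 1)" for s
  have c0': "U.grad\<phi>_sq x = f1 (U.\<phi> x)" if "x \<in> S" for x using c0[OF that] by (simp add: f1_def)
  have smf1: "smooth_on {0<..} f1"
    unfolding f1_def by (intro smooth_on_add smooth_on_diff smooth_on_divide smooth_on_mult smooth_on_power smooth_on_const
        smooth_on_bounded_linear bounded_linear_ident open_greaterThan) auto
  \<comment> \<open>On J the profile equation gives 0 < \<phi>'^2 < 1. The upper bound holds at x0
    because \<open>D\<phi>_norm\<close> subtracts a positive multiple of \<open>lam\<close> from
    1.\<close>
  define J where "J = {0<..} \<inter> f1 -` {0<..<1}"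
  have oJ: "open J" unfolding J_def
    by (rule continuous_open_preimage[OF smooth_on_continuous_on[OF smf1]]) auto
  have "U.grad\<phi>_sq x0 < 1"
    unfolding U.grad\<phi>_sq_def U.D\<phi>_norm[OF x0] using U.\<phi>_pos[OF x0] U.lam_pos[OF x0] by simp
  then have x0J: "U.\<phi> x0 \<in> J" using ne c0'[OF x0] U.\<phi>_pos[OF x0] by (simp add: J_def)
  have smJ: "smooth_on J f1" by (rule smooth_on_subset[OF smf1]) (auto simp: J_def)
  have posJ: "f1 s > 0" if "s \<in> J" for s using that by (simp add: J_def)
  obtain d \<tau> p where d: "d > 0" "ball (U.\<phi> x0) d \<subseteq> J" "smooth_on (ball (U.\<phi> x0) d) \<tau>"
    "\<And>s. s \<in> ball (U.\<phi> x0) d \<Longrightarrow> (\<tau> has_derivative (\<lambda>w. w / sqrt (f1 s))) (at s)"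
    "open (\<tau> ` ball (U.\<phi> x0) d)" "is_interval (\<tau> ` ball (U.\<phi> x0) d)" "smooth_on (\<tau> ` ball (U.\<phi> x0) d) p"
    "\<And>s. s \<in> ball (U.\<phi> x0) d \<Longrightarrow> p (\<tau> s) = s"
    "\<And>s. s \<in> ball (U.\<phi> x0) d \<Longrightarrow> deriv p (\<tau> s) = sqrt (f1 s)"
    by (rule autonomous_solution[OF oJ x0J smJ posJ]) (assumption | rule that)+
  define K where "K = ball (U.\<phi> x0) d"
  note d = d[folded K_def]
  have oS1: "open (S \<inter> U.\<phi> -` K)"
    unfolding K_def by (rule continuous_open_preimage[OF smooth_on_continuous_on[OF U.smooth_\<phi>] oS open_ball])
  moreover have "x0 \<in> S \<inter> U.\<phi> -` K" using x0 d(1) by (simp add: K_def)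
  ultimately obtain r1 where r1: "r1 > 0" "ball x0 r1 \<subseteq> S \<inter> U.\<phi> -` K" using openE by blast
  have gpos: "U.grad\<phi>_sq x > 0" if "x \<in> ball x0 r1" for x
  proof -
    have "x \<in> S" "U.\<phi> x \<in> J" using that r1(2) d(2) by blast+
    then show ?thesis using c0'[of x] posJ by simp
  qed
  have B1S: "ball x0 r1 \<subseteq> S" using r1(2) by blast
  obtain r2 u where u: "r2 > 0" "ball x0 r2 \<subseteq> ball x0 r1" "smooth_on (ball x0 r2) u"
    "\<And>x. x \<in> ball x0 r2 \<Longrightarrow> (u has_derivative U.\<upsilon> x) (at x)"
  proof (rule closed_form_potential[of "ball x0 r1" x0 U.\<upsilon>])
    show "x0 \<in> ball x0 r1" using r1(1) by simp
    show "smooth_on (ball x0 r1) (\<lambda>x. U.\<upsilon> x v)" for v by (rule U.smooth_\<upsilon>[OF open_ball B1S gpos])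
    show "linear (U.\<upsilon> x)" if "x \<in> ball x0 r1" for x using U.linear_\<upsilon> that B1S by blast
    show "dd (\<lambda>x. U.\<upsilon> x w) x v = dd (\<lambda>x. U.\<upsilon> x v) x w" if "x \<in> ball x0 r1" for x v w
      using U.\<upsilon>_closed[OF _ gpos[OF that]] that B1S by blast
  qed (rule open_ball, rule that)
  obtain T k y and Y :: "nat \<Rightarrow> real^'n \<Rightarrow> real^'r" where T: "rigid_motion T" and smk: "smooth_on S k" and smy: "smooth_on S y"
    and smY: "\<And>j. j < m \<Longrightarrow> smooth_on S (Y j)"
    and TF: "\<And>x. x \<in> S \<Longrightarrow> T (F x) = (k x, U.\<phi> x *\<^sub>R y x)"
    and yy: "\<And>x. x \<in> S \<Longrightarrow> y x \<bullet> y x = 1"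
    and YY: "\<And>x i j. x \<in> S \<Longrightarrow> i < m \<Longrightarrow> j < m \<Longrightarrow> Y i x \<bullet> Y j x = (if i = j then 1 else 0)"
    and yY: "\<And>x w. x \<in> S \<Longrightarrow> w = (\<Sum>j<m. (Y j x \<bullet> w) *\<^sub>R Y j x) + (y x \<bullet> w) *\<^sub>R y x"
    and dy: "\<And>x v. x \<in> S \<Longrightarrow> dd y x v = (1 / U.\<phi> x) *\<^sub>R (\<Sum>j<m. (E j x \<bullet> dd F x v) *\<^sub>R Y j x)"
    and dk: "\<And>x v w. x \<in> S \<Longrightarrow> dd k x v \<bullet> dd k x w = dd U.h x v \<bullet> dd U.h x w"
    by (rule leaf_split[OF patch cvx(1) x0 rr]) (assumption | rule that)+
  define B where "B = ball x0 r2"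
  have oB: "open B" and x0B: "x0 \<in> B" using u(1) by (auto simp: B_def)
  have BS: "B \<subseteq> S" using u(2) B1S by (auto simp: B_def)
  have BK: "U.\<phi> x \<in> K" if "x \<in> B" for x using that u(2) r1(2) by (auto simp: B_def)
  have Bpos: "U.grad\<phi>_sq x > 0" "f1 (U.\<phi> x) > 0" "f1 (U.\<phi> x) = U.grad\<phi>_sq x" if "x \<in> B" for x
  proof -
    have x: "x \<in> ball x0 r1" "x \<in> S" using that u(2) BS unfolding B_def by blast+
    show "U.grad\<phi>_sq x > 0" "f1 (U.\<phi> x) > 0" "f1 (U.\<phi> x) = U.grad\<phi>_sq x"
      using gpos[OF x(1)] c0'[OF x(2)] by simp_all
  qed
  note Bsm = smooth_on_subset[OF _ BS]
  define t where "t x = \<tau> (U.\<phi> x)" for x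
  have smt: "smooth_on B t"
    unfolding t_def by (rule smooth_on_compose[OF oB _ _ d(3) Bsm[OF U.smooth_\<phi>]]) (use BK in \<open>auto simp: K_def\<close>)
  have ddt: "(t has_derivative (\<lambda>v. dd U.\<phi> x v / sqrt (U.grad\<phi>_sq x))) (at x)" if "x \<in> B" for x
  proof -
    have "((\<lambda>x. \<tau> (U.\<phi> x)) has_derivative (\<lambda>v. dd U.\<phi> x v / sqrt (f1 (U.\<phi> x)))) (at x)"
      by (rule has_derivative_compose[of U.\<phi> "dd U.\<phi> x" x UNIV \<tau>,
            OF has_derivative_dd[OF U.diff_\<phi>[OF subsetD[OF BS that]]] d(4)[OF BK[OF that]]])
    then show ?thesis unfolding t_def[abs_def] Bpos(3)[OF that] .
  qed
  have ddu: "(u has_derivative U.\<upsilon> x) (at x)" if "x \<in> B" for x using u(4) that by (simp add: B_def)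
  have smu: "smooth_on B u" using u(3) by (simp add: B_def)
  \<comment> \<open>The unit vector y takes values in a sphere, which is not open in its space. A
    radial factor is added as a new variable, so that the scaled vector fills an open set;
    \<open>V0\<close> returns to the slice with factor 1.\<close>
  define Z where "Z = B \<times> {0::real<..}"
  have oZ: "open Z" unfolding Z_def using oB by (intro open_Times open_greaterThan)
  have fZ: "smooth_on Z (\<lambda>z. q (fst z))" if "smooth_on B q" for q :: "real^'n \<Rightarrow> 'z::euclidean_space"
    unfolding Z_def by (rule smooth_on_fst_compose[OF oB open_greaterThan that])
  have sZ: "smooth_on Z snd" by (rule smooth_on_bounded_linear[OF bounded_linear_snd])
  have smG: "smooth_on B (\<lambda>x. sqrt (U.grad\<phi>_sq x))"
    by (rule smooth_on_sqrt[OF oB Bsm[OF U.smooth_grad\<phi>_sq]]) (use Bpos in blast)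
  \<comment> \<open>Frame coefficients of the inverse derivative: on the leaf the factors \<phi> and
    1 / s undo those of dy and of the scaling by the radial variable s, and on the complement the
    coframe of \<open>polar_metric\<close> is inverted. In \<open>L\<close> the radial rate is the
    component of \<open>snd w\<close> along y.\<close>
  define b where "b z w i = (if i < m then (Y i (fst z) \<bullet> snd w) * U.\<phi> (fst z) / snd z
      else if i = m then fst (fst w) * U.D\<phi> m (fst z) / sqrt (U.grad\<phi>_sq (fst z)) - snd (fst w) * U.D\<phi> (m + 1) (fst z)
      else fst (fst w) * U.D\<phi> (m + 1) (fst z) / sqrt (U.grad\<phi>_sq (fst z)) + snd (fst w) * U.D\<phi> m (fst z))"
    for z :: "(real^'n) \<times> real" and w :: "(real \<times> real) \<times> (real^'r)" and i
  define L where "L z w = ((\<Sum>i<m+2. b z w i *\<^sub>R \<xi> i (fst z)), y (fst z) \<bullet> snd w)" for z w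
  have smb: "smooth_on Z (\<lambda>z. b z w i)" for w i
  proof -
    have nz: "snd z \<noteq> 0" "sqrt (U.grad\<phi>_sq (fst z)) \<noteq> 0" if "z \<in> Z" for z
      using that Bpos[of "fst z"] by (auto simp: Z_def)
    have m12: "m < m + 2" "m + 1 < m + 2" by auto
    consider "i < m" | "i = m" | "\<not> i < m" "i \<noteq> m" by blast
    then show ?thesis
    proof cases
      case 1
      have "smooth_on Z (\<lambda>z. (Y i (fst z) \<bullet> snd w) * U.\<phi> (fst z) / snd z)"
        by (intro smooth_on_divide smooth_on_mult smooth_on_inner smooth_on_const oZ sZ fZ Bsm[OF smY[OF 1]] Bsm[OF U.smooth_\<phi>] nz)
      then show ?thesis using 1 by (simp add: b_def)
    next
      case 2
      have "smooth_on Z (\<lambda>z. fst (fst w) * U.D\<phi> m (fst z) / sqrt (U.grad\<phi>_sq (fst z)) - snd (fst w) * U.D\<phi> (m + 1) (fst z))"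
        by (intro smooth_on_diff smooth_on_divide smooth_on_mult smooth_on_const oZ fZ fZ[OF smG] Bsm[OF U.smooth_D\<phi>] m12 nz)
      then show ?thesis using 2 by (simp add: b_def)
    next
      case 3
      have "smooth_on Z (\<lambda>z. fst (fst w) * U.D\<phi> (m + 1) (fst z) / sqrt (U.grad\<phi>_sq (fst z)) + snd (fst w) * U.D\<phi> m (fst z))"
        by (intro smooth_on_add smooth_on_divide smooth_on_mult smooth_on_const oZ fZ fZ[OF smG] Bsm[OF U.smooth_D\<phi>] m12 nz)
      then show ?thesis using 3 by (simp add: b_def)
    qed
  qed
  have smL: "smooth_on Z (\<lambda>z. L z w)" for w
    unfolding L_def
    by (intro smooth_on_Pair smooth_on_sum smooth_on_scaleR smooth_on_inner smooth_on_const oZ smb fZ Bsm[OF U.\<xi>] Bsm[OF smy]) simp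
  define Af where "Af z = (t (fst z), u (fst z))" for z :: "(real^'n) \<times> real"
  define Bf where "Bf z = snd z *\<^sub>R y (fst z)" for z :: "(real^'n) \<times> real"
  define hf where "hf z = k (fst z)" for z :: "(real^'n) \<times> real"
  have smAf: "smooth_on Z Af" unfolding Af_def by (intro smooth_on_Pair oZ fZ smt smu)
  have smBf: "smooth_on Z Bf" unfolding Bf_def by (intro smooth_on_scaleR oZ sZ fZ Bsm[OF smy])
  have smhf: "smooth_on Z hf" unfolding hf_def by (intro fZ Bsm[OF smk])
  have inB: "fst z \<in> B" "fst z \<in> S" "snd z > 0" if "z \<in> Z" for z using that BS by (auto simp: Z_def)
  have bE: "E i (fst z) \<bullet> dd F (fst z) (fst (L z w)) = b z w i" if "z \<in> Z" "i < m + 2" for z w i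
    unfolding L_def fst_conv by (rule U.\<epsilon>_frame_sum[OF inB(2)[OF that(1)] that(2)])
  have dAf: "dd Af z v = (dd U.\<phi> (fst z) (fst v) / sqrt (U.grad\<phi>_sq (fst z)), U.\<upsilon> (fst z) (fst v))" if "z \<in> Z" for z v
    unfolding Af_def
    by (rule dd_eq) (intro has_derivative_Pair has_derivative_compose[OF has_derivative_fst[OF has_derivative_ident] ddt[OF inB(1)[OF that]]]
      has_derivative_compose[OF has_derivative_fst[OF has_derivative_ident] ddu[OF inB(1)[OF that]]])
  have dBf: "dd Bf z v = snd z *\<^sub>R dd y (fst z) (fst v) + snd v *\<^sub>R y (fst z)" if "z \<in> Z" for z v
    unfolding Bf_def
    by (rule dd_eq) (intro has_derivative_scaleR has_derivative_snd[OF has_derivative_ident]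
        dd_fst_compose smooth_on_differentiable[OF smy inB(2)[OF that]])
  have dhf: "dd hf z v = dd k (fst z) (fst v)" if "z \<in> Z" for z v
    unfolding hf_def by (rule dd_eq) (intro dd_fst_compose smooth_on_differentiable[OF smk inB(2)[OF that]])
  have b0: "b z w m = fst (fst w) * U.D\<phi> m (fst z) / sqrt (U.grad\<phi>_sq (fst z)) - snd (fst w) * U.D\<phi> (m + 1) (fst z)"
    "b z w (m + 1) = fst (fst w) * U.D\<phi> (m + 1) (fst z) / sqrt (U.grad\<phi>_sq (fst z)) + snd (fst w) * U.D\<phi> m (fst z)" for z w
    by (simp_all add: b_def)
  have LA: "dd Af z (L z w) = fst w" if z: "z \<in> Z" for z w
  proof -
    note x = inB(2)[OF z] and gp = Bpos(1)[OF inB(1)[OF z]]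
    have sq: "sqrt (U.grad\<phi>_sq (fst z)) * sqrt (U.grad\<phi>_sq (fst z)) = U.grad\<phi>_sq (fst z)" using gp by simp
    have e: "E m (fst z) \<bullet> dd F (fst z) (fst (L z w)) = b z w m" "E (m + 1) (fst z) \<bullet> dd F (fst z) (fst (L z w)) = b z w (m + 1)"
      by (rule bE[OF z], simp)+
    have 1: "dd U.\<phi> (fst z) (fst (L z w)) = fst (fst w) * sqrt (U.grad\<phi>_sq (fst z))"
    proof -
      have "dd U.\<phi> (fst z) (fst (L z w)) = fst (fst w) * U.grad\<phi>_sq (fst z) / sqrt (U.grad\<phi>_sq (fst z))"
        unfolding U.d\<phi>[OF x] e b0 by (simp add: U.grad\<phi>_sq_def power2_eq_square add_divide_distrib algebra_simps)
      then show ?thesis by (simp add: real_div_sqrt gp less_imp_le flip: times_divide_eq_right)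
    qed
    have 2: "U.\<upsilon> (fst z) (fst (L z w)) = snd (fst w)"
    proof -
      have "U.D\<phi> m (fst z) * b z w (m + 1) - U.D\<phi> (m + 1) (fst z) * b z w m = snd (fst w) * U.grad\<phi>_sq (fst z)"
        unfolding b0 by (simp add: U.grad\<phi>_sq_def power2_eq_square algebra_simps)
      then show ?thesis unfolding U.\<upsilon>_def e using gp by simp
    qed
    show ?thesis unfolding dAf[OF z] 1 2 using gp by (simp add: prod_eq_iff)
  qed
  have LB: "dd Bf z (L z w) = snd w" if z: "z \<in> Z" for z w
  proof -
    have pz: "U.\<phi> (fst z) > 0" using U.\<phi>_pos[OF inB(2)[OF z]] .
    have "dd y (fst z) (fst (L z w)) = (1 / U.\<phi> (fst z)) *\<^sub>R (\<Sum>j<m. ((Y j (fst z) \<bullet> snd w) * U.\<phi> (fst z) / snd z) *\<^sub>R Y j (fst z))"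
      unfolding dy[OF inB(2)[OF z]] by (intro arg_cong[of _ _ "\<lambda>q. _ *\<^sub>R q"] sum.cong refl) (use bE[OF z] in \<open>simp add: b_def\<close>)
    also have "\<dots> = (1 / snd z) *\<^sub>R (\<Sum>j<m. (Y j (fst z) \<bullet> snd w) *\<^sub>R Y j (fst z))"
      using pz by (simp add: scaleR_sum_right)
    finally have "dd Bf z (L z w) = (\<Sum>j<m. (Y j (fst z) \<bullet> snd w) *\<^sub>R Y j (fst z)) + (y (fst z) \<bullet> snd w) *\<^sub>R y (fst z)"
      unfolding dBf[OF z] using inB(3)[OF z] by (simp add: L_def)
    then show ?thesis using yY[OF inB(2)[OF z], of "snd w"] by simp
  qed
  have dkk: "dd k x v \<bullet> dd k x w = dd U.\<phi> x v * dd U.\<phi> x w / U.grad\<phi>_sq x + U.grad\<phi>_sq x * (U.\<upsilon> x v * U.\<upsilon> x w) - dd U.\<phi> x v * dd U.\<phi> x w"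
    if "x \<in> B" for x v w
    unfolding dk[OF subsetD[OF BS that]] U.dh_dh[OF subsetD[OF BS that]] U.polar_metric[OF subsetD[OF BS that] Bpos(1)[OF that]] ..
  have L\<phi>: "dd U.\<phi> (fst z) (fst (L z w)) = fst (fst w) * sqrt (U.grad\<phi>_sq (fst z))" "U.\<upsilon> (fst z) (fst (L z w)) = snd (fst w)" if "z \<in> Z" for z w
    using LA[OF that, of w] dAf[OF that, of "L z w"] Bpos(1)[OF inB(1)[OF that]] by (auto simp: prod_eq_iff field_simps)
  \<comment> \<open>These directions fix t and u, and \<open>dkk\<close> expresses the length of dk
    by d\<phi> and \<upsilon> alone; a derivative of length zero is zero.\<close>
  have h0: "dd hf z (L z (0, w)) = 0" if z: "z \<in> Z" for z w
  proof -
    have "dd hf z (L z (0, w)) \<bullet> dd hf z (L z (0, w)) = 0"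
      unfolding dhf[OF z] dkk[OF inB(1)[OF z]] L\<phi>[OF z] by simp
    then show ?thesis by simp
  qed
  have dims: "DIM((real^'n) \<times> real) = DIM(real \<times> real) + DIM(real^'r)" using n rr by simp
  have z0: "(x0, 1) \<in> Z" using x0B by (simp add: Z_def)
  obtain N r G h' where N: "open N" "(x0, 1) \<in> N" "N \<subseteq> Z" "r > 0"
    "homeomorphism N (ball (Af (x0, 1)) r \<times> ball (Bf (x0, 1)) r) (\<lambda>z. (Af z, Bf z)) G"
    "smooth_on (ball (Af (x0, 1)) r) h'" "\<And>z. z \<in> N \<Longrightarrow> hf z = h' (Af z)"
    "\<And>z w. z \<in> N \<Longrightarrow> dd h' (Af z) w = dd hf z (L z (w, 0))"
    by (rule local_product[where L = L, OF oZ z0 smAf smBf smhf smL LA LB h0 dims]) (assumption | rule that)+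
  define V0 where "V0 = (\<lambda>x. (x, 1)) -` N"
  have oV0: "open V0" unfolding V0_def by (rule open_vimage[OF N(1)]) (intro continuous_intros)
  have x0V: "x0 \<in> V0" using N(2) by (simp add: V0_def)
  have V0B: "x \<in> B" and V0S: "x \<in> S" and V0N: "(x, 1) \<in> N" if "x \<in> V0" for x
    using that N(3) BS unfolding V0_def Z_def by auto
  define U0 where "U0 = ball (Af (x0, 1)) r"
  define W0 where "W0 = ball (Bf (x0, 1)) r"
  note hom = N(5)[folded U0_def W0_def] and smh' = N(6)[folded U0_def]
  define \<Theta> where "\<Theta> x = ((t x, u x), y x)" for x
  define P where "P = U0 \<times> (W0 \<inter> sphere 0 1)"
  have AB1: "Af (x, 1) = (t x, u x)" "Bf (x, 1) = y x" for x by (simp_all add: Af_def Bf_def)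
  have ny: "norm (y x) = 1" if "x \<in> S" for x using yy[OF that] by (simp add: norm_eq_sqrt_inner)
  have GN: "G q \<in> N" "Af (G q) = fst q" "Bf (G q) = snd q" if "q \<in> U0 \<times> W0" for q
    using homeomorphism_image2[OF hom] homeomorphism_apply2[OF hom that] that by auto
  have NUW: "(Af z, Bf z) \<in> U0 \<times> W0" "G (Af z, Bf z) = z" if "z \<in> N" for z
    using homeomorphism_image1[OF hom] homeomorphism_apply1[OF hom that] that by blast+
  have \<Theta>P: "\<Theta> x \<in> P" if "x \<in> V0" for x
    using NUW(1)[OF V0N[OF that]] ny[OF V0S[OF that]] by (simp add: P_def \<Theta>_def AB1)
  have G1: "fst (G q) \<in> V0 \<and> \<Theta> (fst (G q)) = q" if q: "q \<in> P" for q
  proof -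
    have q2: "q \<in> U0 \<times> W0" and n1: "norm (snd q) = 1" using q by (auto simp: P_def)
    have zZ: "G q \<in> Z" using GN(1)[OF q2] N(3) by blast
    \<comment> \<open>The norm of \<open>Bf\<close> is the radial variable, so a point over the unit
      sphere lies in the slice with value 1.\<close>
    have "norm (Bf (G q)) = snd (G q)" using inB(3)[OF zZ] ny[OF inB(2)[OF zZ]] by (simp add: Bf_def)
    then have s1: "snd (G q) = 1" using GN(3)[OF q2] n1 by simp
    then have e: "G q = (fst (G q), 1)" by (simp add: prod_eq_iff)
    have "fst (G q) \<in> V0" using GN(1)[OF q2] e by (simp add: V0_def)
    moreover have "\<Theta> (fst (G q)) = q"
      using GN(2,3)[OF q2] AB1[of "fst (G q)"] e by (simp add: \<Theta>_def prod_eq_iff)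
    ultimately show ?thesis ..
  qed
  have hom\<Theta>: "homeomorphism V0 P \<Theta> (\<lambda>q. fst (G q))"
  proof (rule homeomorphismI)
    show "continuous_on V0 \<Theta>" unfolding \<Theta>_def
      by (intro continuous_intros continuous_on_subset[OF smooth_on_continuous_on[OF smt]] continuous_on_subset[OF smooth_on_continuous_on[OF smu]]
          continuous_on_subset[OF smooth_on_continuous_on[OF smy]]) (use V0B V0S in blast)+
    have "P \<subseteq> U0 \<times> W0" by (auto simp: P_def)
    then show "continuous_on P (\<lambda>q. fst (G q))"
      by (intro continuous_on_fst continuous_on_subset[OF homeomorphism_cont2[OF hom]])
    show "\<Theta> ` V0 \<subseteq> P" using \<Theta>P by blast
    show "(\<lambda>q. fst (G q)) ` P \<subseteq> V0" using G1 by blast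
    show "fst (G (\<Theta> x)) = x" if "x \<in> V0" for x
      using NUW(2)[OF V0N[OF that]] by (simp add: \<Theta>_def AB1)
    show "\<Theta> (fst (G q)) = q" if "q \<in> P" for q using G1[OF that] ..
  qed
  have V0c: "V0 \<subseteq> coords c UNIV" using V0S cvx(2) by blast
  have pt: "p (t x) = U.\<phi> x" "(deriv p (t x))\<^sup>2 = U.grad\<phi>_sq x" if "x \<in> B" for x
    using d(8,9)[OF BK[OF that]] Bpos[OF that] by (simp_all add: t_def)
  define HM :: "((real \<times> real) \<times> (real^'r)) metric_field" where
    "HM = warped_metric (diagonal_metric (\<lambda>t. 1) (\<lambda>t. (deriv p t)\<^sup>2)) (\<lambda>(t, u). p t)"
  have iso: "isometric_on V0 (g c) \<Theta> HM"
    unfolding isometric_on_def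
  proof (intro conjI ballI allI)
    show "smooth_on V0 \<Theta>" unfolding \<Theta>_def
      by (intro smooth_on_Pair oV0 smooth_on_subset[OF smt] smooth_on_subset[OF smu] smooth_on_subset[OF smy]) (use V0B V0S in blast)+
    fix x v w assume x: "x \<in> V0"
    note xB = V0B[OF x] and xS = V0S[OF x]
    have D: "dd \<Theta> x v = ((dd U.\<phi> x v / sqrt (U.grad\<phi>_sq x), U.\<upsilon> x v), dd y x v)" for v
      unfolding \<Theta>_def by (rule dd_eq) (intro has_derivative_Pair ddt[OF xB] ddu[OF xB] smooth_on_has_derivative[OF smy xS])
    have yyd: "dd y x v \<bullet> dd y x w = (\<Sum>j<m. (E j x \<bullet> dd F x v) * (E j x \<bullet> dd F x w)) / (U.\<phi> x)\<^sup>2"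
    proof -
      have "(\<Sum>j<m. (E j x \<bullet> dd F x v) *\<^sub>R Y j x) \<bullet> (\<Sum>i<m. (E i x \<bullet> dd F x w) *\<^sub>R Y i x)
        = (\<Sum>j<m. (E j x \<bullet> dd F x v) * (E j x \<bullet> dd F x w))"
        unfolding inner_sum_left
      proof (intro sum.cong refl)
        fix j assume j: "j \<in> {..<m}"
        have "Y j x \<bullet> (\<Sum>i<m. (E i x \<bullet> dd F x w) *\<^sub>R Y i x) = (\<Sum>i<m. if i = j then E i x \<bullet> dd F x w else 0)"
          unfolding inner_sum_right using YY[OF xS] j by (intro sum.cong refl) auto
        then show "((E j x \<bullet> dd F x v) *\<^sub>R Y j x) \<bullet> (\<Sum>i<m. (E i x \<bullet> dd F x w) *\<^sub>R Y i x) = (E j x \<bullet> dd F x v) * (E j x \<bullet> dd F x w)"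
          using j by (simp add: sum.delta)
      qed
      then show ?thesis unfolding dy[OF xS] by (simp add: power2_eq_square)
    qed
    have "dd U.\<phi> x v / sqrt (U.grad\<phi>_sq x) * (dd U.\<phi> x w / sqrt (U.grad\<phi>_sq x)) = dd U.\<phi> x v * dd U.\<phi> x w / U.grad\<phi>_sq x"
      using Bpos(1)[OF xB] by simp
    then have "HM (\<Theta> x) (dd \<Theta> x v) (dd \<Theta> x w) = dd U.\<phi> x v * dd U.\<phi> x w / U.grad\<phi>_sq x + U.grad\<phi>_sq x * (U.\<upsilon> x v * U.\<upsilon> x w)
        + (U.\<phi> x)\<^sup>2 * (dd y x v \<bullet> dd y x w)"
      unfolding D HM_def warped_metric_def diagonal_metric_def \<Theta>_def by (simp add: pt[OF xB])
    also have "(U.\<phi> x)\<^sup>2 * (dd y x v \<bullet> dd y x w) = (\<Sum>j<m. (E j x \<bullet> dd F x v) * (E j x \<bullet> dd F x w))"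
      unfolding yyd using U.\<phi>_pos[OF xS] by simp
    finally show "HM (\<Theta> x) (dd \<Theta> x v) (dd \<Theta> x w) = g c x v w"
      unfolding met[OF xS] U.dF_dF[OF xS] U.polar_metric[OF xS Bpos(1)[OF xB]] by simp
  qed
  define V where "V = param c ` V0"
  note ci = chart_isometry[OF A g c oV0 V0c hom\<Theta> iso, folded V_def]
  have Vx: "\<exists>x\<in>V0. q = param c x \<and> snd c q = x" if "q \<in> V" for q
    using that V0c param_coords(3)[OF A c] by (auto simp: V_def)
  have U0z: "\<exists>z\<in>N. Af z = a" if "a \<in> U0" for a
    using GN[of "(a, Bf (x0, 1))"] that N(4) by (auto simp: W0_def)
  have CR: "real CARD('n) - 1 = real m + 1" "CARD('n) - 3 = m - 1" using n by auto
  have "einstein_rotational A g \<rho> V (T \<circ> f)"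
    unfolding einstein_rotational_def CR
  proof (intro exI conjI)
    show "open (\<tau> ` K)" "is_interval (\<tau> ` K)" "smooth_on (\<tau> ` K) p" by (fact d(5) d(6) d(7))+
    \<comment> \<open>The coefficients of both metrics depend on t only, so the whole line serves as
      the interval of u.\<close>
    show "open (UNIV::real set)" "is_interval (UNIV::real set)" by auto
    show "\<forall>t\<in>\<tau> ` K. 0 < p t \<and> (deriv p t)\<^sup>2 = 1 - \<rho> / (real m + 1) * (p t)\<^sup>2 + c0 / p t ^ (m - 1) \<and>
        0 < (deriv p t)\<^sup>2 \<and> (deriv p t)\<^sup>2 < 1"
    proof (rule ballI)
      fix t' assume "t' \<in> \<tau> ` K"
      then obtain s where s: "s \<in> K" "t' = \<tau> s" by blast
      have "s \<in> J" using s d(2) by blast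
      then have "s > 0" "0 < f1 s" "f1 s < 1" by (auto simp: J_def)
      then show "0 < p t' \<and> (deriv p t')\<^sup>2 = 1 - \<rho> / (real m + 1) * (p t')\<^sup>2 + c0 / p t' ^ (m - 1) \<and>
        0 < (deriv p t')\<^sup>2 \<and> (deriv p t')\<^sup>2 < 1"
        using d(8,9)[OF s(1)] by (simp add: s(2) f1_def)
    qed
    show "open U0" by (simp add: U0_def)
    show "U0 \<subseteq> \<tau> ` K \<times> UNIV"
    proof
      fix a assume "a \<in> U0"
      then obtain z where z: "z \<in> N" "Af z = a" using U0z by blast
      then have "fst a = \<tau> (U.\<phi> (fst z))" by (auto simp: Af_def t_def)
      moreover have "U.\<phi> (fst z) \<in> K" using BK inB(1) N(3) z(1) by blast
      ultimately show "a \<in> \<tau> ` K \<times> UNIV" by (auto simp: mem_Times_iff)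
    qed
    show "isometric_on U0 (diagonal_metric (\<lambda>t. 1 - (deriv p t)\<^sup>2) (\<lambda>t. (deriv p t)\<^sup>2)) h' euclidean_metric"
      unfolding isometric_on_def
    proof (intro conjI ballI allI smh')
      fix a v w assume "a \<in> U0"
      then obtain z where z: "z \<in> N" "Af z = a" using U0z by blast
      have zZ: "z \<in> Z" using z(1) N(3) by blast
      have fa: "fst a = t (fst z)" using z(2) by (auto simp: Af_def)
      have D: "dd h' a v = dd k (fst z) (fst (L z (v, 0)))" for v
        using N(8)[OF z(1), of v] unfolding z(2) dhf[OF zZ] .
      have sq: "sqrt (U.grad\<phi>_sq (fst z)) * sqrt (U.grad\<phi>_sq (fst z)) = U.grad\<phi>_sq (fst z)"
        using Bpos(1)[OF inB(1)[OF zZ]] by simp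
      have "dd h' a v \<bullet> dd h' a w = (fst v * fst w) * (sqrt (U.grad\<phi>_sq (fst z)) * sqrt (U.grad\<phi>_sq (fst z))) / U.grad\<phi>_sq (fst z)
         + U.grad\<phi>_sq (fst z) * (snd v * snd w) - (fst v * fst w) * (sqrt (U.grad\<phi>_sq (fst z)) * sqrt (U.grad\<phi>_sq (fst z)))"
        unfolding D dkk[OF inB(1)[OF zZ]] L\<phi>[OF zZ] by (simp add: mult_ac)
      also have "\<dots> = (1 - U.grad\<phi>_sq (fst z)) * (fst v * fst w) + U.grad\<phi>_sq (fst z) * (snd v * snd w)"
        unfolding sq using Bpos(1)[OF inB(1)[OF zZ]] by (simp add: algebra_simps)
      finally show "euclidean_metric (h' a) (dd h' a v) (dd h' a w) =
          diagonal_metric (\<lambda>t. 1 - (deriv p t)\<^sup>2) (\<lambda>t. (deriv p t)\<^sup>2) a v w"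
        unfolding euclidean_metric_def diagonal_metric_def fa pt(2)[OF inB(1)[OF zZ]] .
    qed
    have "P = (U0 \<times> sphere 0 1) \<inter> (UNIV \<times> W0)" by (auto simp: P_def)
    moreover have "open (UNIV \<times> W0)" unfolding W0_def by (intro open_Times) auto
    ultimately show "openin (top_of_set (U0 \<times> sphere 0 1)) P" by (auto simp: openin_open)
    show "isometry_onto A g V (\<Theta> \<circ> snd c) P (warped_metric (diagonal_metric (\<lambda>t. 1) (\<lambda>t. (deriv p t)\<^sup>2)) (\<lambda>(t, u). p t))"
      using ci(2) unfolding HM_def .
    have Tf: "(T \<circ> f) (param c x) = (h' (t x, u x), p (t x) *\<^sub>R y x)" if "x \<in> V0" for x
      using TF[OF V0S[OF that]] Ff[OF V0S[OF that]] N(7)[OF V0N[OF that]] pt(1)[OF V0B[OF that]]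
      by (simp add: hf_def AB1)
    show "rotational_over V (T \<circ> f) ((\<lambda>(t, u). (h' (t, u), p t)) ` U0)"
    proof (rule rotational_overI)
      show "2 \<le> CARD('r)" using rr m2 by simp
      show "0 < p (fst a)" if a: "a \<in> U0" for a
      proof -
        obtain z where z: "z \<in> N" "Af z = a" using U0z a by blast
        have "fst z \<in> B" using inB(1) N(3) z(1) by blast
        moreover have "fst a = t (fst z)" using z(2) by (auto simp: Af_def)
        ultimately show ?thesis using pt(1) U.\<phi>_pos BS by auto
      qed
      fix q assume "q \<in> V"
      then obtain x where x: "x \<in> V0" "q = param c x" using Vx by blast
      have "(t x, u x) \<in> U0" using NUW(1)[OF V0N[OF x(1)]] by (simp add: AB1)
      then show "\<exists>a\<in>U0. \<exists>y. norm y = 1 \<and> (T \<circ> f) q = (h' a, p (fst a) *\<^sub>R y)"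
        using Tf[OF x(1)] ny[OF V0S[OF x(1)]] unfolding x(2) by (intro bexI[of _ "(t x, u x)"] exI[of _ "y x"]) auto
    qed
    show "\<forall>q\<in>V. \<forall>t u y. (\<Theta> \<circ> snd c) q = ((t, u), y) \<longrightarrow> (T \<circ> f) q = (h' (t, u), p t *\<^sub>R y)"
    proof (intro ballI allI impI)
      fix q t' u' y' assume q: "q \<in> V" "(\<Theta> \<circ> snd c) q = ((t', u'), y')"
      obtain x where x: "x \<in> V0" "q = param c x" "snd c q = x" using Vx[OF q(1)] by blast
      then have "t' = t x" "u' = u x" "y' = y x" using q(2) by (auto simp: \<Theta>_def)
      then show "(T \<circ> f) q = (h' (t', u'), p t' *\<^sub>R y')" using Tf[OF x(1)] x(2) by simp
    qed
  qed
  moreover have "param c x0 \<in> V" using x0V by (simp add: V_def)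
  ultimately show ?thesis using ci(1) T by blast
qed

section \<open>The product case and the developing map of its surface factor\<close>

lemma parseval_triple:
  fixes Y A B :: "real^3"
  assumes "\<And>a b. (Y \<bullet> a) * (Y \<bullet> b) + (A \<bullet> a) * (A \<bullet> b) + (B \<bullet> a) * (B \<bullet> b) = a \<bullet> b"
  shows "a = (Y \<bullet> a) *\<^sub>R Y + (A \<bullet> a) *\<^sub>R A + (B \<bullet> a) *\<^sub>R B"
    "Y \<bullet> Y = 1" "A \<bullet> A = 1" "B \<bullet> B = 1" "Y \<bullet> A = 0" "Y \<bullet> B = 0" "A \<bullet> B = 0"
proof -
  define f where "f c = (Y \<bullet> c, A \<bullet> c, B \<bullet> c)" for c
  define g where "g q = fst q *\<^sub>R Y + fst (snd q) *\<^sub>R A + snd (snd q) *\<^sub>R B" for q :: "real \<times> real \<times> real"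
  have gf: "g (f c) = c" for c
  proof (rule vector_eq_rdot[THEN iffD1], rule allI)
    fix b show "g (f c) \<bullet> b = c \<bullet> b"
      using assms[of c b] by (simp add: g_def f_def inner_add_left)
  qed
  then show "a = (Y \<bullet> a) *\<^sub>R Y + (A \<bullet> a) *\<^sub>R A + (B \<bullet> a) *\<^sub>R B" by (metis f_def fst_conv g_def snd_conv)
  \<comment> \<open>Parseval says that g is a left inverse of the coefficient map f. In equal
    dimensions it is also a right inverse, and evaluating f after g on the standard basis gives the
    orthonormality relations.\<close>
  have "linear g" unfolding g_def by (intro linearI) (simp_all add: algebra_simps)
  then have "f (g q) = q" for q
    using linear_right_inverse_left(2)[where f = g and g = f, OF _ gf] by simp
  from this[of "(1, 0, 0)"] this[of "(0, 1, 0)"] this[of "(0, 0, 1)"]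
  show "Y \<bullet> Y = 1" "A \<bullet> A = 1" "B \<bullet> B = 1" "Y \<bullet> A = 0" "Y \<bullet> B = 0" "A \<bullet> B = 0"
    by (simp_all add: f_def g_def inner_commute)
qed

context umbilic_patch begin

definition nor :: "'a \<Rightarrow> 'b \<Rightarrow> 'b" where "nor x u = u - (\<Sum>k<m+2. (E k x \<bullet> u) *\<^sub>R E k x)"

lemma E_nor: "x \<in> S \<Longrightarrow> k < m + 2 \<Longrightarrow> E k x \<bullet> nor x u = 0"
proof -
  assume x: "x \<in> S" and k: "k < m + 2"
  have "orthonormal (m + 2) (\<lambda>i. E i x)" using orth[OF x] by (simp add: orthonormal_def)
  from projection_facts(3)[OF this k] show ?thesis by (simp add: nor_def inner_diff_right)
qed

lemma linear_nor: "linear (nor x)"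
  unfolding nor_def by (intro linearI)
    (simp_all add: inner_add_right scaleR_add_left sum.distrib scaleR_sum_right scaleR_diff_right algebra_simps)

lemma nor_de:
  assumes x: "x \<in> S" and a: "a \<in> {m, m + 1}"
  shows "nor x (dd (E a) x v) = \<epsilon> m x v *\<^sub>R nor x (dd (E a) x (\<xi> m x)) + \<epsilon> (m + 1) x v *\<^sub>R nor x (dd (E a) x (\<xi> (m + 1) x))"
proof -
  have am: "a < m + 2" using a by auto
  have ld: "linear (dd (E a) x)" by (rule linear_dd[OF diff_E[OF x am]])
  have l: "linear (\<lambda>v. nor x (dd (E a) x v))" using linear_compose[OF ld linear_nor] by (simp add: o_def)
  have z: "nor x (dd (E a) x (\<xi> j x)) = 0" if j: "j < m" for j
  proof -
    let ?y = "nor x (dd (E a) x (\<xi> j x))"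
    have "dd (E a) x (\<xi> j x) \<bullet> ?y = 0" by (rule de_T_normal[OF x a j E_nor[OF x]])
    moreover have "(\<Sum>k<m+2. (E k x \<bullet> dd (E a) x (\<xi> j x)) *\<^sub>R E k x) \<bullet> ?y = 0"
      unfolding inner_sum_left by (intro sum.neutral ballI) (simp add: E_nor[OF x])
    ultimately have "?y \<bullet> ?y = 0" by (subst (1) nor_def) (simp only: inner_diff_left)
    then show ?thesis by simp
  qed
  have "nor x (dd (E a) x v) = nor x (dd (E a) x (\<Sum>i<m+2. \<epsilon> i x v *\<^sub>R \<xi> i x))"
    using frame[OF x, of v] by (rule arg_cong[where f = "\<lambda>v. nor x (dd (E a) x v)"])
  also have "\<dots> = (\<Sum>i<m+2. \<epsilon> i x v *\<^sub>R nor x (dd (E a) x (\<xi> i x)))"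
    by (simp only: linear_sum[OF l] linear_scale[OF l])
  finally show ?thesis unfolding sum_lessThan_add_2 using z by simp
qed

text \<open>The extrinsic curvature of the complementary plane in the sense of the Gauss equation;
  \<open>gauss_curvature_eq\<close> computes it from the Einstein condition.\<close>

definition gauss_curvature :: "'a \<Rightarrow> real" where
  "gauss_curvature x = nor x (dd (E m) x (\<xi> m x)) \<bullet> nor x (dd (E (m + 1)) x (\<xi> (m + 1) x))
     - nor x (dd (E m) x (\<xi> (m + 1) x)) \<bullet> nor x (dd (E m) x (\<xi> (m + 1) x))"

lemma smooth_\<omega>: "smooth_on S (\<lambda>x. \<omega> x v)"
  unfolding \<omega>_def by (intro smooth_on_inner S smooth_on_dd E) auto

lemma linear_\<omega>: "x \<in> S \<Longrightarrow> linear (\<omega> x)"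
  unfolding \<omega>_def using linear_dd[OF diff_E[of x m]]
  by (intro linearI) (simp_all add: linear_add linear_scale inner_add_left)

text \<open>The second structure equation. When the gradient of \<phi> vanishes so does
  \<open>Z\<close>; the derivatives of \<open>E m\<close> and \<open>E (m + 1)\<close> then have no
  leaf part, and only their normal parts contribute to the product that makes up the
  curvature.\<close>

lemma d\<omega>:
  assumes x: "x \<in> S" and D0: "D\<phi> m x = 0" "D\<phi> (m + 1) x = 0"
  shows "dd (\<lambda>z. \<omega> z w) x v - dd (\<lambda>z. \<omega> z v) x w
    = - gauss_curvature x * (\<epsilon> m x v * \<epsilon> (m + 1) x w - \<epsilon> m x w * \<epsilon> (m + 1) x v)"
proof -
  have m2: "m < m + 2" "m + 1 < m + 2" by auto
  have 1: "dd (\<lambda>z. \<omega> z w) x v = dd (E m) x w \<bullet> dd (E (m + 1)) x v + dd (\<lambda>z. dd (E m) z w) x v \<bullet> E (m + 1) x" for v w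
    unfolding \<omega>_def by (rule dd_inner[OF smooth_on_differentiable[OF smooth_on_dd[OF E[OF m2(1)]] x] diff_E[OF x m2(2)]])
  have 2: "dd (\<lambda>z. dd (E m) z w) x v = dd (\<lambda>z. dd (E m) z v) x w" by (rule dd_dd_commute[OF E[OF m2(1)] S x])
  have Z0: "Z a x = 0" if "a \<in> {m, m + 1}" for a
    using D\<phi>_Z[OF x that] D0 that \<phi>_pos[OF x] by auto
  have T0: "E j x \<bullet> dd (E a) x v = 0" if "a \<in> {m, m + 1}" "j < m" for a j v
    using dT_e[OF x that(2,1), of v] dE_skew[OF x, of j a v] that Z0[OF that(1)] by auto
  have sk: "E m x \<bullet> dd (E (m + 1)) x v = - \<omega> x v" "E (m + 1) x \<bullet> dd (E m) x v = \<omega> x v" for v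
    using dE_skew[OF x m2, of v] by (auto simp: \<omega>_def inner_commute)
  have e: "dd (E m) x v = \<omega> x v *\<^sub>R E (m + 1) x + nor x (dd (E m) x v)" for v
    unfolding nor_def sum_lessThan_add_2 using T0[of m] sk e_de[OF x m2(1)] by simp
  have e': "dd (E (m + 1)) x v = - \<omega> x v *\<^sub>R E m x + nor x (dd (E (m + 1)) x v)" for v
    unfolding nor_def sum_lessThan_add_2 using T0[of "m + 1"] sk e_de[OF x m2(2)] by simp
  have i: "dd (E m) x w \<bullet> dd (E (m + 1)) x v = nor x (dd (E m) x w) \<bullet> nor x (dd (E (m + 1)) x v)" for v w
  proof -
    have "dd (E m) x w \<bullet> dd (E (m + 1)) x v = (\<omega> x w *\<^sub>R E (m + 1) x + nor x (dd (E m) x w)) \<bullet> (- \<omega> x v *\<^sub>R E m x + nor x (dd (E (m + 1)) x v))"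
      by (intro arg_cong2[where f = "(\<bullet>)"] e e')
    then show ?thesis using E_nor[OF x m2(1)] E_nor[OF x m2(2)] orth[OF x m2(2,1)]
      by (simp add: inner_add_left inner_add_right inner_diff_right inner_commute[of "nor x _" "E m x"])
  qed
  have s: "nor x (dd (E (m + 1)) x (\<xi> m x)) = nor x (dd (E m) x (\<xi> (m + 1) x))"
  proof -
    define u where "u = dd (E (m + 1)) x (\<xi> m x) - dd (E m) x (\<xi> (m + 1) x)"
    have "nor x u \<bullet> nor x u = u \<bullet> nor x u - (\<Sum>k<m+2. (E k x \<bullet> u) *\<^sub>R E k x) \<bullet> nor x u"
      by (subst (1) nor_def) (rule inner_diff_left)
    moreover have "(\<Sum>k<m+2. (E k x \<bullet> u) *\<^sub>R E k x) \<bullet> nor x u = 0"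
      unfolding inner_sum_left by (intro sum.neutral ballI) (simp add: E_nor[OF x])
    moreover have "u \<bullet> nor x u = 0"
      using sff_symmetric[OF x m2(2,1) normal_iff[OF x E_nor[OF x]], of u] by (subst (1) u_def) (simp add: inner_diff_left)
    ultimately have "nor x u \<bullet> nor x u = 0" by linarith
    then have "nor x u = 0" by (simp only: inner_eq_zero_iff)
    then show ?thesis by (simp add: u_def linear_diff[OF linear_nor])
  qed
  have mm: "m \<in> {m, m + 1}" "m + 1 \<in> {m, m + 1}" by auto
  show ?thesis unfolding 1 2 i nor_de[OF x mm(1), of v] nor_de[OF x mm(1), of w] nor_de[OF x mm(2), of v] nor_de[OF x mm(2), of w] s gauss_curvature_def
    by (simp add: inner_add_left inner_add_right inner_commute algebra_simps)
qed

text \<open>\<open>lam_const_cases\<close> gives \<mu> = 0, that is \<rho> = (m - 1) * lam, and by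
  \<open>D\<phi>_norm\<close> the vanishing gradient makes the square of \<phi> the reciprocal of
  \<open>lam\<close>.\<close>

lemma product_facts:
  assumes "\<And>x v. x \<in> S \<Longrightarrow> dd lam x v = 0" and K: "\<And>x. x \<in> S \<Longrightarrow> gauss_curvature x = \<rho> - real m * \<mu> x" and x: "x \<in> S"
  shows "\<rho> > 0" "gauss_curvature x = \<rho>" "(\<phi> x)\<^sup>2 = (real m - 1) / \<rho>" "\<phi> x = sqrt ((real m - 1) / \<rho>)" "dd \<phi> x v = 0"
proof -
  note z = lam_const_cases[OF assms(1) x]
  have l: "lam x > 0" by (rule lam_pos[OF x])
  have \<rho>: "\<rho> = (real m - 1) * lam x" using z(3) by (simp add: \<mu>_def)
  then show pos: "\<rho> > 0" using l m by simp
  show "gauss_curvature x = \<rho>" using K[OF x] z(3) by simp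
  have "(\<phi> x)\<^sup>2 * lam x = 1" using D\<phi>_norm[OF x] z by simp
  moreover have "P = k / r" if "P * l = 1" "r = k * l" "r > 0" for P k l r :: real
    using that by (cases "l = 0") (auto simp: field_simps)
  ultimately show p: "(\<phi> x)\<^sup>2 = (real m - 1) / \<rho>" using \<rho> pos by blast
  then show "\<phi> x = sqrt ((real m - 1) / \<rho>)" using \<phi>_pos[OF x] by (metis less_eq_real_def real_sqrt_abs abs_of_nonneg)
  show "dd \<phi> x v = 0" using z by (simp add: d\<phi>[OF x])
qed

text \<open>The developing map of a surface of constant curvature \<open>\<kappa>\<^sup>2\<close> into the sphere of radius
  \<open>1 / \<kappa>\<close>: a parallel section of the orthonormal frame bundle of the flat bundle \<open>TL \<oplus> \<real>\<close>.\<close>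

lemma sphere_frame:
  assumes D0: "\<And>x. x \<in> S \<Longrightarrow> D\<phi> m x = 0 \<and> D\<phi> (m + 1) x = 0"
    and K: "\<And>x. x \<in> S \<Longrightarrow> gauss_curvature x = \<kappa> * \<kappa>" and x0: "x0 \<in> S"
  obtains r Y A B where "r > 0" "ball x0 r \<subseteq> S"
    "smooth_on (ball x0 r) Y" "smooth_on (ball x0 r) A" "smooth_on (ball x0 r) B"
    "\<And>x v. x \<in> ball x0 r \<Longrightarrow> dd Y x v = \<kappa> *\<^sub>R (\<epsilon> m x v *\<^sub>R A x + \<epsilon> (m + 1) x v *\<^sub>R B x)"
    "\<And>x a b. x \<in> ball x0 r \<Longrightarrow>
       (Y x \<bullet> a) * (Y x \<bullet> b) + (A x \<bullet> a) * (A x \<bullet> b) + (B x \<bullet> a) * (B x \<bullet> b) = a \<bullet> (b :: real^3)"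
proof -
  \<comment> \<open>The unknowns are the scaled position and a moving tangent frame of the sphere.
    By \<open>d\<epsilon>\<close> and \<open>d\<omega>\<close> the system is flat because the
    surface has curvature \<open>\<kappa> * \<kappa>\<close>.\<close>
  define \<Omega> where "\<Omega> x v q = (\<kappa> *\<^sub>R (\<epsilon> m x v *\<^sub>R fst (snd q) + \<epsilon> (m + 1) x v *\<^sub>R snd (snd q)),
      \<omega> x v *\<^sub>R snd (snd q) - (\<kappa> * \<epsilon> m x v) *\<^sub>R fst q, - (\<kappa> * \<epsilon> (m + 1) x v) *\<^sub>R fst q - \<omega> x v *\<^sub>R fst (snd q))"
    for x v and q :: "(real^3) \<times> (real^3) \<times> (real^3)"
  have m2: "m < m + 2" "m + 1 < m + 2" by auto
  have 1: "smooth_on S (\<lambda>x. \<Omega> x v q)" for v q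
    unfolding \<Omega>_def
    by (intro smooth_on_Pair smooth_on_scaleR smooth_on_add smooth_on_diff smooth_on_minus smooth_on_mult smooth_on_const S smooth_\<epsilon> smooth_\<omega> m2)
  have 2: "linear (\<lambda>v. \<Omega> x v q)" if x: "x \<in> S" for x q
    unfolding \<Omega>_def using linear_dF[OF x] linear_\<omega>[OF x]
    by (intro linearI) (simp_all add: linear_add linear_scale inner_add_right algebra_simps)
  have 3: "linear (\<Omega> x v)" for x v
    unfolding \<Omega>_def by (intro linearI) (simp_all add: algebra_simps)
  have 4: "dd (\<lambda>x. \<Omega> x w q) x v + \<Omega> x w (\<Omega> x v q) = dd (\<lambda>x. \<Omega> x v q) x w + \<Omega> x v (\<Omega> x w q)" if x: "x \<in> S" for x v w q
  proof -
    define e0 where "e0 v = \<epsilon> m x v" for v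
    define e1 where "e1 v = \<epsilon> (m + 1) x v" for v
    define o1 where "o1 v = \<omega> x v" for v
    define de0 where "de0 w v = dd (\<lambda>z. \<epsilon> m z w) x v" for w v
    define de1 where "de1 w v = dd (\<lambda>z. \<epsilon> (m + 1) z w) x v" for w v
    define do1 where "do1 w v = dd (\<lambda>z. \<omega> z w) x v" for w v
    have D: "dd (\<lambda>x. \<Omega> x w q) x v = (\<kappa> *\<^sub>R (de0 w v *\<^sub>R fst (snd q) + de1 w v *\<^sub>R snd (snd q)),
      do1 w v *\<^sub>R snd (snd q) - (\<kappa> * de0 w v) *\<^sub>R fst q, - (\<kappa> * de1 w v) *\<^sub>R fst q - do1 w v *\<^sub>R fst (snd q))" for w v
      unfolding \<Omega>_def de0_def de1_def do1_def
      by (rule dd_eq) (intro has_derivative_Pair has_derivative_add has_derivative_diff has_derivative_minus has_derivative_scaleR_left has_derivative_scaleR_right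
        has_derivative_mult_right smooth_on_has_derivative[OF smooth_\<epsilon> x] smooth_on_has_derivative[OF smooth_\<omega> x] m2)
    have f0: "de0 w v = de0 v w + (o1 v * e1 w - o1 w * e1 v)"
      using d\<epsilon>(1)[OF x, of w v] by (simp add: de0_def o1_def e1_def)
    have f1: "de1 w v = de1 v w - (o1 v * e0 w - o1 w * e0 v)"
      using d\<epsilon>(2)[OF x, of w v] by (simp add: de1_def o1_def e0_def)
    have f2: "do1 w v = do1 v w - \<kappa> * \<kappa> * (e0 v * e1 w - e0 w * e1 v)"
      using d\<omega>[OF x, of w v] D0[OF x] K[OF x] by (simp add: do1_def e0_def e1_def)
    show ?thesis unfolding D[of w v] D[of v w] f0 f1 f2 unfolding \<Omega>_def e0_def[symmetric] e1_def[symmetric] o1_def[symmetric]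
      by (simp add: algebra_simps)
  qed
  define a1 where "a1 = (axis 1 1 :: real^3)"
  define a2 where "a2 = (axis 2 1 :: real^3)"
  define a3 where "a3 = (axis 3 1 :: real^3)"
  obtain r Q where r: "r > 0" "ball x0 r \<subseteq> S" "Q x0 = (a1, a2, a3)" "smooth_on (ball x0 r) Q"
    "\<And>x. x \<in> ball x0 r \<Longrightarrow> (Q has_derivative (\<lambda>v. \<Omega> x v (Q x))) (at x)"
    by (rule flat_linear_system[OF S x0 1 2 3 4, where ?y0.0 = "(a1, a2, a3)"]) (assumption | rule that)+
  define Y where "Y x = fst (Q x)" for x
  define A where "A x = fst (snd (Q x))" for x
  define B where "B x = snd (snd (Q x))" for x
  have DY: "(Y has_derivative (\<lambda>v. \<kappa> *\<^sub>R (\<epsilon> m x v *\<^sub>R A x + \<epsilon> (m + 1) x v *\<^sub>R B x))) (at x)"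
    and DA: "(A has_derivative (\<lambda>v. \<omega> x v *\<^sub>R B x - (\<kappa> * \<epsilon> m x v) *\<^sub>R Y x)) (at x)"
    and DB: "(B has_derivative (\<lambda>v. - (\<kappa> * \<epsilon> (m + 1) x v) *\<^sub>R Y x - \<omega> x v *\<^sub>R A x)) (at x)" if "x \<in> ball x0 r" for x
    using has_derivative_fst[OF r(5)[OF that]] has_derivative_fst[OF has_derivative_snd[OF r(5)[OF that]]]
      has_derivative_snd[OF has_derivative_snd[OF r(5)[OF that]]]
    unfolding \<Omega>_def fst_conv snd_conv Y_def A_def B_def by this
  have pars: "(Y x \<bullet> a) * (Y x \<bullet> b) + (A x \<bullet> a) * (A x \<bullet> b) + (B x \<bullet> a) * (B x \<bullet> b) = a \<bullet> b" if x: "x \<in> ball x0 r" for x a b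
  proof -
    \<comment> \<open>The coefficient matrix of the system is skew, so this sum over the three
      vectors has zero derivative, whereas their mutual inner products satisfy a coupled linear
      system. \<open>parseval_triple\<close> later recovers the inner products.\<close>
    define s where "s x = (Y x \<bullet> a) * (Y x \<bullet> b) + (A x \<bullet> a) * (A x \<bullet> b) + (B x \<bullet> a) * (B x \<bullet> b)" for x
    have "(s has_derivative (\<lambda>v. 0)) (at x within ball x0 r)" if x: "x \<in> ball x0 r" for x
    proof -
      have "(s has_derivative (\<lambda>v.
         (Y x \<bullet> a) * ((\<kappa> *\<^sub>R (\<epsilon> m x v *\<^sub>R A x + \<epsilon> (m + 1) x v *\<^sub>R B x)) \<bullet> b) + ((\<kappa> *\<^sub>R (\<epsilon> m x v *\<^sub>R A x + \<epsilon> (m + 1) x v *\<^sub>R B x)) \<bullet> a) * (Y x \<bullet> b)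
       + ((A x \<bullet> a) * ((\<omega> x v *\<^sub>R B x - (\<kappa> * \<epsilon> m x v) *\<^sub>R Y x) \<bullet> b) + ((\<omega> x v *\<^sub>R B x - (\<kappa> * \<epsilon> m x v) *\<^sub>R Y x) \<bullet> a) * (A x \<bullet> b))
       + ((B x \<bullet> a) * ((- (\<kappa> * \<epsilon> (m + 1) x v) *\<^sub>R Y x - \<omega> x v *\<^sub>R A x) \<bullet> b) + ((- (\<kappa> * \<epsilon> (m + 1) x v) *\<^sub>R Y x - \<omega> x v *\<^sub>R A x) \<bullet> a) * (B x \<bullet> b)))) (at x)"
        unfolding s_def by (intro has_derivative_add has_derivative_mult has_derivative_inner_left DY[OF x] DA[OF x] DB[OF x])
      then have "(s has_derivative (\<lambda>v. 0)) (at x)"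
        by (rule has_derivative_eq_rhs) (simp add: fun_eq_iff inner_add_left inner_diff_left algebra_simps)
      then show ?thesis by (rule has_derivative_at_withinI)
    qed
    then have "\<exists>c. \<forall>x\<in>ball x0 r. s x = c" by (intro has_derivative_zero_constant convex_ball)
    then have "s x = s x0" using x r(1) by (metis centre_in_ball)
    moreover have "s x0 = a \<bullet> b"
      using r(3) by (simp add: s_def Y_def A_def B_def a1_def a2_def a3_def inner_axis' inner_vec_def sum_3 axis_def)
    ultimately show ?thesis by (simp add: s_def)
  qed
  show ?thesis
  proof (rule that[of r Y A B])
    show "smooth_on (ball x0 r) Y" "smooth_on (ball x0 r) A" "smooth_on (ball x0 r) B"
      unfolding Y_def A_def B_def
      by (intro smooth_on_linear_compose[OF open_ball bounded_linear_fst] smooth_on_linear_compose[OF open_ball bounded_linear_snd] r(4))+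
    show "dd Y x v = \<kappa> *\<^sub>R (\<epsilon> m x v *\<^sub>R A x + \<epsilon> (m + 1) x v *\<^sub>R B x)" if "x \<in> ball x0 r" for x v
      by (rule dd_eq[OF DY[OF that]])
  qed (fact r(1), fact r(2), rule pars)
qed

end

text \<open>The developing map divided by \<kappa> gives the point on the first sphere, and
  \<open>\<phi>0 *\<^sub>R y\<close> the point on the second. The component k of the immersion has
  zero derivative along the leaves, so \<open>local_product\<close> makes it a function of the first
  point.\<close>

lemma clifford_patch:
  fixes A :: "('m::topological_space, real^'n) chart set" and f :: "'m \<Rightarrow> (real^'q) \<times> (real^'r)"
  assumes A: "smooth_atlas A" and g: "riemannian_metric A g" and c: "c \<in> A"
    and n: "CARD('n) = m + 2" and rr: "CARD('r) = m + 1"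
    and patch: "umbilic_patch S F \<xi> E \<eta> m \<rho>" and cvx: "convex S" "S \<subseteq> coords c UNIV" and x0: "x0 \<in> S"
    and Ff: "\<And>x. x \<in> S \<Longrightarrow> f (param c x) = F x"
    and met: "\<And>x v w. x \<in> S \<Longrightarrow> g c x v w = dd F x v \<bullet> dd F x w"
    and lam0: "\<And>x v. x \<in> S \<Longrightarrow> dd (umbilic_patch.lam \<eta>) x v = 0"
    and gauss: "\<And>x. x \<in> S \<Longrightarrow> umbilic_patch.gauss_curvature \<xi> E m x = \<rho> - real m * umbilic_patch.\<mu> \<eta> m \<rho> x"
  shows "\<exists>V T. open V \<and> param c x0 \<in> V \<and> rigid_motion T \<and> clifford_product A g \<rho> V (T \<circ> f)"
proof -
  interpret U: umbilic_patch S F \<xi> E \<eta> m \<rho> by fact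
  note oS = U.S and m2 = U.m
  have pf: "\<rho> > 0" "U.gauss_curvature x = \<rho>" "(U.\<phi> x)\<^sup>2 = (real m - 1) / \<rho>" "U.\<phi> x = sqrt ((real m - 1) / \<rho>)"
    "dd U.\<phi> x v = 0" if "x \<in> S" for x v
    by (rule U.product_facts[OF lam0 gauss that], assumption+)+
  have \<rho>: "\<rho> > 0" by (rule pf(1)[OF x0])
  define \<kappa> where "\<kappa> = sqrt \<rho>"
  have \<kappa>: "\<kappa> > 0" "\<kappa> * \<kappa> = \<rho>" using \<rho> by (simp_all add: \<kappa>_def)
  define \<phi>0 where "\<phi>0 = sqrt ((real m - 1) / \<rho>)"
  have \<phi>0: "U.\<phi> x = \<phi>0" if "x \<in> S" for x using pf(4)[OF that] by (simp add: \<phi>0_def)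
  have \<phi>0pos: "\<phi>0 > 0" using U.\<phi>_pos[OF x0] \<phi>0[OF x0] by simp
  have D0: "U.D\<phi> m x = 0 \<and> U.D\<phi> (m + 1) x = 0" if "x \<in> S" for x
    by (intro conjI; rule U.lam_const_cases[OF lam0 that]; assumption)
  have K: "U.gauss_curvature x = \<kappa> * \<kappa>" if "x \<in> S" for x using pf(2)[OF that] \<kappa> by simp
  obtain r1 Y A1 A2 where r1: "r1 > 0" "ball x0 r1 \<subseteq> S"
    and smY1: "smooth_on (ball x0 r1) Y" and smA1: "smooth_on (ball x0 r1) A1" and smA2: "smooth_on (ball x0 r1) A2"
    and dY: "\<And>x v. x \<in> ball x0 r1 \<Longrightarrow> dd Y x v = \<kappa> *\<^sub>R ((E m x \<bullet> dd F x v) *\<^sub>R A1 x + (E (m + 1) x \<bullet> dd F x v) *\<^sub>R A2 x)"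
    and pars: "\<And>x a b. x \<in> ball x0 r1 \<Longrightarrow>
       (Y x \<bullet> a) * (Y x \<bullet> b) + (A1 x \<bullet> a) * (A1 x \<bullet> b) + (A2 x \<bullet> a) * (A2 x \<bullet> b) = a \<bullet> (b :: real^3)"
    by (rule U.sphere_frame[OF D0 K x0]) (assumption | rule that)+
  define B where "B = ball x0 r1"
  note smY1 = smY1[folded B_def] and smA1 = smA1[folded B_def] and smA2 = smA2[folded B_def]
    and dY = dY[folded B_def] and pars = pars[folded B_def]
  have oB: "open B" and x0B: "x0 \<in> B" and BS: "B \<subseteq> S" using r1 by (auto simp: B_def)
  note Bsm = smooth_on_subset[OF _ BS]
  have pt: "a = (Y x \<bullet> a) *\<^sub>R Y x + (A1 x \<bullet> a) *\<^sub>R A1 x + (A2 x \<bullet> a) *\<^sub>R A2 x"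
    "Y x \<bullet> Y x = 1" "A1 x \<bullet> A1 x = 1" "A2 x \<bullet> A2 x = 1" "Y x \<bullet> A1 x = 0" "Y x \<bullet> A2 x = 0" "A1 x \<bullet> A2 x = 0" if "x \<in> B" for x a
    using parseval_triple[of "Y x" "A1 x" "A2 x", OF pars[OF that]] by blast+
  obtain T k y and Y2 :: "nat \<Rightarrow> real^'n \<Rightarrow> real^'r" where T: "rigid_motion T" and smk: "smooth_on S k" and smy: "smooth_on S y"
    and smY: "\<And>j. j < m \<Longrightarrow> smooth_on S (Y2 j)"
    and TF: "\<And>x. x \<in> S \<Longrightarrow> T (F x) = (k x, U.\<phi> x *\<^sub>R y x)"
    and yy: "\<And>x. x \<in> S \<Longrightarrow> y x \<bullet> y x = 1"
    and YY: "\<And>x i j. x \<in> S \<Longrightarrow> i < m \<Longrightarrow> j < m \<Longrightarrow> Y2 i x \<bullet> Y2 j x = (if i = j then 1 else 0)"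
    and yY: "\<And>x w. x \<in> S \<Longrightarrow> w = (\<Sum>j<m. (Y2 j x \<bullet> w) *\<^sub>R Y2 j x) + (y x \<bullet> w) *\<^sub>R y x"
    and dy: "\<And>x v. x \<in> S \<Longrightarrow> dd y x v = (1 / U.\<phi> x) *\<^sub>R (\<Sum>j<m. (E j x \<bullet> dd F x v) *\<^sub>R Y2 j x)"
    and dk: "\<And>x v w. x \<in> S \<Longrightarrow> dd k x v \<bullet> dd k x w = dd U.h x v \<bullet> dd U.h x w"
    by (rule leaf_split[OF patch cvx(1) x0 rr]) (assumption | rule that)+
  have dkk: "dd k x v \<bullet> dd k x w = (E m x \<bullet> dd F x v) * (E m x \<bullet> dd F x w) + (E (m + 1) x \<bullet> dd F x v) * (E (m + 1) x \<bullet> dd F x w)"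
    if "x \<in> S" for x v w
    unfolding dk[OF that] U.dh_dh[OF that] pf(5)[OF that] by simp
  define t where "t x = (1 / \<kappa>) *\<^sub>R Y x" for x
  define q where "q x = \<phi>0 *\<^sub>R y x" for x
  have smt: "smooth_on B t" unfolding t_def by (intro smooth_on_scaleR smooth_on_const oB smY1)
  have smq: "smooth_on B q" unfolding q_def by (intro smooth_on_scaleR smooth_on_const oB Bsm[OF smy])
  have ddt: "(t has_derivative (\<lambda>v. (E m x \<bullet> dd F x v) *\<^sub>R A1 x + (E (m + 1) x \<bullet> dd F x v) *\<^sub>R A2 x)) (at x)" if "x \<in> B" for x
  proof -
    have "(t has_derivative (\<lambda>v. (1 / \<kappa>) *\<^sub>R dd Y x v)) (at x)"
      unfolding t_def by (intro has_derivative_scaleR_right smooth_on_has_derivative[OF smY1 that])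
    moreover have "(1 / \<kappa>) *\<^sub>R dd Y x v = (E m x \<bullet> dd F x v) *\<^sub>R A1 x + (E (m + 1) x \<bullet> dd F x v) *\<^sub>R A2 x" for v
      unfolding dY[OF that] using \<kappa>(1) by simp
    ultimately show ?thesis by simp
  qed
  have ddq: "(q has_derivative (\<lambda>v. \<Sum>j<m. (E j x \<bullet> dd F x v) *\<^sub>R Y2 j x)) (at x)" if "x \<in> B" for x
  proof -
    have xS: "x \<in> S" using that BS by blast
    have "(q has_derivative (\<lambda>v. \<phi>0 *\<^sub>R dd y x v)) (at x)"
      unfolding q_def by (intro has_derivative_scaleR_right smooth_on_has_derivative[OF smy xS])
    moreover have "\<phi>0 *\<^sub>R dd y x v = (\<Sum>j<m. (E j x \<bullet> dd F x v) *\<^sub>R Y2 j x)" for v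
      unfolding dy[OF xS] \<phi>0[OF xS] using \<phi>0pos by simp
    ultimately show ?thesis by simp
  qed
  have nt: "norm (t x) = 1 / \<kappa>" if "x \<in> B" for x using pt(2)[OF that] \<kappa> by (simp add: t_def norm_eq_sqrt_inner[of "Y x"])
  have nq: "norm (q x) = \<phi>0" if "x \<in> B" for x
    using yy[of x] that BS \<phi>0pos by (auto simp: q_def norm_eq_sqrt_inner[of "y x"])
  \<comment> \<open>Both factors take values in spheres, so two radial variables are added; the
    target then has dimension 3 + (m + 1) = m + 4.\<close>
  define Z where "Z = (B \<times> {0::real<..}) \<times> {0::real<..}"
  have oB1: "open (B \<times> {0::real<..})" using oB by (intro open_Times open_greaterThan)
  have oZ: "open Z" unfolding Z_def by (rule open_Times[OF oB1 open_greaterThan])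
  have fZ: "smooth_on Z (\<lambda>z. p (fst (fst z)))" if "smooth_on B p" for p :: "real^'n \<Rightarrow> 'z::euclidean_space"
    unfolding Z_def
    by (rule smooth_on_fst_compose[OF oB1 open_greaterThan, where q = "\<lambda>z. p (fst z)"])
      (rule smooth_on_fst_compose[OF oB open_greaterThan that])
  have sZ: "smooth_on Z snd" by (rule smooth_on_bounded_linear[OF bounded_linear_snd])
  have sZ1: "smooth_on Z (\<lambda>z. snd (fst z))"
    unfolding Z_def by (rule smooth_on_fst_compose[OF oB1 open_greaterThan smooth_on_bounded_linear[OF bounded_linear_snd]])
  define b where "b z w i = (if i < m then (Y2 i (fst (fst z)) \<bullet> snd w) / snd z
      else if i = m then (A1 (fst (fst z)) \<bullet> fst w) / snd (fst z) else (A2 (fst (fst z)) \<bullet> fst w) / snd (fst z))"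
    for z :: "((real^'n) \<times> real) \<times> real" and w :: "(real^3) \<times> (real^'r)" and i
  \<comment> \<open>The radial rates divide out the norms of t and q, which are 1 / \<kappa> and
    \<phi>0; hence the factor \<kappa> and the divisor \<phi>0.\<close>
  define L where "L z w = ((\<Sum>i<m+2. b z w i *\<^sub>R \<xi> i (fst (fst z)), (Y (fst (fst z)) \<bullet> fst w) * \<kappa>), (y (fst (fst z)) \<bullet> snd w) / \<phi>0)" for z w
  have smb: "smooth_on Z (\<lambda>z. b z w i)" for w i
  proof -
    have nz: "snd z \<noteq> 0" "snd (fst z) \<noteq> 0" if "z \<in> Z" for z using that by (auto simp: Z_def)
    consider "i < m" | "i = m" | "\<not> i < m" "i \<noteq> m" by blast
    then show ?thesis
    proof cases
      case 1
      have "smooth_on Z (\<lambda>z. (Y2 i (fst (fst z)) \<bullet> snd w) / snd z)"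
        by (intro smooth_on_divide smooth_on_inner smooth_on_const oZ sZ fZ Bsm[OF smY[OF 1]] nz)
      then show ?thesis using 1 by (simp add: b_def)
    next
      case 2
      have "smooth_on Z (\<lambda>z. (A1 (fst (fst z)) \<bullet> fst w) / snd (fst z))"
        by (intro smooth_on_divide smooth_on_inner smooth_on_const oZ sZ1 fZ smA1 nz)
      then show ?thesis using 2 by (simp add: b_def)
    next
      case 3
      have "smooth_on Z (\<lambda>z. (A2 (fst (fst z)) \<bullet> fst w) / snd (fst z))"
        by (intro smooth_on_divide smooth_on_inner smooth_on_const oZ sZ1 fZ smA2 nz)
      then show ?thesis using 3 by (simp add: b_def)
    qed
  qed
  have smL: "smooth_on Z (\<lambda>z. L z w)" for w
    unfolding L_def using \<phi>0pos
    by (intro smooth_on_Pair smooth_on_sum smooth_on_scaleR smooth_on_divide smooth_on_mult smooth_on_inner smooth_on_const oZ smb fZ Bsm[OF U.\<xi>] Bsm[OF smy] smY1) auto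
  define Af where "Af z = snd (fst z) *\<^sub>R t (fst (fst z))" for z :: "((real^'n) \<times> real) \<times> real"
  define Bf where "Bf z = snd z *\<^sub>R q (fst (fst z))" for z :: "((real^'n) \<times> real) \<times> real"
  define hf where "hf z = k (fst (fst z))" for z :: "((real^'n) \<times> real) \<times> real"
  have smAf: "smooth_on Z Af" unfolding Af_def by (intro smooth_on_scaleR oZ sZ1 fZ smt)
  have smBf: "smooth_on Z Bf" unfolding Bf_def by (intro smooth_on_scaleR oZ sZ fZ smq)
  have smhf: "smooth_on Z hf" unfolding hf_def by (intro fZ Bsm[OF smk])
  have inB: "fst (fst z) \<in> B" "fst (fst z) \<in> S" "snd (fst z) > 0" "snd z > 0" if "z \<in> Z" for z using that BS by (auto simp: Z_def)
  have bE: "E i (fst (fst z)) \<bullet> dd F (fst (fst z)) (fst (fst (L z w))) = b z w i" if "z \<in> Z" "i < m + 2" for z w i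
    unfolding L_def fst_conv by (rule U.\<epsilon>_frame_sum[OF inB(2)[OF that(1)] that(2)])
  have b0: "b z w m = (A1 (fst (fst z)) \<bullet> fst w) / snd (fst z)" "b z w (m + 1) = (A2 (fst (fst z)) \<bullet> fst w) / snd (fst z)" for z w
    by (simp_all add: b_def)
  have ff: "((\<lambda>z. fst (fst z)) has_derivative (\<lambda>v. fst (fst v))) (at z)" for z :: "((real^'n) \<times> real) \<times> real"
    by (intro has_derivative_fst has_derivative_ident)
  have e: "E m (fst (fst z)) \<bullet> dd F (fst (fst z)) (fst (fst (L z w))) = (A1 (fst (fst z)) \<bullet> fst w) / snd (fst z)"
    "E (m + 1) (fst (fst z)) \<bullet> dd F (fst (fst z)) (fst (fst (L z w))) = (A2 (fst (fst z)) \<bullet> fst w) / snd (fst z)" if "z \<in> Z" for z w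
    using bE[OF that, of m w] bE[OF that, of "m + 1" w] b0 by simp_all
  have LA: "dd Af z (L z w) = fst w" if z: "z \<in> Z" for z w
  proof -
    let ?x = "fst (fst z)"
    have "(Af has_derivative (\<lambda>v. snd (fst z) *\<^sub>R ((E m ?x \<bullet> dd F ?x (fst (fst v))) *\<^sub>R A1 ?x + (E (m + 1) ?x \<bullet> dd F ?x (fst (fst v))) *\<^sub>R A2 ?x)
       + snd (fst v) *\<^sub>R t ?x)) (at z)"
      unfolding Af_def
      by (intro has_derivative_scaleR has_derivative_snd has_derivative_fst has_derivative_ident
          has_derivative_compose[OF ff ddt[OF inB(1)[OF z]]])
    then have "dd Af z (L z w) = snd (fst z) *\<^sub>R (((A1 ?x \<bullet> fst w) / snd (fst z)) *\<^sub>R A1 ?x + ((A2 ?x \<bullet> fst w) / snd (fst z)) *\<^sub>R A2 ?x)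
       + ((Y ?x \<bullet> fst w) * \<kappa>) *\<^sub>R t ?x"
      using dd_eq[of Af _ z "L z w"] e[OF z, of w] by (simp add: L_def)
    also have "\<dots> = (Y ?x \<bullet> fst w) *\<^sub>R Y ?x + (A1 ?x \<bullet> fst w) *\<^sub>R A1 ?x + (A2 ?x \<bullet> fst w) *\<^sub>R A2 ?x"
      using inB(3)[OF z] \<kappa>(1) by (simp add: t_def scaleR_add_right)
    finally show ?thesis using pt(1)[OF inB(1)[OF z], of "fst w"] by simp
  qed
  have LB: "dd Bf z (L z w) = snd w" if z: "z \<in> Z" for z w
  proof -
    let ?x = "fst (fst z)"
    have "(Bf has_derivative (\<lambda>v. snd z *\<^sub>R (\<Sum>j<m. (E j ?x \<bullet> dd F ?x (fst (fst v))) *\<^sub>R Y2 j ?x) + snd v *\<^sub>R q ?x)) (at z)"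
      unfolding Bf_def
      by (intro has_derivative_scaleR has_derivative_snd has_derivative_ident has_derivative_compose[OF ff ddq[OF inB(1)[OF z]]])
    then have "dd Bf z (L z w) = snd z *\<^sub>R (\<Sum>j<m. (E j ?x \<bullet> dd F ?x (fst (fst (L z w)))) *\<^sub>R Y2 j ?x) + snd (L z w) *\<^sub>R q ?x"
      by (rule dd_eq)
    moreover have "(\<Sum>j<m. (E j ?x \<bullet> dd F ?x (fst (fst (L z w)))) *\<^sub>R Y2 j ?x) = (\<Sum>j<m. ((Y2 j ?x \<bullet> snd w) / snd z) *\<^sub>R Y2 j ?x)"
      by (intro sum.cong refl) (use bE[OF z] in \<open>simp add: b_def\<close>)
    moreover have "snd z *\<^sub>R (\<Sum>j<m. ((Y2 j ?x \<bullet> snd w) / snd z) *\<^sub>R Y2 j ?x) = (\<Sum>j<m. (Y2 j ?x \<bullet> snd w) *\<^sub>R Y2 j ?x)"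
      using inB(4)[OF z] by (simp add: scaleR_sum_right)
    moreover have "snd (L z w) *\<^sub>R q ?x = (y ?x \<bullet> snd w) *\<^sub>R y ?x"
      unfolding L_def snd_conv q_def using \<phi>0pos by simp
    ultimately have "dd Bf z (L z w) = (\<Sum>j<m. (Y2 j ?x \<bullet> snd w) *\<^sub>R Y2 j ?x) + (y ?x \<bullet> snd w) *\<^sub>R y ?x"
      by (simp only:)
    then show ?thesis using yY[OF inB(2)[OF z], of "snd w"] by simp
  qed
  have dhf: "dd hf z v = dd k (fst (fst z)) (fst (fst v))" if "z \<in> Z" for z v
    unfolding hf_def by (rule dd_eq) (rule has_derivative_compose[OF ff smooth_on_has_derivative[OF smk inB(2)[OF that]]])
  have h0: "dd hf z (L z (0, w)) = 0" if z: "z \<in> Z" for z w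
  proof -
    have "dd hf z (L z (0, w)) \<bullet> dd hf z (L z (0, w)) = 0"
      unfolding dhf[OF z] dkk[OF inB(2)[OF z]] e[OF z] by simp
    then show ?thesis by simp
  qed
  have dims: "DIM(((real^'n) \<times> real) \<times> real) = DIM(real^3) + DIM(real^'r)" using n rr by simp
  have z0: "((x0, 1), 1) \<in> Z" using x0B by (simp add: Z_def)
  obtain N r G h' where N: "open N" "((x0, 1), 1) \<in> N" "N \<subseteq> Z" "r > 0"
    "homeomorphism N (ball (Af ((x0, 1), 1)) r \<times> ball (Bf ((x0, 1), 1)) r) (\<lambda>z. (Af z, Bf z)) G"
    "smooth_on (ball (Af ((x0, 1), 1)) r) h'" "\<And>z. z \<in> N \<Longrightarrow> hf z = h' (Af z)"
    "\<And>z w. z \<in> N \<Longrightarrow> dd h' (Af z) w = dd hf z (L z (w, 0))"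
    by (rule local_product[where L = L, OF oZ z0 smAf smBf smhf smL LA LB h0 dims]) (assumption | rule that)+
  define V0 where "V0 = (\<lambda>x. ((x, 1), 1)) -` N"
  have oV0: "open V0" unfolding V0_def by (rule open_vimage[OF N(1)]) (intro continuous_intros)
  have x0V: "x0 \<in> V0" using N(2) by (simp add: V0_def)
  have V0B: "x \<in> B" and V0S: "x \<in> S" and V0N: "((x, 1), 1) \<in> N" if "x \<in> V0" for x
    using that N(3) BS unfolding V0_def Z_def by auto
  define U0 where "U0 = ball (Af ((x0, 1), 1)) r"
  define W0 where "W0 = ball (Bf ((x0, 1), 1)) r"
  note hom = N(5)[folded U0_def W0_def] and smh' = N(6)[folded U0_def]
  define U1 where "U1 = U0 \<inter> sphere 0 (1 / \<kappa>)"
  define W1 where "W1 = W0 \<inter> sphere 0 \<phi>0"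
  define \<Theta> where "\<Theta> x = (t x, q x)" for x
  have AB1: "Af ((x, 1), 1) = t x" "Bf ((x, 1), 1) = q x" for x by (simp_all add: Af_def Bf_def)
  have GN: "G p \<in> N" "Af (G p) = fst p" "Bf (G p) = snd p" if "p \<in> U0 \<times> W0" for p
    using homeomorphism_image2[OF hom] homeomorphism_apply2[OF hom that] that by auto
  have NUW: "(Af z, Bf z) \<in> U0 \<times> W0" "G (Af z, Bf z) = z" if "z \<in> N" for z
    using homeomorphism_image1[OF hom] homeomorphism_apply1[OF hom that] that by blast+
  have sA: "norm (Af z) = snd (fst z) / \<kappa>" "norm (Bf z) = snd z * \<phi>0" if "z \<in> Z" for z
    using inB[OF that] nt[OF inB(1)[OF that]] nq[OF inB(1)[OF that]] by (simp_all add: Af_def Bf_def)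
  have \<Theta>P: "\<Theta> x \<in> U1 \<times> W1" if "x \<in> V0" for x
    using NUW(1)[OF V0N[OF that]] nt[OF V0B[OF that]] nq[OF V0B[OF that]] by (simp add: U1_def W1_def \<Theta>_def AB1)
  have G1: "fst (fst (G p)) \<in> V0 \<and> \<Theta> (fst (fst (G p))) = p" if p: "p \<in> U1 \<times> W1" for p
  proof -
    have p2: "p \<in> U0 \<times> W0" and n1: "norm (fst p) = 1 / \<kappa>" "norm (snd p) = \<phi>0" using p by (auto simp: U1_def W1_def)
    have zZ: "G p \<in> Z" using GN(1)[OF p2] N(3) by blast
    have "snd (fst (G p)) = 1" using sA(1)[OF zZ] GN(2)[OF p2] n1 \<kappa>(1) by (simp add: field_simps)
    moreover have "snd (G p) = 1" using sA(2)[OF zZ] GN(3)[OF p2] n1 \<phi>0pos by simp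
    ultimately have e: "G p = ((fst (fst (G p)), 1), 1)" by (simp add: prod_eq_iff)
    have "fst (fst (G p)) \<in> V0" using GN(1)[OF p2] e by (simp add: V0_def)
    moreover have "\<Theta> (fst (fst (G p))) = p"
      using GN(2,3)[OF p2] AB1[of "fst (fst (G p))"] e by (simp add: \<Theta>_def prod_eq_iff)
    ultimately show ?thesis ..
  qed
  have hom\<Theta>: "homeomorphism V0 (U1 \<times> W1) \<Theta> (\<lambda>p. fst (fst (G p)))"
  proof (rule homeomorphismI)
    show "continuous_on V0 \<Theta>" unfolding \<Theta>_def
      by (intro continuous_intros continuous_on_subset[OF smooth_on_continuous_on[OF smt]] continuous_on_subset[OF smooth_on_continuous_on[OF smq]])
        (use V0B in blast)+
    have "U1 \<times> W1 \<subseteq> U0 \<times> W0" by (auto simp: U1_def W1_def)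
    then show "continuous_on (U1 \<times> W1) (\<lambda>p. fst (fst (G p)))"
      by (intro continuous_on_fst continuous_on_subset[OF homeomorphism_cont2[OF hom]])
    show "\<Theta> ` V0 \<subseteq> U1 \<times> W1" using \<Theta>P by blast
    show "(\<lambda>p. fst (fst (G p))) ` (U1 \<times> W1) \<subseteq> V0" using G1 by blast
    show "fst (fst (G (\<Theta> x))) = x" if "x \<in> V0" for x
      using NUW(2)[OF V0N[OF that]] by (simp add: \<Theta>_def AB1)
    show "\<Theta> (fst (fst (G p))) = p" if "p \<in> U1 \<times> W1" for p using G1[OF that] ..
  qed
  have V0c: "V0 \<subseteq> coords c UNIV" using V0S cvx(2) by blast
  have iso: "isometric_on V0 (g c) \<Theta> euclidean_metric"
    unfolding isometric_on_def
  proof (intro conjI ballI allI)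
    show "smooth_on V0 \<Theta>" unfolding \<Theta>_def
      by (intro smooth_on_Pair oV0 smooth_on_subset[OF smt] smooth_on_subset[OF smq]) (use V0B in blast)+
    fix x v w assume x: "x \<in> V0"
    note xB = V0B[OF x] and xS = V0S[OF x]
    have D: "dd \<Theta> x v = ((E m x \<bullet> dd F x v) *\<^sub>R A1 x + (E (m + 1) x \<bullet> dd F x v) *\<^sub>R A2 x, \<Sum>j<m. (E j x \<bullet> dd F x v) *\<^sub>R Y2 j x)" for v
      unfolding \<Theta>_def by (rule dd_eq) (intro has_derivative_Pair ddt[OF xB] ddq[OF xB])
    have "(\<Sum>j<m. (E j x \<bullet> dd F x v) *\<^sub>R Y2 j x) \<bullet> (\<Sum>i<m. (E i x \<bullet> dd F x w) *\<^sub>R Y2 i x)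
        = (\<Sum>j<m. (E j x \<bullet> dd F x v) * (E j x \<bullet> dd F x w))"
      unfolding inner_sum_left
    proof (intro sum.cong refl)
      fix j assume j: "j \<in> {..<m}"
      have "Y2 j x \<bullet> (\<Sum>i<m. (E i x \<bullet> dd F x w) *\<^sub>R Y2 i x) = (\<Sum>i<m. if i = j then E i x \<bullet> dd F x w else 0)"
        unfolding inner_sum_right using YY[OF xS] j by (intro sum.cong refl) auto
      then show "((E j x \<bullet> dd F x v) *\<^sub>R Y2 j x) \<bullet> (\<Sum>i<m. (E i x \<bullet> dd F x w) *\<^sub>R Y2 i x) = (E j x \<bullet> dd F x v) * (E j x \<bullet> dd F x w)"
        using j by (simp add: sum.delta)
    qed
    moreover have "((E m x \<bullet> dd F x v) *\<^sub>R A1 x + (E (m + 1) x \<bullet> dd F x v) *\<^sub>R A2 x) \<bullet> ((E m x \<bullet> dd F x w) *\<^sub>R A1 x + (E (m + 1) x \<bullet> dd F x w) *\<^sub>R A2 x)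
       = (E m x \<bullet> dd F x v) * (E m x \<bullet> dd F x w) + (E (m + 1) x \<bullet> dd F x v) * (E (m + 1) x \<bullet> dd F x w)"
      using pt(3,4,7)[OF xB] by (simp add: inner_add_left inner_add_right inner_commute[of "A2 x" "A1 x"])
    ultimately show "euclidean_metric (\<Theta> x) (dd \<Theta> x v) (dd \<Theta> x w) = g c x v w"
      unfolding euclidean_metric_def D inner_Pair met[OF xS] U.dF_dF[OF xS] by simp
  qed
  define V where "V = param c ` V0"
  note ci = chart_isometry[OF A g c oV0 V0c hom\<Theta> iso, folded V_def]
  have Vx: "\<exists>x\<in>V0. p = param c x \<and> snd c p = x" if "p \<in> V" for p
    using that V0c param_coords(3)[OF A c] by (auto simp: V_def)
  \<comment> \<open>Reading off the norm of \<open>Af\<close> shows that a point over the sphere of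
    radius 1 / \<kappa> has first radial variable 1, where the derivative of h' compares with dk
    without scaling.\<close>
  have U1z: "\<exists>z\<in>N. Af z = a \<and> snd (fst z) = 1" if "a \<in> U1" for a
  proof -
    have q: "(a, Bf ((x0, 1), 1)) \<in> U0 \<times> W0" using that N(4) by (auto simp: W0_def U1_def)
    note z = GN[OF q]
    have "norm a = 1 / \<kappa>" using that by (simp add: U1_def)
    then have "snd (fst (G (a, Bf ((x0, 1), 1)))) = 1"
      using sA(1)[OF subsetD[OF N(3) z(1)]] z(2) \<kappa>(1) by (simp add: field_simps)
    then show ?thesis using z by auto
  qed
  have rad: "1 / sqrt \<rho> = 1 / \<kappa>" "sqrt ((real CARD('n) - 3) / \<rho>) = \<phi>0"
    using n by (simp_all add: \<kappa>_def \<phi>0_def)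
  have opU: "openin (top_of_set (sphere 0 (1 / \<kappa>))) U1" "openin (top_of_set (sphere 0 \<phi>0)) W1"
    by (auto simp: openin_open U1_def W1_def U0_def W0_def)
  have "clifford_product A g \<rho> V (T \<circ> f)"
    unfolding clifford_product_def rad
  proof (intro exI conjI)
    show "\<rho> > 0" by (fact \<rho>)
    show "isometry_onto A g V (\<Theta> \<circ> snd c) (U1 \<times> W1) euclidean_metric" by (fact ci(2))
    show "sphere_isometric_immersion (1 / \<kappa>) U1 h'"
      unfolding sphere_isometric_immersion_def
    proof (intro conjI ballI allI impI exI[of _ U0])
      show "open U0" "U1 \<subseteq> U0" "smooth_on U0 h'" using smh' by (auto simp: U0_def U1_def)
      fix a v w assume a: "a \<in> U1" and vw: "v \<bullet> a = 0 \<and> w \<bullet> a = 0"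
      obtain z where z: "z \<in> N" "Af z = a" "snd (fst z) = 1" using U1z[OF a] by blast
      let ?x = "fst (fst z)"
      have zZ: "z \<in> Z" using z(1) N(3) by blast
      \<comment> \<open>Tangency to the sphere means orthogonality to Y, so Parseval leaves the
        components along \<open>A1\<close> and \<open>A2\<close>.\<close>
      have "a = (1 / \<kappa>) *\<^sub>R Y ?x" using z(2,3) by (auto simp: Af_def t_def)
      then have v0: "Y ?x \<bullet> v = 0" using vw \<kappa>(1) by (auto simp: inner_commute)
      have D: "dd h' a v = dd k ?x (fst (fst (L z (v, 0))))" for v
        using N(8)[OF z(1), of v] unfolding z(2) dhf[OF zZ] .
      have "dd h' a v \<bullet> dd h' a w = (A1 ?x \<bullet> v) * (A1 ?x \<bullet> w) + (A2 ?x \<bullet> v) * (A2 ?x \<bullet> w)"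
        unfolding D dkk[OF inB(2)[OF zZ]] e[OF zZ] using z(3) by simp
      then show "dd h' a v \<bullet> dd h' a w = v \<bullet> w" using pars[OF inB(1)[OF zZ], of v w] v0 by simp
    qed (fact opU(1))
    show "\<forall>p\<in>V. (T \<circ> f) p = (h' (fst ((\<Theta> \<circ> snd c) p)), snd ((\<Theta> \<circ> snd c) p))"
    proof
      fix p assume "p \<in> V"
      then obtain x where x: "x \<in> V0" "p = param c x" "snd c p = x" using Vx by blast
      note xS = V0S[OF x(1)]
      have "(T \<circ> f) p = (k x, q x)" using TF[OF xS] Ff[OF xS] \<phi>0[OF xS] x(2) by (simp add: q_def)
      also have "k x = h' (t x)" using N(7)[OF V0N[OF x(1)]] by (simp add: hf_def AB1)
      finally show "(T \<circ> f) p = (h' (fst ((\<Theta> \<circ> snd c) p)), snd ((\<Theta> \<circ> snd c) p))"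
        using x(3) by (simp add: \<Theta>_def)
    qed
  qed (fact opU)+
  moreover have "param c x0 \<in> V" using x0V by (simp add: V_def)
  ultimately show ?thesis using ci(1) T by blast
qed

text \<open>The trace of a rank one map l \<otimes> \<xi> is the value l(\<xi>), and traces add up;
  this evaluates \<open>ricci\<close> directly in the frame.\<close>

lemma trace_matrix_sum:
  fixes \<xi> :: "'i \<Rightarrow> real^'n"
  assumes "\<And>k. k \<in> I \<Longrightarrow> linear (l k)"
  shows "trace (matrix (\<lambda>u. \<Sum>k\<in>I. l k u *\<^sub>R \<xi> k)) = (\<Sum>k\<in>I. l k (\<xi> k))"
proof -
  have "l k (\<xi> k) = (\<Sum>i\<in>UNIV. l k (axis i 1) * \<xi> k $ i)" if "k \<in> I" for k
  proof -
    have "l k (\<xi> k) = l k (\<Sum>i\<in>UNIV. (\<xi> k $ i) *s axis i 1)" by (simp only: basis_expansion)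
    also have "\<dots> = (\<Sum>i\<in>UNIV. (\<xi> k $ i) * l k (axis i 1))"
      by (simp only: linear_sum[OF assms[OF that]] scalar_mult_eq_scaleR linear_scale[OF assms[OF that]] real_scaleR_def)
    finally show ?thesis by (simp only: mult.commute)
  qed
  then show ?thesis
    by (simp add: trace_def matrix_def sum.swap[of _ UNIV I])
qed

section \<open>The Gauss equation in orthonormal frames\<close>

text \<open>Orthonormal frames play the part of the inverse metric: every tangential projection is
  an explicit finite sum, which makes the Christoffel symbols computable and smooth.\<close>

locale framed_immersion =
  fixes S :: "(real^'n) set" and F :: "real^'n \<Rightarrow> 'b::euclidean_space" and G :: "(real^'n) metric_field"
    and \<xi> :: "nat \<Rightarrow> real^'n \<Rightarrow> real^'n" and E :: "nat \<Rightarrow> real^'n \<Rightarrow> 'b" and N :: nat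
  assumes S: "open S" and F: "smooth_on S F"
    and \<xi>: "i < N \<Longrightarrow> smooth_on S (\<xi> i)"
    and E_eq: "x \<in> S \<Longrightarrow> i < N \<Longrightarrow> dd F x (\<xi> i x) = E i x"
    and orth: "x \<in> S \<Longrightarrow> i < N \<Longrightarrow> j < N \<Longrightarrow> E i x \<bullet> E j x = (if i = j then 1 else 0)"
    and frame: "x \<in> S \<Longrightarrow> v = (\<Sum>i<N. (E i x \<bullet> dd F x v) *\<^sub>R \<xi> i x)"
    and met: "x \<in> S \<Longrightarrow> G x v w = dd F x v \<bullet> dd F x w"
begin

abbreviation hess :: "real^'n \<Rightarrow> real^'n \<Rightarrow> real^'n \<Rightarrow> 'b" where "hess x v w \<equiv> dd (\<lambda>z. dd F z w) x v"
abbreviation \<alpha> :: "real^'n \<Rightarrow> real^'n \<Rightarrow> real^'n \<Rightarrow> 'b" where "\<alpha> \<equiv> second_fundamental_form G F"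

lemma smooth_E: "i < N \<Longrightarrow> smooth_on S (E i)"
  using smooth_on_cong[OF S, of "\<lambda>x. dd F x (\<xi> i x)" "E i"] E_eq smooth_on_dd_field[OF S F \<xi>] by simp

lemma linear_dF: "x \<in> S \<Longrightarrow> linear (dd F x)"
  using linear_dd smooth_on_differentiable[OF F] by blast

lemma dF_expand: "x \<in> S \<Longrightarrow> dd F x v = (\<Sum>i<N. (E i x \<bullet> dd F x v) *\<^sub>R E i x)"
proof -
  assume x: "x \<in> S"
  have "dd F x v = dd F x (\<Sum>i<N. (E i x \<bullet> dd F x v) *\<^sub>R \<xi> i x)" using frame[OF x, of v] by simp
  also have "\<dots> = (\<Sum>i<N. (E i x \<bullet> dd F x v) *\<^sub>R dd F x (\<xi> i x))"
    by (simp only: linear_sum[OF linear_dF[OF x]] linear_scale[OF linear_dF[OF x]])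
  finally show ?thesis using E_eq[OF x] by simp
qed

lemma inner_dF: "x \<in> S \<Longrightarrow> u \<bullet> dd F x v = (\<Sum>i<N. (E i x \<bullet> dd F x v) * (E i x \<bullet> u))"
proof -
  assume x: "x \<in> S"
  have "u \<bullet> dd F x v = u \<bullet> (\<Sum>i<N. (E i x \<bullet> dd F x v) *\<^sub>R E i x)" by (rule arg_cong[OF dF_expand[OF x]])
  then show ?thesis by (simp add: inner_sum_right inner_commute[of u])
qed

lemma vector_eqI:
  assumes x: "x \<in> S" and e: "\<And>y. dd F x u \<bullet> dd F x y = dd F x v \<bullet> dd F x y"
  shows "u = v"
proof -
  have "E i x \<bullet> dd F x u = E i x \<bullet> dd F x v" if "i < N" for i
    using e[of "\<xi> i x"] E_eq[OF x that] by (simp add: inner_commute)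
  then have "(\<Sum>i<N. (E i x \<bullet> dd F x u) *\<^sub>R \<xi> i x) = (\<Sum>i<N. (E i x \<bullet> dd F x v) *\<^sub>R \<xi> i x)" by simp
  then show ?thesis using frame[OF x, of u] frame[OF x, of v] by simp
qed

lemma dF_comb: "x \<in> S \<Longrightarrow> dd F x (\<Sum>k<N. a k *\<^sub>R \<xi> k x) = (\<Sum>k<N. a k *\<^sub>R E k x)"
  using E_eq[of x] by (simp add: linear_sum[OF linear_dF] linear_scale[OF linear_dF])

lemma hess_sym: "x \<in> S \<Longrightarrow> hess x v w = hess x w v"
  by (rule dd_dd_commute[OF F S])

lemma linear_hess: "x \<in> S \<Longrightarrow> linear (\<lambda>v. hess x v w)"
  using linear_dd[OF smooth_on_differentiable[OF smooth_on_dd[OF F]]] .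

lemma dF_dF_deriv: "x \<in> S \<Longrightarrow> dd (\<lambda>x. G x w y) x v = dd F x w \<bullet> hess x v y + hess x v w \<bullet> dd F x y"
proof -
  assume x: "x \<in> S"
  have "dd (\<lambda>x. G x w y) x = dd (\<lambda>z. dd F z w \<bullet> dd F z y) x" by (rule dd_cong_open[OF S x met])
  then show ?thesis
    using dd_inner[OF smooth_on_differentiable[OF smooth_on_dd[OF F] x] smooth_on_differentiable[OF smooth_on_dd[OF F] x], of w y v] by simp
qed

text \<open>By the symmetry of \<open>hess\<close> the Koszul expression collapses to twice the
  product of \<open>hess x v w\<close> with dF y. The Christoffel symbol is thus the tangential part
  of the Hessian, and \<open>vector_eqI\<close> gives the uniqueness that \<open>THE\<close>
  requires.\<close>

lemma christoffel_eq:
  assumes x: "x \<in> S"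
  shows "christoffel G x v w = (\<Sum>k<N. (E k x \<bullet> hess x v w) *\<^sub>R \<xi> k x)" (is "_ = ?z")
proof -
  have K: "dd (\<lambda>x. G x w y) x v + dd (\<lambda>x. G x v y) x w - dd (\<lambda>x. G x v w) x y = 2 * (hess x v w \<bullet> dd F x y)" for y
    unfolding dF_dF_deriv[OF x] using hess_sym[OF x, of v w] hess_sym[OF x, of v y] hess_sym[OF x, of w y]
    by (simp add: inner_commute)
  have z: "dd F x ?z \<bullet> dd F x y = hess x v w \<bullet> dd F x y" for y
    unfolding dF_comb[OF x] inner_dF[OF x, of "hess x v w"] by (simp add: inner_sum_left mult.commute)
  show ?thesis unfolding christoffel_def K
  proof (rule the_equality)
    show "\<forall>y. 2 * G x ?z y = 2 * (hess x v w \<bullet> dd F x y)" unfolding met[OF x] using z by simp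
    fix u assume "\<forall>y. 2 * G x u y = 2 * (hess x v w \<bullet> dd F x y)"
    then have "dd F x u \<bullet> dd F x y = dd F x ?z \<bullet> dd F x y" for y unfolding met[OF x] z by simp
    then show "u = ?z" by (rule vector_eqI[OF x])
  qed
qed

definition nor :: "real^'n \<Rightarrow> 'b \<Rightarrow> 'b" where "nor x u = u - (\<Sum>k<N. (E k x \<bullet> u) *\<^sub>R E k x)"

lemma E_nor: "x \<in> S \<Longrightarrow> k < N \<Longrightarrow> E k x \<bullet> nor x u = 0"
proof -
  assume x: "x \<in> S" and k: "k < N"
  have "orthonormal N (\<lambda>i. E i x)" using orth[OF x] by (simp add: orthonormal_def)
  from projection_facts(3)[OF this k] show ?thesis by (simp add: nor_def inner_diff_right)
qed

lemma linear_nor: "linear (nor x)"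
  unfolding nor_def by (intro linearI)
    (simp_all add: inner_add_right scaleR_add_left sum.distrib scaleR_sum_right scaleR_diff_right algebra_simps)

lemma nor_dF: "x \<in> S \<Longrightarrow> nor x (dd F x v) = 0"
  unfolding nor_def by (simp only: dF_expand[symmetric] diff_self)

lemma nor_normal: "x \<in> S \<Longrightarrow> nor x u \<bullet> dd F x v = 0"
  by (simp add: inner_dF E_nor)

lemma dF_christoffel: "x \<in> S \<Longrightarrow> dd F x (christoffel G x v w) = hess x v w - nor x (hess x v w)"
  unfolding christoffel_eq dF_comb nor_def by simp

lemma \<alpha>_eq: "x \<in> S \<Longrightarrow> \<alpha> x v w = nor x (hess x v w)"
  unfolding second_fundamental_form_def dF_christoffel by simp

lemma \<alpha>_sym: "x \<in> S \<Longrightarrow> \<alpha> x v w = \<alpha> x w v"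
  using \<alpha>_eq hess_sym by simp

lemma linear_\<alpha>: "x \<in> S \<Longrightarrow> linear (\<lambda>v. \<alpha> x v w)"
  using linear_compose[OF linear_hess[where x = x and w = w] linear_nor[where x = x]] by (simp add: o_def \<alpha>_eq)

lemma \<alpha>_normal: "x \<in> S \<Longrightarrow> \<alpha> x v w \<bullet> dd F x u = 0"
  by (simp add: \<alpha>_eq nor_normal)

lemma hess_split: "x \<in> S \<Longrightarrow> hess x v w = \<alpha> x v w + dd F x (christoffel G x v w)"
  by (simp add: \<alpha>_eq dF_christoffel)

lemma smooth_hess: "smooth_on S (\<lambda>x. hess x v w)"
  by (rule smooth_on_dd[OF smooth_on_dd[OF F]])

lemma smooth_\<alpha>: "smooth_on S (\<lambda>x. \<alpha> x v w)"
proof -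
  have "smooth_on S (\<lambda>x. nor x (hess x v w))"
    unfolding nor_def by (intro smooth_on_diff smooth_on_sum smooth_on_scaleR smooth_on_inner S smooth_hess smooth_E) auto
  then show ?thesis using smooth_on_cong[OF S \<alpha>_eq] by simp
qed

lemma smooth_christoffel: "smooth_on S (\<lambda>x. christoffel G x v w)"
proof -
  have "smooth_on S (\<lambda>x. \<Sum>k<N. (E k x \<bullet> hess x v w) *\<^sub>R \<xi> k x)"
    by (intro smooth_on_sum smooth_on_scaleR smooth_on_inner S smooth_hess smooth_E \<xi>) auto
  then show ?thesis using smooth_on_cong[OF S christoffel_eq] by simp
qed

lemma nor_dE: 
  assumes x: "x \<in> S" and i: "i < N"
  shows "nor x (dd (E i) x v) = \<alpha> x v (\<xi> i x)"
proof -
  have "dd (E i) x = dd (\<lambda>z. dd F z (\<xi> i z)) x"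
    by (rule dd_cong_open[OF S x]) (use E_eq i in metis)
  then have "dd (E i) x v = hess x v (\<xi> i x) + dd F x (dd (\<xi> i) x v)"
    using dd_dd_field[OF S x F \<xi>[OF i], of v] by simp
  then show ?thesis by (simp add: linear_add[OF linear_nor] nor_dF[OF x] \<alpha>_eq[OF x])
qed

text \<open>The Hessian is \<open>\<alpha>\<close> plus the image of the connection. On
  differentiating, the third derivatives of F cancel in the antisymmetrization, and since
  \<open>\<alpha>\<close> is normal its derivative can be moved onto dF, where it becomes a product
  of two second fundamental forms.\<close>

lemma gauss_equation:
  assumes x: "x \<in> S"
  shows "dd F x (curvature G x u v w) \<bullet> dd F x z = \<alpha> x v w \<bullet> \<alpha> x u z - \<alpha> x u w \<bullet> \<alpha> x v z"
proof -
  let ?\<Gamma> = "\<lambda>v w x. christoffel G x v w"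
  note D = smooth_on_differentiable[OF _ x]
  have 1: "dd F x (dd (?\<Gamma> v w) x u + christoffel G x u (christoffel G x v w)) \<bullet> dd F x z
     = dd (\<lambda>x. hess x v w) x u \<bullet> dd F x z + \<alpha> x v w \<bullet> \<alpha> x u z" for u v
  proof -
    have "dd (\<lambda>y. dd F y (?\<Gamma> v w y)) x = dd (\<lambda>y. hess y v w - \<alpha> y v w) x"
      by (rule dd_cong_open[OF S x]) (simp add: hess_split)
    moreover have "dd (\<lambda>y. hess y v w - \<alpha> y v w) x u = dd (\<lambda>y. hess y v w) x u - dd (\<lambda>y. \<alpha> y v w) x u"
      by (rule dd_eq) (intro has_derivative_diff smooth_on_has_derivative[OF _ x] smooth_hess smooth_\<alpha>)
    ultimately have a: "hess x u (?\<Gamma> v w x) + dd F x (dd (?\<Gamma> v w) x u) = dd (\<lambda>y. hess y v w) x u - dd (\<lambda>y. \<alpha> y v w) x u"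
      using dd_dd_field[OF S x F smooth_christoffel[of v w], of u] by simp
    have "dd (\<lambda>y. \<alpha> y v w \<bullet> dd F y z) x = dd (\<lambda>y. 0) x"
      by (rule dd_cong_open[OF S x \<alpha>_normal])
    then have b: "\<alpha> x v w \<bullet> hess x u z + dd (\<lambda>y. \<alpha> y v w) x u \<bullet> dd F x z = 0"
      using dd_inner[OF D[OF smooth_\<alpha>] D[OF smooth_on_dd[OF F]], of v w z u] by (simp add: frechet_derivative_const)
    have c: "\<alpha> x v w \<bullet> hess x u z = \<alpha> x v w \<bullet> \<alpha> x u z"
      using hess_split[OF x, where v = u and w = z] \<alpha>_normal[OF x] by (simp add: inner_add_right)
    have d: "dd F x (christoffel G x u (?\<Gamma> v w x)) = hess x u (?\<Gamma> v w x) - \<alpha> x u (?\<Gamma> v w x)"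
      using hess_split[OF x, where v = u and w = "?\<Gamma> v w x"] by simp
    have "dd F x (dd (?\<Gamma> v w) x u + christoffel G x u (?\<Gamma> v w x))
      = dd (\<lambda>y. hess y v w) x u - dd (\<lambda>y. \<alpha> y v w) x u - \<alpha> x u (?\<Gamma> v w x)"
      unfolding linear_add[OF linear_dF[OF x]] d using a by (simp add: algebra_simps)
    then show ?thesis using b c \<alpha>_normal[OF x, of u "?\<Gamma> v w x" z] by (simp add: inner_diff_left)
  qed
  have 2: "dd (\<lambda>x. hess x v w) x u = dd (\<lambda>x. hess x u w) x v"
    by (rule dd_dd_commute[OF smooth_on_dd[OF F] S x])
  show ?thesis unfolding curvature_def linear_diff[OF linear_dF[OF x]] inner_diff_left 1 2 by simp
qed

lemma curvature_eq:
  assumes x: "x \<in> S"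
  shows "curvature G x u v w = (\<Sum>k<N. (\<alpha> x v w \<bullet> \<alpha> x u (\<xi> k x) - \<alpha> x u w \<bullet> \<alpha> x v (\<xi> k x)) *\<^sub>R \<xi> k x)"
proof -
  have "E k x \<bullet> dd F x (curvature G x u v w) = \<alpha> x v w \<bullet> \<alpha> x u (\<xi> k x) - \<alpha> x u w \<bullet> \<alpha> x v (\<xi> k x)" if "k < N" for k
    using gauss_equation[OF x, of u v w "\<xi> k x"] E_eq[OF x that] by (simp add: inner_commute)
  then show ?thesis using frame[OF x, of "curvature G x u v w"] by simp
qed

lemma ricci_eq:
  assumes x: "x \<in> S"
  shows "ricci G x v w = (\<Sum>k<N. \<alpha> x v w \<bullet> \<alpha> x (\<xi> k x) (\<xi> k x) - \<alpha> x (\<xi> k x) w \<bullet> \<alpha> x v (\<xi> k x))"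
  unfolding ricci_def curvature_eq[OF x]
proof (rule trace_matrix_sum)
  fix k
  show "linear (\<lambda>u. \<alpha> x v w \<bullet> \<alpha> x u (\<xi> k x) - \<alpha> x u w \<bullet> \<alpha> x v (\<xi> k x))"
    by (intro linearI) (simp_all add: linear_add[OF linear_\<alpha>[OF x]] linear_scale[OF linear_\<alpha>[OF x]] inner_add_right inner_add_left algebra_simps)
qed

end

lemma (in framed_immersion) nor_inner:
  assumes "\<And>k. k < N \<Longrightarrow> E k x \<bullet> y = 0"
  shows "nor x u \<bullet> y = u \<bullet> y"
  using assms by (simp add: nor_def inner_diff_left inner_sum_left)

text \<open>Meant for \<open>\<alpha>\<close> split into an umbilical part along h and a quadratic
  form in the two complementary coordinates. That form contributes (p1 * q2 - q1 * p2)^2 times P . R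
  - Q . Q, which \<open>pr\<close> kills; mixed terms vanish by orthogonality to h.\<close>

lemma gauss_surface_identity:
  fixes h P Q R :: "'b::real_inner"
  assumes "P \<bullet> h = 0" "R \<bullet> h = 0" "Q \<bullet> h = 0" and pr: "P \<bullet> R = Q \<bullet> Q"
  shows "(g2 *\<^sub>R h + (p2 * p2) *\<^sub>R P + (p2 * q2 + q2 * p2) *\<^sub>R Q + (q2 * q2) *\<^sub>R R)
      \<bullet> (g1 *\<^sub>R h + (p1 * p1) *\<^sub>R P + (p1 * q1 + q1 * p1) *\<^sub>R Q + (q1 * q1) *\<^sub>R R)
    - (g *\<^sub>R h + (p1 * p2) *\<^sub>R P + (p1 * q2 + q1 * p2) *\<^sub>R Q + (q1 * q2) *\<^sub>R R)
      \<bullet> (g *\<^sub>R h + (p1 * p2) *\<^sub>R P + (p1 * q2 + q1 * p2) *\<^sub>R Q + (q1 * q2) *\<^sub>R R)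
    = (h \<bullet> h) * (g1 * g2 - g\<^sup>2)"
proof -
  have E: "(g2 *\<^sub>R h + a *\<^sub>R P + b *\<^sub>R Q + c *\<^sub>R R) \<bullet> (g1 *\<^sub>R h + a' *\<^sub>R P + b' *\<^sub>R Q + c' *\<^sub>R R)
    = g1 * g2 * (h \<bullet> h) + a * a' * (P \<bullet> P) + (a * c' + c * a' + b * b') * (Q \<bullet> Q) + (a * b' + b * a') * (P \<bullet> Q)
      + (b * c' + c * b') * (Q \<bullet> R) + c * c' * (R \<bullet> R)" for g1 g2 a b c a' b' c'
    using assms(1-3) inner_commute[of h P] inner_commute[of h Q] inner_commute[of h R] inner_commute[of Q P] inner_commute[of R Q] inner_commute[of R P] pr
    by (simp add: inner_add_left inner_add_right distrib_left distrib_right)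
  show ?thesis unfolding E by algebra
qed

text \<open>Here the Einstein condition is still stated by the Ricci tensor;
  \<open>einstein_algebra\<close> translates it into the extrinsic conditions of
  \<open>umbilic_patch\<close>.\<close>

locale umbilical_frame = framed_immersion S F G \<xi> E "m + 2"
  for S :: "(real^'n) set" and F :: "real^'n \<Rightarrow> 'b::euclidean_space" and G :: "(real^'n) metric_field"
    and \<xi> :: "nat \<Rightarrow> real^'n \<Rightarrow> real^'n" and E :: "nat \<Rightarrow> real^'n \<Rightarrow> 'b" and m :: nat +
  fixes \<eta> :: "real^'n \<Rightarrow> 'b" and \<rho> :: real
  assumes \<eta>: "smooth_on S \<eta>" and \<eta>_normal: "x \<in> S \<Longrightarrow> \<eta> x \<bullet> dd F x v = 0" and \<eta>_nz: "x \<in> S \<Longrightarrow> \<eta> x \<noteq> 0"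
    and umbilic: "x \<in> S \<Longrightarrow> i < m \<Longrightarrow> \<alpha> x (\<xi> i x) w = G x (\<xi> i x) w *\<^sub>R \<eta> x"
    and ein: "x \<in> S \<Longrightarrow> ricci G x v w = \<rho> * G x v w" and m: "m \<ge> 2"
begin

abbreviation \<mu> :: "real^'n \<Rightarrow> real" where "\<mu> x \<equiv> (\<rho> - (real m - 1) * (\<eta> x \<bullet> \<eta> x)) / 2"

lemma G_\<xi>: "x \<in> S \<Longrightarrow> i < m + 2 \<Longrightarrow> G x (\<xi> i x) w = E i x \<bullet> dd F x w"
  by (simp add: met E_eq)

lemma G_\<xi>_\<xi>: "x \<in> S \<Longrightarrow> i < m + 2 \<Longrightarrow> j < m + 2 \<Longrightarrow> G x (\<xi> i x) (\<xi> j x) = (if i = j then 1 else 0)"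
  by (simp add: G_\<xi> E_eq orth)

lemma \<alpha>_\<xi>: "x \<in> S \<Longrightarrow> i < m \<Longrightarrow> j < m + 2 \<Longrightarrow> \<alpha> x (\<xi> i x) (\<xi> j x) = (if i = j then \<eta> x else 0)"
  "x \<in> S \<Longrightarrow> i < m \<Longrightarrow> j < m + 2 \<Longrightarrow> \<alpha> x (\<xi> j x) (\<xi> i x) = (if i = j then \<eta> x else 0)"
  using umbilic[of x i "\<xi> j x"] G_\<xi>_\<xi>[of x i j] \<alpha>_sym[of x "\<xi> i x" "\<xi> j x"] by auto

text \<open>With K = a . d - b . b, the Ricci curvature on the complement gives m * (a . \<eta>) + K
  = \<rho> = m * (d . \<eta>) + K and m * (b . \<eta>) = 0; in a leaf direction it gives (m - 1) *
  (\<eta> . \<eta>) + a . \<eta> + d . \<eta> = \<rho>. These equations are solved for the four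
  quantities.\<close>

lemma einstein_algebra:
  assumes x: "x \<in> S"
  defines "a \<equiv> \<alpha> x (\<xi> m x) (\<xi> m x)" and "b \<equiv> \<alpha> x (\<xi> m x) (\<xi> (m + 1) x)" and "d \<equiv> \<alpha> x (\<xi> (m + 1) x) (\<xi> (m + 1) x)"
  shows "a \<bullet> \<eta> x = \<mu> x" "d \<bullet> \<eta> x = \<mu> x" "b \<bullet> \<eta> x = 0" "a \<bullet> d - b \<bullet> b = \<rho> - real m * \<mu> x"
proof -
  have b': "\<alpha> x (\<xi> (m + 1) x) (\<xi> m x) = b" unfolding b_def by (rule \<alpha>_sym[OF x])
  have m2: "m < m + 2" "m + 1 < m + 2" "0 < m + 2" "0 < m" using m by auto
  have R: "ricci G x v w = (\<Sum>k<m. \<alpha> x v w \<bullet> \<alpha> x (\<xi> k x) (\<xi> k x) - \<alpha> x (\<xi> k x) w \<bullet> \<alpha> x v (\<xi> k x))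
      + ((\<alpha> x v w \<bullet> a - \<alpha> x (\<xi> m x) w \<bullet> \<alpha> x v (\<xi> m x)) + (\<alpha> x v w \<bullet> d - \<alpha> x (\<xi> (m + 1) x) w \<bullet> \<alpha> x v (\<xi> (m + 1) x)))" for v w
    unfolding ricci_eq[OF x] sum_lessThan_add_2 a_def d_def by simp
  have kk: "\<alpha> x (\<xi> k x) (\<xi> k x) = \<eta> x" if "k < m" for k using \<alpha>_\<xi>(1)[OF x that, of k] that by simp
  have k0: "\<alpha> x (\<xi> k x) (\<xi> j x) = 0" "\<alpha> x (\<xi> j x) (\<xi> k x) = 0" if "k < m" "j \<in> {m, m + 1}" for k j
    using \<alpha>_\<xi>[OF x that(1), of j] that by auto
  have t: "ricci G x (\<xi> i x) (\<xi> j x) = real m * (\<alpha> x (\<xi> i x) (\<xi> j x) \<bullet> \<eta> x)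
      + ((\<alpha> x (\<xi> i x) (\<xi> j x) \<bullet> a - \<alpha> x (\<xi> m x) (\<xi> j x) \<bullet> \<alpha> x (\<xi> i x) (\<xi> m x))
      + (\<alpha> x (\<xi> i x) (\<xi> j x) \<bullet> d - \<alpha> x (\<xi> (m + 1) x) (\<xi> j x) \<bullet> \<alpha> x (\<xi> i x) (\<xi> (m + 1) x)))"
    if "i \<in> {m, m + 1}" "j \<in> {m, m + 1}" for i j
  proof -
    have "(\<Sum>k<m. \<alpha> x (\<xi> i x) (\<xi> j x) \<bullet> \<alpha> x (\<xi> k x) (\<xi> k x) - \<alpha> x (\<xi> k x) (\<xi> j x) \<bullet> \<alpha> x (\<xi> i x) (\<xi> k x)) = (\<Sum>k<m. \<alpha> x (\<xi> i x) (\<xi> j x) \<bullet> \<eta> x)"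
      by (intro sum.cong refl) (use kk k0 that in simp)
    then show ?thesis unfolding R by simp
  qed
  have "ricci G x (\<xi> m x) (\<xi> m x) = \<rho>" "ricci G x (\<xi> (m + 1) x) (\<xi> (m + 1) x) = \<rho>" "ricci G x (\<xi> m x) (\<xi> (m + 1) x) = 0"
    using ein[OF x] G_\<xi>_\<xi>[OF x] by auto
  moreover have mm: "m \<in> {m, m + 1}" "m + 1 \<in> {m, m + 1}" by auto
  ultimately have 1: "real m * (a \<bullet> \<eta> x) + (a \<bullet> d - b \<bullet> b) = \<rho>" "real m * (d \<bullet> \<eta> x) + (a \<bullet> d - b \<bullet> b) = \<rho>" "real m * (b \<bullet> \<eta> x) = 0"
    using t[OF mm(1,1), unfolded b' a_def[symmetric] b_def[symmetric] d_def[symmetric]]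
      t[OF mm(2,2), unfolded b' a_def[symmetric] b_def[symmetric] d_def[symmetric]]
      t[OF mm(1,2), unfolded b' a_def[symmetric] b_def[symmetric] d_def[symmetric]] inner_commute[of a d] inner_commute[of a b] inner_commute[of d b]
    by linarith+
  have "ricci G x (\<xi> 0 x) (\<xi> 0 x) = \<rho>" using ein[OF x] G_\<xi>_\<xi>[OF x m2(3,3)] by simp
  moreover have "(\<Sum>k<m. \<alpha> x (\<xi> 0 x) (\<xi> 0 x) \<bullet> \<alpha> x (\<xi> k x) (\<xi> k x) - \<alpha> x (\<xi> k x) (\<xi> 0 x) \<bullet> \<alpha> x (\<xi> 0 x) (\<xi> k x))
     = (\<Sum>k<m. \<eta> x \<bullet> \<eta> x - (if k = 0 then \<eta> x \<bullet> \<eta> x else 0))"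
    by (intro sum.cong refl) (use kk[OF m2(4)] kk \<alpha>_\<xi>[OF x m2(4)] in auto)
  moreover have "\<dots> = real m * (\<eta> x \<bullet> \<eta> x) - \<eta> x \<bullet> \<eta> x" using m2(4) by (simp add: sum_subtractf sum.delta)
  ultimately have 2: "real m * (\<eta> x \<bullet> \<eta> x) - \<eta> x \<bullet> \<eta> x + \<eta> x \<bullet> a + \<eta> x \<bullet> d = \<rho>"
    using R[of "\<xi> 0 x" "\<xi> 0 x"] k0[OF m2(4)] kk[OF m2(4)] by simp
  have 3: "a \<bullet> \<eta> x = d \<bullet> \<eta> x" using 1 m2(4) by (metis add_right_cancel mult_left_cancel of_nat_0_eq_iff less_numeral_extra(3))
  then show m: "a \<bullet> \<eta> x = \<mu> x" using 2 by (simp add: inner_commute algebra_simps)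
  then show "d \<bullet> \<eta> x = \<mu> x" using 3 by (simp only:)
  show "a \<bullet> d - b \<bullet> b = \<rho> - real m * \<mu> x" using 1(1) unfolding m by linarith
  show "b \<bullet> \<eta> x = 0" using 1(3) m2(4) by simp
qed

lemma \<alpha>_expand:
  assumes x: "x \<in> S"
  defines "p \<equiv> \<lambda>v. E m x \<bullet> dd F x v" and "q \<equiv> \<lambda>v. E (m + 1) x \<bullet> dd F x v"
  shows "\<alpha> x v w = G x v w *\<^sub>R \<eta> x + (p v * p w) *\<^sub>R (\<alpha> x (\<xi> m x) (\<xi> m x) - \<eta> x)
    + (p v * q w + q v * p w) *\<^sub>R \<alpha> x (\<xi> m x) (\<xi> (m + 1) x)
    + (q v * q w) *\<^sub>R (\<alpha> x (\<xi> (m + 1) x) (\<xi> (m + 1) x) - \<eta> x)"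
proof -
  have e: "\<alpha> x v w = (\<Sum>k<m. (E k x \<bullet> dd F x v) *\<^sub>R \<alpha> x (\<xi> k x) w) + (p v *\<^sub>R \<alpha> x (\<xi> m x) w + q v *\<^sub>R \<alpha> x (\<xi> (m + 1) x) w)" for v w
  proof -
    have "\<alpha> x v w = \<alpha> x (\<Sum>i<m + 2. (E i x \<bullet> dd F x v) *\<^sub>R \<xi> i x) w"
      by (rule arg_cong[OF frame[OF x], where f = "\<lambda>v. \<alpha> x v w"])
    then show ?thesis
      unfolding linear_sum[OF linear_\<alpha>[OF x]] linear_scale[OF linear_\<alpha>[OF x]] unfolding sum_lessThan_add_2 p_def q_def .
  qed
  have f: "\<alpha> x (\<xi> j x) w = p w *\<^sub>R \<alpha> x (\<xi> m x) (\<xi> j x) + q w *\<^sub>R \<alpha> x (\<xi> (m + 1) x) (\<xi> j x)" if "j \<in> {m, m + 1}" for j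
  proof -
    have "(\<Sum>k<m. (E k x \<bullet> dd F x w) *\<^sub>R \<alpha> x (\<xi> k x) (\<xi> j x)) = 0"
      by (intro sum.neutral ballI) (use \<alpha>_\<xi>(1)[OF x, of _ j] that in auto)
    then show ?thesis using e[of w "\<xi> j x"] \<alpha>_sym[OF x, of "\<xi> j x" w] by simp
  qed
  have g: "G x v w = (\<Sum>k<m. (E k x \<bullet> dd F x v) * (E k x \<bullet> dd F x w)) + (p v * p w + q v * q w)"
    unfolding met[OF x] using inner_dF[OF x, where u = "dd F x v" and v = w, unfolded sum_lessThan_add_2]
    by (simp only: p_def q_def mult.commute)
  have h: "(\<Sum>k<m. (E k x \<bullet> dd F x v) *\<^sub>R \<alpha> x (\<xi> k x) w) = (\<Sum>k<m. (E k x \<bullet> dd F x v) * (E k x \<bullet> dd F x w)) *\<^sub>R \<eta> x"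
    unfolding scaleR_sum_left by (intro sum.cong refl) (use umbilic[OF x] G_\<xi>[OF x] in simp)
  show ?thesis unfolding e[of v w] h g using f[of m] f[of "m + 1"] \<alpha>_sym[OF x, of "\<xi> (m + 1) x" "\<xi> m x"]
    by (simp add: algebra_simps)
qed

lemma gram_pos:
  assumes x: "x \<in> S" and vw: "v \<noteq> w" "independent {v, w}"
  shows "G x v v * G x w w - (G x v w)\<^sup>2 \<noteq> 0"
proof
  assume d: "G x v v * G x w w - (G x v w)\<^sup>2 = 0"
  define u where "u = G x w w *\<^sub>R v - G x v w *\<^sub>R w"
  have "dd F x u = G x w w *\<^sub>R dd F x v - G x v w *\<^sub>R dd F x w"
    by (simp add: u_def linear_diff[OF linear_dF[OF x]] linear_scale[OF linear_dF[OF x]])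
  then have "dd F x u \<bullet> dd F x u = (G x w w *\<^sub>R dd F x v - G x v w *\<^sub>R dd F x w) \<bullet> (G x w w *\<^sub>R dd F x v - G x v w *\<^sub>R dd F x w)"
    by (simp only:)
  then have "dd F x u \<bullet> dd F x u = G x w w * (G x v v * G x w w - (G x v w)\<^sup>2)"
    by (simp add: met[OF x] inner_diff_left inner_diff_right inner_commute algebra_simps power2_eq_square)
  then have "dd F x u = 0" using d by simp
  then have u0: "u = 0" using vector_eqI[OF x, of u 0] linear_0[OF linear_dF[OF x]] by simp
  have w0: "w \<noteq> 0" using vw(2) dependent_zero[of "{v, w}"] by auto
  then have "dd F x w \<noteq> 0" using vector_eqI[OF x, of w 0] linear_0[OF linear_dF[OF x]] by auto
  then have "G x w w \<noteq> 0" by (simp add: met[OF x])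
  moreover have "G x w w *\<^sub>R v = G x v w *\<^sub>R w" using u0 by (simp add: u_def)
  ultimately have "v = (G x v w / G x w w) *\<^sub>R w"
    by (metis (no_types, lifting) divide_inverse_commute scaleR_one scaleR_scaleR left_inverse)
  then have "v \<in> span {w}" by (metis span_base span_scale singletonI)
  then show False using vw by (simp add: independent_insert)
qed

text \<open>The hypothesis on the length of \<eta> means \<mu> = \<eta> . \<eta>. Then the
  complementary entries of \<open>\<alpha>\<close>, with \<eta> removed from the diagonal, are
  orthogonal to \<eta> and satisfy P . R = Q . Q, so \<open>gauss_surface_identity\<close> applies
  to every plane.\<close>

lemma sectional_curvature_const:
  assumes x: "x \<in> S" and c: "(real m + 1) * (\<eta> x \<bullet> \<eta> x) = \<rho>" and vw: "v \<noteq> w" "independent {v, w}"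
  shows "sectional_curvature G x v w = \<rho> / (real m + 1)"
proof -
  define P where "P = \<alpha> x (\<xi> m x) (\<xi> m x) - \<eta> x"
  define Q where "Q = \<alpha> x (\<xi> m x) (\<xi> (m + 1) x)"
  define R where "R = \<alpha> x (\<xi> (m + 1) x) (\<xi> (m + 1) x) - \<eta> x"
  note ea = einstein_algebra[OF x]
  have \<mu>: "\<mu> x = \<eta> x \<bullet> \<eta> x" using c by (simp add: field_simps)
  have 1: "P \<bullet> \<eta> x = 0" "R \<bullet> \<eta> x = 0" "Q \<bullet> \<eta> x = 0" using ea \<mu> by (simp_all add: P_def Q_def R_def inner_diff_left)
  have 2: "P \<bullet> R = Q \<bullet> Q"
    using ea(4) ea(1,2) \<mu> c unfolding P_def R_def Q_def
    by (simp add: inner_diff_left inner_diff_right inner_commute[of "\<eta> x" "\<alpha> x (\<xi> (Suc m) x) (\<xi> (Suc m) x)"] algebra_simps)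
  define p where "p v = E m x \<bullet> dd F x v" for v
  define q where "q v = E (m + 1) x \<bullet> dd F x v" for v
  have A: "\<alpha> x v w = G x v w *\<^sub>R \<eta> x + (p v * p w) *\<^sub>R P + (p v * q w + q v * p w) *\<^sub>R Q + (q v * q w) *\<^sub>R R" for v w
    using \<alpha>_expand[OF x, of v w] unfolding P_def Q_def R_def p_def q_def .
  have "\<alpha> x w w \<bullet> \<alpha> x v v - \<alpha> x v w \<bullet> \<alpha> x v w = (\<eta> x \<bullet> \<eta> x) * (G x v v * G x w w - (G x v w)\<^sup>2)"
    using gauss_surface_identity[OF 1 2, of "G x w w" "p w" "q w" "G x v v" "p v" "q v" "G x v w"]
    unfolding A by (simp only: mult.commute)
  then have "G x (curvature G x v w w) v = (\<eta> x \<bullet> \<eta> x) * (G x v v * G x w w - (G x v w)\<^sup>2)"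
    unfolding met[OF x] using gauss_equation[OF x, of v w w v] \<alpha>_sym[OF x, of w v] by (simp add: met[OF x])
  then have "sectional_curvature G x v w = \<eta> x \<bullet> \<eta> x"
    unfolding sectional_curvature_def using gram_pos[OF x vw] by simp
  then show ?thesis using c by (simp add: field_simps)
qed

lemma umbilic_patch:
  assumes "\<And>x. x \<in> S \<Longrightarrow> (real m + 1) * (\<eta> x \<bullet> \<eta> x) \<noteq> \<rho>"
  shows "umbilic_patch S F \<xi> E \<eta> m \<rho>"
proof
  show "dd (E i) x v \<bullet> y = (E i x \<bullet> dd F x v) * (\<eta> x \<bullet> y)"
    if x: "x \<in> S" and i: "i < m" and y: "\<And>k. k < m + 2 \<Longrightarrow> E k x \<bullet> y = 0" for x i v y
  proof -
    have i2: "i < m + 2" using i by simp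
    have "dd (E i) x v \<bullet> y = nor x (dd (E i) x v) \<bullet> y"
      by (rule nor_inner[OF y, symmetric])
    also have "nor x (dd (E i) x v) = \<alpha> x (\<xi> i x) v" using nor_dE[OF x i2] \<alpha>_sym[OF x] by simp
    finally show ?thesis using umbilic[OF x i] G_\<xi>[OF x i2] by simp
  qed
  show "dd (E a) x v \<bullet> \<eta> x = \<mu> x * (E a x \<bullet> dd F x v)" if x: "x \<in> S" and a: "a \<in> {m, m + 1}" for x a v
  proof -
    have a2: "a < m + 2" using a by auto
    have "E k x \<bullet> \<eta> x = 0" if "k < m + 2" for k using \<eta>_normal[OF x] E_eq[OF x that] by (metis inner_commute)
    then have "dd (E a) x v \<bullet> \<eta> x = nor x (dd (E a) x v) \<bullet> \<eta> x"
      by (rule nor_inner[symmetric])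
    also have "nor x (dd (E a) x v) = \<alpha> x v (\<xi> a x)" by (rule nor_dE[OF x a2])
    finally have "dd (E a) x v \<bullet> \<eta> x = (E a x \<bullet> dd F x v) * (\<alpha> x (\<xi> a x) (\<xi> a x) \<bullet> \<eta> x)"
      using \<alpha>_expand[OF x, of v "\<xi> a x"] einstein_algebra(3)[OF x] G_\<xi>[OF x a2, of v] met[OF x] orth[OF x] E_eq[OF x] a
      by (auto simp: inner_add_left inner_diff_left inner_commute algebra_simps)
    moreover have "\<alpha> x (\<xi> a x) (\<xi> a x) \<bullet> \<eta> x = \<mu> x" using einstein_algebra(1,2)[OF x] a by auto
    ultimately show ?thesis by (simp only: mult.commute)
  qed
qed (use S F \<xi> smooth_E \<eta> m E_eq orth frame \<eta>_normal \<eta>_nz assms in auto)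

end

section \<open>The lower bound for the codimension\<close>

lemma orthonormal_le_DIM:
  fixes w :: "nat \<Rightarrow> 'b::euclidean_space"
  assumes "orthonormal k w" shows "k \<le> DIM('b)"
  using dim_projection[OF assms] dim_subset_UNIV by metis

context umbilical_frame begin

lemma gauss_curvature_eq:
  assumes nonconst: "\<And>x. x \<in> S \<Longrightarrow> (real m + 1) * (\<eta> x \<bullet> \<eta> x) \<noteq> \<rho>" and x: "x \<in> S"
  shows "umbilic_patch.gauss_curvature \<xi> E m x = \<rho> - real m * umbilic_patch.\<mu> \<eta> m \<rho> x"
proof -
  interpret U: umbilic_patch S F \<xi> E \<eta> m \<rho> by (rule umbilic_patch[OF nonconst])
  have m2: "m < m + 2" "m + 1 < m + 2" by auto
  have n: "U.nor x u = nor x u" for u by (simp only: U.nor_def nor_def)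
  have "U.gauss_curvature x = \<rho> - real m * \<mu> x"
    unfolding U.gauss_curvature_def n nor_dE[OF x m2(1)] nor_dE[OF x m2(2)]
    using einstein_algebra(4)[OF x] \<alpha>_sym[OF x, of "\<xi> m x" "\<xi> (m + 1) x"] by simp
  then show ?thesis by (simp only: U.\<mu>_def U.lam_def)
qed

text \<open>In codimension one all normal vectors are multiples of \<open>\<eta>\<close>, and the Gauss equation becomes a
  quadratic equation for \<open>\<mu>\<close> whose second root \<open>\<mu> = \<eta> \<bullet> \<eta>\<close> belongs to constant curvature.\<close>

lemma codim_one:
  assumes b: "DIM('b) \<le> m + 3" and x: "x \<in> S" and nonconst: "(real m + 1) * (\<eta> x \<bullet> \<eta> x) \<noteq> \<rho>"
  shows "(real m - 1) * (\<eta> x \<bullet> \<eta> x) = - \<rho>"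
proof -
  define l where "l = \<eta> x \<bullet> \<eta> x"
  have l: "l > 0" using \<eta>_nz[OF x] by (simp add: l_def)
  have \<eta>E: "E k x \<bullet> \<eta> x = 0" if "k < m + 2" for k using \<eta>_normal[OF x] E_eq[OF x that] by (metis inner_commute)
  \<comment> \<open>Otherwise the tangent frame, \<eta> and the residual u would yield m + 4
    orthonormal vectors.\<close>
  have mult: "y = ((y \<bullet> \<eta> x) / l) *\<^sub>R \<eta> x" if y: "\<And>k. k < m + 2 \<Longrightarrow> E k x \<bullet> y = 0" for y
  proof (rule ccontr)
    define u where "u = y - ((y \<bullet> \<eta> x) / l) *\<^sub>R \<eta> x"
    assume "\<not> ?thesis"
    then have u0: "u \<noteq> 0" by (simp add: u_def)
    have uE: "E k x \<bullet> u = 0" if "k < m + 2" for k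
      using y[OF that] \<eta>E[OF that] by (simp add: u_def inner_diff_right)
    have u\<eta>: "u \<bullet> \<eta> x = 0" using l by (simp add: u_def inner_diff_left l_def)
    define e where "e = (1 / norm (\<eta> x)) *\<^sub>R \<eta> x"
    define e' where "e' = (1 / norm u) *\<^sub>R u"
    have n: "(1 / norm z) *\<^sub>R z \<bullet> (1 / norm z) *\<^sub>R z = 1" if "z \<noteq> 0" for z :: 'b
      using that by (simp add: power2_norm_eq_inner[symmetric] power2_eq_square)
    have ee: "e \<bullet> e = 1" "e' \<bullet> e' = 1" "e \<bullet> e' = 0" "e' \<bullet> e = 0"
      using n[OF u0] n[OF \<eta>_nz[OF x]] u\<eta> by (auto simp: e_def e'_def inner_commute)
    have Ee: "E k x \<bullet> e = 0" "E k x \<bullet> e' = 0" "e \<bullet> E k x = 0" "e' \<bullet> E k x = 0" if "k < m + 2" for k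
      using \<eta>E[OF that] uE[OF that] by (auto simp: e_def e'_def inner_commute)
    define w where "w i = (if i < m + 2 then E i x else if i = m + 2 then e else e')" for i
    have "orthonormal (m + 4) w"
      unfolding orthonormal_def
    proof (intro allI impI)
      fix i j assume "i < m + 4" "j < m + 4"
      then have "i < m + 2 \<or> i = m + 2 \<or> i = m + 3" "j < m + 2 \<or> j = m + 2 \<or> j = m + 3" by linarith+
      then show "w i \<bullet> w j = (if i = j then 1 else 0)"
        by (elim disjE) (simp_all add: w_def ee Ee orth[OF x])
    qed
    then show False using orthonormal_le_DIM[of "m + 4" w] b by simp
  qed
  note ea = einstein_algebra[OF x]
  have nE: "E k x \<bullet> \<alpha> x v w = 0" if "k < m + 2" for k v w
    using \<alpha>_normal[OF x, of v w "\<xi> k x"] E_eq[OF x that] by (simp add: inner_commute)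
  have e: "\<alpha> x v w = ((\<alpha> x v w \<bullet> \<eta> x) / l) *\<^sub>R \<eta> x" for v w by (rule mult[OF nE])
  have 1: "\<alpha> x (\<xi> m x) (\<xi> m x) = (\<mu> x / l) *\<^sub>R \<eta> x" "\<alpha> x (\<xi> (m + 1) x) (\<xi> (m + 1) x) = (\<mu> x / l) *\<^sub>R \<eta> x" "\<alpha> x (\<xi> m x) (\<xi> (m + 1) x) = 0"
    using e[of "\<xi> m x" "\<xi> m x"] e[of "\<xi> (m + 1) x" "\<xi> (m + 1) x"] e[of "\<xi> m x" "\<xi> (m + 1) x"] unfolding ea(1-3) by simp_all
  define u where "u = \<mu> x"
  have "(u / l) * ((u / l) * l) = \<rho> - real m * u"
    using ea(4) unfolding 1 u_def[symmetric]
    by (simp only: inner_scaleR_left inner_scaleR_right inner_zero_left l_def[symmetric] diff_0_right)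
  then have 2: "u * u = (\<rho> - real m * u) * l" using l by (simp add: field_simps)
  have "2 * (z / 2) = z" for z :: real by simp
  from this[of "\<rho> - (real m - 1) * l"] have r: "\<rho> = 2 * u + (real m - 1) * l" unfolding u_def l_def by linarith
  have "(u - l) * (u + (real m - 1) * l) = 0" using 2 unfolding r by (simp add: algebra_simps)
  moreover have "u \<noteq> l" using nonconst unfolding l_def[symmetric] r by (auto simp: algebra_simps)
  ultimately have "u + (real m - 1) * l = 0" by (metis mult_eq_0_iff eq_iff_diff_eq_0)
  then show ?thesis unfolding l_def[symmetric] using r by linarith
qed

text \<open>By \<open>codim_one\<close> the function \<open>lam\<close> would be - \<rho> / (m - 1),
  hence constant, and \<open>lam_const_cases\<close> would give \<mu> = 0, that is lam = \<rho> / (m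
  - 1). Together these force lam = 0. As m + 4 = n + 2, the bound means p \<ge> 2.\<close>

lemma codim_ge_two:
  assumes nonconst: "\<And>x. x \<in> S \<Longrightarrow> (real m + 1) * (\<eta> x \<bullet> \<eta> x) \<noteq> \<rho>" and x: "x \<in> S"
  shows "DIM('b) \<ge> m + 4"
proof (rule ccontr)
  assume "\<not> ?thesis"
  then have b: "DIM('b) \<le> m + 3" by simp
  interpret U: umbilic_patch S F \<xi> E \<eta> m \<rho> by (rule umbilic_patch[OF nonconst])
  have m1: "real m - 1 > 0" using m by simp
  have c: "(real m - 1) * U.lam x = - \<rho>" if "x \<in> S" for x
    using codim_one[OF b that nonconst[OF that]] by (simp only: U.lam_def)
  have l: "U.lam z = - \<rho> / (real m - 1)" if "z \<in> S" for z
    using c[OF that] m1 by (simp add: field_simps)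
  have "dd U.lam z v = 0" if "z \<in> S" for z v
  proof -
    have "dd U.lam z = dd (\<lambda>_. - \<rho> / (real m - 1)) z" by (rule dd_cong_open[OF S that l])
    then show ?thesis by (simp add: frechet_derivative_const)
  qed
  then have "U.\<mu> x = 0" by (rule U.lam_const_cases(3)[OF _ x])
  then have "\<rho> = 0" using c[OF x] by (simp add: U.\<mu>_def)
  then show False using c[OF x] m1 U.lam_pos[OF x] by simp
qed

end

section \<open>Orthonormal frames adapted to the umbilical distribution\<close>

lemma gram_schmidt_frame:
  fixes F :: "'a::euclidean_space \<Rightarrow> 'b::euclidean_space" and X :: "nat \<Rightarrow> 'a \<Rightarrow> 'a"
  assumes S: "open S" "x0 \<in> S" and F: "smooth_on S F" and inj: "\<forall>x\<in>S. \<forall>v. dd F x v = 0 \<longrightarrow> v = 0"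
    and X: "\<forall>i<k. smooth_on S (X i)"
    and ind: "\<forall>i<k. X i x0 \<notin> span ((\<lambda>j. X j x0) ` {..<i})"
  shows "\<exists>N \<xi>. open N \<and> x0 \<in> N \<and> N \<subseteq> S \<and> (\<forall>i<k. smooth_on N (\<xi> i)) \<and>
    (\<forall>x\<in>N. \<forall>i<k. \<xi> i x \<in> span ((\<lambda>j. X j x) ` {..i})) \<and>
    (\<forall>x\<in>N. \<forall>i<k. \<forall>j<k. dd F x (\<xi> i x) \<bullet> dd F x (\<xi> j x) = (if i = j then 1 else 0))"
  using X ind
proof (induction k)
  case 0
  then show ?case using S by auto
next
  case (Suc k)
  have X': "\<forall>i<k. smooth_on S (X i)" using Suc.prems(1) by simp
  have ind': "\<forall>i<k. X i x0 \<notin> span ((\<lambda>j. X j x0) ` {..<i})" using Suc.prems(2) by simp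
  from Suc.IH[OF X' ind']
  obtain N \<xi> where N: "open N" "x0 \<in> N" "N \<subseteq> S" and \<xi>': "\<forall>i<k. smooth_on N (\<xi> i)"
    and sp': "\<forall>x\<in>N. \<forall>i<k. \<xi> i x \<in> span ((\<lambda>j. X j x) ` {..i})"
    and on': "\<forall>x\<in>N. \<forall>i<k. \<forall>j<k. dd F x (\<xi> i x) \<bullet> dd F x (\<xi> j x) = (if i = j then 1 else 0)"
    by (elim exE conjE) (rule that)
  have \<xi>: "smooth_on N (\<xi> i)" if "i < k" for i by (rule \<xi>'[rule_format, OF that])
  have sp: "\<xi> i x \<in> span ((\<lambda>j. X j x) ` {..i})" if "x \<in> N" "i < k" for i x
    by (rule sp'[rule_format, OF that])
  have on: "dd F x (\<xi> i x) \<bullet> dd F x (\<xi> j x) = (if i = j then 1 else 0)" if "x \<in> N" "i < k" "j < k" for x i j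
    by (rule on'[rule_format, OF that])
  note FN = smooth_on_subset[OF F N(3)]
  have Xk: "smooth_on N (X k)" by (rule smooth_on_subset[OF _ N(3)]) (use Suc.prems(1) in simp)
  have lin: "linear (dd F x)" if "x \<in> N" for x using linear_dd[OF smooth_on_differentiable[OF FN that]] .
  \<comment> \<open>Gram-Schmidt in the pulled back metric. Subtracting earlier fields keeps each
    result in the span of the inputs up to its own index, which later places the first m fields in
    the distribution.\<close>
  define u where "u x = X k x - (\<Sum>i<k. (dd F x (\<xi> i x) \<bullet> dd F x (X k x)) *\<^sub>R \<xi> i x)" for x
  define s where "s x = dd F x (u x) \<bullet> dd F x (u x)" for x
  have su: "smooth_on N u" unfolding u_def
    by (intro smooth_on_diff smooth_on_sum smooth_on_scaleR smooth_on_inner smooth_on_dd_field N(1) FN Xk \<xi>) auto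
  have ss: "smooth_on N s" unfolding s_def by (intro smooth_on_inner smooth_on_dd_field N(1) FN su)
  have sub: "span ((\<lambda>j. X j x) ` {..i}) \<subseteq> span ((\<lambda>j. X j x) ` {..<k})" if "i < k" for i x
    by (intro span_mono image_mono) (use that in auto)
  have usum: "(\<Sum>i<k. (dd F x (\<xi> i x) \<bullet> dd F x (X k x)) *\<^sub>R \<xi> i x) \<in> span ((\<lambda>j. X j x) ` {..<k})" if "x \<in> N" for x
    by (intro span_sum span_scale) (use sp[OF that] sub in blast)
  have "u x0 \<noteq> 0"
  proof
    assume "u x0 = 0"
    then have "X k x0 = (\<Sum>i<k. (dd F x0 (\<xi> i x0) \<bullet> dd F x0 (X k x0)) *\<^sub>R \<xi> i x0)" by (simp add: u_def)
    then show False using usum[OF N(2)] Suc.prems(2) by simp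
  qed
  then have s0: "s x0 > 0" using inj S(2) by (auto simp: s_def)
  \<comment> \<open>Independence is assumed at x0; the residual stays nonzero on the open set where
    its square s is positive.\<close>
  define N' where "N' = s -` {0<..} \<inter> N"
  have oN': "open N'" unfolding N'_def
    using continuous_on_open_vimage[OF N(1)] smooth_on_continuous_on[OF ss] open_greaterThan by blast
  have N'N: "N' \<subseteq> N" and sp': "\<And>x. x \<in> N' \<Longrightarrow> s x > 0" by (auto simp: N'_def)
  define \<zeta> where "\<zeta> x = (1 / sqrt (s x)) *\<^sub>R u x" for x
  define \<xi>' where "\<xi>' i = (if i < k then \<xi> i else \<zeta>)" for i
  have s\<zeta>: "smooth_on N' \<zeta>" unfolding \<zeta>_def
    by (intro smooth_on_scaleR smooth_on_divide smooth_on_sqrt smooth_on_const oN' smooth_on_subset[OF su N'N] smooth_on_subset[OF ss N'N])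
      (use sp' in fastforce)+
  have d\<zeta>: "dd F x (\<zeta> x) = (1 / sqrt (s x)) *\<^sub>R dd F x (u x)" if "x \<in> N'" for x
    unfolding \<zeta>_def using linear_scale[OF lin] that N'N by blast
  have o1: "dd F x (\<xi> j x) \<bullet> dd F x (u x) = 0" if x: "x \<in> N" and j: "j < k" for x j
  proof -
    have "dd F x (u x) = dd F x (X k x) - (\<Sum>i<k. (dd F x (\<xi> i x) \<bullet> dd F x (X k x)) *\<^sub>R dd F x (\<xi> i x))"
      by (simp add: u_def linear_diff[OF lin[OF x]] linear_sum[OF lin[OF x]] linear_scale[OF lin[OF x]])
    moreover have "dd F x (\<xi> j x) \<bullet> (\<Sum>i<k. (dd F x (\<xi> i x) \<bullet> dd F x (X k x)) *\<^sub>R dd F x (\<xi> i x))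
      = (\<Sum>i<k. if i = j then dd F x (\<xi> i x) \<bullet> dd F x (X k x) else 0)"
      unfolding inner_sum_right using on[OF x j] by (intro sum.cong refl) auto
    ultimately show ?thesis using j by (simp add: inner_diff_right sum.delta)
  qed
  have o2: "dd F x (\<zeta> x) \<bullet> dd F x (\<zeta> x) = 1" if "x \<in> N'" for x
    using sp'[OF that] unfolding d\<zeta>[OF that] by (simp add: s_def[symmetric] real_sqrt_mult_self power2_eq_square[symmetric])
  show ?case
  proof (intro exI[of _ N'] exI[of _ \<xi>'] conjI ballI allI impI)
    show "open N'" "x0 \<in> N'" "N' \<subseteq> S" using oN' N s0 by (auto simp: N'_def)
    fix i assume i: "i < Suc k"
    show "smooth_on N' (\<xi>' i)" using s\<zeta> smooth_on_subset[OF \<xi> N'N] by (simp add: \<xi>'_def)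
    fix x assume x: "x \<in> N'"
    have xN: "x \<in> N" using x N'N by blast
    show "\<xi>' i x \<in> span ((\<lambda>j. X j x) ` {..i})"
    proof (cases "i < k")
      case True then show ?thesis using sp[OF xN True] by (simp add: \<xi>'_def)
    next
      case False
      then have ik: "i = k" using i by simp
      have "span ((\<lambda>j. X j x) ` {..<k}) \<subseteq> span ((\<lambda>j. X j x) ` {..k})" by (intro span_mono image_mono) auto
      then have "u x \<in> span ((\<lambda>j. X j x) ` {..k})"
        unfolding u_def by (intro span_diff[OF span_base subsetD[OF _ usum[OF xN]]]) auto
      then show ?thesis unfolding ik \<xi>'_def \<zeta>_def by (simp add: span_scale)
    qed
    fix j assume j: "j < Suc k"
    show "dd F x (\<xi>' i x) \<bullet> dd F x (\<xi>' j x) = (if i = j then 1 else 0)"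
      using i j on[OF xN, of i j] o1[OF xN, of i] o1[OF xN, of j] o2[OF x] d\<zeta>[OF x]
      by (auto simp: \<xi>'_def inner_commute less_Suc_eq)
  qed
qed

lemma orthonormal_frame_expansion:
  fixes L :: "'a::euclidean_space \<Rightarrow> 'b::euclidean_space"
  assumes L: "linear L" "\<And>v. L v = 0 \<Longrightarrow> v = 0" and k: "k = DIM('a)"
    and on: "orthonormal k (\<lambda>i. L (e i))"
  shows "v = (\<Sum>i<k. (L (e i) \<bullet> L v) *\<^sub>R e i)"
proof -
  define P where "P v = (\<Sum>i<k. (L (e i) \<bullet> v) *\<^sub>R L (e i))" for v
  note pf = projection_facts[OF on, folded P_def]
  have PL: "P u = L (\<Sum>i<k. (L (e i) \<bullet> u) *\<^sub>R e i)" for u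
    by (simp add: P_def linear_sum[OF L(1)] linear_scale[OF L(1)])
  have inj: "inj L" using L linear_injective_0 by blast
  have "range P = range L"
  proof (rule subspace_dim_equal)
    show "subspace (range P)" "subspace (range L)" using pf(1) L(1) linear_subspace_image subspace_UNIV by blast+
    show "range P \<subseteq> range L" using PL by auto
    have "dim (range L) = DIM('a)" using dim_image_eq[OF L(1) inj[THEN inj_on_subset], of UNIV] by simp
    then show "dim (range P) \<ge> dim (range L)" using dim_projection[OF on] k unfolding P_def by simp
  qed
  then obtain u where "L v = P u" by blast
  then have "L v = P (L v)" using pf(4)[of u] by simp
  then show ?thesis unfolding PL using inj by (metis injD)
qed

text \<open>The m fields spanning the distribution are completed by two constant vectors chosen at
  x0, and Gram-Schmidt is applied to the list in this order.\<close>

lemma umbilical_frame_exists: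
  fixes S :: "(real^'n) set" and F :: "real^'n \<Rightarrow> 'b::euclidean_space"
  assumes S: "open S" "x0 \<in> S" and G: "metric_on S G" and iso: "isometric_on S G F euclidean_metric"
    and \<eta>: "smooth_on S \<eta>" "\<And>x v. x \<in> S \<Longrightarrow> \<eta> x \<bullet> dd F x v = 0" "\<And>x. x \<in> S \<Longrightarrow> \<eta> x \<noteq> 0"
    and D: "smooth_distribution_on S m (\<lambda>x. umbilical_space G F (\<eta> x) x)"
    and ein: "\<And>x v w. x \<in> S \<Longrightarrow> ricci G x v w = \<rho> * G x v w"
    and n: "CARD('n) = m + 2" and m: "m \<ge> 2"
  shows "\<exists>N \<xi> E. open N \<and> x0 \<in> N \<and> N \<subseteq> S \<and> umbilical_frame N F G \<xi> E m \<eta> \<rho>"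
proof -
  have F: "smooth_on S F" and met: "\<And>x v w. x \<in> S \<Longrightarrow> G x v w = dd F x v \<bullet> dd F x w"
    using iso by (auto simp: isometric_on_def euclidean_metric_def)
  have inj: "v = 0" if "x \<in> S" "dd F x v = 0" for x v
    using G that met[OF that(1), of v v] unfolding metric_on_def by (metis inner_zero_left less_irrefl)
  note D0 = D[unfolded smooth_distribution_on_def]
  have dim: "dim (umbilical_space G F (\<eta> x0) x0) = m" using bspec[OF conjunct1[OF D0] S(2)] ..
  from bspec[OF conjunct2[OF D0] S(2)]
  obtain N X where N: "open N" "x0 \<in> N" "N \<subseteq> S" and X': "\<forall>i<m. smooth_on N (X i)"
    and span': "\<forall>y\<in>N. span ((\<lambda>i::nat. X i y) ` {..<m}) = umbilical_space G F (\<eta> y) y"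
    by (elim exE conjE) (rule that)
  note X = X'[rule_format] and span = span'[rule_format]
  have dm: "dim ((\<lambda>i. X i x0) ` {..<m}) = m" using span[OF N(2)] dim by (metis dim_span)
  have dl: "dim (B :: (real^'n) set) < DIM(real^'n) \<Longrightarrow> \<exists>v. v \<notin> span B" for B
    by (metis UNIV_eq_I dim_UNIV dim_span less_irrefl)
  obtain v1 where v1: "v1 \<notin> span ((\<lambda>i. X i x0) ` {..<m})" using dl dm n by force
  have "dim (insert v1 ((\<lambda>i. X i x0) ` {..<m})) < DIM(real^'n)"
    using v1 dm n by (simp add: dim_insert)
  then obtain v2 where v2: "v2 \<notin> span (insert v1 ((\<lambda>i. X i x0) ` {..<m}))" using dl by blast
  define Y where "Y i = (if i < m then X i else if i = m then (\<lambda>_. v1) else (\<lambda>_. v2))" for i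
  have Yim: "(\<lambda>j. Y j x) ` {..<i} = (\<lambda>j. X j x) ` {..<i}" if "i \<le> m" for i x
    using that by (intro image_cong) (auto simp: Y_def)
  have ind: "Y i x0 \<notin> span ((\<lambda>j. Y j x0) ` {..<i})" if i: "i < m + 2" for i
  proof -
    consider "i < m" | "i = m" | "i = m + 1" using i by linarith
    then show ?thesis
    proof cases
      case 1
      let ?I = "{..<m} - {i}"
      \<comment> \<open>The m values span a space of dimension m, so none of them is
        redundant.\<close>
      have "X i x0 \<notin> span ((\<lambda>j. X j x0) ` {..<i})"
      proof
        assume "X i x0 \<in> span ((\<lambda>j. X j x0) ` {..<i})"
        moreover have "span ((\<lambda>j. X j x0) ` {..<i}) \<subseteq> span ((\<lambda>j. X j x0) ` ?I)"
          by (intro span_mono image_mono) (use 1 in auto)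
        ultimately have "X i x0 \<in> span ((\<lambda>j. X j x0) ` ?I)" by blast
        then have "span (insert (X i x0) ((\<lambda>j. X j x0) ` ?I)) = span ((\<lambda>j. X j x0) ` ?I)" by (rule span_redundant)
        moreover have "insert (X i x0) ((\<lambda>j. X j x0) ` ?I) = (\<lambda>j. X j x0) ` {..<m}" using 1 by auto
        ultimately have "m = dim ((\<lambda>j. X j x0) ` ?I)" using dm by (metis dim_span)
        also have "\<dots> \<le> card ?I" by (meson card_image_le dim_le_card' finite_Diff finite_imageI finite_lessThan le_trans)
        finally show False using 1 by simp
      qed
      then show ?thesis using 1 Yim[of i x0] by (simp add: Y_def)
    next
      case 2 then show ?thesis using v1 Yim[of m x0] by (simp add: Y_def)
    next
      case 3
      have "(\<lambda>j. Y j x0) ` {..<m + 1} = insert v1 ((\<lambda>i. X i x0) ` {..<m})"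
        using Yim[of m x0] by (simp add: lessThan_Suc Y_def)
      then show ?thesis using v2 3 by (simp add: Y_def)
    qed
  qed
  have sY: "smooth_on N (Y i)" if "i < m + 2" for i using X by (simp add: Y_def)
  have "\<forall>i<m + 2. smooth_on N (Y i)" "\<forall>i<m + 2. Y i x0 \<notin> span ((\<lambda>j. Y j x0) ` {..<i})"
    using sY ind by blast+
  moreover have "\<forall>x\<in>N. \<forall>v. dd F x v = 0 \<longrightarrow> v = 0" using inj N(3) by blast
  ultimately have "\<exists>N' \<xi>. open N' \<and> x0 \<in> N' \<and> N' \<subseteq> N \<and> (\<forall>i<m + 2. smooth_on N' (\<xi> i)) \<and>
    (\<forall>x\<in>N'. \<forall>i<m + 2. \<xi> i x \<in> span ((\<lambda>j. Y j x) ` {..i})) \<and>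
    (\<forall>x\<in>N'. \<forall>i<m + 2. \<forall>j<m + 2. dd F x (\<xi> i x) \<bullet> dd F x (\<xi> j x) = (if i = j then 1 else 0))"
    by (intro gram_schmidt_frame[OF N(1,2) smooth_on_subset[OF F N(3)]])
  then
  obtain N' \<xi> where N': "open N'" "x0 \<in> N'" "N' \<subseteq> N" and \<xi>': "\<forall>i<m + 2. smooth_on N' (\<xi> i)"
    and sp': "\<forall>x\<in>N'. \<forall>i<m + 2. \<xi> i x \<in> span ((\<lambda>j. Y j x) ` {..i})"
    and on': "\<forall>x\<in>N'. \<forall>i<m + 2. \<forall>j<m + 2. dd F x (\<xi> i x) \<bullet> dd F x (\<xi> j x) = (if i = j then 1 else 0)"
    by (elim exE conjE) (rule that)
  have \<xi>: "smooth_on N' (\<xi> i)" if "i < m + 2" for i by (rule \<xi>'[rule_format, OF that])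
  have sp: "\<xi> i x \<in> span ((\<lambda>j. Y j x) ` {..i})" if "x \<in> N'" "i < m + 2" for i x
    by (rule sp'[rule_format, OF that])
  have on: "dd F x (\<xi> i x) \<bullet> dd F x (\<xi> j x) = (if i = j then 1 else 0)" if "x \<in> N'" "i < m + 2" "j < m + 2" for x i j
    by (rule on'[rule_format, OF that])
  have N'S: "N' \<subseteq> S" using N' N by blast
  define E where "E i x = dd F x (\<xi> i x)" for i x
  have um: "second_fundamental_form G F x (\<xi> i x) w = G x (\<xi> i x) w *\<^sub>R \<eta> x" if x: "x \<in> N'" and i: "i < m" for x i w
  proof -
    have "(\<lambda>j. Y j x) ` {..i} \<subseteq> (\<lambda>j. X j x) ` {..<m}" using i by (auto simp: Y_def)
    then have "\<xi> i x \<in> span ((\<lambda>j. X j x) ` {..<m})" by (rule subsetD[OF span_mono sp[OF x]]) (use i in simp)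
    then have "\<xi> i x \<in> umbilical_space G F (\<eta> x) x" using span[OF subsetD[OF N'(3) x]] by simp
    then show ?thesis by (simp add: umbilical_space_def)
  qed
  have fr: "v = (\<Sum>i<m + 2. (E i x \<bullet> dd F x v) *\<^sub>R \<xi> i x)" if x: "x \<in> N'" for x v
    unfolding E_def
  proof (rule orthonormal_frame_expansion)
    show "linear (dd F x)" using linear_dd[OF smooth_on_differentiable[OF F]] x N'S by blast
    show "v = 0" if "dd F x v = 0" for v by (rule inj[OF subsetD[OF N'S x] that])
    show "m + 2 = DIM(real^'n)" using n by simp
    show "orthonormal (m + 2) (\<lambda>i. dd F x (\<xi> i x))" unfolding orthonormal_def using on[OF x] by blast
  qed
  have "umbilical_frame N' F G \<xi> E m \<eta> \<rho>"
  proof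
    show "E i x \<bullet> E j x = (if i = j then 1 else 0)" if "x \<in> N'" "i < m + 2" "j < m + 2" for x i j
      using on[OF that] by (simp add: E_def)
  qed (use N'S N'(1) F \<xi> fr met \<eta> um ein m smooth_on_subset in \<open>auto simp: E_def\<close>)
  then show ?thesis using N' N'S by blast
qed

text \<open>A vanishing gradient of \<phi> makes \<open>Z\<close> vanish, and with it the derivative
  of \<open>lam\<close> along the complement; along the leaves that derivative is zero by
  \<open>dlam_\<xi>\<close>.\<close>

lemma (in umbilic_patch) grad\<phi>_sq_pos:
  assumes x: "x \<in> S" and ne: "dd lam x v \<noteq> 0"
  shows "grad\<phi>_sq x > 0"
proof (rule ccontr)
  assume "\<not> ?thesis"
  then have D: "D\<phi> m x = 0" "D\<phi> (m + 1) x = 0"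
    using sum_power2_gt_zero_iff[of "D\<phi> m x" "D\<phi> (m + 1) x"] by (auto simp: grad\<phi>_sq_def)
  have "dd lam x (\<xi> i x) = 0" if "i < m + 2" for i
  proof (cases "i < m")
    case True then show ?thesis by (rule dlam_\<xi>[OF x])
  next
    case False
    then have i: "i \<in> {m, m + 1}" using that by auto
    then have "Z i x = 0" using D\<phi>_Z[OF x i] D \<phi>_pos[OF x] by auto
    then show ?thesis using \<theta>_nz[OF x] by (simp add: Z_def)
  qed
  then have "dd lam x v = 0"
    by (rule linear_ext[OF x linear_dd[OF smooth_on_differentiable[OF smooth_lam x]]])
  then show False using ne by simp
qed

lemma umbilical_frame_subset:
  assumes "umbilical_frame S F G \<xi> E m \<eta> \<rho>" "open S'" "S' \<subseteq> S"
  shows "umbilical_frame S' F G \<xi> E m \<eta> \<rho>"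
proof -
  interpret U: umbilical_frame S F G \<xi> E m \<eta> \<rho> by fact
  note sub = smooth_on_subset[OF _ assms(3)]
  note in_S = subsetD[OF assms(3)]
  show ?thesis
  proof unfold_locales
    show "v = (\<Sum>i<m + 2. (E i x \<bullet> dd F x v) *\<^sub>R \<xi> i x)" if "x \<in> S'" for x v by (rule U.frame[OF in_S[OF that]])
  qed (use assms(2) U.m sub[OF U.F] sub[OF U.\<xi>] sub[OF U.\<eta>] U.E_eq[OF in_S] U.orth[OF in_S] U.met[OF in_S]
      U.\<eta>_normal[OF in_S] U.\<eta>_nz[OF in_S] U.umbilic[OF in_S] U.ein[OF in_S] in blast)+
qed

theorem theorem7:
  fixes A :: "('m::{t2_space, second_countable_topology}, real^'n) chart set"
    and g :: "('m, real^'n) chart \<Rightarrow> (real^'n) metric_field"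
    and f :: "'m \<Rightarrow> (real^'q) \<times> (real^'r)"
    and \<rho> :: real and n p :: nat
  assumes "CARD('n) = n" and "n \<ge> 4"
    and "CARD('q) = p + 1" and "CARD('r) = n - 1"
    and "smooth_atlas A" and "riemannian_metric A g"
    and "einstein A g \<rho>"
    and "\<And>V. open V \<Longrightarrow> V \<noteq> {} \<Longrightarrow> \<not> constant_sectional_curvature_on A g V"
    and "umbilical_immersion (n - 2) A g f"
  shows "p \<ge> 2 \<and>
    (\<exists>D. open D \<and> closure D = UNIV \<and>
      (\<forall>x\<in>D. \<exists>V T. open V \<and> x \<in> V \<and> rigid_motion T \<and>
         (clifford_product A g \<rho> V (T \<circ> f) \<or> einstein_rotational A g \<rho> V (T \<circ> f))))"
proof -
  define m where "m = n - 2"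
  have m: "m \<ge> 2" and n: "CARD('n) = m + 2" and r: "CARD('r) = m + 1" using assms(1,2,4) by (auto simp: m_def)
  note A = assms(5) and g = assms(6)
  obtain \<eta> where iso: "isometric_immersion A g f" and \<eta>: "smooth_map_on A UNIV \<eta>" "\<forall>x. \<eta> x \<noteq> 0"
    and nrm: "\<forall>c\<in>A. \<forall>x\<in>coords c UNIV. \<forall>v. \<eta> (param c x) \<bullet> dd (f \<circ> param c) x v = 0"
    and dist: "\<forall>c\<in>A. smooth_distribution_on (coords c UNIV) m
           (\<lambda>x. umbilical_space (g c) (f \<circ> param c) (\<eta> (param c x)) x)"
    using assms(9) unfolding umbilical_immersion_def m_def[symmetric] by (elim exE conjE) (rule that)
  \<comment> \<open>The equation \<mu> = \<eta> . \<eta>. If it held throughout an open set, every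
    sectional curvature there would be \<rho> / (m + 1).\<close>
  define bad where "bad q \<longleftrightarrow> (real m + 1) * (\<eta> q \<bullet> \<eta> q) = \<rho>" for q
  have frames: "\<exists>N \<xi> E. open N \<and> x0 \<in> N \<and> N \<subseteq> coords c UNIV \<and>
      umbilical_frame N (f \<circ> param c) (g c) \<xi> E m (\<eta> \<circ> param c) \<rho>"
    if c: "c \<in> A" and x0: "x0 \<in> coords c UNIV" for c x0
  proof (rule umbilical_frame_exists[OF param_coords(6)[OF A c] x0 _ _ _ _ _ _ _ n m])
    show "metric_on (coords c UNIV) (g c)" using g c by (simp add: riemannian_metric_def)
    show "isometric_on (coords c UNIV) (g c) (f \<circ> param c) euclidean_metric"
      using iso c by (simp add: isometric_immersion_def isometric_map_on_def)
    show "smooth_on (coords c UNIV) (\<eta> \<circ> param c)" using \<eta>(1) c by (simp add: smooth_map_on_def)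
    show "(\<eta> \<circ> param c) x \<bullet> dd (f \<circ> param c) x v = 0" if "x \<in> coords c UNIV" for x v
      using nrm c that by simp
    show "(\<eta> \<circ> param c) x \<noteq> 0" for x using \<eta>(2) by simp
    show "smooth_distribution_on (coords c UNIV) m (\<lambda>x. umbilical_space (g c) (f \<circ> param c) ((\<eta> \<circ> param c) x) x)"
      using dist c by simp
    show "ricci (g c) x v w = \<rho> * g c x v w" if "x \<in> coords c UNIV" for x v w
      using assms(7) c that by (simp add: einstein_def)
  qed
  have inV: "param c x \<in> V" "x \<in> coords c UNIV" if "c \<in> A" "x \<in> coords c V" for c x V
    using that param_coords(1)[OF A that(1)] by (auto simp: coords_def)
  have dense: "\<exists>q\<in>V. \<not> bad q" if V: "open V" "V \<noteq> {}" for V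
  proof (rule ccontr)
    assume b: "\<not> ?thesis"
    have "sectional_curvature (g c) x v w = \<rho> / (real m + 1)"
      if c: "c \<in> A" and x: "x \<in> coords c V" and vw: "v \<noteq> w \<and> independent {v, w}" for c x v w
    proof -
      obtain N \<xi> E where N: "x \<in> N" "umbilical_frame N (f \<circ> param c) (g c) \<xi> E m (\<eta> \<circ> param c) \<rho>"
        using frames[OF c inV(2)[OF c x]] by blast
      have "bad (param c x)" using b inV(1)[OF c x] by blast
      then show ?thesis
        using umbilical_frame.sectional_curvature_const[OF N(2,1)] vw by (simp add: bad_def)
    qed
    then have "constant_sectional_curvature_on A g V"
      unfolding constant_sectional_curvature_on_def by blast
    then show False using assms(8)[OF V] by blast
  qed
  define good where "good q V T \<longleftrightarrow> open V \<and> q \<in> V \<and> rigid_motion T \<and>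
     (clifford_product A g \<rho> V (T \<circ> f) \<or> einstein_rotational A g \<rho> V (T \<circ> f))" for q V T
  \<comment> \<open>The set of good points is open by its form, so density follows from one good
    point in every nonempty open set.\<close>
  have main: "p \<ge> 2 \<and> (\<exists>q\<in>Ob. \<exists>V T. good q V T)" if Ob: "open Ob" "Ob \<noteq> {}" for Ob
  proof -
    obtain q where q: "q \<in> Ob" "\<not> bad q" using dense[OF Ob] by blast
    obtain c where c: "c \<in> A" "q \<in> fst c" using A unfolding smooth_atlas_def by blast
    define x0 where "x0 = snd c q"
    note pc = param_coords[OF A c(1)]
    have px0: "param c x0 = q" and x0: "x0 \<in> coords c UNIV" using pc(1,2)[OF c(2)] by (simp_all add: x0_def)
    obtain N \<xi> E where N: "open N" "x0 \<in> N" "N \<subseteq> coords c UNIV"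
      and fr: "umbilical_frame N (f \<circ> param c) (g c) \<xi> E m (\<eta> \<circ> param c) \<rho>"
      using frames[OF c(1) x0] by blast
    define b where "b x = (real m + 1) * ((\<eta> \<circ> param c) x \<bullet> (\<eta> \<circ> param c) x) - \<rho>" for x
    have cb: "continuous_on N b"
      unfolding b_def
      by (intro continuous_on_diff continuous_on_mult continuous_on_const continuous_on_inner
          smooth_on_continuous_on umbilical_frame.\<eta>[OF fr])
    define N' where "N' = (b -` (- {0}) \<inter> N) \<inter> coords c Ob"
    have "open (b -` (- {0}) \<inter> N)" using cb continuous_on_open_vimage[OF N(1)] by blast
    then have "open N'" unfolding N'_def by (rule open_Int[OF _ open_coords[OF A c(1) Ob(1)]])
    moreover have "x0 \<in> N'"
      using q c(2) N(2) px0 by (auto simp: N'_def b_def bad_def coords_def x0_def)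
    ultimately obtain e where e: "e > 0" "ball x0 e \<subseteq> N'" using openE by blast
    define S where "S = ball x0 e"
    have S: "open S" "convex S" "x0 \<in> S" "S \<subseteq> N" "S \<subseteq> coords c UNIV" "S \<subseteq> coords c Ob"
      using e N(3) by (auto simp: S_def N'_def)
    interpret U: umbilical_frame S "f \<circ> param c" "g c" \<xi> E m "\<eta> \<circ> param c" \<rho>
      by (rule umbilical_frame_subset[OF fr S(1,4)])
    have nc: "(real m + 1) * ((\<eta> \<circ> param c) x \<bullet> (\<eta> \<circ> param c) x) \<noteq> \<rho>" if "x \<in> S" for x
      using that e(2) by (auto simp: S_def N'_def b_def)
    note patch = U.umbilic_patch[OF nc]
    interpret P: umbilic_patch S "f \<circ> param c" \<xi> E "\<eta> \<circ> param c" m \<rho> by (rule patch)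
    have "p \<ge> 2" using U.codim_ge_two[OF nc S(3)] assms(3) r by simp
    moreover have "\<exists>q\<in>Ob. \<exists>V T. good q V T"
    \<comment> \<open>If \<open>lam\<close> varies, the base point moves to one where its derivative
      is nonzero; otherwise \<open>lam\<close> is constant on the whole ball and the product case
      applies at x0.\<close>
    proof (cases "\<exists>x\<in>S. \<exists>v. dd P.lam x v \<noteq> 0")
      case True
      then obtain x v where x: "x \<in> S" "dd P.lam x v \<noteq> 0" by blast
      have "\<exists>V T. open V \<and> param c x \<in> V \<and> rigid_motion T \<and> einstein_rotational A g \<rho> V (T \<circ> f)"
        by (rule rotational_patch[OF A g c(1) n r patch S(2,5) x(1) _ U.met P.grad\<phi>_sq_pos[OF x]]) simp_all
      then show ?thesis using inV(1)[OF c(1) subsetD[OF S(6) x(1)]] unfolding good_def by blast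
    next
      case False
      then have l0: "dd P.lam x v = 0" if "x \<in> S" for x v using that by blast
      have "\<exists>V T. open V \<and> param c x0 \<in> V \<and> rigid_motion T \<and> clifford_product A g \<rho> V (T \<circ> f)"
        by (rule clifford_patch[OF A g c(1) n r patch S(2,5,3) _ U.met l0 U.gauss_curvature_eq[OF nc]]) simp_all
      then show ?thesis using inV(1)[OF c(1) subsetD[OF S(6,3)]] unfolding good_def by blast
    qed
    ultimately show ?thesis ..
  qed
  define D where "D = {q. \<exists>V T. good q V T}"
  have "open D"
    unfolding open_subopen[of D]
  proof
    fix q assume "q \<in> D"
    then obtain V T where "good q V T" by (auto simp: D_def)
    then have "open V" "q \<in> V" "V \<subseteq> D" by (auto simp: D_def good_def)
    then show "\<exists>V. open V \<and> q \<in> V \<and> V \<subseteq> D" by blast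
  qed
  moreover have "closure D = UNIV"
  proof (rule ccontr)
    assume "closure D \<noteq> UNIV"
    then have "open (- closure D)" "- closure D \<noteq> {}" by auto
    from main[OF this] obtain q where "q \<in> - closure D" "q \<in> D" by (auto simp: D_def)
    then show False using closure_subset by blast
  qed
  moreover have "\<forall>x\<in>D. \<exists>V T. good x V T" by (simp add: D_def)
  \<comment> \<open>Types are inhabited, so the whole manifold is a nonempty open set.\<close>
  moreover have "p \<ge> 2" using main[of UNIV] by simp
  ultimately show ?thesis unfolding good_def by blast
qed

end
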